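(* Let $f$ and $g$ be as in the context, and assume that $$ f\cdot g\in L^1(\mathbb{R})\cap L^2(\mathbb{R}) $$ and that $$ \mathbb{E}\big[\widetilde Q_T^2(1)\big]\longrightarrow 16\pi^3\int_{-\infty}^{\infty} f^2(x)g^2(x)\,dx\qquad\text{as } T\to\infty. $$ Then, as $T\to\infty$, the finite-dimensional distributions of the process $\{\widetilde Q_T(t),\ t\in[0,1]\}$ converge to those of $\{\sigma B(t),\ t\in[0,1]\}$, where $B(t)$ is a standard Brownian motion and $$ \sigma^2=16\pi^3\int_{-\infty}^{\infty} f^2(x)g^2(x)\,dx. $$
   Context: $\{X(t),\ t\in\mathbb{R}\}$ is a centered real-valued stationary Gaussian process with spectral density $f\in L^1(\mathbb{R})$ and covariance function $r(t)=\widehat f(t)=\int_{\mathbb{R}}e^{ixt}f(x)\,dx$. The generating function $g\in L^1(\mathbb{R})$ is a real-valued even function with $g\ge 0$ (standing assumption), and $\widehat g(t)=\int_{\mathbb{R}}e^{ixt}g(x)\,dx$. For $T>0$ and $t\in[0,1]$ define $$Q_T(t)=\int_0^{Tt}\int_0^{Tt}\widehat g(u-v)X(u)X(v)\,du\,dv,\qquad \widetilde Q_T(t)=T^{-1/2}\big(Q_T(t)-\mathbb{E}[Q_T(t)]\big).$$ *)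

theory Defs
  imports "HOL-Probability.Probability"
begin

text \<open>
  The convention is \<open>h^(t) = \<integral> e^{ixt} h(x) dx\<close>, without a factor \<open>2\<pi>\<close>.
\<close>

definition fourier_hat :: "(real \<Rightarrow> real) \<Rightarrow> real \<Rightarrow> complex" where
  "fourier_hat h t = (CLBINT x. exp (\<i> * complex_of_real (x * t)) * complex_of_real (h x))"

text \<open>Gaussian laws include the degenerate ones (point masses).\<close>

definition gaussian_law :: "real \<Rightarrow> real \<Rightarrow> real measure" where
  "gaussian_law m s =
     (if s = 0 then return borel m else density lborel (\<lambda>x. ennreal (normal_density m s x)))"

definition gaussian_process :: "'a measure \<Rightarrow> (real \<Rightarrow> 'a \<Rightarrow> real) \<Rightarrow> bool" where
  "gaussian_process M X \<longleftrightarrow>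
     (\<forall>t. X t \<in> borel_measurable M) \<and>
     (\<forall>J c. finite J \<longrightarrow>
        (\<exists>m s. s \<ge> 0 \<and> distr M borel (\<lambda>\<omega>. \<Sum>t\<in>J. c t * X t \<omega>) = gaussian_law m s))"

definition centered_process :: "'a measure \<Rightarrow> (real \<Rightarrow> 'a \<Rightarrow> real) \<Rightarrow> bool" where
  "centered_process M X \<longleftrightarrow>
     (\<forall>t. integrable M (X t) \<and> (\<integral>\<omega>. X t \<omega> \<partial>M) = 0)"

definition stationary_process :: "'a measure \<Rightarrow> (real \<Rightarrow> 'a \<Rightarrow> real) \<Rightarrow> bool" where
  "stationary_process M X \<longleftrightarrow>
     (\<forall>J h. finite J \<longrightarrow>
        distr M (PiM J (\<lambda>_. borel)) (\<lambda>\<omega>. \<lambda>t\<in>J. X (t + h) \<omega>) =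
        distr M (PiM J (\<lambda>_. borel)) (\<lambda>\<omega>. \<lambda>t\<in>J. X t \<omega>))"

text \<open>
  Meant for centered stationary processes, whose covariance function is
  \<open>r(t) = E[X(s + t) X(s)]\<close> for any \<open>s\<close>. The equation is one between complex numbers,
  so it also says that the transform of \<open>f\<close> is real.
\<close>

definition has_spectral_density ::
    "'a measure \<Rightarrow> (real \<Rightarrow> 'a \<Rightarrow> real) \<Rightarrow> (real \<Rightarrow> real) \<Rightarrow> bool" where
  "has_spectral_density M X f \<longleftrightarrow>
     integrable lborel f \<and> (\<forall>x. f x \<ge> 0) \<and>
     (\<forall>s t. complex_of_real (\<integral>\<omega>. X (s + t) \<omega> * X s \<omega> \<partial>M) = fourier_hat f t)"

text \<open>
  Joint measurability is what makes the pathwise integrals defining \<open>Q\<^sub>T(t)\<close>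
  meaningful random variables.
\<close>

definition measurable_process :: "'a measure \<Rightarrow> (real \<Rightarrow> 'a \<Rightarrow> real) \<Rightarrow> bool" where
  "measurable_process M X \<longleftrightarrow> (\<lambda>(t, \<omega>). X t \<omega>) \<in> borel_measurable (borel \<Otimes>\<^sub>M M)"

text \<open>
  For even \<open>g\<close> the transform is real, so taking the real part loses nothing.
\<close>

definition Q_func ::
    "(real \<Rightarrow> real) \<Rightarrow> (real \<Rightarrow> 'a \<Rightarrow> real) \<Rightarrow> real \<Rightarrow> real \<Rightarrow> 'a \<Rightarrow> real" where
  "Q_func g X T t \<omega> =
     (LBINT v:{0..T * t}. (LBINT u:{0..T * t}. Re (fourier_hat g (u - v)) * X u \<omega> * X v \<omega>))"

definition Q_tilde ::
    "'a measure \<Rightarrow> (real \<Rightarrow> real) \<Rightarrow> (real \<Rightarrow> 'a \<Rightarrow> real) \<Rightarrow> real \<Rightarrow> real \<Rightarrow> 'a \<Rightarrow> real" where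
  "Q_tilde M g X T t \<omega> =
     T powr (- 1 / 2) * (Q_func g X T t \<omega> - (\<integral>\<omega>'. Q_func g X T t \<omega>' \<partial>M))"

definition standard_brownian_motion_on ::
    "real set \<Rightarrow> 'b measure \<Rightarrow> (real \<Rightarrow> 'b \<Rightarrow> real) \<Rightarrow> bool" where
  "standard_brownian_motion_on I N B \<longleftrightarrow>
     prob_space N \<and>
     (\<forall>t\<in>I. B t \<in> borel_measurable N) \<and>
     (AE \<omega> in N. B 0 \<omega> = 0) \<and>
     (\<forall>s\<in>I. \<forall>t\<in>I. s < t \<longrightarrow>
        distr N borel (\<lambda>\<omega>. B t \<omega> - B s \<omega>) = gaussian_law 0 (sqrt (t - s))) \<and>
     (\<forall>n (\<tau> :: nat \<Rightarrow> real). (\<forall>i\<le>n. \<tau> i \<in> I) \<and> (\<forall>i<n. \<tau> i \<le> \<tau> (Suc i)) \<longrightarrow>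
        prob_space.indep_vars N (\<lambda>_. borel) (\<lambda>i \<omega>. B (\<tau> (Suc i)) \<omega> - B (\<tau> i) \<omega>) {..<n}) \<and>
     (AE \<omega> in N. continuous_on I (\<lambda>t. B t \<omega>))"

text \<open>
  Weak convergence of Borel probability measures along a filter; the library's
  \<open>weak_conv_m\<close> covers only sequences of measures on the real line.
\<close>

definition weakly_tendsto ::
    "('i \<Rightarrow> 'v::topological_space measure) \<Rightarrow> 'v measure \<Rightarrow> 'i filter \<Rightarrow> bool" where
  "weakly_tendsto \<mu> \<nu> F \<longleftrightarrow>
     (\<forall>\<phi> :: 'v \<Rightarrow> real. continuous_on UNIV \<phi> \<and> bounded (range \<phi>) \<longrightarrow>
        ((\<lambda>i. \<integral>x. \<phi> x \<partial>\<mu> i) \<longlongrightarrow> (\<integral>x. \<phi> x \<partial>\<nu>)) F)"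

text \<open>
  Law of \<open>(Y(t\<^sub>k))\<^sub>k\<close>, with the finitely many time points indexed by a finite type.
\<close>

definition fin_dim_law ::
    "'a measure \<Rightarrow> (real \<Rightarrow> 'a \<Rightarrow> real) \<Rightarrow> ('k::finite \<Rightarrow> real) \<Rightarrow> (real ^ 'k) measure" where
  "fin_dim_law M Y t = distr M borel (\<lambda>\<omega>. \<chi> k. Y (t k) \<omega>)"

end

theory Submission
  imports Defs
begin

text \<open>
  Fix weights \<open>c\<^sub>k\<close> and let \<open>W = \<Sum>\<^sub>k c\<^sub>k Q_tilde(t\<^sub>k)\<close>. This is a centred quadratic functional
  \<open>\<integral>\<integral> K(u,v) (X(u) X(v) - r(u - v)) du dv\<close> with kernel
  \<open>K(u,v) = T\<^sup>-\<^sup>1\<^sup>/\<^sup>2 \<Sum>\<^sub>k c\<^sub>k 1{u, v \<le> T t\<^sub>k} g^(u - v)\<close>. Such kernels are composed through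
  the covariance, \<open>(K L)(b,d) = \<integral>\<integral> K(b,a) r(a - c) L(c,d) da dc\<close>. Since \<open>r\<close> is the transform
  of \<open>f\<close>, this composition is that of integral operators on \<open>L\<^sup>2(f(x) dx)\<close>; let \<open>\<Phi>\<close> be the
  Hermitian operator that belongs to \<open>K\<close>, and \<open>p\<^sub>n\<close> the trace of \<open>\<Phi>\<^sup>n\<close>.

  Gaussian integration by parts gives a recursion for the mixed moments of the functionals
  whose kernels are the powers of \<open>K\<close>, with no data besides the \<open>p\<^sub>n\<close> (\<open>moment_recursion\<close>). If
  \<open>p\<^sub>2 \<longlonglongrightarrow> V / 2\<close> and \<open>p\<^sub>n \<longlonglongrightarrow> 0\<close> for \<open>n \<ge> 3\<close>, the recursion forces the moments of \<open>W\<close> to converge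
  to those of a centred normal law of variance \<open>V\<close> (\<open>moments_limit\<close>), and the Taylor series of
  the exponential turns this into convergence of characteristic functions
  (\<open>moments_imp_char_limit\<close>). With Hilbert-Schmidt norms, \<open>p\<^sub>2 = \<parallel>\<Phi>\<parallel>\<^sup>2\<close> and
  \<open>|p\<^sub>n| \<le> \<parallel>\<Phi>\<Phi>\<parallel> \<parallel>\<Phi>\<parallel>\<^sup>n\<^sup>-\<^sup>2\<close> (\<open>rtr_bounds\<close>). So two limits are needed: \<open>\<parallel>\<Phi>\<parallel>\<^sup>2 \<longlonglongrightarrow> V / 2\<close>
  (\<open>second_trace_limit\<close>) and \<open>\<parallel>\<Phi>\<Phi>\<parallel> \<longlonglongrightarrow> 0\<close> (\<open>fourth_trace_limit\<close>).

  For bounded \<open>f\<close> and \<open>g\<close> both are accessible. On the whole line a product of Toeplitz kernels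
  is the Toeplitz kernel of the product of the symbols, by Plancherel's theorem; on a window
  the error sits near the end points and is negligible on average (\<open>Toeplitz_trace_limit\<close>).
  Moreover the operator norm of \<open>\<Phi>\<close> is \<open>O(T\<^sup>-\<^sup>1\<^sup>/\<^sup>2)\<close>, by boundedness of Fourier multipliers
  (\<open>hs_kmult_Psi\<close>).

  General \<open>f\<close> and \<open>g\<close> are cut off at a level \<open>n\<close>. The cut is harmless because of a
  monotonicity: cutting \<open>f\<close> restricts the operator to a subset, and \<open>\<parallel>\<Phi>\<parallel>\<close> is symmetric in \<open>f\<close>
  and \<open>g\<close> (\<open>hs_Amp_swap\<close>). Hence the squared distance between the full and the truncated
  operator is bounded by the loss in \<open>\<parallel>\<Phi>\<parallel>\<^sup>2\<close> (\<open>truncation_distance\<close>). The assumption on the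
  variance says how \<open>\<parallel>\<Phi>\<parallel>\<^sup>2\<close> grows for the full operator, the bounded case says it for the
  truncated one, and the difference of the two constants, a multiple of the integral of
  \<open>(f g)\<^sup>2\<close> minus that of its truncation, is small for large \<open>n\<close>. In this way the assumption
  on the variance replaces all regularity of \<open>f\<close> and \<open>g\<close>.

  Convergence of the characteristic functions of all combinations \<open>W\<close> together with bounded
  second moments gives weak convergence of the vectors (\<open>weak_convergence_from_char\<close>, by
  approximation with trigonometric polynomials), and the limit is recognised by the
  characteristic function of Brownian motion at finitely many times (\<open>Brownian_char\<close>).
\<close>

section \<open>Square-integrable functions\<close>

lemma cis_measurable [measurable]: "cis \<in> borel_measurable borel"
  by (intro borel_measurable_continuous_onI continuous_intros)

lemma cnj_measurable [measurable]: "cnj \<in> borel_measurable borel"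
  by (intro borel_measurable_continuous_onI continuous_intros)

text \<open>
  For a function that is not integrable the left side is zero, the default value of the
  Bochner integral.
\<close>

lemma norm_integral_le_nn_integral:
  fixes f :: "'a \<Rightarrow> 'b::{banach, second_countable_topology}"
  shows "ennreal (norm (integral\<^sup>L M f)) \<le> (\<integral>\<^sup>+x. ennreal (norm (f x)) \<partial>M)"
  by (cases "integrable M f") (auto simp: integral_norm_bound_ennreal not_integrable_integral_eq)

lemma Cauchy_Schwarz_integrable:
  fixes f g :: "'a \<Rightarrow> 'b::{real_normed_div_algebra, banach, second_countable_topology}"
  assumes [measurable]: "f \<in> borel_measurable M" "g \<in> borel_measurable M"
    and "integrable M (\<lambda>x. (norm (f x))\<^sup>2)" "integrable M (\<lambda>x. (norm (g x))\<^sup>2)"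
  shows "integrable M (\<lambda>x. f x * g x)"
proof (rule Bochner_Integration.integrable_bound)
  show "integrable M (\<lambda>x. (norm (f x))\<^sup>2 + (norm (g x))\<^sup>2)" using assms by simp
  show "(\<lambda>x. f x * g x) \<in> borel_measurable M" by measurable
  show "AE x in M. norm (f x * g x) \<le> norm ((norm (f x))\<^sup>2 + (norm (g x))\<^sup>2)"
  proof (intro AE_I2)
    fix x
    have "2 * (norm (f x) * norm (g x)) \<le> (norm (f x))\<^sup>2 + (norm (g x))\<^sup>2"
      using sum_squares_bound[of "norm (f x)" "norm (g x)"] by simp
    moreover have "0 \<le> norm (f x) * norm (g x)" by simp
    ultimately show "norm (f x * g x) \<le> norm ((norm (f x))\<^sup>2 + (norm (g x))\<^sup>2)"
      by (simp add: norm_mult del: norm_ge_zero)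
  qed
qed

lemma Cauchy_Schwarz_integral:
  fixes f g :: "'a \<Rightarrow> 'b::{real_normed_div_algebra, banach, second_countable_topology}"
  assumes [measurable]: "f \<in> borel_measurable M" "g \<in> borel_measurable M"
    and i: "integrable M (\<lambda>x. (norm (f x))\<^sup>2)" "integrable M (\<lambda>x. (norm (g x))\<^sup>2)"
  shows "(norm (\<integral>x. f x * g x \<partial>M))\<^sup>2 \<le> (\<integral>x. (norm (f x))\<^sup>2 \<partial>M) * (\<integral>x. (norm (g x))\<^sup>2 \<partial>M)"
proof -
  have "ennreal ((norm (\<integral>x. f x * g x \<partial>M))\<^sup>2) \<le> (\<integral>\<^sup>+x. ennreal (norm (f x * g x)) \<partial>M)\<^sup>2"
    using norm_integral_le_nn_integral[of M "\<lambda>x. f x * g x"]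
    by (simp add: ennreal_power[symmetric] power_mono)
  also have "(\<integral>\<^sup>+x. ennreal (norm (f x * g x)) \<partial>M) = (\<integral>\<^sup>+x. ennreal (norm (f x)) * ennreal (norm (g x)) \<partial>M)"
    by (simp add: norm_mult ennreal_mult)
  also have "(\<dots>)\<^sup>2 \<le> (\<integral>\<^sup>+x. (ennreal (norm (f x)))\<^sup>2 \<partial>M) * (\<integral>\<^sup>+x. (ennreal (norm (g x)))\<^sup>2 \<partial>M)"
    by (rule Cauchy_Schwarz_nn_integral) auto
  also have "\<dots> = ennreal (\<integral>x. (norm (f x))\<^sup>2 \<partial>M) * ennreal (\<integral>x. (norm (g x))\<^sup>2 \<partial>M)"
    using i by (simp add: ennreal_power nn_integral_eq_integral)
  also have "\<dots> = ennreal ((\<integral>x. (norm (f x))\<^sup>2 \<partial>M) * (\<integral>x. (norm (g x))\<^sup>2 \<partial>M))"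
    by (simp add: ennreal_mult)
  finally show ?thesis by (simp add: ennreal_le_iff)
qed

definition sqn :: "'a measure \<Rightarrow> ('a \<Rightarrow> 'b::real_normed_vector) \<Rightarrow> real" where
  "sqn M f = sqrt (\<integral>x. (norm (f x))\<^sup>2 \<partial>M)"

definition sq_int :: "'a measure \<Rightarrow> ('a \<Rightarrow> 'b::{real_normed_div_algebra, banach, second_countable_topology}) \<Rightarrow> bool" where
  "sq_int M f \<longleftrightarrow> f \<in> borel_measurable M \<and> integrable M (\<lambda>x. (norm (f x))\<^sup>2)"

lemma sqn_nonneg [simp]: "0 \<le> sqn M f" by (simp add: sqn_def)

lemma sqn_square: "(sqn M f)\<^sup>2 = (\<integral>x. (norm (f x))\<^sup>2 \<partial>M)"
  by (simp add: sqn_def)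

lemma sq_int_integrable_mult: "sq_int M f \<Longrightarrow> sq_int M g \<Longrightarrow> integrable M (\<lambda>x. f x * g x)"
  by (intro Cauchy_Schwarz_integrable) (auto simp: sq_int_def)

lemma sq_int_Cauchy_Schwarz:
  assumes "sq_int M f" "sq_int M g"
  shows "norm (\<integral>x. f x * g x \<partial>M) \<le> sqn M f * sqn M g"
proof (rule power2_le_imp_le)
  show "(norm (\<integral>x. f x * g x \<partial>M))\<^sup>2 \<le> (sqn M f * sqn M g)\<^sup>2"
    using Cauchy_Schwarz_integral[of f M g] assms by (simp add: sq_int_def power_mult_distrib sqn_square)
qed simp

lemma sq_int_cmult: "sq_int M f \<Longrightarrow> sq_int M (\<lambda>x. c * f x)"
  by (auto simp: sq_int_def norm_mult power_mult_distrib)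

lemma sqn_cmult:
  fixes f :: "'a \<Rightarrow> 'b::{real_normed_div_algebra, banach, second_countable_topology}"
  shows "sqn M (\<lambda>x. c * f x) = norm c * sqn M f"
  by (simp add: sqn_def norm_mult power_mult_distrib real_sqrt_mult)

lemma sq_int_zero [simp]: "sq_int M (\<lambda>x. 0)" by (simp add: sq_int_def)

lemma sqn_zero [simp]: "sqn M (\<lambda>x. 0) = 0" by (simp add: sqn_def)

lemma sq_int_norm: "sq_int M f \<Longrightarrow> sq_int M (\<lambda>x. norm (f x))"
  by (auto simp: sq_int_def)

lemma sq_int_add:
  assumes f: "sq_int M f" and g: "sq_int M g"
  shows "sq_int M (\<lambda>x. f x + g x)"
  unfolding sq_int_def
proof
  have [measurable]: "f \<in> borel_measurable M" "g \<in> borel_measurable M" using assms by (auto simp: sq_int_def)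
  show "(\<lambda>x. f x + g x) \<in> borel_measurable M" by measurable
  show "integrable M (\<lambda>x. (norm (f x + g x))\<^sup>2)"
  proof (rule Bochner_Integration.integrable_bound)
    show "integrable M (\<lambda>x. 2 * (norm (f x))\<^sup>2 + 2 * (norm (g x))\<^sup>2)" using assms by (simp add: sq_int_def)
    show "AE x in M. norm ((norm (f x + g x))\<^sup>2) \<le> norm (2 * (norm (f x))\<^sup>2 + 2 * (norm (g x))\<^sup>2)"
    proof (intro AE_I2)
      fix x
      have "(norm (f x + g x))\<^sup>2 \<le> (norm (f x) + norm (g x))\<^sup>2"
        by (intro power_mono norm_triangle_ineq) auto
      also have "\<dots> \<le> 2 * (norm (f x))\<^sup>2 + 2 * (norm (g x))\<^sup>2"
        using sum_squares_bound[of "norm (f x)" "norm (g x)"] by (simp add: power2_sum)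
      finally show "norm ((norm (f x + g x))\<^sup>2) \<le> norm (2 * (norm (f x))\<^sup>2 + 2 * (norm (g x))\<^sup>2)"
        by simp
    qed
  qed measurable
qed

lemma sqn_triangle:
  assumes f: "sq_int M f" and g: "sq_int M g"
  shows "sqn M (\<lambda>x. f x + g x) \<le> sqn M f + sqn M g"
proof (rule power2_le_imp_le)
  have fg: "norm (\<integral>x. norm (f x) * norm (g x) \<partial>M) \<le> sqn M f * sqn M g"
    using sq_int_Cauchy_Schwarz[OF sq_int_norm[OF f] sq_int_norm[OF g]] by (simp add: sqn_def)
  have i: "integrable M (\<lambda>x. norm (f x) * norm (g x))"
    using sq_int_integrable_mult[OF sq_int_norm[OF f] sq_int_norm[OF g]] .
  have "(sqn M (\<lambda>x. f x + g x))\<^sup>2 \<le> (\<integral>x. (norm (f x))\<^sup>2 + (norm (g x))\<^sup>2 + 2 * (norm (f x) * norm (g x)) \<partial>M)"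
    unfolding sqn_square
  proof (rule integral_mono)
    show "integrable M (\<lambda>x. (norm (f x + g x))\<^sup>2)" using sq_int_add[OF f g] by (simp add: sq_int_def)
    show "integrable M (\<lambda>x. (norm (f x))\<^sup>2 + (norm (g x))\<^sup>2 + 2 * (norm (f x) * norm (g x)))"
      using f g i by (simp add: sq_int_def)
    fix x
    have "(norm (f x + g x))\<^sup>2 \<le> (norm (f x) + norm (g x))\<^sup>2"
      by (intro power_mono norm_triangle_ineq) auto
    then show "(norm (f x + g x))\<^sup>2 \<le> (norm (f x))\<^sup>2 + (norm (g x))\<^sup>2 + 2 * (norm (f x) * norm (g x))"
      by (simp add: power2_sum)
  qed
  also have "\<dots> = (sqn M f)\<^sup>2 + (sqn M g)\<^sup>2 + 2 * (\<integral>x. norm (f x) * norm (g x) \<partial>M)"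
    using f g i by (simp add: sq_int_def sqn_square)
  also have "\<dots> \<le> (sqn M f + sqn M g)\<^sup>2" using fg by (simp add: power2_sum)
  finally show "(sqn M (\<lambda>x. f x + g x))\<^sup>2 \<le> (sqn M f + sqn M g)\<^sup>2" .
qed simp

lemma sq_int_sum: "finite I \<Longrightarrow> (\<And>i. i \<in> I \<Longrightarrow> sq_int M (f i)) \<Longrightarrow> sq_int M (\<lambda>x. \<Sum>i\<in>I. f i x)"
  by (induction I rule: finite_induct) (auto intro: sq_int_add)

lemma sqn_sum_le:
  "finite I \<Longrightarrow> (\<And>i. i \<in> I \<Longrightarrow> sq_int M (f i)) \<Longrightarrow> sqn M (\<lambda>x. \<Sum>i\<in>I. f i x) \<le> (\<Sum>i\<in>I. sqn M (f i))"
proof (induction I rule: finite_induct)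
  case (insert a F)
  have "sqn M (\<lambda>x. f a x + (\<Sum>i\<in>F. f i x)) \<le> sqn M (f a) + sqn M (\<lambda>x. \<Sum>i\<in>F. f i x)"
    using insert by (intro sqn_triangle sq_int_sum) auto
  with insert show ?case by force
qed simp

lemma sq_int_uminus: "sq_int M f \<Longrightarrow> sq_int M (\<lambda>x. - f x)"
  using sq_int_cmult[of M f "-1"] by simp

lemma sq_int_diff: "sq_int M f \<Longrightarrow> sq_int M g \<Longrightarrow> sq_int M (\<lambda>x. f x - g x)"
  using sq_int_add[of M f "\<lambda>x. - g x"] sq_int_uminus[of M g] by simp

lemma sqn_le_add_diff:
  assumes "sq_int M f" "sq_int M g"
  shows "sqn M f \<le> sqn M g + sqn M (\<lambda>x. f x - g x)"
  using sqn_triangle[OF assms(2) sq_int_diff[OF assms]] by simp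

lemma sq_int_cnj: "sq_int M f \<Longrightarrow> sq_int M (\<lambda>x. cnj (f x))"
  by (auto simp: sq_int_def)

lemma sqn_cnj [simp]: "sqn M (\<lambda>x. cnj (f x)) = sqn M f"
  by (simp add: sqn_def)

lemma sq_int_bounded:
  assumes "finite_measure M" and [measurable]: "f \<in> borel_measurable M" and b: "\<And>x. norm (f x) \<le> C"
  shows "sq_int M f"
  unfolding sq_int_def
proof
  show "integrable M (\<lambda>x. (norm (f x))\<^sup>2)"
  proof (rule finite_measure.integrable_const_bound[OF assms(1), of _ "C\<^sup>2"])
    show "AE x in M. norm ((norm (f x))\<^sup>2) \<le> C\<^sup>2"
      using b by (intro AE_I2) (auto intro!: power_mono)
  qed measurable
qed fact

text \<open>
  Estimates are carried out with nonnegative integrals, where no integrability has to be known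
  in advance; this converts their result.
\<close>

lemma sq_intI_nn:
  assumes [measurable]: "f \<in> borel_measurable M"
    and b: "(\<integral>\<^sup>+x. ennreal ((norm (f x))\<^sup>2) \<partial>M) \<le> ennreal (c\<^sup>2)" "0 \<le> c"
  shows "sq_int M f" "sqn M f \<le> c"
proof -
  have *: "integrable M (\<lambda>x. (norm (f x))\<^sup>2)"
    by (rule integrableI_bounded) (use b in \<open>auto simp: top_unique less_top[symmetric] intro: le_less_trans\<close>)
  then show "sq_int M f" by (simp add: sq_int_def)
  have "ennreal (\<integral>x. (norm (f x))\<^sup>2 \<partial>M) \<le> ennreal (c\<^sup>2)"
    using b nn_integral_eq_integral[OF *] by simp
  then have "(sqn M f)\<^sup>2 \<le> c\<^sup>2" by (simp add: sqn_square ennreal_le_iff)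
  then show "sqn M f \<le> c" using b(2) by (rule power2_le_imp_le)
qed

lemma sq_int_nn:
  assumes "sq_int M f"
  shows "(\<integral>\<^sup>+x. ennreal ((norm (f x))\<^sup>2) \<partial>M) = ennreal ((sqn M f)\<^sup>2)"
  using assms by (simp add: sq_int_def sqn_square nn_integral_eq_integral)

section \<open>Exchanging integrals\<close>

lemma integrable_pair_dominated:
  fixes h :: "'a \<times> 'b \<Rightarrow> 'c::{banach, second_countable_topology}"
  assumes A: "sigma_finite_measure A" and B: "sigma_finite_measure B"
    and [measurable]: "h \<in> borel_measurable (A \<Otimes>\<^sub>M B)"
    and p: "integrable A p" and q: "integrable B q"
    and b: "\<And>x y. norm (h (x, y)) \<le> p x * (q y :: real)"
  shows "integrable (A \<Otimes>\<^sub>M B) h"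
proof (rule Bochner_Integration.integrable_bound)
  interpret pair_sigma_finite A B using A B by (simp add: pair_sigma_finite_def)
  have [measurable]: "p \<in> borel_measurable A" "q \<in> borel_measurable B" using p q by auto
  show "integrable (A \<Otimes>\<^sub>M B) (\<lambda>(x, y). p x * q y)"
  proof (rule Fubini_integrable)
    show "integrable A (\<lambda>x. \<integral>y. norm (case (x, y) of (x, y) \<Rightarrow> p x * q y) \<partial>B)"
      using p q by (simp add: abs_mult)
    show "AE x in A. integrable B (\<lambda>y. case (x, y) of (x, y) \<Rightarrow> p x * q y)"
      using q by simp
  qed measurable
  show "AE x in A \<Otimes>\<^sub>M B. norm (h x) \<le> norm (case x of (x, y) \<Rightarrow> p x * q y)"
    using b by (intro AE_I2) (auto split: prod.split intro: order_trans[OF _ abs_ge_self])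
qed fact

text \<open>
  Used over Lebesgue measure, where boundedness of the integrand is not enough.
\<close>

lemma Fubini_swap_dominated:
  fixes h :: "'a \<Rightarrow> 'b \<Rightarrow> 'c::{banach, second_countable_topology}"
  assumes A: "sigma_finite_measure A" and B: "sigma_finite_measure B"
    and m: "(\<lambda>(x, y). h x y) \<in> borel_measurable (A \<Otimes>\<^sub>M B)"
    and p: "integrable A p" and q: "integrable B q"
    and b: "\<And>x y. norm (h x y) \<le> p x * (q y :: real)"
  shows "(\<integral>x. \<integral>y. h x y \<partial>B \<partial>A) = (\<integral>y. \<integral>x. h x y \<partial>A \<partial>B)"
proof -
  interpret pair_sigma_finite A B using A B by (simp add: pair_sigma_finite_def)
  show ?thesis
    using Fubini_integral[of h] integrable_pair_dominated[OF A B m p q] b by simp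
qed

lemma Fubini_swap_bounded:
  fixes h :: "'a \<Rightarrow> 'b \<Rightarrow> 'c::{banach, second_countable_topology}"
  assumes A: "finite_measure A" and B: "finite_measure B"
    and m: "(\<lambda>(x, y). h x y) \<in> borel_measurable (A \<Otimes>\<^sub>M B)"
    and b: "\<And>x y. norm (h x y) \<le> C"
  shows "(\<integral>x. \<integral>y. h x y \<partial>B \<partial>A) = (\<integral>y. \<integral>x. h x y \<partial>A \<partial>B)"
proof -
  interpret A: finite_measure A by fact
  interpret B: finite_measure B by fact
  show ?thesis
    using b by (intro Fubini_swap_dominated[of A B h "\<lambda>_. C" "\<lambda>_. 1"] m) (auto intro: A.sigma_finite_measure B.sigma_finite_measure)
qed

section \<open>The Fourier transform\<close>

definition ft :: "(real \<Rightarrow> complex) \<Rightarrow> real \<Rightarrow> complex" where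
  "ft h t = (\<integral>x. cis (x * t) * h x \<partial>lborel)"

lemma fourier_hat_eq_ft: "fourier_hat h t = ft (\<lambda>x. complex_of_real (h x)) t"
  by (simp add: fourier_hat_def ft_def cis_conv_exp)

lemma integrable_cis_mult:
  assumes "integrable M h" "g \<in> borel_measurable M"
  shows "integrable M (\<lambda>x. cis (g x) * h x)"
  using assms(1)
  by (rule Bochner_Integration.integrable_bound) (use assms in \<open>auto simp: norm_mult\<close>)

lemma ft_measurable [measurable]:
  assumes [measurable]: "h \<in> borel_measurable borel"
  shows "ft h \<in> borel_measurable borel"
  unfolding ft_def by measurable

lemma norm_ft_le: "norm (ft h t) \<le> (\<integral>x. norm (h x) \<partial>lborel)"
proof -
  have "norm (ft h t) \<le> (\<integral>x. norm (cis (x * t) * h x) \<partial>lborel)"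
    unfolding ft_def by (rule integral_norm_bound)
  then show ?thesis by (simp add: norm_mult)
qed

text \<open>
  The multiplication formula: both sides are the same double integral.
\<close>

lemma ft_multiplication:
  assumes h: "integrable lborel h" and g: "integrable lborel g"
  shows "(\<integral>t. ft h t * g t \<partial>lborel) = (\<integral>x. h x * ft g x \<partial>lborel)"
proof -
  have [measurable]: "h \<in> borel_measurable borel" "g \<in> borel_measurable borel" using h g by auto
  have "(\<integral>t. \<integral>x. cis (x * t) * h x * g t \<partial>lborel \<partial>lborel) = (\<integral>x. \<integral>t. cis (x * t) * h x * g t \<partial>lborel \<partial>lborel)"
    using h g
    by (intro Fubini_swap_dominated[where p = "\<lambda>t. norm (g t)" and q = "\<lambda>x. norm (h x)"])
       (auto simp: norm_mult lborel.sigma_finite_measure_axioms)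
  then show ?thesis by (simp add: ft_def mult_ac flip: integral_mult_right_zero)
qed

lemma ft_cis_mult: "ft (\<lambda>x. cis (x * s) * h x) t = ft h (s + t)"
  unfolding ft_def by (intro Bochner_Integration.integral_cong) (auto simp: cis_mult distrib_left algebra_simps)

lemma cnj_ft: "cnj (ft h t) = ft (\<lambda>x. cnj (h x)) (- t)"
  unfolding ft_def Bochner_Integration.integral_cnj[symmetric] by (simp add: cis_cnj)

lemma ft_of_real_uminus: "ft (\<lambda>x. complex_of_real (h x)) (- t) = cnj (ft (\<lambda>x. complex_of_real (h x)) t)"
  by (simp add: cnj_ft)

lemma ft_reflect: "ft (\<lambda>x. h (- x)) t = ft h (- t)"
proof -
  have "ft h (- t) = (\<integral>x. cis (x * (- t)) * h x \<partial>lborel)" by (simp add: ft_def)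
  also have "\<dots> = (\<integral>x. cis ((- x) * (- t)) * h (- x) \<partial>lborel)"
    using lborel_integral_real_affine[of "-1" "\<lambda>x. cis (x * (- t)) * h x" 0] by simp
  finally show ?thesis by (simp add: ft_def)
qed

text \<open>
  Gaussians serve as convergence factors in the proof of Plancherel's theorem, because their
  transform is explicit.
\<close>

lemma integrable_gaussian:
  fixes \<epsilon> :: real assumes "\<epsilon> > 0"
  shows "integrable lborel (\<lambda>t. exp (- (\<epsilon> * t)\<^sup>2 / 2))"
proof -
  have "integrable lborel (\<lambda>t::real. sqrt (2 * pi * (1 / \<epsilon>) ^ 2) * normal_density 0 (1 / \<epsilon>) t)"
    using assms by simp
  also have "(\<lambda>t. sqrt (2 * pi * (1 / \<epsilon>) ^ 2) * normal_density 0 (1 / \<epsilon>) t) = (\<lambda>t. exp (- (\<epsilon> * t)\<^sup>2 / 2))"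
    using assms by (auto simp: normal_density_def power_divide power_mult_distrib real_sqrt_mult real_sqrt_divide field_simps)
  finally show ?thesis .
qed

lemma ft_gaussian:
  fixes \<epsilon> :: real assumes "\<epsilon> > 0"
  shows "ft (\<lambda>t. complex_of_real (exp (- (\<epsilon> * t)\<^sup>2 / 2))) z = complex_of_real (2 * pi * normal_density 0 \<epsilon> z)"
proof -
  have c: "char std_normal_distribution (z / \<epsilon>) = complex_of_real (exp (- ((z / \<epsilon>)\<^sup>2) / 2))"
    by (simp add: char_std_normal_distribution)
  have "char std_normal_distribution (z / \<epsilon>) = (\<integral>t. std_normal_density t *\<^sub>R cis (t * (z / \<epsilon>)) \<partial>lborel)"
    unfolding char_def by (subst integral_density) (auto simp: cis_conv_exp mult_ac)
  also have "\<dots> = \<epsilon> *\<^sub>R (\<integral>t. std_normal_density (\<epsilon> * t) *\<^sub>R cis (\<epsilon> * t * (z / \<epsilon>)) \<partial>lborel)"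
    using lborel_integral_real_affine[of \<epsilon> "\<lambda>t. std_normal_density t *\<^sub>R cis (t * (z / \<epsilon>))" 0] assms by simp
  also have "(\<lambda>t. std_normal_density (\<epsilon> * t) *\<^sub>R cis (\<epsilon> * t * (z / \<epsilon>)))
      = (\<lambda>t. complex_of_real (1 / sqrt (2 * pi)) * (cis (t * z) * complex_of_real (exp (- (\<epsilon> * t)\<^sup>2 / 2))))"
    using assms by (auto simp: std_normal_density_def scaleR_conv_of_real)
  finally have "complex_of_real (exp (- ((z / \<epsilon>)\<^sup>2) / 2))
      = complex_of_real (\<epsilon> / sqrt (2 * pi)) * ft (\<lambda>t. complex_of_real (exp (- (\<epsilon> * t)\<^sup>2 / 2))) z"
    unfolding c by (simp add: ft_def scaleR_conv_of_real)
  then have "ft (\<lambda>t. complex_of_real (exp (- (\<epsilon> * t)\<^sup>2 / 2))) z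
      = complex_of_real (sqrt (2 * pi) / \<epsilon> * exp (- ((z / \<epsilon>)\<^sup>2) / 2))"
    using assms by (simp add: field_simps)
  also have "sqrt (2 * pi) / \<epsilon> * exp (- ((z / \<epsilon>)\<^sup>2) / 2) = 2 * pi * normal_density 0 \<epsilon> z"
  proof -
    have "sqrt (2 * pi) * sqrt (2 * pi) = 2 * pi" by simp
    then show ?thesis using assms
      by (simp add: normal_density_def power_divide real_sqrt_mult field_simps)
  qed
  finally show ?thesis .
qed

text \<open>
  The Gaussian factor makes the left side absolutely convergent for all integrable functions.
  By two applications of the multiplication formula it turns into a convolution with a narrow
  normal density.
\<close>

lemma regularised_Parseval:
  assumes h1: "integrable lborel h1" and h2: "integrable lborel h2" and e: "\<epsilon> > 0"
  shows "(\<integral>t. ft h1 t * cnj (ft h2 t) * complex_of_real (exp (- (\<epsilon> * t)\<^sup>2 / 2)) \<partial>lborel)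
    = 2 * pi * (\<integral>x. h1 x * (\<integral>y. cnj (h2 y) * complex_of_real (normal_density 0 \<epsilon> (x - y)) \<partial>lborel) \<partial>lborel)"
proof -
  have [measurable]: "h1 \<in> borel_measurable borel" "h2 \<in> borel_measurable borel" using h1 h2 by auto
  define E where "E t = complex_of_real (exp (- (\<epsilon> * t)\<^sup>2 / 2))" for t
  have E[simp]: "integrable lborel E" unfolding E_def using integrable_gaussian[OF e] by simp
  have [measurable]: "E \<in> borel_measurable borel" using E by (rule borel_measurable_integrable[of lborel, simplified])
  define k where "k y = cnj (h2 (- y))" for y
  have h2k: "integrable lborel (\<lambda>y. cnj (h2 y))" using h2 by simp
  have k: "integrable lborel k"
    unfolding k_def using lborel_integrable_real_affine[OF h2k, of "-1" 0] by simp
  have [measurable]: "k \<in> borel_measurable borel" unfolding k_def by measurable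
  have cnj2: "cnj (ft h2 t) = ft k t" for t
    unfolding k_def cnj_ft by (subst ft_reflect) simp
  have int: "integrable lborel (\<lambda>t. ft k t * E t)"
  proof (rule Bochner_Integration.integrable_bound)
    show "integrable lborel (\<lambda>t. (\<integral>x. norm (k x) \<partial>lborel) * norm (E t))" by simp
    show "AE t in lborel. norm (ft k t * E t) \<le> norm ((\<integral>x. norm (k x) \<partial>lborel) * norm (E t))"
      by (intro AE_I2) (simp add: norm_mult mult_right_mono norm_ft_le)
  qed measurable
  have inner: "ft (\<lambda>t. ft k t * E t) x = 2 * pi * (\<integral>y. cnj (h2 y) * complex_of_real (normal_density 0 \<epsilon> (x - y)) \<partial>lborel)" for x
  proof -
    have "ft (\<lambda>t. ft k t * E t) x = (\<integral>t. ft k t * (cis (t * x) * E t) \<partial>lborel)"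
      by (simp add: ft_def mult_ac)
    also have "\<dots> = (\<integral>y. k y * ft (\<lambda>t. cis (t * x) * E t) y \<partial>lborel)"
      by (intro ft_multiplication k integrable_cis_mult) auto
    also have "\<dots> = (\<integral>y. k y * complex_of_real (2 * pi * normal_density 0 \<epsilon> (x + y)) \<partial>lborel)"
      by (simp only: ft_cis_mult E_def[abs_def] ft_gaussian[OF e])
    also have "\<dots> = (\<integral>y. cnj (h2 y) * complex_of_real (2 * pi * normal_density 0 \<epsilon> (x - y)) \<partial>lborel)"
      by (subst lborel_integral_real_affine[of "-1" _ 0]) (simp_all add: k_def)
    also have "\<dots> = (\<integral>y. 2 * pi * (cnj (h2 y) * complex_of_real (normal_density 0 \<epsilon> (x - y))) \<partial>lborel)"
      by (intro Bochner_Integration.integral_cong) auto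
    finally show ?thesis by simp
  qed
  have "(\<integral>t. ft h1 t * cnj (ft h2 t) * E t \<partial>lborel) = (\<integral>t. ft h1 t * (ft k t * E t) \<partial>lborel)"
    by (simp add: cnj2 mult_ac)
  also have "\<dots> = (\<integral>x. h1 x * ft (\<lambda>t. ft k t * E t) x \<partial>lborel)"
    by (rule ft_multiplication[OF h1 int])
  also have "\<dots> = (\<integral>x. 2 * pi * (h1 x * (\<integral>y. cnj (h2 y) * complex_of_real (normal_density 0 \<epsilon> (x - y)) \<partial>lborel)) \<partial>lborel)"
    unfolding inner by (intro Bochner_Integration.integral_cong) auto
  finally show ?thesis by (simp add: E_def)
qed

lemma nn_integral_lborel_shift:
  fixes h :: "real \<Rightarrow> ennreal"
  assumes [measurable]: "h \<in> borel_measurable borel"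
  shows "(\<integral>\<^sup>+x. h (a - x) \<partial>lborel) = (\<integral>\<^sup>+x. h x \<partial>lborel)"
    "(\<integral>\<^sup>+x. h (a + x) \<partial>lborel) = (\<integral>\<^sup>+x. h x \<partial>lborel)"
    "(\<integral>\<^sup>+x. h (x - a) \<partial>lborel) = (\<integral>\<^sup>+x. h x \<partial>lborel)"
    "(\<integral>\<^sup>+x. h (x + a) \<partial>lborel) = (\<integral>\<^sup>+x. h x \<partial>lborel)"
  using nn_integral_real_affine[of h "-1" a] nn_integral_real_affine[of h 1 a] nn_integral_real_affine[of h 1 "-a"]
  by (simp_all add: add_ac)

text \<open>
  One half of Plancherel's theorem. In the regularised formula the right side is at most
  \<open>2 pi\<close> times the integral of \<open>|h|\<^sup>2\<close>, since \<open>|h(x) h(y)| \<le> (|h(x)|\<^sup>2 + |h(y)|\<^sup>2) / 2\<close> and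
  the normal density has mass one; Fatou's lemma removes the factor.
\<close>

theorem Bessel_inequality:
  assumes h: "integrable lborel h"
  shows "(\<integral>\<^sup>+t. ennreal ((norm (ft h t))\<^sup>2) \<partial>lborel) \<le> ennreal (2 * pi) * (\<integral>\<^sup>+x. ennreal ((norm (h x))\<^sup>2) \<partial>lborel)"
proof -
  have [measurable]: "h \<in> borel_measurable borel" using h by auto
  define \<epsilon> where "\<epsilon> n = 1 / real (Suc n)" for n
  have e: "\<epsilon> n > 0" for n by (simp add: \<epsilon>_def)
  have e0: "\<epsilon> \<longlonglongrightarrow> 0" unfolding \<epsilon>_def by (rule LIMSEQ_Suc[OF lim_1_over_n])
  define J where "J n = (\<integral>\<^sup>+t. ennreal ((norm (ft h t))\<^sup>2 * exp (- (\<epsilon> n * t)\<^sup>2 / 2)) \<partial>lborel)" for n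
  have J: "J n \<le> ennreal (2 * pi) * (\<integral>\<^sup>+x. ennreal ((norm (h x))\<^sup>2) \<partial>lborel)" for n
  proof -
    let ?n = "\<lambda>z. normal_density 0 (\<epsilon> n) z"
    have i: "integrable lborel (\<lambda>t. (norm (ft h t))\<^sup>2 * exp (- (\<epsilon> n * t)\<^sup>2 / 2))"
    proof (rule Bochner_Integration.integrable_bound)
      show "integrable lborel (\<lambda>t. (\<integral>x. norm (h x) \<partial>lborel)\<^sup>2 * exp (- (\<epsilon> n * t)\<^sup>2 / 2))"
        using integrable_gaussian[OF e] by simp
      show "AE t in lborel. norm ((norm (ft h t))\<^sup>2 * exp (- (\<epsilon> n * t)\<^sup>2 / 2)) \<le> norm ((\<integral>x. norm (h x) \<partial>lborel)\<^sup>2 * exp (- (\<epsilon> n * t)\<^sup>2 / 2))"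
        by (intro AE_I2) (simp add: abs_mult mult_right_mono power_mono norm_ft_le)
    qed measurable
    have "complex_of_real (\<integral>t. (norm (ft h t))\<^sup>2 * exp (- (\<epsilon> n * t)\<^sup>2 / 2) \<partial>lborel)
        = (\<integral>t. ft h t * cnj (ft h t) * complex_of_real (exp (- (\<epsilon> n * t)\<^sup>2 / 2)) \<partial>lborel)"
      by (subst integral_complex_of_real[symmetric]) (simp only: of_real_mult complex_norm_square)
    also have "\<dots> = 2 * pi * (\<integral>x. h x * (\<integral>y. cnj (h y) * complex_of_real (?n (x - y)) \<partial>lborel) \<partial>lborel)"
      by (rule regularised_Parseval[OF h h e])
    finally have eq: "complex_of_real (\<integral>t. (norm (ft h t))\<^sup>2 * exp (- (\<epsilon> n * t)\<^sup>2 / 2) \<partial>lborel) = \<dots>" .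
    have "(\<integral>t. (norm (ft h t))\<^sup>2 * exp (- (\<epsilon> n * t)\<^sup>2 / 2) \<partial>lborel)
        \<le> norm (complex_of_real (\<integral>t. (norm (ft h t))\<^sup>2 * exp (- (\<epsilon> n * t)\<^sup>2 / 2) \<partial>lborel))"
      unfolding norm_of_real by (rule abs_ge_self)
    also have "\<dots> = norm (2 * pi * (\<integral>x. h x * (\<integral>y. cnj (h y) * complex_of_real (?n (x - y)) \<partial>lborel) \<partial>lborel))"
      by (simp only: eq)
    also have "\<dots> = 2 * pi * norm (\<integral>x. h x * (\<integral>y. cnj (h y) * complex_of_real (?n (x - y)) \<partial>lborel) \<partial>lborel)"
      by (simp add: norm_mult)
    finally have "J n \<le> ennreal (2 * pi) * ennreal (norm (\<integral>x. h x * (\<integral>y. cnj (h y) * complex_of_real (?n (x - y)) \<partial>lborel) \<partial>lborel))"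
      unfolding J_def by (subst nn_integral_eq_integral[OF i]) (auto simp flip: ennreal_mult)
    also have "\<dots> \<le> ennreal (2 * pi) * (\<integral>\<^sup>+x. ennreal (norm (h x)) * (\<integral>\<^sup>+y. ennreal (norm (h y)) * ennreal (?n (x - y)) \<partial>lborel) \<partial>lborel)"
    proof (intro mult_left_mono order_trans[OF norm_integral_le_nn_integral] nn_integral_mono)
      fix x
      have "ennreal (norm (\<integral>y. cnj (h y) * complex_of_real (?n (x - y)) \<partial>lborel))
          \<le> (\<integral>\<^sup>+y. ennreal (norm (cnj (h y) * complex_of_real (?n (x - y)))) \<partial>lborel)"
        by (rule norm_integral_le_nn_integral)
      then show "ennreal (norm (h x * (\<integral>y. cnj (h y) * complex_of_real (?n (x - y)) \<partial>lborel)))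
          \<le> ennreal (norm (h x)) * (\<integral>\<^sup>+y. ennreal (norm (h y)) * ennreal (?n (x - y)) \<partial>lborel)"
        by (simp add: norm_mult ennreal_mult mult_left_mono)
    qed simp
    also have "\<dots> \<le> ennreal (2 * pi) * (\<integral>\<^sup>+x. \<integral>\<^sup>+y. (ennreal ((norm (h x))\<^sup>2 / 2) + ennreal ((norm (h y))\<^sup>2 / 2)) * ennreal (?n (x - y)) \<partial>lborel \<partial>lborel)"
    proof (intro mult_left_mono nn_integral_mono)
      fix x
      have "ennreal (norm (h x)) * (\<integral>\<^sup>+y. ennreal (norm (h y)) * ennreal (?n (x - y)) \<partial>lborel)
          = (\<integral>\<^sup>+y. ennreal (norm (h x) * norm (h y)) * ennreal (?n (x - y)) \<partial>lborel)"
        by (simp add: nn_integral_cmult[symmetric] ennreal_mult mult.assoc)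
      also have "\<dots> \<le> (\<integral>\<^sup>+y. (ennreal ((norm (h x))\<^sup>2 / 2) + ennreal ((norm (h y))\<^sup>2 / 2)) * ennreal (?n (x - y)) \<partial>lborel)"
      proof (intro nn_integral_mono mult_right_mono)
        fix y
        have "norm (h x) * norm (h y) \<le> (norm (h x))\<^sup>2 / 2 + (norm (h y))\<^sup>2 / 2"
          using sum_squares_bound[of "norm (h x)" "norm (h y)"] by simp
        then have "ennreal (norm (h x) * norm (h y)) \<le> ennreal ((norm (h x))\<^sup>2 / 2 + (norm (h y))\<^sup>2 / 2)"
          by (rule ennreal_leI)
        then show "ennreal (norm (h x) * norm (h y)) \<le> ennreal ((norm (h x))\<^sup>2 / 2) + ennreal ((norm (h y))\<^sup>2 / 2)"
          by simp
      qed simp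
      finally show "ennreal (norm (h x)) * (\<integral>\<^sup>+y. ennreal (norm (h y)) * ennreal (?n (x - y)) \<partial>lborel) \<le> \<dots>" .
    qed simp
    also have "(\<integral>\<^sup>+x. \<integral>\<^sup>+y. (ennreal ((norm (h x))\<^sup>2 / 2) + ennreal ((norm (h y))\<^sup>2 / 2)) * ennreal (?n (x - y)) \<partial>lborel \<partial>lborel)
        = (\<integral>\<^sup>+x. \<integral>\<^sup>+y. ennreal ((norm (h x))\<^sup>2 / 2) * ennreal (?n (x - y)) \<partial>lborel \<partial>lborel)
        + (\<integral>\<^sup>+x. \<integral>\<^sup>+y. ennreal ((norm (h y))\<^sup>2 / 2) * ennreal (?n (x - y)) \<partial>lborel \<partial>lborel)"
      by (simp add: distrib_right nn_integral_add)
    also have "(\<integral>\<^sup>+x. \<integral>\<^sup>+y. ennreal ((norm (h y))\<^sup>2 / 2) * ennreal (?n (x - y)) \<partial>lborel \<partial>lborel)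
        = (\<integral>\<^sup>+y. \<integral>\<^sup>+x. ennreal ((norm (h y))\<^sup>2 / 2) * ennreal (?n (x - y)) \<partial>lborel \<partial>lborel)"
      by (rule lborel_pair.Fubini') measurable
    also have "(\<integral>\<^sup>+y. \<integral>\<^sup>+x. ennreal ((norm (h y))\<^sup>2 / 2) * ennreal (?n (x - y)) \<partial>lborel \<partial>lborel)
        = (\<integral>\<^sup>+y. ennreal ((norm (h y))\<^sup>2 / 2) \<partial>lborel)"
      using e by (simp add: nn_integral_cmult nn_integral_lborel_shift(3)[of "\<lambda>z. ennreal (?n z)"] nn_integral_eq_integral)
    also have "(\<integral>\<^sup>+x. \<integral>\<^sup>+y. ennreal ((norm (h x))\<^sup>2 / 2) * ennreal (?n (x - y)) \<partial>lborel \<partial>lborel)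
        = (\<integral>\<^sup>+x. ennreal ((norm (h x))\<^sup>2 / 2) \<partial>lborel)"
      using e by (simp add: nn_integral_cmult nn_integral_lborel_shift(1)[of "\<lambda>z. ennreal (?n z)"] nn_integral_eq_integral)
    also have "(\<integral>\<^sup>+x. ennreal ((norm (h x))\<^sup>2 / 2) \<partial>lborel) + (\<integral>\<^sup>+x. ennreal ((norm (h x))\<^sup>2 / 2) \<partial>lborel) = (\<integral>\<^sup>+x. ennreal ((norm (h x))\<^sup>2) \<partial>lborel)"
    proof (subst nn_integral_add[symmetric])
      have "ennreal (a / 2) + ennreal (a / 2) = ennreal a" if "0 \<le> a" for a :: real
        using that by (subst ennreal_plus[symmetric]) auto
      then show "(\<integral>\<^sup>+x. ennreal ((norm (h x))\<^sup>2 / 2) + ennreal ((norm (h x))\<^sup>2 / 2) \<partial>lborel) = (\<integral>\<^sup>+x. ennreal ((norm (h x))\<^sup>2) \<partial>lborel)"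
        by (simp only: zero_le_power2)
    qed measurable
    finally show ?thesis .
  qed
  have "(\<integral>\<^sup>+t. ennreal ((norm (ft h t))\<^sup>2) \<partial>lborel) = (\<integral>\<^sup>+t. liminf (\<lambda>n. ennreal ((norm (ft h t))\<^sup>2 * exp (- (\<epsilon> n * t)\<^sup>2 / 2))) \<partial>lborel)"
  proof (intro nn_integral_cong)
    fix t
    have "(\<lambda>n. (norm (ft h t))\<^sup>2 * exp (- (\<epsilon> n * t)\<^sup>2 / 2)) \<longlonglongrightarrow> (norm (ft h t))\<^sup>2 * exp (- (0 * t)\<^sup>2 / 2)"
      by (intro tendsto_intros e0) auto
    then have "(\<lambda>n. ennreal ((norm (ft h t))\<^sup>2 * exp (- (\<epsilon> n * t)\<^sup>2 / 2))) \<longlonglongrightarrow> ennreal ((norm (ft h t))\<^sup>2)"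
      by (intro tendsto_ennrealI) simp
    then show "ennreal ((norm (ft h t))\<^sup>2) = liminf (\<lambda>n. ennreal ((norm (ft h t))\<^sup>2 * exp (- (\<epsilon> n * t)\<^sup>2 / 2)))"
      by (rule lim_imp_Liminf[OF trivial_limit_sequentially, symmetric])
  qed
  also have "\<dots> \<le> liminf J"
    unfolding J_def by (rule nn_integral_liminf) measurable
  also have "\<dots> \<le> liminf (\<lambda>_::nat. ennreal (2 * pi) * (\<integral>\<^sup>+x. ennreal ((norm (h x))\<^sup>2) \<partial>lborel))"
    by (rule Liminf_mono) (use J in auto)
  finally show ?thesis by (simp add: Liminf_const)
qed

lemma integral_lborel_shift:
  fixes h :: "real \<Rightarrow> 'b::{banach, second_countable_topology}"
  shows "(\<integral>x. h (a + x) \<partial>lborel) = (\<integral>x. h x \<partial>lborel)" "(\<integral>x. h (x + a) \<partial>lborel) = (\<integral>x. h x \<partial>lborel)"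
    "(\<integral>x. h (a - x) \<partial>lborel) = (\<integral>x. h x \<partial>lborel)"
  using lborel_integral_real_affine[of 1 h a] lborel_integral_real_affine[of "-1" h a] by (simp_all add: add_ac)

lemma integrable_lborel_shift:
  fixes h :: "real \<Rightarrow> 'b::{banach, second_countable_topology}"
  assumes "integrable lborel h"
  shows "integrable lborel (\<lambda>x. h (a + x))" "integrable lborel (\<lambda>x. h (x + a))" "integrable lborel (\<lambda>x. h (a - x))"
  using lborel_integrable_real_affine[OF assms, of 1 a] lborel_integrable_real_affine[OF assms, of "-1" a]
  by (simp_all add: add_ac)

text \<open>
  Open sets come first because there the pointwise convergence is obvious.
\<close>

lemma L1_translation_continuous_open:
  assumes U: "open U" and fin: "emeasure lborel U < \<infinity>" and z: "z \<longlonglongrightarrow> (0::real)"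
  shows "(\<lambda>n. \<integral>x. \<bar>indicator U (x + z n) - indicator U x\<bar> \<partial>lborel) \<longlonglongrightarrow> (0::real)"
proof -
  let ?u = "indicator U :: real \<Rightarrow> real"
  have [measurable]: "U \<in> sets borel" using U by simp
  have u: "integrable lborel ?u" using fin by (simp add: integrable_indicator_iff)
  have uz: "integrable lborel (\<lambda>x. ?u (x + a))" for a by (rule integrable_lborel_shift(2)[OF u])
  \<comment> \<open>Both indicators have the same integral, so the distance is twice the loss; on an open set the loss tends to zero pointwise.\<close>
  have "(\<integral>x. \<bar>?u (x + z n) - ?u x\<bar> \<partial>lborel) = 2 * (\<integral>x. max 0 (?u x - ?u (x + z n)) \<partial>lborel)" for n
  proof -
    have "(\<integral>x. \<bar>?u (x + z n) - ?u x\<bar> \<partial>lborel) = (\<integral>x. 2 * max 0 (?u x - ?u (x + z n)) + (?u (x + z n) - ?u x) \<partial>lborel)"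
      by (intro Bochner_Integration.integral_cong) (auto simp: indicator_def)
    also have "\<dots> = 2 * (\<integral>x. max 0 (?u x - ?u (x + z n)) \<partial>lborel) + ((\<integral>x. ?u (x + z n) \<partial>lborel) - (\<integral>x. ?u x \<partial>lborel))"
      using u uz[of "z n"] by simp
    finally show ?thesis by (simp only: integral_lborel_shift(2))
  qed
  moreover have "(\<lambda>n. \<integral>x. max 0 (?u x - ?u (x + z n)) \<partial>lborel) \<longlonglongrightarrow> (\<integral>x. 0 \<partial>(lborel :: real measure))"
  proof (rule integral_dominated_convergence[where w = ?u])
    show "AE x in lborel. (\<lambda>n. max 0 (?u x - ?u (x + z n))) \<longlonglongrightarrow> 0"
    proof (intro AE_I2)
      fix x
      show "(\<lambda>n. max 0 (?u x - ?u (x + z n))) \<longlonglongrightarrow> 0"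
      proof (cases "x \<in> U")
        case True
        have "(\<lambda>n. x + z n) \<longlonglongrightarrow> x + 0" by (intro tendsto_intros z)
        then have "\<forall>\<^sub>F n in sequentially. x + z n \<in> U"
          using topological_tendstoD[OF _ U] True by simp
        then show ?thesis
          by (intro tendsto_eventually) (auto elim!: eventually_mono simp: True)
      qed (simp add: indicator_def)
    qed
  qed (use u in \<open>auto simp: indicator_def\<close>)
  ultimately show ?thesis using tendsto_mult_left[of _ 0 _ 2] by fastforce
qed

lemma nonneg_null_sequenceI:
  fixes a :: "nat \<Rightarrow> real"
  assumes "\<And>n. 0 \<le> a n" and "\<And>e. e > 0 \<Longrightarrow> \<exists>b. b \<longlonglongrightarrow> 0 \<and> (\<forall>n. a n \<le> b n + e)"
  shows "a \<longlonglongrightarrow> 0"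
proof (rule LIMSEQ_I)
  fix r :: real assume r: "0 < r"
  obtain b where b: "b \<longlonglongrightarrow> 0" "\<And>n. a n \<le> b n + r / 2" using assms(2)[of "r / 2"] r by auto
  have "\<forall>\<^sub>F n in sequentially. b n < r / 2" using order_tendstoD(2)[OF b(1), of "r / 2"] r by simp
  then obtain N where "\<And>n. n \<ge> N \<Longrightarrow> b n < r / 2" by (auto simp: eventually_sequentially)
  then show "\<exists>N. \<forall>n\<ge>N. norm (a n - 0) < r"
    using assms(1) b(2) by (intro exI[of _ N]) (smt (verit) field_sum_of_halves real_norm_def)
qed

text \<open>
  Sets of finite measure are approximated by open ones from outside, functions by simple ones.
\<close>

theorem L1_translation_continuous:
  fixes h :: "real \<Rightarrow> complex"
  assumes "integrable lborel h" and z: "z \<longlonglongrightarrow> (0::real)"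
  shows "(\<lambda>n. \<integral>x. norm (h (x + z n) - h x) \<partial>lborel) \<longlonglongrightarrow> 0"
  using assms(1)
proof (induction rule: integrable_induct)
  case (base A c)
  have A[measurable]: "A \<in> sets borel" using base by simp
  let ?a = "indicator A :: real \<Rightarrow> real"
  have a: "integrable lborel ?a" using base by (simp add: integrable_indicator_iff)
  have az: "integrable lborel (\<lambda>x. ?a (x + v))" for v by (rule integrable_lborel_shift(2)[OF a])
  have "(\<lambda>n. \<integral>x. \<bar>?a (x + z n) - ?a x\<bar> \<partial>lborel) \<longlonglongrightarrow> 0"
  proof (rule nonneg_null_sequenceI)
    fix e :: real assume e: "e > 0"
    obtain U where U: "open U" "A \<subseteq> U" "emeasure lborel (U - A) < ennreal (e / 2)"
      using outer_regular_lborel[of A "e / 2"] e by auto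
    have [measurable]: "U \<in> sets borel" using U by simp
    have "emeasure lborel U = emeasure lborel A + emeasure lborel (U - A)"
      using U(2) by (subst plus_emeasure) (auto intro!: arg_cong[where f = "emeasure lborel"])
    also have "\<dots> < \<infinity>" using base U(3) by (auto simp: less_top[symmetric] top_unique)
    finally have Uf: "emeasure lborel U < \<infinity>" .
    let ?u = "indicator U :: real \<Rightarrow> real"
    have u: "integrable lborel ?u" using Uf by (simp add: integrable_indicator_iff)
    have uz: "integrable lborel (\<lambda>x. ?u (x + v))" for v by (rule integrable_lborel_shift(2)[OF u])
    have d: "(\<integral>x. ?u x - ?a x \<partial>lborel) \<le> e / 2"
    proof -
      have "(\<integral>x. ?u x - ?a x \<partial>lborel) = (\<integral>x. indicator (U - A) x \<partial>lborel)"
        using U(2) by (intro Bochner_Integration.integral_cong) (auto simp: indicator_def)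
      also have "\<dots> = measure lborel (U - A)" by simp
      also have "ennreal \<dots> = emeasure lborel (U - A)"
        using U(3) by (subst emeasure_eq_ennreal_measure) auto
      then have "measure lborel (U - A) \<le> e / 2"
        using U(3) e by (metis ennreal_le_iff less_eq_real_def less_imp_le half_gt_zero)
      finally show ?thesis .
    qed
    have "(\<integral>x. \<bar>?a (x + z n) - ?a x\<bar> \<partial>lborel) \<le> (\<integral>x. \<bar>?u (x + z n) - ?u x\<bar> \<partial>lborel) + e" for n
    proof -
      have "(\<integral>x. \<bar>?a (x + z n) - ?a x\<bar> \<partial>lborel)
        \<le> (\<integral>x. \<bar>?u (x + z n) - ?u x\<bar> + ((?u (x + z n) - ?a (x + z n)) + (?u x - ?a x)) \<partial>lborel)"
      proof (rule integral_mono)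
        show "integrable lborel (\<lambda>x. \<bar>?a (x + z n) - ?a x\<bar>)"
          by (intro integrable_abs Bochner_Integration.integrable_diff a az)
        show "integrable lborel (\<lambda>x. \<bar>?u (x + z n) - ?u x\<bar> + ((?u (x + z n) - ?a (x + z n)) + (?u x - ?a x)))"
          by (intro Bochner_Integration.integrable_add integrable_abs Bochner_Integration.integrable_diff a az u uz)
      qed (use U(2) in \<open>auto simp: indicator_def\<close>)
      also have "\<dots> = (\<integral>x. \<bar>?u (x + z n) - ?u x\<bar> \<partial>lborel) + ((\<integral>x. ?u (x + z n) - ?a (x + z n) \<partial>lborel) + (\<integral>x. ?u x - ?a x \<partial>lborel))"
        using a u az[of "z n"] uz[of "z n"] by simp
      also have "(\<integral>x. ?u (x + z n) - ?a (x + z n) \<partial>lborel) = (\<integral>x. ?u x - ?a x \<partial>lborel)"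
        by (rule integral_lborel_shift(2)[of "\<lambda>x. ?u x - ?a x"])
      finally show ?thesis using d by simp
    qed
    then show "\<exists>b. b \<longlonglongrightarrow> 0 \<and> (\<forall>n. (\<integral>x. \<bar>?a (x + z n) - ?a x\<bar> \<partial>lborel) \<le> b n + e)"
      using L1_translation_continuous_open[OF U(1) Uf z] by blast
  qed simp
  then have "(\<lambda>n. (\<integral>x. \<bar>?a (x + z n) - ?a x\<bar> \<partial>lborel) * norm c) \<longlonglongrightarrow> 0"
    by (rule tendsto_mult_left_zero)
  moreover have "(\<integral>x. norm (indicator A (x + z n) *\<^sub>R c - indicator A x *\<^sub>R c) \<partial>lborel) = (\<integral>x. \<bar>?a (x + z n) - ?a x\<bar> \<partial>lborel) * norm c" for n
    by (simp flip: scaleR_diff_left integral_mult_left_zero)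
  ultimately show ?case by simp
next
  case (add f g)
  have f: "integrable lborel (\<lambda>x. f (x + v))" and g: "integrable lborel (\<lambda>x. g (x + v))" for v
    using add by (auto intro: integrable_lborel_shift)
  have "(\<lambda>n. (\<integral>x. norm (f (x + z n) - f x) \<partial>lborel) + (\<integral>x. norm (g (x + z n) - g x) \<partial>lborel)) \<longlonglongrightarrow> 0"
    using tendsto_add[OF add(3,4)] by simp
  then show ?case
  proof (rule Lim_null_comparison[rotated], intro always_eventually allI)
    fix n
    have "(\<integral>x. norm (f (x + z n) + g (x + z n) - (f x + g x)) \<partial>lborel)
      \<le> (\<integral>x. norm (f (x + z n) - f x) + norm (g (x + z n) - g x) \<partial>lborel)"
      using f[of "z n"] g[of "z n"] add(1,2)
      by (intro integral_mono) (auto simp: add_diff_add norm_triangle_ineq)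
    also have "\<dots> = (\<integral>x. norm (f (x + z n) - f x) \<partial>lborel) + (\<integral>x. norm (g (x + z n) - g x) \<partial>lborel)"
      using f[of "z n"] g[of "z n"] add(1,2) by simp
    finally show "norm (\<integral>x. norm (f (x + z n) + g (x + z n) - (f x + g x)) \<partial>lborel) \<le> \<dots>"
      by simp
  qed
next
  case (lim f s)
  have conv: "(\<lambda>i. s i x) \<longlonglongrightarrow> f x" and bnd: "norm (s i x) \<le> 2 * norm (f x)" for i x
    using lim by auto
  have IH: "(\<lambda>n. \<integral>x. norm (s i (x + z n) - s i x) \<partial>lborel) \<longlonglongrightarrow> 0" for i
    using lim by blast
  have f: "integrable lborel (\<lambda>x. f (x + v))" and s: "integrable lborel (\<lambda>x. s i (x + v))" for v i
    using lim by (auto intro: integrable_lborel_shift)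
  have D: "(\<lambda>i. \<integral>x. norm (s i x - f x) \<partial>lborel) \<longlonglongrightarrow> (\<integral>x. 0 \<partial>(lborel :: real measure))"
  proof (rule integral_dominated_convergence[where w = "\<lambda>x. 3 * norm (f x)"])
    show "AE x in lborel. (\<lambda>i. norm (s i x - f x)) \<longlonglongrightarrow> 0"
    proof (intro AE_I2)
      fix x show "(\<lambda>i. norm (s i x - f x)) \<longlonglongrightarrow> 0"
        using conv[of x] by (intro tendsto_norm_zero) (simp add: LIM_zero_iff)
    qed
    show "AE x in lborel. norm (norm (s i x - f x)) \<le> 3 * norm (f x)" for i
    proof (intro AE_I2)
      fix x
      show "norm (norm (s i x - f x)) \<le> 3 * norm (f x)"
        using norm_triangle_ineq4[of "s i x" "f x"] bnd[of i x] by simp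
    qed
  qed (use lim in auto)
  show ?case
  proof (rule nonneg_null_sequenceI)
    fix e :: real assume e: "e > 0"
    have "\<forall>\<^sub>F i in sequentially. (\<integral>x. norm (s i x - f x) \<partial>lborel) < e / 2"
      using order_tendstoD(2)[OF D, of "e / 2"] e by simp
    then obtain i where i: "(\<integral>x. norm (s i x - f x) \<partial>lborel) < e / 2"
      by (auto simp: eventually_sequentially)
    have "(\<integral>x. norm (f (x + z n) - f x) \<partial>lborel) \<le> (\<integral>x. norm (s i (x + z n) - s i x) \<partial>lborel) + e" for n
    proof -
      have "(\<integral>x. norm (f (x + z n) - f x) \<partial>lborel)
        \<le> (\<integral>x. norm (s i (x + z n) - s i x) + (norm (s i (x + z n) - f (x + z n)) + norm (s i x - f x)) \<partial>lborel)"
      proof (rule integral_mono)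
        fix x
        have "f (x + z n) - f x = (s i (x + z n) - s i x) - (s i (x + z n) - f (x + z n)) + (s i x - f x)" by simp
        then show "norm (f (x + z n) - f x) \<le> norm (s i (x + z n) - s i x) + (norm (s i (x + z n) - f (x + z n)) + norm (s i x - f x))"
            using norm_triangle_ineq[of "s i (x + z n) - s i x - (s i (x + z n) - f (x + z n))" "s i x - f x"]
              norm_triangle_ineq4[of "s i (x + z n) - s i x" "s i (x + z n) - f (x + z n)"] by simp
      qed (use f s lim in auto)
      also have "\<dots> = (\<integral>x. norm (s i (x + z n) - s i x) \<partial>lborel) + ((\<integral>x. norm (s i (x + z n) - f (x + z n)) \<partial>lborel) + (\<integral>x. norm (s i x - f x) \<partial>lborel))"
        using f s lim by simp
      also have "(\<integral>x. norm (s i (x + z n) - f (x + z n)) \<partial>lborel) = (\<integral>x. norm (s i x - f x) \<partial>lborel)"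
        by (rule integral_lborel_shift(2)[of "\<lambda>x. norm (s i x - f x)"])
      finally show ?thesis using i by simp
    qed
    then show "\<exists>b. b \<longlonglongrightarrow> 0 \<and> (\<forall>n. (\<integral>x. norm (f (x + z n) - f x) \<partial>lborel) \<le> b n + e)"
      using IH by blast
  qed simp
qed

lemma sq_int_bounded_L1:
  fixes h :: "'a \<Rightarrow> 'b::{real_normed_div_algebra, banach, second_countable_topology}"
  assumes h: "integrable M h" and b: "\<And>x. norm (h x) \<le> C"
  shows "sq_int M h"
  unfolding sq_int_def
proof
  show [measurable]: "h \<in> borel_measurable M" using h by auto
  show "integrable M (\<lambda>x. (norm (h x))\<^sup>2)"
  proof (rule Bochner_Integration.integrable_bound)
    show "integrable M (\<lambda>x. C * norm (h x))" using h by simp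
    have C: "C \<ge> 0" using b order_trans[OF norm_ge_zero] by blast
    show "AE x in M. norm ((norm (h x))\<^sup>2) \<le> norm (C * norm (h x))"
      using b C by (intro AE_I2) (simp add: power2_eq_square mult_right_mono)
  qed measurable
qed

lemma ft_sq_int:
  assumes h: "integrable lborel h" and h2: "sq_int lborel h"
  shows "sq_int lborel (ft h)" "sqn lborel (ft h) \<le> sqrt (2 * pi) * sqn lborel h"
proof -
  have [measurable]: "h \<in> borel_measurable borel" using h by auto
  have "(\<integral>\<^sup>+t. ennreal ((norm (ft h t))\<^sup>2) \<partial>lborel) \<le> ennreal (2 * pi) * ennreal ((sqn lborel h)\<^sup>2)"
    using Bessel_inequality[OF h] by (simp add: sq_int_nn[OF h2])
  then have *: "(\<integral>\<^sup>+t. ennreal ((norm (ft h t))\<^sup>2) \<partial>lborel) \<le> ennreal ((sqrt (2 * pi) * sqn lborel h)\<^sup>2)"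
    by (simp add: power_mult_distrib flip: ennreal_mult)
  show "sq_int lborel (ft h)" by (rule sq_intI_nn(1)[OF _ *]) auto
  show "sqn lborel (ft h) \<le> sqrt (2 * pi) * sqn lborel h" by (rule sq_intI_nn(2)[OF _ *]) auto
qed

text \<open>
  Boundedness of one function and integrability of the other make their correlation \<open>\<psi>\<close>
  continuous at zero. As the normal density narrows, the regularised formula therefore tends
  to \<open>2 pi \<psi>(0)\<close>.
\<close>

theorem Plancherel_bounded:
  assumes h1: "integrable lborel h1" and b1: "\<And>x. norm (h1 x) \<le> C"
    and h2: "integrable lborel h2" and b2: "\<And>x. norm (h2 x) \<le> C"
  shows "(\<integral>t. ft h1 t * cnj (ft h2 t) \<partial>lborel) = 2 * pi * (\<integral>x. h1 x * cnj (h2 x) \<partial>lborel)"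
proof -
  have [measurable]: "h1 \<in> borel_measurable borel" "h2 \<in> borel_measurable borel" using h1 h2 by auto
  have C: "C \<ge> 0" using b1 order_trans[OF norm_ge_zero] by blast
  have i: "integrable lborel (\<lambda>t. ft h1 t * cnj (ft h2 t))"
    by (intro sq_int_integrable_mult sq_int_cnj ft_sq_int sq_int_bounded_L1[OF h1 b1] sq_int_bounded_L1[OF h2 b2] h1 h2)
  define \<epsilon> where "\<epsilon> n = 1 / real (Suc n)" for n
  have e: "\<epsilon> n > 0" for n by (simp add: \<epsilon>_def)
  have e0: "\<epsilon> \<longlonglongrightarrow> 0" unfolding \<epsilon>_def by (rule LIMSEQ_Suc[OF lim_1_over_n])
  define \<psi> where "\<psi> v = (\<integral>x. h1 x * cnj (h2 (x + v)) \<partial>lborel)" for v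
  have sh: "integrable lborel (\<lambda>x. h2 (x + v))" for v by (rule integrable_lborel_shift(2)[OF h2])
  have ih: "integrable lborel (\<lambda>x. h1 x * cnj (h2 (x + v)))" for v
    by (rule Bochner_Integration.integrable_bound[of _ "\<lambda>x. C * norm (h1 x)"])
       (use h1 b2 C in \<open>auto simp: norm_mult mult.commute[of C] intro!: mult_left_mono AE_I2\<close>)
  have [measurable]: "\<psi> \<in> borel_measurable borel" unfolding \<psi>_def by measurable
  have \<psi>b: "norm (\<psi> v) \<le> C * (\<integral>x. norm (h1 x) \<partial>lborel)" for v
  proof -
    have "norm (\<psi> v) \<le> (\<integral>x. norm (h1 x * cnj (h2 (x + v))) \<partial>lborel)"
      unfolding \<psi>_def by (rule integral_norm_bound)
    also have "\<dots> \<le> (\<integral>x. C * norm (h1 x) \<partial>lborel)"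
      by (rule integral_mono[OF integrable_norm[OF ih]])
        (use h1 b2 in \<open>auto simp: norm_mult mult.commute[of C] intro!: mult_left_mono\<close>)
    finally show ?thesis by simp
  qed
  have \<psi>0: "(\<lambda>n. \<psi> (v n)) \<longlonglongrightarrow> \<psi> 0" if v: "v \<longlonglongrightarrow> 0" for v
  proof -
    have "(\<lambda>n. \<psi> (v n) - \<psi> 0) \<longlonglongrightarrow> 0"
    proof (rule Lim_null_comparison, intro always_eventually allI)
      show "(\<lambda>n. C * (\<integral>x. norm (h2 (x + v n) - h2 x) \<partial>lborel)) \<longlonglongrightarrow> 0"
        using tendsto_mult_left[OF L1_translation_continuous[OF h2 v], of C] by simp
      fix n
      have "\<psi> (v n) - \<psi> 0 = (\<integral>x. h1 x * cnj (h2 (x + v n) - h2 x) \<partial>lborel)"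
        using ih[of "v n"] ih[of 0] by (simp add: \<psi>_def right_diff_distrib)
      also have "norm \<dots> \<le> (\<integral>x. norm (h1 x * cnj (h2 (x + v n) - h2 x)) \<partial>lborel)"
        by (rule integral_norm_bound)
      also have "\<dots> \<le> (\<integral>x. C * norm (h2 (x + v n) - h2 x) \<partial>lborel)"
      proof (rule integral_mono)
        show "integrable lborel (\<lambda>x. norm (h1 x * cnj (h2 (x + v n) - h2 x)))"
          using Bochner_Integration.integrable_diff[OF ih[of "v n"] ih[of 0]]
          by (intro integrable_norm) (simp add: right_diff_distrib)
        show "integrable lborel (\<lambda>x. C * norm (h2 (x + v n) - h2 x))" using h2 sh by simp
      qed (unfold norm_mult complex_mod_cnj, intro mult_right_mono b1, simp)
      finally show "norm (\<psi> (v n) - \<psi> 0) \<le> C * (\<integral>x. norm (h2 (x + v n) - h2 x) \<partial>lborel)" by simp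
    qed
    then show ?thesis by (simp add: LIM_zero_iff)
  qed
  have smooth: "(\<integral>x. h1 x * (\<integral>y. cnj (h2 y) * complex_of_real (normal_density 0 (\<epsilon> n) (x - y)) \<partial>lborel) \<partial>lborel)
      = (\<integral>z. complex_of_real (std_normal_density z) * \<psi> (- \<epsilon> n * z) \<partial>lborel)" for n
  proof -
    have "(\<integral>y. cnj (h2 y) * complex_of_real (normal_density 0 (\<epsilon> n) (x - y)) \<partial>lborel)
        = (\<integral>z. complex_of_real (std_normal_density z) * cnj (h2 (x + (- \<epsilon> n * z))) \<partial>lborel)" for x
    proof -
      have d: "\<epsilon> n * normal_density 0 (\<epsilon> n) (\<epsilon> n * z) = std_normal_density z" for z
        using e[of n] by (simp add: normal_density_def std_normal_density_def power_mult_distrib real_sqrt_mult)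
      have "(\<integral>y. cnj (h2 y) * complex_of_real (normal_density 0 (\<epsilon> n) (x - y)) \<partial>lborel)
        = \<epsilon> n *\<^sub>R (\<integral>z. cnj (h2 (x + (- \<epsilon> n * z))) * complex_of_real (normal_density 0 (\<epsilon> n) (\<epsilon> n * z)) \<partial>lborel)"
        using e[of n] by (subst lborel_integral_real_affine[of "- \<epsilon> n" _ x]) auto
      also have "\<dots> = (\<integral>z. complex_of_real (\<epsilon> n * normal_density 0 (\<epsilon> n) (\<epsilon> n * z)) * cnj (h2 (x + (- \<epsilon> n * z))) \<partial>lborel)"
        by (subst integral_scaleR_right[symmetric]) (auto simp: scaleR_conv_of_real mult_ac intro!: Bochner_Integration.integral_cong)
      finally show ?thesis by (simp only: d)
    qed
    then have "(\<integral>x. h1 x * (\<integral>y. cnj (h2 y) * complex_of_real (normal_density 0 (\<epsilon> n) (x - y)) \<partial>lborel) \<partial>lborel)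
      = (\<integral>x. \<integral>z. h1 x * (complex_of_real (std_normal_density z) * cnj (h2 (x + (- \<epsilon> n * z)))) \<partial>lborel \<partial>lborel)"
      by simp
    also have "\<dots> = (\<integral>z. \<integral>x. h1 x * (complex_of_real (std_normal_density z) * cnj (h2 (x + (- \<epsilon> n * z)))) \<partial>lborel \<partial>lborel)"
    proof (rule Fubini_swap_dominated[where p = "\<lambda>x. norm (h1 x)" and q = "\<lambda>z. C * std_normal_density z"])
      fix x z
      show "norm (h1 x * (complex_of_real (std_normal_density z) * cnj (h2 (x + (- \<epsilon> n * z))))) \<le> norm (h1 x) * (C * std_normal_density z)"
        using b2 by (auto simp: norm_mult mult.commute[of C] intro!: mult_left_mono)
    qed (use h1 in \<open>auto simp: lborel.sigma_finite_measure_axioms\<close>)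
    also have "\<dots> = (\<integral>z. complex_of_real (std_normal_density z) * \<psi> (- \<epsilon> n * z) \<partial>lborel)"
      unfolding \<psi>_def by (subst integral_mult_right_zero[symmetric]) (simp add: mult_ac)
    finally show ?thesis .
  qed
  have R: "(\<lambda>n. \<integral>z. complex_of_real (std_normal_density z) * \<psi> (- \<epsilon> n * z) \<partial>lborel)
      \<longlonglongrightarrow> (\<integral>z. complex_of_real (std_normal_density z) * \<psi> 0 \<partial>lborel)"
  proof (rule integral_dominated_convergence[where w = "\<lambda>z. std_normal_density z * (C * (\<integral>x. norm (h1 x) \<partial>lborel))"])
    show "AE z in lborel. (\<lambda>n. complex_of_real (std_normal_density z) * \<psi> (- \<epsilon> n * z)) \<longlonglongrightarrow> complex_of_real (std_normal_density z) * \<psi> 0"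
    proof (intro AE_I2 tendsto_mult tendsto_const \<psi>0)
      fix z show "(\<lambda>n. - \<epsilon> n * z) \<longlonglongrightarrow> 0"
        using tendsto_mult_right[OF tendsto_minus[OF e0], of z] by simp
    qed
    show "AE z in lborel. norm (complex_of_real (std_normal_density z) * \<psi> (- \<epsilon> n * z)) \<le> std_normal_density z * (C * (\<integral>x. norm (h1 x) \<partial>lborel))" for n
      using \<psi>b by (intro AE_I2) (simp add: norm_mult mult_left_mono)
  qed (auto intro!: integrable_normal_density)
  have "(\<integral>z. complex_of_real (std_normal_density z) * \<psi> 0 \<partial>lborel) = \<psi> 0"
    by (simp add: integral_normal_density)
  with R have R: "(\<lambda>n. 2 * pi * (\<integral>z. complex_of_real (std_normal_density z) * \<psi> (- \<epsilon> n * z) \<partial>lborel)) \<longlonglongrightarrow> 2 * pi * \<psi> 0"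
    by (intro tendsto_mult_left) simp
  have "(\<lambda>n. \<integral>t. ft h1 t * cnj (ft h2 t) * complex_of_real (exp (- (\<epsilon> n * t)\<^sup>2 / 2)) \<partial>lborel) \<longlonglongrightarrow> (\<integral>t. ft h1 t * cnj (ft h2 t) \<partial>lborel)"
  proof (rule integral_dominated_convergence[where w = "\<lambda>t. norm (ft h1 t * cnj (ft h2 t))"])
    show "AE t in lborel. (\<lambda>n. ft h1 t * cnj (ft h2 t) * complex_of_real (exp (- (\<epsilon> n * t)\<^sup>2 / 2))) \<longlonglongrightarrow> ft h1 t * cnj (ft h2 t)"
    proof (intro AE_I2)
      fix t
      have "(\<lambda>n. ft h1 t * cnj (ft h2 t) * complex_of_real (exp (- (\<epsilon> n * t)\<^sup>2 / 2))) \<longlonglongrightarrow> ft h1 t * cnj (ft h2 t) * complex_of_real (exp (- (0 * t)\<^sup>2 / 2))"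
        by (intro tendsto_intros e0) auto
      then show "(\<lambda>n. ft h1 t * cnj (ft h2 t) * complex_of_real (exp (- (\<epsilon> n * t)\<^sup>2 / 2))) \<longlonglongrightarrow> ft h1 t * cnj (ft h2 t)" by simp
    qed
    show "integrable lborel (\<lambda>t. norm (ft h1 t * cnj (ft h2 t)))" using i by (rule integrable_norm)
    show "AE t in lborel. norm (ft h1 t * cnj (ft h2 t) * complex_of_real (exp (- (\<epsilon> n * t)\<^sup>2 / 2))) \<le> norm (ft h1 t * cnj (ft h2 t))" for n
      by (intro AE_I2) (simp add: norm_mult mult_left_le)
  qed measurable
  moreover have "(\<lambda>n. \<integral>t. ft h1 t * cnj (ft h2 t) * complex_of_real (exp (- (\<epsilon> n * t)\<^sup>2 / 2)) \<partial>lborel) \<longlonglongrightarrow> 2 * pi * \<psi> 0"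
    unfolding regularised_Parseval[OF h1 h2 e] smooth by (rule R)
  ultimately show ?thesis using LIMSEQ_unique by (simp add: \<psi>_def) blast
qed

text \<open>
  The map sending \<open>\<phi>\<close> to \<open>\<integral> \<phi>(a) h^(a - b) da\<close> multiplies the transform of \<open>\<phi>\<close> by \<open>h\<close> and
  transforms back. Bessel's inequality is applied to both transforms, which costs \<open>2 pi\<close> in
  all.
\<close>

lemma multiplier_bound_L1:
  assumes h: "integrable lborel h" and b: "\<And>x. norm (h x) \<le> K" and p: "integrable lborel \<phi>"
  shows "(\<integral>\<^sup>+b. ennreal ((norm (\<integral>a. \<phi> a * ft h (a - b) \<partial>lborel))\<^sup>2) \<partial>lborel)
    \<le> ennreal ((2 * pi * K)\<^sup>2) * (\<integral>\<^sup>+a. ennreal ((norm (\<phi> a))\<^sup>2) \<partial>lborel)"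
proof -
  have [measurable]: "h \<in> borel_measurable borel" "\<phi> \<in> borel_measurable borel" using h p by auto
  have K: "K \<ge> 0" using b order_trans[OF norm_ge_zero] by blast
  define \<rho> where "\<rho> x = h x * ft \<phi> x" for x
  have \<rho>: "integrable lborel \<rho>"
    unfolding \<rho>_def
  proof (rule Bochner_Integration.integrable_bound[of _ "\<lambda>x. norm (h x) * (\<integral>x. norm (\<phi> x) \<partial>lborel)"])
    show "AE x in lborel. norm (h x * ft \<phi> x) \<le> norm (norm (h x) * (\<integral>x. norm (\<phi> x) \<partial>lborel))"
      by (intro AE_I2) (simp add: norm_mult mult_left_mono norm_ft_le)
  qed (use h in auto)
  have eq: "(\<integral>a. \<phi> a * ft h (a - b) \<partial>lborel) = ft \<rho> (- b)" for b
  proof -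
    have "(\<integral>a. \<phi> a * ft h (a - b) \<partial>lborel) = (\<integral>a. ft (\<lambda>x. cis (x * (- b)) * h x) a * \<phi> a \<partial>lborel)"
      unfolding ft_cis_mult by (simp add: mult.commute)
    also have "\<dots> = (\<integral>x. cis (x * (- b)) * h x * ft \<phi> x \<partial>lborel)"
      by (rule ft_multiplication[OF integrable_cis_mult[OF h] p]) measurable
    finally show ?thesis by (simp add: ft_def[of \<rho>] \<rho>_def mult_ac)
  qed
  have "(\<integral>\<^sup>+b. ennreal ((norm (\<integral>a. \<phi> a * ft h (a - b) \<partial>lborel))\<^sup>2) \<partial>lborel) = (\<integral>\<^sup>+b. ennreal ((norm (ft \<rho> (0 - b)))\<^sup>2) \<partial>lborel)"
    by (simp add: eq)
  also have "\<dots> = (\<integral>\<^sup>+b. ennreal ((norm (ft \<rho> b))\<^sup>2) \<partial>lborel)"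
    using \<rho> by (intro nn_integral_lborel_shift(1)[of "\<lambda>b. ennreal ((norm (ft \<rho> b))\<^sup>2)"]) auto
  also have "\<dots> \<le> ennreal (2 * pi) * (\<integral>\<^sup>+x. ennreal ((norm (\<rho> x))\<^sup>2) \<partial>lborel)"
    by (rule Bessel_inequality[OF \<rho>])
  also have "\<dots> \<le> ennreal (2 * pi) * (\<integral>\<^sup>+x. ennreal (K\<^sup>2) * ennreal ((norm (ft \<phi> x))\<^sup>2) \<partial>lborel)"
    using b by (intro mult_left_mono nn_integral_mono)
      (auto simp: \<rho>_def norm_mult power_mult_distrib simp flip: ennreal_mult intro!: ennreal_leI mult_right_mono power_mono)
  also have "\<dots> = ennreal (2 * pi) * (ennreal (K\<^sup>2) * (\<integral>\<^sup>+x. ennreal ((norm (ft \<phi> x))\<^sup>2) \<partial>lborel))"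
    by (simp add: nn_integral_cmult)
  also have "\<dots> \<le> ennreal (2 * pi) * (ennreal (K\<^sup>2) * (ennreal (2 * pi) * (\<integral>\<^sup>+x. ennreal ((norm (\<phi> x))\<^sup>2) \<partial>lborel)))"
    by (intro mult_left_mono Bessel_inequality p) auto
  also have "\<dots> = ennreal ((2 * pi * K)\<^sup>2) * (\<integral>\<^sup>+a. ennreal ((norm (\<phi> a))\<^sup>2) \<partial>lborel)"
  proof -
    have "(2 * pi * K)\<^sup>2 = 2 * pi * (K\<^sup>2 * (2 * pi))" by (simp add: power2_eq_square)
    then have "ennreal ((2 * pi * K)\<^sup>2) = ennreal (2 * pi) * (ennreal (K\<^sup>2) * ennreal (2 * pi))"
      by (simp only: ennreal_mult pi_ge_zero zero_le_power2 mult_nonneg_nonneg zero_le_numeral)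
    then show ?thesis by (simp only: mult.assoc)
  qed
  finally show ?thesis .
qed

text \<open>
  Restricting \<open>\<phi>\<close> to bounded intervals makes it integrable, and Fatou's lemma passes to the
  limit.
\<close>

theorem multiplier_bound:
  assumes h: "integrable lborel h" and b: "\<And>x. norm (h x) \<le> K" and p: "sq_int lborel \<phi>"
  shows "(\<integral>\<^sup>+b. ennreal ((norm (\<integral>a. \<phi> a * ft h (a - b) \<partial>lborel))\<^sup>2) \<partial>lborel)
    \<le> ennreal ((2 * pi * K)\<^sup>2) * (\<integral>\<^sup>+a. ennreal ((norm (\<phi> a))\<^sup>2) \<partial>lborel)"
proof -
  have [measurable]: "h \<in> borel_measurable borel" "\<phi> \<in> borel_measurable borel"
    using h p by (auto simp: sq_int_def)
  have sh: "sq_int lborel (\<lambda>a. ft h (a - b))" for b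
  proof -
    have "integrable lborel (\<lambda>x. cis (x * (- b)) * h x)" by (intro integrable_cis_mult h) measurable
    then have "sq_int lborel (ft (\<lambda>x. cis (x * (- b)) * h x))"
      using b by (intro ft_sq_int sq_int_bounded_L1[of _ _ K]) (auto simp: norm_mult)
    then show ?thesis unfolding ft_cis_mult by simp
  qed
  define \<phi>' where "\<phi>' n a = indicator {- real n..real n} a *\<^sub>R \<phi> a" for n a
  have i: "integrable lborel (\<phi>' n)" for n
  proof -
    have "sq_int lborel (indicator {- real n..real n} :: real \<Rightarrow> complex)"
    proof (rule sq_int_bounded_L1[of _ _ 1])
      have "integrable lborel (\<lambda>x. indicator {- real n..real n} x *\<^sub>R (1::complex))"
        by (intro integrable_scaleR_left) (simp add: integrable_indicator_iff)
      then show "integrable lborel (indicator {- real n..real n} :: real \<Rightarrow> complex)"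
        by (rule Bochner_Integration.integrable_cong[THEN iffD1, rotated -1]) (auto simp: indicator_def)
    qed (simp add: indicator_def)
    from sq_int_integrable_mult[OF this p] show ?thesis
      unfolding \<phi>'_def by (rule Bochner_Integration.integrable_cong[THEN iffD1, rotated -1]) (auto simp: indicator_def)
  qed
  have lim: "(\<lambda>n. \<integral>a. \<phi>' n a * ft h (a - b) \<partial>lborel) \<longlonglongrightarrow> (\<integral>a. \<phi> a * ft h (a - b) \<partial>lborel)" for b
  proof (rule integral_dominated_convergence[where w = "\<lambda>a. norm (\<phi> a * ft h (a - b))"])
    show "integrable lborel (\<lambda>a. norm (\<phi> a * ft h (a - b)))"
      by (intro integrable_norm sq_int_integrable_mult p sh)
    show "AE a in lborel. (\<lambda>n. \<phi>' n a * ft h (a - b)) \<longlonglongrightarrow> \<phi> a * ft h (a - b)"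
    proof (intro AE_I2 tendsto_eventually)
      fix a
      obtain N :: nat where "\<bar>a\<bar> \<le> real N" using real_arch_simple by blast
      then show "\<forall>\<^sub>F n in sequentially. \<phi>' n a * ft h (a - b) = \<phi> a * ft h (a - b)"
        by (intro eventually_sequentiallyI[of N]) (auto simp: \<phi>'_def indicator_def)
    qed
  qed (auto simp: \<phi>'_def indicator_def)
  have "(\<integral>\<^sup>+b. ennreal ((norm (\<integral>a. \<phi> a * ft h (a - b) \<partial>lborel))\<^sup>2) \<partial>lborel)
      = (\<integral>\<^sup>+b. liminf (\<lambda>n. ennreal ((norm (\<integral>a. \<phi>' n a * ft h (a - b) \<partial>lborel))\<^sup>2)) \<partial>lborel)"
  proof (intro nn_integral_cong)
    fix b
    have "(\<lambda>n. ennreal ((norm (\<integral>a. \<phi>' n a * ft h (a - b) \<partial>lborel))\<^sup>2)) \<longlonglongrightarrow> ennreal ((norm (\<integral>a. \<phi> a * ft h (a - b) \<partial>lborel))\<^sup>2)"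
      by (intro tendsto_ennrealI tendsto_intros lim)
    then show "ennreal ((norm (\<integral>a. \<phi> a * ft h (a - b) \<partial>lborel))\<^sup>2) = liminf (\<lambda>n. ennreal ((norm (\<integral>a. \<phi>' n a * ft h (a - b) \<partial>lborel))\<^sup>2))"
      by (rule lim_imp_Liminf[OF trivial_limit_sequentially, symmetric])
  qed
  also have "\<dots> \<le> liminf (\<lambda>n. \<integral>\<^sup>+b. ennreal ((norm (\<integral>a. \<phi>' n a * ft h (a - b) \<partial>lborel))\<^sup>2) \<partial>lborel)"
    unfolding \<phi>'_def by (rule nn_integral_liminf) measurable
  also have "\<dots> \<le> liminf (\<lambda>n::nat. ennreal ((2 * pi * K)\<^sup>2) * (\<integral>\<^sup>+a. ennreal ((norm (\<phi> a))\<^sup>2) \<partial>lborel))"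
  proof (intro Liminf_mono always_eventually allI)
    fix n
    have "(\<integral>\<^sup>+b. ennreal ((norm (\<integral>a. \<phi>' n a * ft h (a - b) \<partial>lborel))\<^sup>2) \<partial>lborel)
      \<le> ennreal ((2 * pi * K)\<^sup>2) * (\<integral>\<^sup>+a. ennreal ((norm (\<phi>' n a))\<^sup>2) \<partial>lborel)"
      by (rule multiplier_bound_L1[OF h b i])
    also have "\<dots> \<le> ennreal ((2 * pi * K)\<^sup>2) * (\<integral>\<^sup>+a. ennreal ((norm (\<phi> a))\<^sup>2) \<partial>lborel)"
      by (intro mult_left_mono nn_integral_mono) (auto simp: \<phi>'_def indicator_def)
    finally show "(\<integral>\<^sup>+b. ennreal ((norm (\<integral>a. \<phi>' n a * ft h (a - b) \<partial>lborel))\<^sup>2) \<partial>lborel) \<le> \<dots>" .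
  qed
  finally show ?thesis by (simp add: Liminf_const)
qed

section \<open>Bounded kernels on finite measure spaces\<close>

text \<open>
  Kernels are integrated over finite measures only. There measurability and boundedness give
  integrability and Fubini's theorem, and both pass to products and to integrals over a
  variable, so that side conditions reduce to applying introduction rules.
\<close>

definition bdd :: "('a \<Rightarrow> 'b::real_normed_vector) \<Rightarrow> bool" where
  "bdd f \<longleftrightarrow> (\<exists>C. \<forall>x. norm (f x) \<le> C)"

lemma bddI: "(\<And>x. norm (f x) \<le> C) \<Longrightarrow> bdd f" by (auto simp: bdd_def)

lemma bddE: assumes "bdd f" obtains C where "C \<ge> 0" "\<And>x. norm (f x) \<le> C"
proof -
  obtain C where C: "\<And>x. norm (f x) \<le> C" using assms by (auto simp: bdd_def)
  then have "norm (f x) \<le> max C 0" for x by (simp add: le_max_iff_disj)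
  then show ?thesis using that[of "max C 0"] by simp
qed

lemma bdd_const: "bdd (\<lambda>x. c)" by (rule bddI[of _ "norm c"]) simp

lemma bdd_cis: "bdd (\<lambda>x. cis (h x))" by (rule bddI[of _ 1]) simp

lemma bdd_mult:
  fixes f g :: "'a \<Rightarrow> 'b::real_normed_algebra"
  assumes "bdd f" "bdd g" shows "bdd (\<lambda>x. f x * g x)"
proof -
  obtain C where C: "C \<ge> 0" "\<And>x. norm (f x) \<le> C" by (rule bddE[OF assms(1)]) (rule that)
  obtain D where D: "D \<ge> 0" "\<And>x. norm (g x) \<le> D" by (rule bddE[OF assms(2)]) (rule that)
  show ?thesis
    by (rule bddI[of _ "C * D"]) (intro order_trans[OF norm_mult_ineq] mult_mono C D norm_ge_zero)
qed

lemma bdd_add: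
  assumes "bdd f" "bdd g" shows "bdd (\<lambda>x. f x + g x)"
proof -
  obtain C where C: "C \<ge> 0" "\<And>x. norm (f x) \<le> C" by (rule bddE[OF assms(1)]) (rule that)
  obtain D where D: "D \<ge> 0" "\<And>x. norm (g x) \<le> D" by (rule bddE[OF assms(2)]) (rule that)
  show ?thesis
    by (rule bddI[of _ "C + D"]) (intro order_trans[OF norm_triangle_ineq] add_mono C D)
qed

lemma bdd_sum: "(\<And>i. i \<in> I \<Longrightarrow> bdd (f i)) \<Longrightarrow> bdd (\<lambda>x. \<Sum>i\<in>I. f i x)"
  by (induction I rule: infinite_finite_induct) (auto intro: bdd_add bdd_const)

lemma bdd_cnj: "bdd f \<Longrightarrow> bdd (\<lambda>x. cnj (f x))" by (auto simp: bdd_def)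

lemma bdd_of_real: "bdd f \<Longrightarrow> bdd (\<lambda>x. complex_of_real (f x))" by (auto simp: bdd_def)

lemma bdd_indicator: "bdd (\<lambda>x. indicator A (h x) :: 'b::real_normed_algebra_1)"
  by (rule bddI[of _ 1]) (auto simp: indicator_def)

lemma norm_integral_bounded:
  fixes f :: "'a \<Rightarrow> 'b::{banach, second_countable_topology}"
  assumes M: "finite_measure M" and C: "0 \<le> C" "\<And>x. norm (f x) \<le> C"
  shows "norm (integral\<^sup>L M f) \<le> C * measure M (space M)"
proof (cases "integrable M f")
  case True
  interpret finite_measure M by fact
  have "norm (integral\<^sup>L M f) \<le> (\<integral>x. norm (f x) \<partial>M)" by (rule integral_norm_bound)
  also have "\<dots> \<le> (\<integral>x. C \<partial>M)" using True C by (intro integral_mono) auto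
  finally show ?thesis by (simp add: mult.commute)
next
  case False then show ?thesis using C by (simp add: not_integrable_integral_eq)
qed

lemma bdd_integral:
  fixes X :: "'a \<Rightarrow> 'b \<Rightarrow> 'c::{banach, second_countable_topology}"
  assumes "finite_measure M" "bdd (\<lambda>q. X (fst q) (snd q))"
  shows "bdd (\<lambda>x. \<integral>v. X x v \<partial>M)"
proof -
  obtain C where C: "C \<ge> 0" "\<And>q. norm (X (fst q) (snd q)) \<le> C" by (rule bddE[OF assms(2)]) (rule that)
  then have "norm (X x v) \<le> C" for x v using C(2)[of "(x, v)"] by simp
  then show ?thesis
    using C(1) by (intro bddI[of _ "C * measure M (space M)"] norm_integral_bounded[OF assms(1)]) auto
qed

lemma Fubini_bdd:
  fixes h :: "'a \<Rightarrow> 'b \<Rightarrow> 'c::{banach, second_countable_topology}"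
  assumes "finite_measure A" "finite_measure B"
    and "(\<lambda>q. h (fst q) (snd q)) \<in> borel_measurable (A \<Otimes>\<^sub>M B)"
    and "bdd (\<lambda>q. h (fst q) (snd q))"
  shows "(\<integral>x. \<integral>y. h x y \<partial>B \<partial>A) = (\<integral>y. \<integral>x. h x y \<partial>A \<partial>B)"
proof -
  obtain C where C: "C \<ge> 0" "\<And>q. norm (h (fst q) (snd q)) \<le> C" by (rule bddE[OF assms(4)]) (rule that)
  show ?thesis
  proof (rule Fubini_swap_bounded[OF assms(1,2)])
    show "norm (h x y) \<le> C" for x y using C(2)[of "(x, y)"] by simp
  qed (use assms(3) in \<open>simp add: case_prod_unfold\<close>)
qed

lemma bdd_integrable:
  fixes f :: "'a \<Rightarrow> 'b::{banach, second_countable_topology}"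
  assumes "finite_measure M" "f \<in> borel_measurable M" "bdd f"
  shows "integrable M f"
proof -
  obtain C where "\<And>x. norm (f x) \<le> C" using assms(3) by (auto simp: bdd_def)
  then show ?thesis using assms by (intro finite_measure.integrable_const_bound[of M _ C]) auto
qed

lemma bdd_sq_int:
  fixes f :: "'a \<Rightarrow> 'b::{real_normed_div_algebra, banach, second_countable_topology}"
  assumes "finite_measure M" "f \<in> borel_measurable M" "bdd f"
  shows "sq_int M f"
proof -
  obtain C where "\<And>x. norm (f x) \<le> C" using assms(3) by (auto simp: bdd_def)
  then show ?thesis using assms by (intro sq_int_bounded[of M _ C]) auto
qed

definition kernel :: "(real \<Rightarrow> real \<Rightarrow> complex) \<Rightarrow> bool" where
  "kernel K \<longleftrightarrow> (\<lambda>q. K (fst q) (snd q)) \<in> borel_measurable (borel \<Otimes>\<^sub>M borel) \<and> bdd (\<lambda>q. K (fst q) (snd q))"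

lemma kernel_measurable:
  assumes "kernel K" "f \<in> borel_measurable M" "g \<in> borel_measurable M"
  shows "(\<lambda>x. K (f x) (g x)) \<in> borel_measurable M"
proof -
  have "(\<lambda>q. K (fst q) (snd q)) \<in> borel_measurable (borel \<Otimes>\<^sub>M borel)" using assms by (simp add: kernel_def)
  moreover have "(\<lambda>x. (f x, g x)) \<in> M \<rightarrow>\<^sub>M borel \<Otimes>\<^sub>M borel" using assms by measurable
  ultimately have "(\<lambda>x. (\<lambda>q. K (fst q) (snd q)) (f x, g x)) \<in> borel_measurable M"
    by (rule measurable_compose[rotated])
  then show ?thesis by simp
qed

lemma kernel_bdd: "kernel K \<Longrightarrow> bdd (\<lambda>x. K (f x) (g x))"
proof -
  assume "kernel K"
  then obtain C where C: "\<And>q. norm (K (fst q) (snd q)) \<le> C" by (auto simp: kernel_def bdd_def)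
  have "norm (K (f x) (g x)) \<le> C" for x using C[of "(f x, g x)"] by simp
  then show ?thesis by (rule bddI)
qed

text \<open>
  The spectral form of a kernel. The isometry between the linear span of the process and \<open>L\<^sup>2\<close>
  of the spectral measure takes \<open>X(u)\<close> to the exponential \<open>cis (u * _)\<close>, and turns the
  quadratic form of \<open>K\<close> into the integral operator with this kernel.
\<close>

definition hat :: "real measure \<Rightarrow> real measure \<Rightarrow> (real \<Rightarrow> real \<Rightarrow> complex) \<Rightarrow> real \<Rightarrow> real \<Rightarrow> complex" where
  "hat S S' K y w = (\<integral>u. \<integral>v. cis (- (y * u)) * K u v * cis (w * v) \<partial>S' \<partial>S)"

text \<open>
  Composition through a covariance \<open>r\<close>. The two inner variables may range over different
  windows.
\<close>

definition kcomp :: "real measure \<Rightarrow> real measure \<Rightarrow> (real \<Rightarrow> complex) \<Rightarrow> (real \<Rightarrow> real \<Rightarrow> complex)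
    \<Rightarrow> (real \<Rightarrow> real \<Rightarrow> complex) \<Rightarrow> real \<Rightarrow> real \<Rightarrow> complex" where
  "kcomp S S' r K L u b = (\<integral>v. \<integral>a. K u v * r (v - a) * L a b \<partial>S' \<partial>S)"

definition ftm :: "real measure \<Rightarrow> real \<Rightarrow> complex" where
  "ftm F t = (\<integral>y. cis (y * t) \<partial>F)"

definition fin_borel :: "real measure \<Rightarrow> bool" where
  "fin_borel M \<longleftrightarrow> finite_measure M \<and> sets M = sets borel"

lemma fin_borelD: "fin_borel M \<Longrightarrow> finite_measure M" "fin_borel M \<Longrightarrow> sets M = sets borel"
  "fin_borel M \<Longrightarrow> sigma_finite_measure M"
  by (auto simp: fin_borel_def finite_measure_def)

lemma kernel_hat:
  assumes "fin_borel S" "fin_borel S'" and K: "kernel K"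
  shows "kernel (hat S S' K)"
  unfolding kernel_def
proof
  note [measurable_cong] = fin_borelD(2)[OF assms(1)] fin_borelD(2)[OF assms(2)]
  interpret S: sigma_finite_measure S by (rule fin_borelD(3)[OF assms(1)])
  interpret S': sigma_finite_measure S' by (rule fin_borelD(3)[OF assms(2)])
  note [measurable (raw)] = kernel_measurable[OF K]
  show "(\<lambda>q. hat S S' K (fst q) (snd q)) \<in> borel_measurable (borel \<Otimes>\<^sub>M borel)"
    unfolding hat_def by measurable
  show "bdd (\<lambda>q. hat S S' K (fst q) (snd q))"
    unfolding hat_def by (intro bdd_integral fin_borelD assms bdd_mult bdd_cis kernel_bdd[OF K])
qed

lemma ftm_measurable [measurable]: "fin_borel F \<Longrightarrow> ftm F \<in> borel_measurable borel"
proof -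
  assume F: "fin_borel F"
  note [measurable_cong] = fin_borelD(2)[OF F]
  interpret F: sigma_finite_measure F by (rule fin_borelD(3)[OF F])
  show ?thesis unfolding ftm_def by measurable
qed

lemma ftm_bdd: "fin_borel F \<Longrightarrow> bdd (\<lambda>x. ftm F (h x))"
  unfolding ftm_def by (intro bdd_integral fin_borelD bdd_cis)

lemma kernel_kcomp:
  assumes "fin_borel S" "fin_borel S'" and F: "fin_borel F" and K: "kernel K" and L: "kernel L"
  shows "kernel (kcomp S S' (ftm F) K L)"
  unfolding kernel_def
proof
  note [measurable_cong] = fin_borelD(2)[OF assms(1)] fin_borelD(2)[OF assms(2)]
  interpret S: sigma_finite_measure S by (rule fin_borelD(3)[OF assms(1)])
  interpret S': sigma_finite_measure S' by (rule fin_borelD(3)[OF assms(2)])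
  note [measurable (raw)] = kernel_measurable[OF K] kernel_measurable[OF L] measurable_compose[OF _ ftm_measurable[OF F]]
  show "(\<lambda>q. kcomp S S' (ftm F) K L (fst q) (snd q)) \<in> borel_measurable (borel \<Otimes>\<^sub>M borel)"
    unfolding kcomp_def by measurable
  show "bdd (\<lambda>q. kcomp S S' (ftm F) K L (fst q) (snd q))"
    unfolding kcomp_def by (intro bdd_integral fin_borelD assms bdd_mult ftm_bdd[OF F] kernel_bdd[OF K] kernel_bdd[OF L])
qed

text \<open>
  The covariance \<open>ftm F (v - a)\<close> is the integral of \<open>cis (w * v) * cis (- (w * a))\<close> over \<open>w\<close>;
  moving this integral outside separates the variables of the two factors.
\<close>

theorem hat_kcomp:
  assumes S: "fin_borel S1" "fin_borel S2" "fin_borel S3" "fin_borel S4" and F: "fin_borel F"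
    and K: "kernel K" and L: "kernel L"
  shows "hat S1 S4 (kcomp S2 S3 (ftm F) K L) y z = (\<integral>w. hat S1 S2 K y w * hat S3 S4 L w z \<partial>F)"
proof -
  note [measurable_cong] = S[THEN fin_borelD(2)] F[THEN fin_borelD(2)]
  interpret S1: sigma_finite_measure S1 by (rule fin_borelD(3)[OF S(1)])
  interpret S2: sigma_finite_measure S2 by (rule fin_borelD(3)[OF S(2)])
  interpret S3: sigma_finite_measure S3 by (rule fin_borelD(3)[OF S(3)])
  interpret S4: sigma_finite_measure S4 by (rule fin_borelD(3)[OF S(4)])
  interpret F: sigma_finite_measure F by (rule fin_borelD(3)[OF F])
  note fin = S[THEN fin_borelD(1)] F[THEN fin_borelD(1)]
  note [measurable (raw)] = kernel_measurable[OF K] kernel_measurable[OF L] measurable_compose[OF _ ftm_measurable[OF F]]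
  note b = bdd_integral fin bdd_mult bdd_cis ftm_bdd[OF F] kernel_bdd[OF K] kernel_bdd[OF L]
  define k where "k v = (\<integral>u. cis (- (y * u)) * K u v \<partial>S1)" for v
  define l where "l a = (\<integral>b. L a b * cis (z * b) \<partial>S4)" for a
  have [measurable]: "k \<in> borel_measurable borel" "l \<in> borel_measurable borel"
    unfolding k_def l_def by measurable
  have bk: "bdd (\<lambda>x. k (h x))" and bl: "bdd (\<lambda>x. l (h x))" for h :: "'a \<Rightarrow> real"
    unfolding k_def l_def by (intro b)+
  have bk': "bdd (\<lambda>x. k (h x))" and bl': "bdd (\<lambda>x. l (h x))" for h :: "'b \<Rightarrow> real"
    unfolding k_def l_def by (intro b)+
  define m where "m v = (\<integral>a. ftm F (v - a) * l a \<partial>S3)" for v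
  have [measurable]: "m \<in> borel_measurable borel" unfolding m_def by measurable
  have bl2: "bdd (\<lambda>x::real \<times> real. l (h x))" for h unfolding l_def by (intro b)
  have bl3: "bdd (\<lambda>x::(real \<times> real) \<times> real. l (h x))" for h unfolding l_def by (intro b)
  have bk2: "bdd (\<lambda>x::real \<times> real. k (h x))" for h unfolding k_def by (intro b)
  have bm2: "bdd (\<lambda>x::real \<times> real. m (h x))" for h unfolding m_def by (intro b bl3)

  have "hat S1 S4 (kcomp S2 S3 (ftm F) K L) y z
      = (\<integral>u. cis (- (y * u)) * (\<integral>b. \<integral>v. \<integral>a. K u v * ftm F (v - a) * (L a b * cis (z * b)) \<partial>S3 \<partial>S2 \<partial>S4) \<partial>S1)"
    unfolding hat_def kcomp_def by (simp add: mult.assoc flip: integral_mult_right_zero integral_mult_left_zero)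
  also have "(\<lambda>u. \<integral>b. \<integral>v. \<integral>a. K u v * ftm F (v - a) * (L a b * cis (z * b)) \<partial>S3 \<partial>S2 \<partial>S4)
      = (\<lambda>u. \<integral>v. \<integral>b. \<integral>a. K u v * ftm F (v - a) * (L a b * cis (z * b)) \<partial>S3 \<partial>S4 \<partial>S2)"
    by (intro ext Fubini_bdd fin b) measurable
  also have "\<dots> = (\<lambda>u. \<integral>v. \<integral>a. \<integral>b. K u v * ftm F (v - a) * (L a b * cis (z * b)) \<partial>S4 \<partial>S3 \<partial>S2)"
    by (intro ext Bochner_Integration.integral_cong refl Fubini_bdd fin b) measurable
  also have "\<dots> = (\<lambda>u. \<integral>v. K u v * m v \<partial>S2)"
    by (simp add: m_def l_def mult.assoc flip: integral_mult_right_zero)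
  also have "(\<integral>u. cis (- (y * u)) * (\<integral>v. K u v * m v \<partial>S2) \<partial>S1) = (\<integral>u. \<integral>v. cis (- (y * u)) * K u v * m v \<partial>S2 \<partial>S1)"
    by (simp add: mult.assoc flip: integral_mult_right_zero)
  also have "\<dots> = (\<integral>v. \<integral>u. cis (- (y * u)) * K u v * m v \<partial>S1 \<partial>S2)"
    by (intro Fubini_bdd fin b bm2) measurable
  also have "\<dots> = (\<integral>v. k v * m v \<partial>S2)" by (simp add: k_def flip: integral_mult_left_zero)
  finally have lhs: "hat S1 S4 (kcomp S2 S3 (ftm F) K L) y z = (\<integral>v. k v * m v \<partial>S2)" .

  have hK: "hat S1 S2 K y w = (\<integral>v. k v * cis (w * v) \<partial>S2)" for w
  proof -
    have "hat S1 S2 K y w = (\<integral>v. \<integral>u. cis (- (y * u)) * K u v * cis (w * v) \<partial>S1 \<partial>S2)"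
      unfolding hat_def by (intro Fubini_bdd fin b) measurable
    then show ?thesis by (simp add: k_def flip: integral_mult_left_zero)
  qed
  have hL: "hat S3 S4 L w z = (\<integral>a. cis (- (w * a)) * l a \<partial>S3)" for w
    unfolding hat_def l_def by (simp add: mult.assoc flip: integral_mult_right_zero)
  have [measurable]: "(\<lambda>w. hat S3 S4 L w z) \<in> borel_measurable borel" unfolding hL by measurable
  have bhL: "bdd (\<lambda>x::real \<times> real. hat S3 S4 L (h x) z)" for h
    unfolding hL by (intro b bl3)
  have "(\<integral>w. hat S1 S2 K y w * hat S3 S4 L w z \<partial>F) = (\<integral>w. \<integral>v. k v * cis (w * v) * hat S3 S4 L w z \<partial>S2 \<partial>F)"
    by (simp add: hK flip: integral_mult_left_zero)
  also have "\<dots> = (\<integral>v. \<integral>w. k v * cis (w * v) * hat S3 S4 L w z \<partial>F \<partial>S2)"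
    by (intro Fubini_bdd fin b bhL bk2) measurable
  also have "\<dots> = (\<integral>v. k v * (\<integral>w. cis (w * v) * hat S3 S4 L w z \<partial>F) \<partial>S2)"
    by (simp add: mult.assoc flip: integral_mult_right_zero)
  also have "(\<lambda>v. \<integral>w. cis (w * v) * hat S3 S4 L w z \<partial>F) = m"
  proof
    fix v
    have "(\<integral>w. cis (w * v) * hat S3 S4 L w z \<partial>F) = (\<integral>w. \<integral>a. cis (w * (v - a)) * l a \<partial>S3 \<partial>F)"
      by (simp add: hL mult.assoc[symmetric] cis_mult right_diff_distrib flip: integral_mult_right_zero)
    also have "\<dots> = (\<integral>a. \<integral>w. cis (w * (v - a)) * l a \<partial>F \<partial>S3)"
      by (intro Fubini_bdd fin b bl2) measurable
    finally show "(\<integral>w. cis (w * v) * hat S3 S4 L w z \<partial>F) = m v"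
      by (simp add: m_def ftm_def flip: integral_mult_left_zero)
  qed
  finally show ?thesis by (simp add: lhs)
qed

text \<open>
  On the diagonal the two exponentials merge into the transform of the spectral measure.
\<close>

theorem trace_hat:
  assumes S: "fin_borel S1" "fin_borel S2" and F: "fin_borel F" and K: "kernel K"
  shows "(\<integral>y. hat S1 S2 K y y \<partial>F) = (\<integral>u. \<integral>v. K u v * ftm F (v - u) \<partial>S2 \<partial>S1)"
proof -
  note [measurable_cong] = S[THEN fin_borelD(2)] F[THEN fin_borelD(2)]
  interpret S1: sigma_finite_measure S1 by (rule fin_borelD(3)[OF S(1)])
  interpret S2: sigma_finite_measure S2 by (rule fin_borelD(3)[OF S(2)])
  interpret F: sigma_finite_measure F by (rule fin_borelD(3)[OF F])
  note fin = S[THEN fin_borelD(1)] F[THEN fin_borelD(1)]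
  note [measurable (raw)] = kernel_measurable[OF K]
  note b = bdd_integral fin bdd_mult bdd_cis kernel_bdd[OF K]
  have eq: "cis (- (y * u)) * K u v * cis (y * v) = K u v * cis (y * (v - u))" for y u v
  proof -
    have "cis (- (y * u)) * K u v * cis (y * v) = K u v * (cis (- (y * u)) * cis (y * v))" by (simp only: mult_ac)
    also have "cis (- (y * u)) * cis (y * v) = cis (y * (v - u))" by (simp add: cis_mult algebra_simps)
    finally show ?thesis .
  qed
  have "(\<integral>y. hat S1 S2 K y y \<partial>F) = (\<integral>y. \<integral>u. \<integral>v. K u v * cis (y * (v - u)) \<partial>S2 \<partial>S1 \<partial>F)"
    by (simp add: hat_def eq)
  also have "\<dots> = (\<integral>u. \<integral>y. \<integral>v. K u v * cis (y * (v - u)) \<partial>S2 \<partial>F \<partial>S1)"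
    by (intro Fubini_bdd fin b) measurable
  also have "\<dots> = (\<integral>u. \<integral>v. \<integral>y. K u v * cis (y * (v - u)) \<partial>F \<partial>S2 \<partial>S1)"
    by (intro Bochner_Integration.integral_cong refl Fubini_bdd fin b) measurable
  finally show ?thesis by (simp add: ftm_def flip: integral_mult_right_zero)
qed

definition window :: "real \<Rightarrow> real measure" where
  "window l = density lborel (\<lambda>u. indicator {0..l} u)"

definition dens :: "(real \<Rightarrow> real) \<Rightarrow> real measure" where
  "dens h = density lborel (\<lambda>x. ennreal (h x))"

lemma fin_borel_window [simp]: "fin_borel (window l)"
  unfolding fin_borel_def
proof
  show "finite_measure (window l)"
    by (cases "0 \<le> l") (auto intro!: finite_measureI simp: window_def emeasure_density)
qed (simp add: window_def)

lemma sets_window [simp, measurable_cong]: "sets (window l) = sets borel" by (simp add: window_def)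

lemma finite_window [simp]: "finite_measure (window l)" by (simp add: fin_borelD(1))

lemma sigma_finite_window [simp]: "sigma_finite_measure (window l)" by (simp add: fin_borelD(3))

lemma integral_window:
  fixes f :: "real \<Rightarrow> 'b::{banach, second_countable_topology}"
  assumes [measurable]: "f \<in> borel_measurable borel"
  shows "(\<integral>u. f u \<partial>window l) = (\<integral>u. indicator {0..l} u *\<^sub>R f u \<partial>lborel)"
proof -
  have "window l = density lborel (\<lambda>u. ennreal (indicator {0..l} u))"
    unfolding window_def by (intro arg_cong2[where f = density]) (auto simp: indicator_def)
  then show ?thesis by (simp add: integral_density)
qed

lemma nn_integral_window:
  assumes [measurable]: "f \<in> borel_measurable borel"
  shows "(\<integral>\<^sup>+u. f u \<partial>window l) = (\<integral>\<^sup>+u. indicator {0..l} u * f u \<partial>lborel)"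
  by (simp add: window_def nn_integral_density)

lemma measure_window: "0 \<le> l \<Longrightarrow> measure (window l) (space (window l)) = l"
  by (simp add: window_def measure_def emeasure_density)

lemma fin_borel_dens:
  assumes "integrable lborel h"
  shows "fin_borel (dens h)"
  unfolding fin_borel_def
proof
  have "(\<integral>\<^sup>+x. ennreal (h x) \<partial>lborel) \<le> (\<integral>\<^sup>+x. ennreal (norm (h x)) \<partial>lborel)"
    by (intro nn_integral_mono) (auto intro: ennreal_leI)
  also have "\<dots> < \<infinity>" using assms by (simp add: integrable_iff_bounded)
  finally show "finite_measure (dens h)"
    using assms by (intro finite_measureI) (auto simp: dens_def emeasure_density)
qed (simp add: dens_def)

lemma sets_dens [simp, measurable_cong]: "sets (dens h) = sets borel" by (simp add: dens_def)

lemma integral_dens: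
  fixes f :: "real \<Rightarrow> 'b::{banach, second_countable_topology}"
  assumes [measurable]: "h \<in> borel_measurable borel" "f \<in> borel_measurable borel" and "\<And>x. 0 \<le> h x"
  shows "(\<integral>x. f x \<partial>dens h) = (\<integral>x. h x *\<^sub>R f x \<partial>lborel)"
  using assms(3) by (simp add: dens_def integral_density)

lemma ftm_dens:
  assumes [measurable]: "h \<in> borel_measurable borel" and "\<And>x. 0 \<le> h x"
  shows "ftm (dens h) t = ft (\<lambda>x. complex_of_real (h x)) t"
  unfolding ftm_def ft_def by (subst integral_dens) (auto simp: assms(2) scaleR_conv_of_real mult.commute)

section \<open>Toeplitz kernels and their overlaps\<close>

definition Toep :: "real measure \<Rightarrow> real \<Rightarrow> real \<Rightarrow> complex" where
  "Toep G u v = ftm G (u - v)"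

definition Dirichlet :: "real \<Rightarrow> real \<Rightarrow> complex" where
  "Dirichlet l y = ftm (window l) y"

text \<open>
  The Toeplitz kernel of a window, in spectral form.
\<close>

definition Amp :: "real measure \<Rightarrow> real \<Rightarrow> real \<Rightarrow> real \<Rightarrow> complex" where
  "Amp G l y w = hat (window l) (window l) (Toep G) y w"

text \<open>
  The Hilbert-Schmidt inner product of two Toeplitz operators. Up to the factor \<open>2 / T\<close> it is
  the covariance of the quadratic functionals at two times.
\<close>

definition overlap :: "real measure \<Rightarrow> real measure \<Rightarrow> real \<Rightarrow> real \<Rightarrow> complex" where
  "overlap G F l l' = (\<integral>p. Amp G l (fst p) (snd p) * cnj (Amp G l' (fst p) (snd p)) \<partial>(F \<Otimes>\<^sub>M F))"

lemma kernel_Toep: "fin_borel G \<Longrightarrow> kernel (Toep G)"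
  unfolding kernel_def Toep_def by (intro conjI ftm_bdd) (auto intro!: measurable_compose[OF _ ftm_measurable])

lemma kernel_Amp: "fin_borel G \<Longrightarrow> kernel (Amp G l)"
  unfolding Amp_def[abs_def] by (intro kernel_hat kernel_Toep) auto

lemma Dirichlet_measurable [measurable]: "Dirichlet l \<in> borel_measurable borel"
  unfolding Dirichlet_def[abs_def] by (intro ftm_measurable) simp

lemma Dirichlet_bdd: "bdd (\<lambda>x. Dirichlet l (h x))"
  unfolding Dirichlet_def[abs_def] by (intro ftm_bdd) simp

lemma cnj_ftm: "cnj (ftm F t) = ftm F (- t)"
  unfolding ftm_def Bochner_Integration.integral_cnj[symmetric] by (simp add: cis_cnj)

text \<open>
  A Toeplitz kernel is a mixture of exponentials \<open>cis (x * (u - v))\<close>, hence its spectral form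
  is a mixture of kernels of rank one.
\<close>

lemma Amp_spectral:
  assumes G: "fin_borel G"
  shows "Amp G l y w = (\<integral>x. Dirichlet l (x - y) * cnj (Dirichlet l (x - w)) \<partial>G)"
proof -
  note [measurable_cong] = G[THEN fin_borelD(2)]
  interpret S: sigma_finite_measure "window l" by simp
  interpret G: sigma_finite_measure G by (rule fin_borelD(3)[OF G])
  note fin = finite_window G[THEN fin_borelD(1)]
  note b = bdd_integral fin bdd_mult bdd_cis
  have e1: "cis (- (y * u)) * ftm G (u - v) * cis (w * v) = (\<integral>x. cis ((x - y) * u) * cis (- ((x - w) * v)) \<partial>G)" for u v
    unfolding ftm_def
    by (subst integral_mult_right_zero[symmetric], subst integral_mult_left_zero[symmetric])
       (simp add: cis_mult algebra_simps)
  have "Amp G l y w = (\<integral>u. \<integral>v. \<integral>x. cis ((x - y) * u) * cis (- ((x - w) * v)) \<partial>G \<partial>window l \<partial>window l)"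
    by (simp only: Amp_def hat_def Toep_def e1)
  also have "\<dots> = (\<integral>u. \<integral>x. \<integral>v. cis ((x - y) * u) * cis (- ((x - w) * v)) \<partial>window l \<partial>G \<partial>window l)"
    by (intro Bochner_Integration.integral_cong refl Fubini_bdd fin b) measurable
  also have "\<dots> = (\<integral>x. \<integral>u. \<integral>v. cis ((x - y) * u) * cis (- ((x - w) * v)) \<partial>window l \<partial>window l \<partial>G)"
    by (intro Fubini_bdd fin b) measurable
  also have "\<dots> = (\<integral>x. Dirichlet l (x - y) * cnj (Dirichlet l (x - w)) \<partial>G)"
  proof -
    have "(\<integral>v. cis (- ((x - w) * v)) \<partial>window l) = ftm (window l) (- (x - w))" "(\<integral>u. cis ((x - y) * u) \<partial>window l) = ftm (window l) (x - y)" for x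
      unfolding ftm_def by (intro Bochner_Integration.integral_cong refl; simp add: algebra_simps)+
    then show ?thesis unfolding Dirichlet_def cnj_ftm by simp
  qed
  finally show ?thesis .
qed

lemma cnj_Amp: "fin_borel G \<Longrightarrow> cnj (Amp G l y w) = Amp G l w y"
  by (simp add: Amp_spectral mult.commute flip: Bochner_Integration.integral_cnj)

lemma integral_pair_bdd:
  fixes h :: "'a \<Rightarrow> 'b \<Rightarrow> 'c::{banach, second_countable_topology}"
  assumes "finite_measure A" "finite_measure B"
    and m: "(\<lambda>q. h (fst q) (snd q)) \<in> borel_measurable (A \<Otimes>\<^sub>M B)"
    and b: "bdd (\<lambda>q. h (fst q) (snd q))"
  shows "(\<integral>q. h (fst q) (snd q) \<partial>(A \<Otimes>\<^sub>M B)) = (\<integral>x. \<integral>y. h x y \<partial>B \<partial>A)"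
proof -
  interpret A: finite_measure A by fact
  interpret B: finite_measure B by fact
  interpret pair_sigma_finite A B ..
  have "finite_measure (A \<Otimes>\<^sub>M B)"
    by (rule finite_measure_pair_measure[OF assms(2,1)])
  from bdd_integrable[OF this m b] show ?thesis by (subst integral_fst'[symmetric]) auto
qed

text \<open>
  The product of two Toeplitz kernels with the inner variable confined to the window.
\<close>

definition Uker :: "real measure \<Rightarrow> real measure \<Rightarrow> real \<Rightarrow> real \<Rightarrow> real \<Rightarrow> complex" where
  "Uker G F l u a = (\<integral>v. ftm G (u - v) * ftm F (v - a) \<partial>window l)"

lemma kernel_Uker:
  assumes G: "fin_borel G" and F: "fin_borel F"
  shows "kernel (Uker G F l)"
  unfolding kernel_def
proof
  interpret S: sigma_finite_measure "window l" by simp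
  note [measurable (raw)] = measurable_compose[OF _ ftm_measurable[OF F]] measurable_compose[OF _ ftm_measurable[OF G]]
  show "(\<lambda>q. Uker G F l (fst q) (snd q)) \<in> borel_measurable (borel \<Otimes>\<^sub>M borel)"
    unfolding Uker_def by measurable
  show "bdd (\<lambda>q. Uker G F l (fst q) (snd q))"
    unfolding Uker_def by (intro bdd_integral finite_window bdd_mult ftm_bdd G F)
qed

lemma integral_prod_split:
  fixes X :: "'a \<Rightarrow> complex" and Y :: "'b \<Rightarrow> complex"
  shows "(\<integral>v. \<integral>b. X v * Y b \<partial>B \<partial>A) = (\<integral>v. X v \<partial>A) * (\<integral>b. Y b \<partial>B)"
  by simp

text \<open>
  In the time domain the overlap is the trace of a cyclic product of four Toeplitz kernels,
  two with symbol \<open>g\<close> and two with symbol \<open>f\<close>; they are grouped into two pairs.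
\<close>

lemma overlap_time_domain:
  assumes G: "fin_borel G" and F: "fin_borel F"
  shows "overlap G F l l' = (\<integral>p. Uker G F l (fst p) (snd p) * Uker G F l' (snd p) (fst p) \<partial>(window l \<Otimes>\<^sub>M window l'))"
proof -
  note [measurable_cong] = F[THEN fin_borelD(2)]
  interpret S: sigma_finite_measure "window l" by simp
  interpret S': sigma_finite_measure "window l'" by simp
  interpret F: sigma_finite_measure F by (rule fin_borelD(3)[OF F])
  note fin = finite_window F[THEN fin_borelD(1)] G[THEN fin_borelD(1)]
  note [measurable (raw)] = measurable_compose[OF _ ftm_measurable[OF F]] measurable_compose[OF _ ftm_measurable[OF G]]
    kernel_measurable[OF kernel_Amp[OF G]] kernel_measurable[OF kernel_Uker[OF G F]]
  note b = bdd_integral fin bdd_mult bdd_cis ftm_bdd[OF F] ftm_bdd[OF G] kernel_bdd[OF kernel_Amp[OF G]] kernel_bdd[OF kernel_Uker[OF G F]]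
  let ?K = "Toep G"
  have "overlap G F l l' = (\<integral>y. \<integral>w. Amp G l y w * Amp G l' w y \<partial>F \<partial>F)"
    unfolding overlap_def cnj_Amp[OF G] by (intro integral_pair_bdd b) measurable
  also have "\<dots> = (\<integral>y. hat (window l) (window l') (kcomp (window l) (window l') (ftm F) ?K ?K) y y \<partial>F)"
    unfolding Amp_def by (subst hat_kcomp) (auto intro: kernel_Toep G F)
  also have "\<dots> = (\<integral>u. \<integral>b. kcomp (window l) (window l') (ftm F) ?K ?K u b * ftm F (b - u) \<partial>window l' \<partial>window l)"
    by (rule trace_hat) (auto intro!: F kernel_kcomp kernel_Toep G)
  also have "\<dots> = (\<integral>u. \<integral>b. \<integral>v. \<integral>a. ftm G (u - v) * ftm F (v - a) * (ftm G (a - b) * ftm F (b - u)) \<partial>window l' \<partial>window l \<partial>window l' \<partial>window l)"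
    by (simp add: kcomp_def Toep_def mult.assoc flip: integral_mult_left_zero)
  also have "\<dots> = (\<integral>u. \<integral>v. \<integral>b. \<integral>a. ftm G (u - v) * ftm F (v - a) * (ftm G (a - b) * ftm F (b - u)) \<partial>window l' \<partial>window l' \<partial>window l \<partial>window l)"
    by (intro Bochner_Integration.integral_cong refl Fubini_bdd b) measurable
  also have "\<dots> = (\<integral>u. \<integral>v. \<integral>a. \<integral>b. ftm G (u - v) * ftm F (v - a) * (ftm G (a - b) * ftm F (b - u)) \<partial>window l' \<partial>window l' \<partial>window l \<partial>window l)"
    by (intro Bochner_Integration.integral_cong refl Fubini_bdd b) measurable
  also have "\<dots> = (\<integral>u. \<integral>a. \<integral>v. \<integral>b. ftm G (u - v) * ftm F (v - a) * (ftm G (a - b) * ftm F (b - u)) \<partial>window l' \<partial>window l \<partial>window l' \<partial>window l)"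
    by (intro Bochner_Integration.integral_cong refl Fubini_bdd b) measurable
  also have "\<dots> = (\<integral>u. \<integral>a. Uker G F l u a * Uker G F l' a u \<partial>window l' \<partial>window l)"
    by (simp only: Uker_def integral_prod_split)
  also have "\<dots> = (\<integral>p. Uker G F l (fst p) (snd p) * Uker G F l' (snd p) (fst p) \<partial>(window l \<Otimes>\<^sub>M window l'))"
    by (intro integral_pair_bdd[symmetric] b) measurable
  finally show ?thesis .
qed

section \<open>Averages of convolution type over long windows\<close>

text \<open>
  With \<open>u = T \<theta>\<close> the inner integral runs over a window that, seen from \<open>u\<close>, grows to the whole
  line if \<open>0 < \<theta> < t\<close> and moves away to infinity if \<open>\<theta> > t\<close>.
\<close>

theorem window_average:
  fixes q :: "real \<Rightarrow> real"
  assumes q: "integrable lborel q" and st: "0 \<le> s" "0 \<le> t"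
  shows "((\<lambda>T. (\<integral>u. \<integral>a. q (u - a) \<partial>window (T * t) \<partial>window (T * s)) / T) \<longlongrightarrow> min s t * (\<integral>x. q x \<partial>lborel)) at_top"
proof (rule tendsto_at_topI_sequentially)
  fix X :: "nat \<Rightarrow> real" assume X: "filterlim X at_top sequentially"
  have [measurable]: "q \<in> borel_measurable borel" using q by auto
  let ?I = "\<integral>x. q x \<partial>lborel"
  have ev: "\<forall>\<^sub>F n in sequentially. c \<le> X n" for c using X by (simp add: filterlim_at_top)
  define H where "H n \<theta> = (\<integral>x. indicator {0..X n * t} (X n * \<theta> - x) * q x \<partial>lborel)" for n \<theta>
  have [measurable]: "H n \<in> borel_measurable borel" for n unfolding H_def by measurable
  have "(\<lambda>n. \<integral>\<theta>. indicator {0..s} \<theta> * H n \<theta> \<partial>lborel) \<longlonglongrightarrow> (\<integral>\<theta>. indicator {0..s} \<theta> * (indicator {..<t} \<theta> * ?I) \<partial>lborel)"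
  proof (rule integral_dominated_convergence[where w = "\<lambda>\<theta>. indicator {0..s} \<theta> * (\<integral>x. \<bar>q x\<bar> \<partial>lborel)"])
    have Hb: "\<bar>H n \<theta>\<bar> \<le> (\<integral>x. \<bar>q x\<bar> \<partial>lborel)" for n \<theta>
    proof -
      have "\<bar>H n \<theta>\<bar> \<le> (\<integral>x. \<bar>indicator {0..X n * t} (X n * \<theta> - x) * q x\<bar> \<partial>lborel)"
        unfolding H_def by (rule integral_abs_bound)
      also have "\<dots> \<le> (\<integral>x. \<bar>q x\<bar> \<partial>lborel)"
        using q by (intro integral_mono' integrable_abs) (auto simp: indicator_def)
      finally show ?thesis .
    qed
    show "AE \<theta> in lborel. norm (indicator {0..s} \<theta> * H n \<theta>) \<le> indicator {0..s} \<theta> * (\<integral>x. \<bar>q x\<bar> \<partial>lborel)" for n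
      using Hb by (intro AE_I2) (auto simp: indicator_def)
    have "AE \<theta> in lborel. \<theta> \<noteq> (0::real)" "AE \<theta> in lborel. \<theta> \<noteq> t" by (rule AE_lborel_singleton)+
    then show "AE \<theta> in lborel. (\<lambda>n. indicator {0..s} \<theta> * H n \<theta>) \<longlonglongrightarrow> indicator {0..s} \<theta> * (indicator {..<t} \<theta> * ?I)"
    proof eventually_elim
      fix \<theta> :: real assume \<theta>: "\<theta> \<noteq> 0" "\<theta> \<noteq> t"
      show "(\<lambda>n. indicator {0..s} \<theta> * H n \<theta>) \<longlonglongrightarrow> indicator {0..s} \<theta> * (indicator {..<t} \<theta> * ?I)"
      proof (cases "0 < \<theta>")
        case True
        have "(\<lambda>n. H n \<theta>) \<longlonglongrightarrow> (\<integral>x. indicator {..<t} \<theta> * q x \<partial>lborel)"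
          unfolding H_def
        proof (rule integral_dominated_convergence[where w = "\<lambda>x. \<bar>q x\<bar>"])
          show "AE x in lborel. (\<lambda>n. indicator {0..X n * t} (X n * \<theta> - x) * q x) \<longlonglongrightarrow> indicator {..<t} \<theta> * q x"
          proof (intro AE_I2 tendsto_mult tendsto_const)
            fix x
            have 1: "\<forall>\<^sub>F n in sequentially. x / \<theta> \<le> X n" by (rule ev)
            have 2: "\<forall>\<^sub>F n in sequentially. 1 + \<bar>x\<bar> / \<bar>t - \<theta>\<bar> \<le> X n" by (rule ev)
            have "\<forall>\<^sub>F n in sequentially. indicator {0..X n * t} (X n * \<theta> - x) = (indicator {..<t} \<theta> :: real)"
              using 1 2
            proof eventually_elim
              case (elim n)
              have a: "0 \<le> X n * \<theta> - x" using elim(1) True by (simp add: field_simps)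
              have d: "\<bar>t - \<theta>\<bar> > 0" using \<theta> by simp
              have "\<bar>x\<bar> / \<bar>t - \<theta>\<bar> < X n" using elim(2) by simp
              then have c: "\<bar>x\<bar> < X n * \<bar>t - \<theta>\<bar>" using d by (simp add: field_simps)
              show ?case
              proof (cases "\<theta> < t")
                case True
                then have "\<bar>x\<bar> < X n * t - X n * \<theta>" using c by (simp add: algebra_simps)
                then show ?thesis using a True by (auto simp: indicator_def)
              next
                case False
                then have "\<bar>x\<bar> < X n * \<theta> - X n * t" using c by (simp add: algebra_simps)
                then show ?thesis using a False by (auto simp: indicator_def)
              qed
            qed
            then show "(\<lambda>n. indicator {0..X n * t} (X n * \<theta> - x)) \<longlonglongrightarrow> (indicator {..<t} \<theta> :: real)"
              by (rule tendsto_eventually)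
          qed
        qed (use q in \<open>auto simp: indicator_def\<close>)
        then show ?thesis by (intro tendsto_mult tendsto_const) simp
      qed (use \<theta> in \<open>simp add: indicator_def\<close>)
    qed
  qed (use st in \<open>auto simp: integrable_indicator_iff\<close>)
  also have "(\<integral>\<theta>. indicator {0..s} \<theta> * (indicator {..<t} \<theta> * ?I) \<partial>lborel) = (\<integral>\<theta>. indicator ({0..s} \<inter> {..<t}) \<theta> \<partial>lborel) * ?I"
    by (simp add: indicator_inter_arith mult.assoc flip: integral_mult_left_zero)
  also have "(\<integral>\<theta>. indicator ({0..s} \<inter> {..<t}) \<theta> \<partial>lborel) = min s t"
  proof (cases "t \<le> s")
    case True
    then have "{0..s} \<inter> {..<t} = {0..<t}" by auto
    then show ?thesis using st True by simp
  next
    case False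
    then have "{0..s} \<inter> {..<t} = {0..s}" by auto
    then show ?thesis using st False by simp
  qed
  finally have "(\<lambda>n. \<integral>\<theta>. indicator {0..s} \<theta> * H n \<theta> \<partial>lborel) \<longlonglongrightarrow> min s t * ?I" .
  moreover have "\<forall>\<^sub>F n in sequentially. (\<integral>\<theta>. indicator {0..s} \<theta> * H n \<theta> \<partial>lborel) = (\<integral>u. \<integral>a. q (u - a) \<partial>window (X n * t) \<partial>window (X n * s)) / X n"
    using ev[of 1]
  proof eventually_elim
    case (elim n)
    then have X0: "X n > 0" by simp
    interpret S: sigma_finite_measure "window (X n * t)" by simp
    have inner: "(\<integral>a. q (u - a) \<partial>window (X n * t)) = (\<integral>x. indicator {0..X n * t} (u - x) * q x \<partial>lborel)" for u
      by (subst integral_window, measurable) (use integral_lborel_shift(3)[of "\<lambda>x. indicator {0..X n * t} (u - x) * q x" u] in simp)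
    have "(\<integral>u. \<integral>a. q (u - a) \<partial>window (X n * t) \<partial>window (X n * s)) = (\<integral>u. indicator {0..X n * s} u * (\<integral>a. q (u - a) \<partial>window (X n * t)) \<partial>lborel)"
      by (subst integral_window) auto
    also have "\<dots> = X n * (\<integral>\<theta>. indicator {0..X n * s} (X n * \<theta>) * (\<integral>a. q (X n * \<theta> - a) \<partial>window (X n * t)) \<partial>lborel)"
      using X0 by (subst lborel_integral_real_affine[of "X n" _ 0]) auto
    also have "(\<lambda>\<theta>. indicator {0..X n * s} (X n * \<theta>) * (\<integral>a. q (X n * \<theta> - a) \<partial>window (X n * t))) = (\<lambda>\<theta>. indicator {0..s} \<theta> * H n \<theta>)"
      using X0 unfolding inner H_def by (auto simp: indicator_def zero_le_mult_iff)
    finally show ?case using X0 by simp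
  qed
  ultimately show "(\<lambda>n. (\<integral>u. \<integral>a. q (u - a) \<partial>window (X n * t) \<partial>window (X n * s)) / X n) \<longlonglongrightarrow> min s t * ?I"
    by (rule Lim_transform_eventually)
qed

section \<open>Traces of products of Toeplitz operators with bounded symbols\<close>

definition bounded_density :: "real \<Rightarrow> (real \<Rightarrow> real) \<Rightarrow> bool" where
  "bounded_density K h \<longleftrightarrow> integrable lborel h \<and> (\<forall>x. 0 \<le> h x \<and> h x \<le> K)"

lemma bounded_densityD:
  assumes "bounded_density K h"
  shows "integrable lborel h" "\<And>x. 0 \<le> h x" "\<And>x. h x \<le> K" "h \<in> borel_measurable borel" "0 \<le> K"
    "integrable lborel (\<lambda>x. complex_of_real (h x))" "\<And>x. norm (complex_of_real (h x)) \<le> K"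
    "fin_borel (dens h)" "ftm (dens h) = ft (\<lambda>x. complex_of_real (h x))"
proof -
  show *: "integrable lborel h" "\<And>x. 0 \<le> h x" "\<And>x. h x \<le> K" using assms by (auto simp: bounded_density_def)
  then show "h \<in> borel_measurable borel" by auto
  then show "ftm (dens h) = ft (\<lambda>x. complex_of_real (h x))" using *(2) by (intro ext ftm_dens) auto
  show "0 \<le> K" using *(2)[of 0] *(3)[of 0] by linarith
qed (use assms in \<open>auto simp: bounded_density_def intro: fin_borel_dens\<close>)

context
  fixes f g :: "real \<Rightarrow> real" and K :: real
  assumes f: "bounded_density K f" and g: "bounded_density K g"
begin

private abbreviation "r \<equiv> ftm (dens f)"
private abbreviation "\<gamma> \<equiv> ftm (dens g)"

text \<open>
  In this context the products of Toeplitz kernels are compared with what they would be if the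
  inner variable ran over the whole line: \<open>Lker\<close> is the kernel of the whole line, \<open>edge\<close> the
  difference.
\<close>

definition Lker where "Lker x = 2 * complex_of_real pi * ft (\<lambda>y. complex_of_real (f y * g y)) x"
definition Gsq where "Gsq x = (norm (ftm (dens g) x))\<^sup>2"
definition edge where "edge l u a = Lker (u - a) - Uker (dens g) (dens f) l u a"

lemma fg_density: "bounded_density (K * K) (\<lambda>x. f x * g x)"
  unfolding bounded_density_def
proof (intro conjI allI)
  note F = bounded_densityD[OF f] note G = bounded_densityD[OF g]
  show "integrable lborel (\<lambda>x. f x * g x)"
    by (rule Bochner_Integration.integrable_bound[of _ "\<lambda>x. K * f x"])
       (use F G in \<open>auto simp: abs_mult mult.commute[of K] intro!: mult_left_mono AE_I2\<close>)
  show "0 \<le> f x * g x" "f x * g x \<le> K * K" for x using F G by (auto intro: mult_mono)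
qed

lemma sq_int_ftm: assumes "bounded_density C h" shows "sq_int lborel (ftm (dens h))"
  unfolding bounded_densityD(9)[OF assms]
  by (intro ft_sq_int sq_int_bounded_L1[of _ _ C] bounded_densityD[OF assms])

lemma transforms_measurable [measurable]: "ftm (dens g) \<in> borel_measurable borel" "ftm (dens f) \<in> borel_measurable borel"
  by (intro ftm_measurable bounded_densityD(8)[OF g] bounded_densityD(8)[OF f])+

lemma integrable_Gsq: "integrable lborel Gsq"
  using sq_int_ftm[OF g] by (simp add: sq_int_def Gsq_def[abs_def])

lemma Lker_measurable [measurable]: "Lker \<in> borel_measurable borel"
proof -
  note [measurable] = bounded_densityD(4)[OF f] bounded_densityD(4)[OF g]
  show ?thesis unfolding Lker_def[abs_def] by measurable
qed

lemma Lker_sq_int: "sq_int lborel Lker"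
  using sq_int_ftm[OF fg_density] unfolding Lker_def[abs_def] bounded_densityD(9)[OF fg_density]
  by (intro sq_int_cmult) simp

lemma integral_Lker_square: "(\<integral>x. (norm (Lker x))\<^sup>2 \<partial>lborel) = (2 * pi) ^ 3 * (\<integral>x. (f x * g x)\<^sup>2 \<partial>lborel)"
proof -
  let ?h = "\<lambda>y. complex_of_real (f y * g y)"
  note H = bounded_densityD[OF fg_density]
  have "complex_of_real (\<integral>x. (norm (ft ?h x))\<^sup>2 \<partial>lborel) = (\<integral>x. ft ?h x * cnj (ft ?h x) \<partial>lborel)"
    by (subst integral_complex_of_real[symmetric]) (simp only: complex_norm_square)
  also have "\<dots> = 2 * pi * (\<integral>x. ?h x * cnj (?h x) \<partial>lborel)"
    by (rule Plancherel_bounded[OF H(6,7) H(6,7)])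
  also have "(\<integral>x. ?h x * cnj (?h x) \<partial>lborel) = complex_of_real (\<integral>x. (f x * g x)\<^sup>2 \<partial>lborel)"
    by (subst integral_complex_of_real[symmetric]) (simp add: power2_eq_square)
  finally have "complex_of_real (\<integral>x. (norm (ft ?h x))\<^sup>2 \<partial>lborel) = complex_of_real (2 * pi * (\<integral>x. (f x * g x)\<^sup>2 \<partial>lborel))"
    by simp
  then have "(\<integral>x. (norm (ft ?h x))\<^sup>2 \<partial>lborel) = 2 * pi * (\<integral>x. (f x * g x)\<^sup>2 \<partial>lborel)"
    by (simp only: of_real_eq_iff)
  moreover have "(norm (Lker x))\<^sup>2 = (2 * pi)\<^sup>2 * (norm (ft ?h x))\<^sup>2" for x
    unfolding Lker_def norm_mult power_mult_distrib by simp
  ultimately have "(\<integral>x. (norm (Lker x))\<^sup>2 \<partial>lborel) = (2 * pi)\<^sup>2 * (2 * pi * (\<integral>x. (f x * g x)\<^sup>2 \<partial>lborel))"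
    by (simp only: integral_mult_right_zero)
  then show ?thesis by (simp only: power2_eq_square power3_eq_cube mult.assoc)
qed

lemma sq_int_reflect_shift:
  assumes "sq_int lborel h" shows "sq_int lborel (\<lambda>v. h (u - v :: real))"
  using assms integrable_lborel_shift(3)[of "\<lambda>x. (norm (h x))\<^sup>2" u] by (auto simp: sq_int_def)

lemma sq_int_shift:
  assumes "sq_int lborel h" shows "sq_int lborel (\<lambda>v. h (v - u :: real))"
  using assms integrable_lborel_shift(2)[of "\<lambda>x. (norm (h x))\<^sup>2" "-u"] by (auto simp: sq_int_def)

text \<open>
  On the whole line Toeplitz kernels are convolutions, so their symbols multiply; the constant
  \<open>2 pi\<close> is the one of Plancherel's theorem.
\<close>

lemma whole_line_product: "(\<integral>v. \<gamma> (u - v) * r (v - a) \<partial>lborel) = Lker (u - a)"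
proof -
  note F = bounded_densityD[OF f] note G = bounded_densityD[OF g]
  let ?f = "\<lambda>x. cis (x * (- a)) * complex_of_real (f x)" and ?g = "\<lambda>x. cis (x * (- u)) * complex_of_real (g x)"
  have [measurable]: "f \<in> borel_measurable borel" "g \<in> borel_measurable borel" by (rule F(4) G(4))+
  have r: "r (v - a) = ft ?f v" for v unfolding F(9) ft_cis_mult by simp
  have \<gamma>: "\<gamma> (u - v) = cnj (ft ?g v)" for v
    unfolding G(9) ft_cis_mult by (simp add: ft_of_real_uminus[symmetric])
  have "(\<integral>v. \<gamma> (u - v) * r (v - a) \<partial>lborel) = (\<integral>v. ft ?f v * cnj (ft ?g v) \<partial>lborel)"
    unfolding r \<gamma> by (simp add: mult.commute)
  also have "\<dots> = 2 * pi * (\<integral>x. ?f x * cnj (?g x) \<partial>lborel)"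
    by (rule Plancherel_bounded[of _ K])
       (use F G in \<open>auto simp: norm_mult intro!: integrable_cis_mult\<close>)
  also have "(\<lambda>x. ?f x * cnj (?g x)) = (\<lambda>x. cis (x * (u - a)) * complex_of_real (f x * g x))"
  proof
    fix x
    have "?f x * cnj (?g x) = cis (x * (- a)) * cis (x * u) * complex_of_real (f x * g x)"
      by (simp add: cis_cnj mult_ac)
    also have "cis (x * (- a)) * cis (x * u) = cis (x * (u - a))" by (simp add: cis_mult algebra_simps)
    finally show "?f x * cnj (?g x) = cis (x * (u - a)) * complex_of_real (f x * g x)" .
  qed
  finally show ?thesis by (simp add: Lker_def ft_def)
qed

lemma edge_eq: "edge l u a = (\<integral>v. (1 - indicator {0..l} v) * \<gamma> (u - v) * r (v - a) \<partial>lborel)"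
proof -
  have i: "integrable lborel (\<lambda>v. \<gamma> (u - v) * r (v - a))"
    by (intro sq_int_integrable_mult sq_int_reflect_shift sq_int_shift sq_int_ftm[OF f] sq_int_ftm[OF g])
  have j: "integrable lborel (\<lambda>v. indicator {0..l} v *\<^sub>R (\<gamma> (u - v) * r (v - a)))"
    using integrable_mult_indicator[OF _ i, of "{0..l}"] by simp
  have "edge l u a = (\<integral>v. \<gamma> (u - v) * r (v - a) \<partial>lborel) - (\<integral>v. indicator {0..l} v *\<^sub>R (\<gamma> (u - v) * r (v - a)) \<partial>lborel)"
    unfolding edge_def whole_line_product Uker_def by (subst integral_window) auto
  also have "\<dots> = (\<integral>v. \<gamma> (u - v) * r (v - a) - indicator {0..l} v *\<^sub>R (\<gamma> (u - v) * r (v - a)) \<partial>lborel)"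
    using i j by simp
  also have "\<dots> = (\<integral>v. (1 - indicator {0..l} v) * \<gamma> (u - v) * r (v - a) \<partial>lborel)"
    by (intro Bochner_Integration.integral_cong) (auto simp: indicator_def)
  finally show ?thesis .
qed

text \<open>
  For fixed \<open>u\<close> the edge term arises from the part of \<open>g^(u - v)\<close> with \<open>v\<close> outside of the
  window, by the Fourier multiplier with the bounded symbol \<open>f\<close>.
\<close>

lemma edge_row: "(\<integral>\<^sup>+a. ennreal ((norm (edge l u a))\<^sup>2) \<partial>lborel)
    \<le> ennreal ((2 * pi * K)\<^sup>2) * ennreal ((\<integral>x. Gsq x \<partial>lborel) - (\<integral>v. Gsq (u - v) \<partial>window l))"
proof -
  note F = bounded_densityD[OF f] note G = bounded_densityD[OF g]
  let ?\<phi> = "\<lambda>v. (1 - indicator {0..l} v) * \<gamma> (u - v)"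
  have Gsq[measurable]: "Gsq \<in> borel_measurable borel" unfolding Gsq_def[abs_def] by measurable
  have i: "integrable lborel (\<lambda>v. Gsq (u - v))" by (rule integrable_lborel_shift(3)[OF integrable_Gsq])
  have j: "integrable lborel (\<lambda>v. indicator {0..l} v *\<^sub>R Gsq (u - v))"
    using integrable_mult_indicator[OF _ i, of "{0..l}"] by simp
  have eq: "(norm (?\<phi> v))\<^sup>2 = Gsq (u - v) - indicator {0..l} v *\<^sub>R Gsq (u - v)" for v
    by (simp add: Gsq_def indicator_def norm_mult)
  have k: "integrable lborel (\<lambda>v. (norm (?\<phi> v))\<^sup>2)" unfolding eq using i j by simp
  have \<phi>: "sq_int lborel ?\<phi>" unfolding sq_int_def using k by simp
  have "(\<integral>\<^sup>+a. ennreal ((norm (edge l u a))\<^sup>2) \<partial>lborel) \<le> ennreal ((2 * pi * K)\<^sup>2) * (\<integral>\<^sup>+v. ennreal ((norm (?\<phi> v))\<^sup>2) \<partial>lborel)"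
    unfolding edge_eq F(9) by (rule multiplier_bound[OF F(6,7) \<phi>])
  also have "(\<integral>\<^sup>+v. ennreal ((norm (?\<phi> v))\<^sup>2) \<partial>lborel) = ennreal (\<integral>v. (norm (?\<phi> v))\<^sup>2 \<partial>lborel)"
    by (rule nn_integral_eq_integral[OF k]) simp
  also have "(\<integral>v. (norm (?\<phi> v))\<^sup>2 \<partial>lborel) = (\<integral>x. Gsq x \<partial>lborel) - (\<integral>v. Gsq (u - v) \<partial>window l)"
    unfolding eq using i j integral_lborel_shift(3)[of Gsq u] by (subst integral_window) auto
  finally show ?thesis .
qed

text \<open>
  The mass of \<open>|g^(u - v)|\<^sup>2\<close> with \<open>u\<close> inside and \<open>v\<close> outside of the window.
\<close>

definition leak where "leak l = l * (\<integral>x. Gsq x \<partial>lborel) - (\<integral>u. \<integral>v. Gsq (u - v) \<partial>window l \<partial>window l)"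

lemma Gsq_window: "0 \<le> (\<integral>v. Gsq (u - v) \<partial>window l)" "(\<integral>v. Gsq (u - v) \<partial>window l) \<le> (\<integral>x. Gsq x \<partial>lborel)"
proof -
  have [measurable]: "Gsq \<in> borel_measurable borel" unfolding Gsq_def[abs_def] by measurable
  have i: "integrable lborel (\<lambda>v. Gsq (u - v))" by (rule integrable_lborel_shift(3)[OF integrable_Gsq])
  have "(\<integral>v. Gsq (u - v) \<partial>window l) = (\<integral>v. indicator {0..l} v *\<^sub>R Gsq (u - v) \<partial>lborel)" by (rule integral_window) measurable
  also have "\<dots> \<le> (\<integral>v. Gsq (u - v) \<partial>lborel)"
    using i by (intro integral_mono') (auto simp: indicator_def Gsq_def)
  finally show "(\<integral>v. Gsq (u - v) \<partial>window l) \<le> (\<integral>x. Gsq x \<partial>lborel)" by (simp only: integral_lborel_shift(3))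
  show "0 \<le> (\<integral>v. Gsq (u - v) \<partial>window l)" by (intro integral_nonneg_AE) (simp add: Gsq_def)
qed

lemma edge_total:
  assumes "0 \<le> l"
  shows "(\<integral>\<^sup>+u. \<integral>\<^sup>+a. ennreal ((norm (edge l u a))\<^sup>2) \<partial>window l' \<partial>window l) \<le> ennreal ((2 * pi * K)\<^sup>2 * leak l)" "0 \<le> leak l"
proof -
  interpret S: finite_measure "window l" by simp
  have [measurable]: "Gsq \<in> borel_measurable borel" unfolding Gsq_def[abs_def] by measurable
  have [measurable]: "(\<lambda>a. edge l u a) \<in> borel_measurable borel" for u
    unfolding edge_eq by measurable
  let ?c = "\<integral>x. Gsq x \<partial>lborel" and ?w = "\<lambda>u. \<integral>v. Gsq (u - v) \<partial>window l"
  have w: "integrable (window l) ?w"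
    using Gsq_window by (intro S.integrable_const_bound[of _ ?c]) auto
  have leak: "leak l = (\<integral>u. ?c - ?w u \<partial>window l)"
    using w assms by (simp add: leak_def measure_window)
  show "0 \<le> leak l" unfolding leak using Gsq_window by (intro integral_nonneg_AE) simp
  have "(\<integral>\<^sup>+u. \<integral>\<^sup>+a. ennreal ((norm (edge l u a))\<^sup>2) \<partial>window l' \<partial>window l) \<le> (\<integral>\<^sup>+u. ennreal ((2 * pi * K)\<^sup>2) * ennreal (?c - ?w u) \<partial>window l)"
  proof (intro nn_integral_mono)
    fix u
    have "(\<integral>\<^sup>+a. ennreal ((norm (edge l u a))\<^sup>2) \<partial>window l') \<le> (\<integral>\<^sup>+a. ennreal ((norm (edge l u a))\<^sup>2) \<partial>lborel)"
      by (subst nn_integral_window, measurable) (auto intro!: nn_integral_mono simp: indicator_def)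
    then show "(\<integral>\<^sup>+a. ennreal ((norm (edge l u a))\<^sup>2) \<partial>window l') \<le> ennreal ((2 * pi * K)\<^sup>2) * ennreal (?c - ?w u)"
      using edge_row by (rule order_trans)
  qed
  also have "\<dots> = ennreal ((2 * pi * K)\<^sup>2) * (\<integral>\<^sup>+u. ennreal (?c - ?w u) \<partial>window l)"
    by (rule nn_integral_cmult) measurable
  also have "(\<integral>\<^sup>+u. ennreal (?c - ?w u) \<partial>window l) = ennreal (leak l)"
    unfolding leak using w Gsq_window by (intro nn_integral_eq_integral) auto
  also have "ennreal ((2 * pi * K)\<^sup>2) * ennreal (leak l) = ennreal ((2 * pi * K)\<^sup>2 * leak l)"
    by (rule ennreal_mult'[symmetric]) simp
  finally show "(\<integral>\<^sup>+u. \<integral>\<^sup>+a. ennreal ((norm (edge l u a))\<^sup>2) \<partial>window l' \<partial>window l) \<le> ennreal ((2 * pi * K)\<^sup>2 * leak l)" .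
qed

text \<open>
  Both terms of the leak grow like the length of the window times the integral of \<open>|g^|\<^sup>2\<close>.
\<close>

lemma leak_sublinear:
  assumes "0 \<le> s" shows "((\<lambda>T. leak (T * s) / T) \<longlongrightarrow> 0) at_top"
proof -
  have "((\<lambda>T. s * (\<integral>x. Gsq x \<partial>lborel) - (\<integral>u. \<integral>a. Gsq (u - a) \<partial>window (T * s) \<partial>window (T * s)) / T) \<longlongrightarrow> s * (\<integral>x. Gsq x \<partial>lborel) - min s s * (\<integral>x. Gsq x \<partial>lborel)) at_top"
    by (intro tendsto_diff tendsto_const window_average integrable_Gsq assms)
  moreover have "\<forall>\<^sub>F T in at_top. s * (\<integral>x. Gsq x \<partial>lborel) - (\<integral>u. \<integral>a. Gsq (u - a) \<partial>window (T * s) \<partial>window (T * s)) / T = leak (T * s) / T"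
    using eventually_gt_at_top[of 0] by eventually_elim (simp add: leak_def diff_divide_distrib)
  ultimately show ?thesis by (simp add: Lim_transform_eventually)
qed

lemma fin_pair: "finite_measure (window l \<Otimes>\<^sub>M window l')" by (rule finite_measure_pair_measure) auto

lemma edge_sqn:
  assumes "0 \<le> l" "0 \<le> l'"
  shows "sqn (window l \<Otimes>\<^sub>M window l') (\<lambda>p. edge l (fst p) (snd p)) \<le> 2 * pi * K * sqrt (leak l)"
    "sqn (window l \<Otimes>\<^sub>M window l') (\<lambda>p. edge l' (snd p) (fst p)) \<le> 2 * pi * K * sqrt (leak l')"
proof -
  interpret S: sigma_finite_measure "window l" by simp
  interpret S': sigma_finite_measure "window l'" by simp
  interpret pair_sigma_finite "window l" "window l'" ..
  have m: "(\<lambda>q. edge l (fst q) (snd q)) \<in> borel_measurable (borel \<Otimes>\<^sub>M borel)" for l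
    unfolding edge_eq by measurable
  have m'[measurable (raw)]: "(\<lambda>x. edge l (f x) (g x)) \<in> borel_measurable M"
    if "f \<in> borel_measurable M" "g \<in> borel_measurable M" for f g l and M :: "'z measure"
    using measurable_compose[OF measurable_Pair[OF that] m] by simp
  have K: "0 \<le> K" by (rule bounded_densityD(5)[OF f])
  have sq: "(2 * pi * K * sqrt (leak l))\<^sup>2 = (2 * pi * K)\<^sup>2 * leak l" if "0 \<le> l" for l
    using edge_total(2)[OF that] by (simp add: power_mult_distrib)
  show "sqn (window l \<Otimes>\<^sub>M window l') (\<lambda>p. edge l (fst p) (snd p)) \<le> 2 * pi * K * sqrt (leak l)"
  proof (rule sq_intI_nn(2))
    have "(\<integral>\<^sup>+p. ennreal ((norm (edge l (fst p) (snd p)))\<^sup>2) \<partial>(window l \<Otimes>\<^sub>M window l')) = (\<integral>\<^sup>+u. \<integral>\<^sup>+a. ennreal ((norm (edge l u a))\<^sup>2) \<partial>window l' \<partial>window l)"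
      by (subst S'.nn_integral_fst[symmetric]) auto
    then show "(\<integral>\<^sup>+p. ennreal ((norm (edge l (fst p) (snd p)))\<^sup>2) \<partial>(window l \<Otimes>\<^sub>M window l')) \<le> ennreal ((2 * pi * K * sqrt (leak l))\<^sup>2)"
      using edge_total(1)[OF assms(1)] by (simp only: sq[OF assms(1)])
  qed (use K edge_total(2)[OF assms(1)] in auto)
  show "sqn (window l \<Otimes>\<^sub>M window l') (\<lambda>p. edge l' (snd p) (fst p)) \<le> 2 * pi * K * sqrt (leak l')"
  proof (rule sq_intI_nn(2))
    have "(\<integral>\<^sup>+p. ennreal ((norm (edge l' (snd p) (fst p)))\<^sup>2) \<partial>(window l \<Otimes>\<^sub>M window l')) = (\<integral>\<^sup>+a. \<integral>\<^sup>+u. ennreal ((norm (edge l' a u))\<^sup>2) \<partial>window l \<partial>window l')"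
      by (subst nn_integral_snd[symmetric]) auto
    then show "(\<integral>\<^sup>+p. ennreal ((norm (edge l' (snd p) (fst p)))\<^sup>2) \<partial>(window l \<Otimes>\<^sub>M window l')) \<le> ennreal ((2 * pi * K * sqrt (leak l'))\<^sup>2)"
      using edge_total(1)[OF assms(2)] by (simp only: sq[OF assms(2)])
  qed (use K edge_total(2)[OF assms(2)] in auto)
qed

lemma Lker_bdd: "bdd (\<lambda>x. Lker (h x))"
  using ftm_bdd[OF bounded_densityD(8)[OF fg_density], of h] unfolding Lker_def bounded_densityD(9)[OF fg_density]
  by (intro bdd_mult bdd_const)

lemma cnj_Lker: "cnj (Lker x) = Lker (- x)"
  by (simp only: Lker_def complex_cnj_mult ft_of_real_uminus complex_cnj_numeral complex_cnj_complex_of_real)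

lemma Lker_window:
  assumes "0 \<le> s" "0 \<le> t"
  shows "((\<lambda>T. (sqn (window (T * s) \<Otimes>\<^sub>M window (T * t)) (\<lambda>p. Lker (fst p - snd p)))\<^sup>2 / T)
    \<longlongrightarrow> (2 * pi) ^ 3 * min s t * (\<integral>x. (f x * g x)\<^sup>2 \<partial>lborel)) at_top"
proof -
  have b: "bdd (\<lambda>q. (norm (Lker (fst q - snd q)))\<^sup>2)"
  proof -
    obtain C where "C \<ge> 0" "\<And>x. norm (Lker (fst x - snd x)) \<le> C" by (rule bddE[OF Lker_bdd]) (rule that)
    then show ?thesis by (intro bddI[of _ "C\<^sup>2"]) (auto intro: power_mono)
  qed
  have "(sqn (window l \<Otimes>\<^sub>M window l') (\<lambda>p. Lker (fst p - snd p)))\<^sup>2 = (\<integral>u. \<integral>a. (norm (Lker (u - a)))\<^sup>2 \<partial>window l' \<partial>window l)" for l l'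
    unfolding sqn_square by (rule integral_pair_bdd[OF finite_window finite_window _ b]) measurable
  moreover have "integrable lborel (\<lambda>x. (norm (Lker x))\<^sup>2)" using Lker_sq_int by (simp add: sq_int_def)
  from window_average[OF this assms]
  have "((\<lambda>T. (\<integral>u. \<integral>a. (norm (Lker (u - a)))\<^sup>2 \<partial>window (T * t) \<partial>window (T * s)) / T) \<longlongrightarrow> min s t * ((2 * pi) ^ 3 * (\<integral>x. (f x * g x)\<^sup>2 \<partial>lborel))) at_top"
    by (simp only: integral_Lker_square)
  ultimately show ?thesis by (simp only: mult_ac)
qed

text \<open>
  By the Cauchy-Schwarz inequality, replacing the two products of kernels in the time domain
  by the kernel of the whole line costs \<open>o(T)\<close>. What remains is a window average of
  \<open>|Lker|\<^sup>2\<close>.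
\<close>

theorem Toeplitz_trace_limit:
  assumes st: "0 \<le> s" "0 \<le> t"
  shows "((\<lambda>T. overlap (dens g) (dens f) (T * s) (T * t) / T)
    \<longlongrightarrow> complex_of_real ((2 * pi) ^ 3 * min s t * (\<integral>x. (f x * g x)\<^sup>2 \<partial>lborel))) at_top"
proof -
  note G = bounded_densityD(8)[OF g] note F = bounded_densityD(8)[OF f]
  define P where "P T = window (T * s) \<Otimes>\<^sub>M window (T * t)" for T
  define \<Lambda> where "\<Lambda> T = sqn (P T) (\<lambda>p. Lker (fst p - snd p))" for T
  define e1 where "e1 T = 2 * pi * K * sqrt (leak (T * s))" for T
  define e2 where "e2 T = 2 * pi * K * sqrt (leak (T * t))" for T
  let ?c = "(2 * pi) ^ 3 * min s t * (\<integral>x. (f x * g x)\<^sup>2 \<partial>lborel)"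
  have lim\<Lambda>: "((\<lambda>T. (\<Lambda> T)\<^sup>2 / T) \<longlongrightarrow> ?c) at_top"
    unfolding \<Lambda>_def P_def by (rule Lker_window[OF st])
  have bound: "norm (overlap (dens g) (dens f) (T * s) (T * t) - complex_of_real ((\<Lambda> T)\<^sup>2)) \<le> e1 T * (\<Lambda> T + e2 T) + \<Lambda> T * e2 T" if T: "T > 0" for T
  proof -
    have l: "0 \<le> T * s" "0 \<le> T * t" using T st by auto
    note fin = fin_pair[of "T * s" "T * t", folded P_def]
    have sets[measurable_cong]: "sets (P T) = sets (borel \<Otimes>\<^sub>M borel)"
      unfolding P_def by (rule sets_pair_measure_cong) auto
    note [measurable (raw)] = kernel_measurable[OF kernel_Uker[OF G F]]
    define U1 where "U1 p = Uker (dens g) (dens f) (T * s) (fst p) (snd p)" for p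
    define U2 where "U2 p = Uker (dens g) (dens f) (T * t) (snd p) (fst p)" for p
    define L1 where "L1 p = Lker (fst p - snd p)" for p :: "real \<times> real"
    define L2 where "L2 p = Lker (snd p - fst p)" for p :: "real \<times> real"
    have q: "sq_int (P T) U1" "sq_int (P T) U2"
      unfolding U1_def[abs_def] U2_def[abs_def] by (intro bdd_sq_int fin kernel_bdd kernel_Uker G F; measurable)+
    have qL: "sq_int (P T) L1" "sq_int (P T) L2"
      unfolding L1_def[abs_def] L2_def[abs_def] by (intro bdd_sq_int fin Lker_bdd; measurable)+
    have cL: "L2 p = cnj (L1 p)" for p by (simp add: L1_def L2_def cnj_Lker)
    have nL: "sqn (P T) L1 = \<Lambda> T" "sqn (P T) L2 = \<Lambda> T"
      by (auto simp: cL[abs_def] \<Lambda>_def L1_def[abs_def])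
    have d1: "sqn (P T) (\<lambda>p. L1 p - U1 p) \<le> e1 T" and d2: "sqn (P T) (\<lambda>p. L2 p - U2 p) \<le> e2 T"
      using edge_sqn[OF l] by (simp_all add: edge_def L1_def L2_def U1_def U2_def P_def e1_def e2_def)
    have n2: "sqn (P T) U2 \<le> \<Lambda> T + e2 T"
    proof -
      have "sqn (P T) U2 \<le> sqn (P T) L2 + sqn (P T) (\<lambda>x. U2 x - L2 x)" by (rule sqn_le_add_diff) (rule q qL)+
      also have "sqn (P T) (\<lambda>x. U2 x - L2 x) = sqn (P T) (\<lambda>x. L2 x - U2 x)" by (simp add: sqn_def norm_minus_commute)
      finally show ?thesis using d2 nL by simp
    qed
    have "complex_of_real ((\<Lambda> T)\<^sup>2) = (\<integral>p. L1 p * L2 p \<partial>P T)"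
      unfolding nL(1)[symmetric] sqn_square cL by (subst integral_complex_of_real[symmetric]) (simp only: complex_norm_square)
    then have "complex_of_real ((\<Lambda> T)\<^sup>2) - overlap (dens g) (dens f) (T * s) (T * t) = (\<integral>p. L1 p * L2 p - U1 p * U2 p \<partial>P T)"
      unfolding overlap_time_domain[OF G F] using sq_int_integrable_mult[OF q] sq_int_integrable_mult[OF qL]
      by (simp add: U1_def U2_def P_def)
    also have "\<dots> = (\<integral>p. (L1 p - U1 p) * U2 p + L1 p * (L2 p - U2 p) \<partial>P T)"
      by (intro Bochner_Integration.integral_cong) (auto simp: algebra_simps)
    also have "\<dots> = (\<integral>p. (L1 p - U1 p) * U2 p \<partial>P T) + (\<integral>p. L1 p * (L2 p - U2 p) \<partial>P T)"
      by (intro Bochner_Integration.integral_add sq_int_integrable_mult sq_int_diff q qL)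
    also have "norm \<dots> \<le> e1 T * (\<Lambda> T + e2 T) + \<Lambda> T * e2 T"
    proof (intro order_trans[OF norm_triangle_ineq] add_mono)
      have "norm (\<integral>p. (L1 p - U1 p) * U2 p \<partial>P T) \<le> sqn (P T) (\<lambda>p. L1 p - U1 p) * sqn (P T) U2"
        by (intro sq_int_Cauchy_Schwarz sq_int_diff q qL)
      also have "\<dots> \<le> e1 T * (\<Lambda> T + e2 T)"
        by (rule mult_mono[OF d1 n2]) (use order_trans[OF sqn_nonneg d1] in auto)
      finally show "norm (\<integral>p. (L1 p - U1 p) * U2 p \<partial>P T) \<le> \<dots>" .
      have "norm (\<integral>p. L1 p * (L2 p - U2 p) \<partial>P T) \<le> sqn (P T) L1 * sqn (P T) (\<lambda>p. L2 p - U2 p)"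
        by (intro sq_int_Cauchy_Schwarz sq_int_diff q qL)
      also have "\<dots> \<le> \<Lambda> T * e2 T" unfolding nL by (rule mult_left_mono[OF d2]) (simp add: \<Lambda>_def)
      finally show "norm (\<integral>p. L1 p * (L2 p - U2 p) \<partial>P T) \<le> \<dots>" .
    qed
    finally show ?thesis by (simp add: norm_minus_commute)
  qed
  have sq: "((\<lambda>T. \<Lambda> T / sqrt T) \<longlongrightarrow> sqrt ?c) at_top"
  proof (rule Lim_transform_eventually)
    show "((\<lambda>T. sqrt ((\<Lambda> T)\<^sup>2 / T)) \<longlongrightarrow> sqrt ?c) at_top" by (intro tendsto_real_sqrt lim\<Lambda>)
    show "\<forall>\<^sub>F T in at_top. sqrt ((\<Lambda> T)\<^sup>2 / T) = \<Lambda> T / sqrt T"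
      using eventually_gt_at_top[of 0] by eventually_elim (simp add: real_sqrt_divide \<Lambda>_def)
  qed
  have e: "((\<lambda>T. 2 * pi * K * sqrt (leak (T * v)) / sqrt T) \<longlongrightarrow> 0) at_top" if "0 \<le> v" for v
  proof -
    have "((\<lambda>T. 2 * pi * K * sqrt (leak (T * v) / T)) \<longlongrightarrow> 2 * pi * K * sqrt 0) at_top"
      by (intro tendsto_mult_left tendsto_real_sqrt leak_sublinear that)
    then show ?thesis by (simp add: real_sqrt_divide)
  qed
  have "((\<lambda>T. e1 T / sqrt T * (\<Lambda> T / sqrt T + e2 T / sqrt T) + \<Lambda> T / sqrt T * (e2 T / sqrt T)) \<longlongrightarrow> 0 * (sqrt ?c + 0) + sqrt ?c * 0) at_top"
    unfolding e1_def e2_def by (intro tendsto_intros sq e st)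
  then have Z: "((\<lambda>T. e1 T / sqrt T * (\<Lambda> T / sqrt T + e2 T / sqrt T) + \<Lambda> T / sqrt T * (e2 T / sqrt T)) \<longlongrightarrow> 0) at_top" by simp
  have "((\<lambda>T. overlap (dens g) (dens f) (T * s) (T * t) / T - complex_of_real ((\<Lambda> T)\<^sup>2 / T)) \<longlongrightarrow> 0) at_top"
  proof (rule Lim_null_comparison[OF _ Z])
    show "\<forall>\<^sub>F T in at_top. norm (overlap (dens g) (dens f) (T * s) (T * t) / complex_of_real T - complex_of_real ((\<Lambda> T)\<^sup>2 / T))
       \<le> e1 T / sqrt T * (\<Lambda> T / sqrt T + e2 T / sqrt T) + \<Lambda> T / sqrt T * (e2 T / sqrt T)"
      using eventually_gt_at_top[of 0]
    proof eventually_elim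
      case (elim T)
      have "norm (overlap (dens g) (dens f) (T * s) (T * t) / complex_of_real T - complex_of_real ((\<Lambda> T)\<^sup>2 / T))
        = norm (overlap (dens g) (dens f) (T * s) (T * t) - complex_of_real ((\<Lambda> T)\<^sup>2)) / T"
        using elim by (simp add: diff_divide_distrib[symmetric] norm_divide)
      also have "\<dots> \<le> (e1 T * (\<Lambda> T + e2 T) + \<Lambda> T * e2 T) / T"
        using bound[OF elim] elim by (intro divide_right_mono) auto
      also have "\<dots> = (e1 T * (\<Lambda> T + e2 T) + \<Lambda> T * e2 T) / (sqrt T * sqrt T)" using elim by simp
      also have "\<dots> = e1 T / sqrt T * (\<Lambda> T / sqrt T + e2 T / sqrt T) + \<Lambda> T / sqrt T * (e2 T / sqrt T)"
        by (simp only: add_divide_distrib[symmetric] times_divide_times_eq)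
      finally show ?case .
    qed
  qed
  moreover have "((\<lambda>T. complex_of_real ((\<Lambda> T)\<^sup>2 / T)) \<longlongrightarrow> complex_of_real ?c) at_top"
    by (rule tendsto_of_real[OF lim\<Lambda>])
  ultimately show ?thesis using tendsto_add by fastforce
qed

end

section \<open>Hilbert-Schmidt norms\<close>

definition hs :: "real measure \<Rightarrow> (real \<Rightarrow> real \<Rightarrow> complex) \<Rightarrow> real" where
  "hs F K = sqn (F \<Otimes>\<^sub>M F) (\<lambda>p. K (fst p) (snd p))"

definition kmult :: "real measure \<Rightarrow> (real \<Rightarrow> real \<Rightarrow> complex) \<Rightarrow> (real \<Rightarrow> real \<Rightarrow> complex) \<Rightarrow> real \<Rightarrow> real \<Rightarrow> complex" where
  "kmult F K L y z = (\<integral>w. K y w * L w z \<partial>F)"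

lemma hs_nonneg [simp]: "0 \<le> hs F K" by (simp add: hs_def)

lemma fin_borel_pair:
  assumes "fin_borel F" "fin_borel F'"
  shows "finite_measure (F \<Otimes>\<^sub>M F')" "sets (F \<Otimes>\<^sub>M F') = sets (borel \<Otimes>\<^sub>M borel)"
  using assms by (auto simp: fin_borel_def intro!: finite_measure_pair_measure sets_pair_measure_cong)

lemma kernel_sq_int:
  assumes F: "fin_borel F" and K: "kernel K"
  shows "sq_int (F \<Otimes>\<^sub>M F) (\<lambda>p. K (fst p) (snd p))"
proof -
  note [measurable_cong] = fin_borel_pair(2)[OF F F]
  show ?thesis
    by (intro bdd_sq_int fin_borel_pair F kernel_bdd[OF K] kernel_measurable[OF K]) measurable
qed

lemma kernel_norm_sq_bdd: "kernel K \<Longrightarrow> bdd (\<lambda>q. (norm (K (f q) (g q)))\<^sup>2)"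
proof -
  assume K: "kernel K"
  obtain C where "C \<ge> 0" "\<And>x. norm (K (f x) (g x)) \<le> C" by (rule bddE[OF kernel_bdd[OF K]]) (rule that)
  then show ?thesis by (intro bddI[of _ "C\<^sup>2"]) (auto intro: power_mono)
qed

lemma hs_square:
  assumes F: "fin_borel F" and K: "kernel K"
  shows "(hs F K)\<^sup>2 = (\<integral>y. \<integral>z. (norm (K y z))\<^sup>2 \<partial>F \<partial>F)"
proof -
  note [measurable_cong] = fin_borelD(2)[OF F]
  note [measurable (raw)] = kernel_measurable[OF K]
  show ?thesis unfolding hs_def sqn_square
    by (intro integral_pair_bdd kernel_norm_sq_bdd K fin_borelD[OF F]) measurable
qed

lemma kernel_cmult: "kernel K \<Longrightarrow> kernel (\<lambda>y z. c * K y z)"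
  unfolding kernel_def by (auto intro: bdd_mult bdd_const)

lemma kernel_add: "kernel K \<Longrightarrow> kernel L \<Longrightarrow> kernel (\<lambda>y z. K y z + L y z)"
  unfolding kernel_def by (auto intro: bdd_add)

lemma kernel_diff: "kernel K \<Longrightarrow> kernel L \<Longrightarrow> kernel (\<lambda>y z. K y z - L y z)"
  using kernel_add[of K "\<lambda>y z. -1 * L y z"] kernel_cmult[of L "-1"] by simp

lemma kernel_sum: "(\<And>i. i \<in> I \<Longrightarrow> kernel (K i)) \<Longrightarrow> kernel (\<lambda>y z. \<Sum>i\<in>I. K i y z)"
proof (induction I rule: infinite_finite_induct)
  case (insert x F)
  then show ?case by (simp add: kernel_add)
qed (auto simp: kernel_def intro: bdd_const)

lemma kernel_restrict:
  assumes K: "kernel K" and E: "E \<in> sets borel"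
  shows "kernel (\<lambda>y z. indicator E y * indicator E z * K y z)"
  unfolding kernel_def
proof
  note [measurable (raw)] = kernel_measurable[OF K] note [measurable] = E
  show "(\<lambda>q. indicator E (fst q) * indicator E (snd q) * K (fst q) (snd q)) \<in> borel_measurable (borel \<Otimes>\<^sub>M borel)"
    by measurable
  show "bdd (\<lambda>q. indicator E (fst q) * indicator E (snd q) * K (fst q) (snd q))"
    by (intro bdd_mult bdd_indicator kernel_bdd K)
qed

lemma kernel_kmult:
  assumes F: "fin_borel F" and K: "kernel K" and L: "kernel L"
  shows "kernel (kmult F K L)"
  unfolding kernel_def
proof
  interpret F: sigma_finite_measure F by (rule fin_borelD(3)[OF F])
  note [measurable_cong] = fin_borelD(2)[OF F]
  note [measurable (raw)] = kernel_measurable[OF K] kernel_measurable[OF L]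
  show "(\<lambda>q. kmult F K L (fst q) (snd q)) \<in> borel_measurable (borel \<Otimes>\<^sub>M borel)"
    unfolding kmult_def by measurable
  show "bdd (\<lambda>q. kmult F K L (fst q) (snd q))"
    unfolding kmult_def by (intro bdd_integral fin_borelD[OF F] bdd_mult kernel_bdd K L)
qed

lemma hs_sum_le:
  assumes F: "fin_borel F" and "finite I" and K: "\<And>i. i \<in> I \<Longrightarrow> kernel (K i)"
  shows "hs F (\<lambda>y z. \<Sum>i\<in>I. c i * K i y z) \<le> (\<Sum>i\<in>I. norm (c i) * hs F (K i))"
proof -
  have "hs F (\<lambda>y z. \<Sum>i\<in>I. c i * K i y z) \<le> (\<Sum>i\<in>I. sqn (F \<Otimes>\<^sub>M F) (\<lambda>p. c i * K i (fst p) (snd p)))"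
    unfolding hs_def by (intro sqn_sum_le assms(2) sq_int_cmult kernel_sq_int F K)
  then show ?thesis by (simp add: sqn_cmult hs_def)
qed

lemma hs_triangle:
  assumes F: "fin_borel F" and "kernel K" "kernel L"
  shows "hs F (\<lambda>y z. K y z + L y z) \<le> hs F K + hs F L"
  unfolding hs_def by (intro sqn_triangle kernel_sq_int assms)

text \<open>
  Bounds on operator norms enter through this lemma: the hypothesis says that \<open>L\<close>, acting on
  the rows of \<open>K\<close>, has norm at most \<open>C\<close>.
\<close>

lemma hs_kmult_row_bound:
  assumes F: "fin_borel F" and K: "kernel K" and L: "kernel L" and "0 \<le> C"
    and row: "\<And>y. (\<integral>z. (norm (kmult F K L y z))\<^sup>2 \<partial>F) \<le> C\<^sup>2 * (\<integral>w. (norm (K y w))\<^sup>2 \<partial>F)"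
  shows "hs F (kmult F K L) \<le> C * hs F K"
proof (rule power2_le_imp_le)
  interpret F: sigma_finite_measure F by (rule fin_borelD(3)[OF F])
  note [measurable_cong] = fin_borelD(2)[OF F]
  note [measurable (raw)] = kernel_measurable[OF K] kernel_measurable[OF L] kernel_measurable[OF kernel_kmult[OF F K L]]
  have i: "integrable F (\<lambda>y. \<integral>z. (norm (M y z))\<^sup>2 \<partial>F)" if M: "kernel M" for M
  proof -
    note [measurable (raw)] = kernel_measurable[OF M]
    show ?thesis by (intro bdd_integrable bdd_integral kernel_norm_sq_bdd M fin_borelD[OF F]) measurable
  qed
  have "(hs F (kmult F K L))\<^sup>2 \<le> (\<integral>y. C\<^sup>2 * (\<integral>w. (norm (K y w))\<^sup>2 \<partial>F) \<partial>F)"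
    unfolding hs_square[OF F kernel_kmult[OF F K L]]
    using i[OF K] i[OF kernel_kmult[OF F K L]] row by (intro integral_mono) auto
  then show "(hs F (kmult F K L))\<^sup>2 \<le> (C * hs F K)\<^sup>2"
    by (simp add: power_mult_distrib hs_square[OF F K])
qed (use \<open>0 \<le> C\<close> in simp)

lemma hs_kmult_le:
  assumes F: "fin_borel F" and K: "kernel K" and L: "kernel L"
  shows "hs F (kmult F K L) \<le> hs F K * hs F L"
proof -
  interpret F: sigma_finite_measure F by (rule fin_borelD(3)[OF F])
  note [measurable_cong] = fin_borelD(2)[OF F]
  note [measurable (raw)] = kernel_measurable[OF K] kernel_measurable[OF L] kernel_measurable[OF kernel_kmult[OF F K L]]
  have "hs F (kmult F K L) \<le> hs F L * hs F K"
  proof (rule hs_kmult_row_bound[OF F K L])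
    fix y
    have sK: "sq_int F (K y)" by (intro bdd_sq_int kernel_bdd[OF K] fin_borelD[OF F]) measurable
    have sL: "sq_int F (\<lambda>w. L w z)" for z by (intro bdd_sq_int kernel_bdd[OF L] fin_borelD[OF F]) measurable
    have p: "(norm (kmult F K L y z))\<^sup>2 \<le> (\<integral>w. (norm (L w z))\<^sup>2 \<partial>F) * (\<integral>w. (norm (K y w))\<^sup>2 \<partial>F)" for z
    proof -
      have "norm (kmult F K L y z) \<le> sqn F (K y) * sqn F (\<lambda>w. L w z)"
        unfolding kmult_def by (rule sq_int_Cauchy_Schwarz[OF sK sL])
      then have "(norm (kmult F K L y z))\<^sup>2 \<le> (sqn F (K y) * sqn F (\<lambda>w. L w z))\<^sup>2" by (rule power_mono) simp
      then show ?thesis by (simp add: power_mult_distrib sqn_square mult.commute)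
    qed
    have "(\<integral>z. (norm (kmult F K L y z))\<^sup>2 \<partial>F) \<le> (\<integral>z. (\<integral>w. (norm (L w z))\<^sup>2 \<partial>F) * (\<integral>w. (norm (K y w))\<^sup>2 \<partial>F) \<partial>F)"
    proof (rule integral_mono[OF _ _ p])
      show "integrable F (\<lambda>z. (norm (kmult F K L y z))\<^sup>2)"
        by (intro bdd_integrable kernel_norm_sq_bdd kernel_kmult F K L fin_borelD[OF F]) measurable
      show "integrable F (\<lambda>z. (\<integral>w. (norm (L w z))\<^sup>2 \<partial>F) * (\<integral>w. (norm (K y w))\<^sup>2 \<partial>F))"
        by (intro integrable_mult_left bdd_integrable bdd_integral kernel_norm_sq_bdd L fin_borelD[OF F]) measurable
    qed
    also have "\<dots> = (\<integral>z. \<integral>w. (norm (L w z))\<^sup>2 \<partial>F \<partial>F) * (\<integral>w. (norm (K y w))\<^sup>2 \<partial>F)" by simp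
    also have "(\<integral>z. \<integral>w. (norm (L w z))\<^sup>2 \<partial>F \<partial>F) = (\<integral>w. \<integral>z. (norm (L w z))\<^sup>2 \<partial>F \<partial>F)"
      by (intro Fubini_bdd fin_borelD[OF F] kernel_norm_sq_bdd L) measurable
    also have "\<dots> = (hs F L)\<^sup>2" by (rule hs_square[OF F L, symmetric])
    finally show "(\<integral>z. (norm (kmult F K L y z))\<^sup>2 \<partial>F) \<le> (hs F L)\<^sup>2 * (\<integral>w. (norm (K y w))\<^sup>2 \<partial>F)" .
  qed simp
  then show ?thesis by (simp add: mult.commute)
qed

section \<open>Truncation of the symbols\<close>

lemma overlap_diag:
  assumes G: "fin_borel G" and F: "fin_borel F"
  shows "overlap G F l l = complex_of_real ((hs F (Amp G l))\<^sup>2)"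
  unfolding hs_def sqn_square overlap_def by (subst integral_complex_of_real[symmetric]) (simp only: complex_norm_square)

text \<open>
  Both sides are the square root of one integral over four variables, alternately distributed
  by \<open>F\<close> and \<open>G\<close>, of a cyclic product of Dirichlet kernels. This exchanges the roles of the
  spectral density and the generating function.
\<close>

lemma hs_Amp_swap:
  assumes G: "fin_borel G" and F: "fin_borel F"
  shows "hs F (Amp G l) = hs G (Amp F l)"
proof -
  note [measurable_cong] = G[THEN fin_borelD(2)] F[THEN fin_borelD(2)]
  interpret F: sigma_finite_measure F by (rule fin_borelD(3)[OF F])
  interpret G: sigma_finite_measure G by (rule fin_borelD(3)[OF G])
  note fin = F[THEN fin_borelD(1)] G[THEN fin_borelD(1)]
  let ?D = "Dirichlet l"
  note b = fin bdd_mult bdd_integral bdd_cnj Dirichlet_bdd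
  have cD: "?D (a - c) = cnj (?D (c - a))" for a c unfolding Dirichlet_def cnj_ftm by simp
  have sq: "complex_of_real ((hs F (Amp G l))\<^sup>2)
     = (\<integral>y. \<integral>w. \<integral>x. \<integral>z. ?D (x - y) * cnj (?D (x - w)) * (cnj (?D (z - y)) * ?D (z - w)) \<partial>G \<partial>G \<partial>F \<partial>F)"
    if G: "fin_borel G" and F: "fin_borel F" for F G
  proof -
    note [measurable_cong] = G[THEN fin_borelD(2)] F[THEN fin_borelD(2)]
    note [measurable (raw)] = kernel_measurable[OF kernel_Amp[OF G]]
    have "complex_of_real ((hs F (Amp G l))\<^sup>2) = (\<integral>y. \<integral>w. Amp G l y w * cnj (Amp G l y w) \<partial>F \<partial>F)"
      unfolding overlap_diag[OF G F, symmetric] overlap_def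
      by (intro integral_pair_bdd fin_borelD[OF F] bdd_mult bdd_cnj kernel_bdd[OF kernel_Amp[OF G]]) measurable
    also have "\<dots> = (\<integral>y. \<integral>w. (\<integral>x. ?D (x - y) * cnj (?D (x - w)) \<partial>G) * (\<integral>z. cnj (?D (z - y)) * ?D (z - w) \<partial>G) \<partial>F \<partial>F)"
      by (simp add: Amp_spectral[OF G] flip: Bochner_Integration.integral_cnj)
    finally show ?thesis by (simp only: integral_prod_split)
  qed
  let ?h = "\<lambda>y w x z. ?D (x - y) * cnj (?D (x - w)) * (cnj (?D (z - y)) * ?D (z - w))"
  have "complex_of_real ((hs F (Amp G l))\<^sup>2) = (\<integral>y. \<integral>w. \<integral>x. \<integral>z. ?h y w x z \<partial>G \<partial>G \<partial>F \<partial>F)"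
    by (rule sq[OF G F])
  also have "\<dots> = (\<integral>y. \<integral>x. \<integral>w. \<integral>z. ?h y w x z \<partial>G \<partial>F \<partial>G \<partial>F)"
    by (intro Bochner_Integration.integral_cong refl Fubini_bdd b) measurable
  also have "\<dots> = (\<integral>y. \<integral>x. \<integral>z. \<integral>w. ?h y w x z \<partial>F \<partial>G \<partial>G \<partial>F)"
    by (intro Bochner_Integration.integral_cong refl Fubini_bdd b) measurable
  also have "\<dots> = (\<integral>x. \<integral>y. \<integral>z. \<integral>w. ?h y w x z \<partial>F \<partial>G \<partial>F \<partial>G)"
    by (intro Fubini_bdd b) measurable
  also have "\<dots> = (\<integral>x. \<integral>z. \<integral>y. \<integral>w. ?h y w x z \<partial>F \<partial>F \<partial>G \<partial>G)"
    by (intro Bochner_Integration.integral_cong refl Fubini_bdd b) measurable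
  also have "\<dots> = (\<integral>x. \<integral>z. \<integral>w. \<integral>y. ?h y w x z \<partial>F \<partial>F \<partial>G \<partial>G)"
    by (intro Bochner_Integration.integral_cong refl Fubini_bdd b) measurable
  also have "\<dots> = complex_of_real ((hs G (Amp F l))\<^sup>2)"
  proof -
    have "?D (x - y) * cnj (?D (x - w)) * (cnj (?D (z - y)) * ?D (z - w))
      = ?D (w - x) * cnj (?D (w - z)) * (cnj (?D (y - x)) * ?D (y - z))" for x y z w
      by (simp add: cD[of w x] cD[of w z] cD[of y x] cD[of y z] mult_ac)
    then show ?thesis unfolding sq[OF F G] by (intro Bochner_Integration.integral_cong refl)
  qed
  finally have "(hs F (Amp G l))\<^sup>2 = (hs G (Amp F l))\<^sup>2" by (simp only: of_real_eq_iff)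
  then show ?thesis by (simp add: power2_eq_iff_nonneg)
qed

definition trunc :: "real \<Rightarrow> (real \<Rightarrow> real) \<Rightarrow> real \<Rightarrow> real" where
  "trunc K h x = h x * indicator {x. h x \<le> K} x"

lemma restricted_integrable:
  assumes h: "integrable lborel h" and E: "E \<in> sets borel"
  shows "integrable lborel (\<lambda>x. h x * indicator E x :: real)"
  using integrable_mult_indicator[of E lborel h] assms by (simp add: mult.commute)

lemma integral_restricted:
  fixes k :: "real \<Rightarrow> 'b::{banach, second_countable_topology}"
  assumes h: "integrable lborel h" "\<And>x. 0 \<le> h x" and E[measurable]: "E \<in> sets borel"
    and [measurable]: "k \<in> borel_measurable borel"
  shows "(\<integral>x. k x \<partial>dens (\<lambda>x. h x * indicator E x)) = (\<integral>x. indicator E x *\<^sub>R k x \<partial>dens h)"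
proof -
  have [measurable]: "h \<in> borel_measurable borel" using h by auto
  show ?thesis using h(2) by (simp add: integral_dens)
qed

text \<open>
  Truncating the spectral density can be undone at the price of cutting the kernel, which lets
  kernels for different densities be compared in one space.
\<close>

lemma hs_restricted:
  assumes h: "integrable lborel h" "\<And>x. 0 \<le> h x" and E[measurable]: "E \<in> sets borel" and K: "kernel K"
  shows "hs (dens (\<lambda>x. h x * indicator E x)) K = hs (dens h) (\<lambda>y z. indicator E y * indicator E z * K y z)"
proof -
  have F: "fin_borel (dens h)" "fin_borel (dens (\<lambda>x. h x * indicator E x))"
    using h restricted_integrable[OF h(1) E] by (auto intro: fin_borel_dens)
  interpret F: sigma_finite_measure "dens h" by (rule fin_borelD(3)[OF F(1)])
  interpret FE: sigma_finite_measure "dens (\<lambda>x. h x * indicator E x)" by (rule fin_borelD(3)[OF F(2)])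
  note [measurable (raw)] = kernel_measurable[OF K]
  have "(hs (dens (\<lambda>x. h x * indicator E x)) K)\<^sup>2 = (\<integral>y. indicator E y * (\<integral>z. indicator E z * (norm (K y z))\<^sup>2 \<partial>dens h) \<partial>dens h)"
    unfolding hs_square[OF F(2) K] by (simp add: integral_restricted[OF h E])
  also have "\<dots> = (\<integral>y. \<integral>z. (norm (indicator E y * indicator E z * K y z))\<^sup>2 \<partial>dens h \<partial>dens h)"
    by (simp add: norm_mult power_mult_distrib indicator_def if_distrib flip: integral_mult_right_zero cong: if_cong)
      (intro Bochner_Integration.integral_cong refl; simp)
  finally have "(hs (dens (\<lambda>x. h x * indicator E x)) K)\<^sup>2 = (hs (dens h) (\<lambda>y z. indicator E y * indicator E z * K y z))\<^sup>2"
    by (simp only: hs_square[OF F(1) kernel_restrict[OF K E]])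
  then show ?thesis by (simp add: power2_eq_iff_nonneg)
qed

text \<open>
  Meant for kernels with disjoint supports that are both cut out of a third one.
\<close>

lemma hs_Pythagoras:
  assumes F: "fin_borel F" and K: "kernel A" "kernel B" "kernel C"
    and le: "\<And>y z. (norm (A y z))\<^sup>2 + (norm (B y z))\<^sup>2 \<le> (norm (C y z))\<^sup>2"
  shows "(hs F A)\<^sup>2 + (hs F B)\<^sup>2 \<le> (hs F C)\<^sup>2"
proof -
  note i = kernel_sq_int[OF F K(1)] kernel_sq_int[OF F K(2)] kernel_sq_int[OF F K(3)]
  have "(hs F A)\<^sup>2 + (hs F B)\<^sup>2 = (\<integral>p. (norm (A (fst p) (snd p)))\<^sup>2 + (norm (B (fst p) (snd p)))\<^sup>2 \<partial>(F \<Otimes>\<^sub>M F))"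
    using i unfolding hs_def sqn_square by (simp add: sq_int_def)
  also have "\<dots> \<le> (\<integral>p. (norm (C (fst p) (snd p)))\<^sup>2 \<partial>(F \<Otimes>\<^sub>M F))"
    using i le by (intro integral_mono) (auto simp: sq_int_def)
  finally show ?thesis unfolding hs_def sqn_square .
qed

lemma nn_integral_dens:
  assumes [measurable]: "h \<in> borel_measurable borel" "k \<in> borel_measurable borel"
  shows "(\<integral>\<^sup>+x. k x \<partial>dens h) = (\<integral>\<^sup>+x. ennreal (h x) * k x \<partial>lborel)"
  by (simp add: dens_def nn_integral_density)

lemma integral_dens_add:
  fixes k :: "real \<Rightarrow> complex"
  assumes h: "integrable lborel h1" "\<And>x. 0 \<le> h1 x" "integrable lborel h2" "\<And>x. 0 \<le> h2 x"
    and k: "k \<in> borel_measurable borel" "bdd k"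
  shows "(\<integral>x. k x \<partial>dens (\<lambda>x. h1 x + h2 x)) = (\<integral>x. k x \<partial>dens h1) + (\<integral>x. k x \<partial>dens h2)"
proof -
  note [measurable] = k(1) have [measurable]: "h1 \<in> borel_measurable borel" "h2 \<in> borel_measurable borel" using h by auto
  obtain C where C: "C \<ge> 0" "\<And>x. norm (k x) \<le> C" by (rule bddE[OF k(2)]) (rule that)
  have i: "integrable lborel (\<lambda>x. h x *\<^sub>R k x)" if "integrable lborel h" for h :: "real \<Rightarrow> real"
  proof (rule Bochner_Integration.integrable_bound[of _ "\<lambda>x. C * norm (h x)"])
    show "AE x in lborel. norm (h x *\<^sub>R k x) \<le> norm (C * norm (h x))"
      using C by (intro AE_I2) (simp add: mult.commute[of C] mult_left_mono)
  qed (use that in auto)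
  show ?thesis using h i[OF h(1)] i[OF h(3)] by (simp add: integral_dens scaleR_add_left)
qed

lemma trunc_bounded_density:
  assumes "integrable lborel h" "\<And>x. 0 \<le> h x" "0 \<le> K"
  shows "bounded_density K (trunc K h)"
proof -
  have [measurable]: "h \<in> borel_measurable borel" using assms by auto
  show ?thesis
    unfolding bounded_density_def trunc_def
    using assms restricted_integrable[OF assms(1), of "{x. h x \<le> K}"] by (auto simp: indicator_def)
qed

text \<open>
  Convolution with the Dirichlet kernel: on the transforms it is restriction to the window,
  times \<open>2 pi\<close>. Hence its norm does not depend on the length of the window.
\<close>

definition Lop :: "real \<Rightarrow> (real \<Rightarrow> complex) \<Rightarrow> real \<Rightarrow> complex" where
  "Lop l q x = (\<integral>w. q w * Dirichlet l (x - w) \<partial>lborel)"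

lemma Lop_bound:
  assumes q: "integrable lborel q"
  shows "(\<integral>\<^sup>+x. ennreal ((norm (Lop l q x))\<^sup>2) \<partial>lborel) \<le> ennreal ((2 * pi)\<^sup>2) * (\<integral>\<^sup>+x. ennreal ((norm (q x))\<^sup>2) \<partial>lborel)"
proof -
  let ?h = "\<lambda>x. complex_of_real (indicator {0..l} (- x))"
  have h: "integrable lborel ?h"
  proof -
    have "integrable lborel (\<lambda>x. indicator {0..l} x :: real)"
      by (cases "0 \<le> l") (auto simp: integrable_indicator_iff)
    from lborel_integrable_real_affine[OF this, of "-1" 0] show ?thesis by simp
  qed
  have D: "Dirichlet l (b - a) = ft ?h (a - b)" for a b
  proof -
    have "ft ?h (a - b) = ft (\<lambda>x. complex_of_real (indicator {0..l} x)) (b - a)"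
      using ft_reflect[of "\<lambda>x. complex_of_real (indicator {0..l} x)" "a - b"] by simp
    also have "\<dots> = (\<integral>x. indicator {0..l} x *\<^sub>R cis (x * (b - a)) \<partial>lborel)"
      unfolding ft_def by (intro Bochner_Integration.integral_cong) (auto simp: scaleR_conv_of_real)
    also have "\<dots> = Dirichlet l (b - a)"
      unfolding Dirichlet_def ftm_def by (subst integral_window) auto
    finally show ?thesis by simp
  qed
  have "(\<integral>\<^sup>+b. ennreal ((norm (\<integral>a. q a * ft ?h (a - b) \<partial>lborel))\<^sup>2) \<partial>lborel)
    \<le> ennreal ((2 * pi * 1)\<^sup>2) * (\<integral>\<^sup>+a. ennreal ((norm (q a))\<^sup>2) \<partial>lborel)"
    by (rule multiplier_bound_L1[OF h _ q]) (auto simp: indicator_def)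
  then show ?thesis by (simp add: Lop_def D)
qed

context
  fixes f g :: "real \<Rightarrow> real"
  assumes f: "integrable lborel f" "\<And>x. 0 \<le> f x" and g: "integrable lborel g" "\<And>x. 0 \<le> g x"
begin

lemma symbols_measurable: "f \<in> borel_measurable borel" "g \<in> borel_measurable borel"
  using f g by auto

private abbreviation "F \<equiv> dens f"
private abbreviation "G \<equiv> dens g"

lemma finFG: "fin_borel F" "fin_borel G" "fin_borel (dens (trunc K f))" "fin_borel (dens (trunc K g))"
proof -
  note [measurable] = symbols_measurable
  show "fin_borel F" "fin_borel G" using f g by (auto intro: fin_borel_dens)
  have "{x. f x \<le> K} \<in> sets borel" "{x. g x \<le> K} \<in> sets borel" by measurable
  then show "fin_borel (dens (trunc K f))" "fin_borel (dens (trunc K g))"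
    unfolding trunc_def[abs_def] using f g by (auto intro!: fin_borel_dens restricted_integrable)
qed

text \<open>
  The Toeplitz operator for the truncated symbols, as an operator over the full spectral
  measure.
\<close>

definition Psi :: "real \<Rightarrow> real \<Rightarrow> real \<Rightarrow> real \<Rightarrow> complex" where
  "Psi K l y w = indicator {x. f x \<le> K} y * indicator {x. f x \<le> K} w * Amp (dens (trunc K g)) l y w"

definition defect :: "real \<Rightarrow> real \<Rightarrow> real" where
  "defect K l = (hs F (Amp G l))\<^sup>2 - (hs (dens (trunc K f)) (Amp (dens (trunc K g)) l))\<^sup>2"

lemma level_sets: "{x. f x \<le> K} \<in> sets borel" "{x. g x \<le> K} \<in> sets borel" "- {x. g x \<le> K} \<in> sets borel"
proof -
  note [measurable] = symbols_measurable
  show "{x. f x \<le> K} \<in> sets borel" "{x. g x \<le> K} \<in> sets borel" by measurable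
  then show "- {x. g x \<le> K} \<in> sets borel" by (intro borel_comp)
qed

lemma kernel_Psi: "kernel (Psi K l)"
  unfolding Psi_def[abs_def] by (intro kernel_restrict kernel_Amp finFG level_sets)

lemma hs_Psi: "hs F (Psi K l) = hs (dens (trunc K f)) (Amp (dens (trunc K g)) l)"
  unfolding Psi_def[abs_def] trunc_def[of K f, abs_def]
  by (rule hs_restricted[OF f level_sets(1) kernel_Amp[OF finFG(4)], symmetric])

lemma overlap_Psi: "overlap (dens (trunc K g)) (dens (trunc K f)) l l'
    = (\<integral>p. Psi K l (fst p) (snd p) * cnj (Psi K l' (fst p) (snd p)) \<partial>(F \<Otimes>\<^sub>M F))"
proof -
  note [measurable] = symbols_measurable
  let ?E = "{x. f x \<le> K}" let ?A = "Amp (dens (trunc K g))"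
  note [measurable] = level_sets(1)
  note [measurable (raw)] = kernel_measurable[OF kernel_Amp[OF finFG(4)]]
  interpret F: sigma_finite_measure F by (rule fin_borelD(3)[OF finFG(1)])
  have "overlap (dens (trunc K g)) (dens (trunc K f)) l l' = (\<integral>y. \<integral>w. ?A l y w * cnj (?A l' y w) \<partial>dens (trunc K f) \<partial>dens (trunc K f))"
    unfolding overlap_def
    by (intro integral_pair_bdd fin_borelD finFG bdd_mult bdd_cnj kernel_bdd[OF kernel_Amp[OF finFG(4)]]) measurable
  also have "\<dots> = (\<integral>y. indicator ?E y *\<^sub>R (\<integral>w. indicator ?E w *\<^sub>R (?A l y w * cnj (?A l' y w)) \<partial>F) \<partial>F)"
    unfolding trunc_def[of K f, abs_def] by (simp add: integral_restricted[OF f level_sets(1)])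
  also have "\<dots> = (\<integral>y. \<integral>w. indicator ?E y *\<^sub>R (indicator ?E w *\<^sub>R (?A l y w * cnj (?A l' y w))) \<partial>F \<partial>F)"
    by (simp only: integral_scaleR_right)
  also have "\<dots> = (\<integral>y. \<integral>w. Psi K l y w * cnj (Psi K l' y w) \<partial>F \<partial>F)"
    by (intro Bochner_Integration.integral_cong refl) (auto simp: Psi_def indicator_def)
  also have "\<dots> = (\<integral>p. Psi K l (fst p) (snd p) * cnj (Psi K l' (fst p) (snd p)) \<partial>(F \<Otimes>\<^sub>M F))"
  proof -
    note [measurable (raw)] = kernel_measurable[OF kernel_Psi]
    show ?thesis by (intro integral_pair_bdd[symmetric] fin_borelD finFG bdd_mult bdd_cnj kernel_bdd[OF kernel_Psi]) measurable
  qed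
  finally show ?thesis .
qed

lemma Amp_split: "Amp G l y w = Amp (dens (trunc K g)) l y w + Amp (dens (\<lambda>x. g x * indicator (- {x. g x \<le> K}) x)) l y w"
proof -
  note [measurable] = symbols_measurable
  let ?R = "\<lambda>x. g x * indicator (- {x. g x \<le> K}) x"
  have R: "integrable lborel ?R" by (rule restricted_integrable[OF g(1) level_sets(3)])
  have T: "integrable lborel (trunc K g)"
    unfolding trunc_def[abs_def] by (rule restricted_integrable[OF g(1) level_sets(2)])
  have "G = dens (\<lambda>x. trunc K g x + ?R x)"
    by (rule arg_cong[where f = dens]) (auto simp: trunc_def indicator_def)
  then have "Amp G l y w = (\<integral>x. Dirichlet l (x - y) * cnj (Dirichlet l (x - w)) \<partial>dens (\<lambda>x. trunc K g x + ?R x))"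
    using Amp_spectral[OF finFG(2)] by simp
  also have "\<dots> = (\<integral>x. Dirichlet l (x - y) * cnj (Dirichlet l (x - w)) \<partial>dens (trunc K g))
      + (\<integral>x. Dirichlet l (x - y) * cnj (Dirichlet l (x - w)) \<partial>dens ?R)"
    using g(2) by (intro integral_dens_add T R bdd_mult bdd_cnj Dirichlet_bdd) (auto simp: trunc_def)
  finally show ?thesis by (simp only: Amp_spectral[OF finFG(4)] Amp_spectral[OF fin_borel_dens[OF R]])
qed

text \<open>
  Truncation lowers both symbols. Lowering \<open>f\<close> removes a part \<open>X\<close> of the kernel that is
  disjoint from the rest; lowering \<open>g\<close> afterwards removes a part \<open>Y\<close>, for which the same holds
  once the roles of the symbols are exchanged. So the squares of the norms of \<open>X\<close> and \<open>Y\<close> are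
  both bounded by the total loss.
\<close>

theorem truncation_distance:
  shows "0 \<le> defect K l" "hs F (\<lambda>y z. Amp G l y z - Psi K l y z) \<le> 2 * sqrt (defect K l)"
    "hs F (Psi K l) \<le> hs F (Amp G l)"
proof -
  note [measurable] = symbols_measurable
  let ?E = "{x. f x \<le> K}" and ?E' = "{x. g x \<le> K}"
  let ?R = "dens (\<lambda>x. g x * indicator (- ?E') x)"
  let ?FK = "dens (trunc K f)" and ?GK = "dens (trunc K g)"
  have R: "fin_borel ?R" by (intro fin_borel_dens restricted_integrable[OF g(1) level_sets(3)])
  define X where "X y z = Amp G l y z - indicator ?E y * indicator ?E z * Amp G l y z" for y z
  define Y where "Y y z = indicator ?E y * indicator ?E z * Amp ?R l y z" for y z
  have kX: "kernel X" unfolding X_def[abs_def] by (intro kernel_diff kernel_restrict level_sets kernel_Amp finFG)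
  have kY: "kernel Y" unfolding Y_def[abs_def] by (intro kernel_restrict level_sets kernel_Amp R)
  \<comment> \<open>The loss from truncating the spectral density, then the one from truncating the generating function.\<close>
  have "(hs F X)\<^sup>2 + (hs F (\<lambda>y z. indicator ?E y * indicator ?E z * Amp G l y z))\<^sup>2 \<le> (hs F (Amp G l))\<^sup>2"
    by (intro hs_Pythagoras finFG kX kernel_restrict level_sets kernel_Amp) (auto simp: X_def indicator_def)
  moreover have "hs F (\<lambda>y z. indicator ?E y * indicator ?E z * Amp G l y z) = hs ?FK (Amp G l)"
    unfolding trunc_def[of K f, abs_def] by (rule hs_restricted[OF f level_sets(1) kernel_Amp[OF finFG(2)], symmetric])
  ultimately have a: "(hs F X)\<^sup>2 + (hs ?FK (Amp G l))\<^sup>2 \<le> (hs F (Amp G l))\<^sup>2" by simp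
  have "hs F Y = hs ?FK (Amp ?R l)"
    unfolding Y_def[abs_def] trunc_def[of K f, abs_def] by (rule hs_restricted[OF f level_sets(1) kernel_Amp[OF R], symmetric])
  also have "\<dots> = hs ?R (Amp ?FK l)" by (rule hs_Amp_swap[OF R finFG(3)])
  also have "\<dots> = hs G (\<lambda>x z. indicator (- ?E') x * indicator (- ?E') z * Amp ?FK l x z)"
    by (rule hs_restricted[OF g level_sets(3) kernel_Amp[OF finFG(3)]])
  finally have Y: "hs F Y = hs G (\<lambda>x z. indicator (- ?E') x * indicator (- ?E') z * Amp ?FK l x z)" .
  have "hs ?GK (Amp ?FK l) = hs G (\<lambda>x z. indicator ?E' x * indicator ?E' z * Amp ?FK l x z)"
    unfolding trunc_def[of K g, abs_def] by (rule hs_restricted[OF g level_sets(2) kernel_Amp[OF finFG(3)]])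
  moreover have "(hs G (\<lambda>x z. indicator (- ?E') x * indicator (- ?E') z * Amp ?FK l x z))\<^sup>2
     + (hs G (\<lambda>x z. indicator ?E' x * indicator ?E' z * Amp ?FK l x z))\<^sup>2 \<le> (hs G (Amp ?FK l))\<^sup>2"
    by (intro hs_Pythagoras finFG kernel_restrict level_sets kernel_Amp) (auto simp: indicator_def)
  ultimately have b: "(hs F Y)\<^sup>2 + (hs ?FK (Amp ?GK l))\<^sup>2 \<le> (hs ?FK (Amp G l))\<^sup>2"
    unfolding Y hs_Amp_swap[OF finFG(4,3)] hs_Amp_swap[OF finFG(2,3)] by simp
  from a b have d: "(hs F X)\<^sup>2 \<le> defect K l" "(hs F Y)\<^sup>2 \<le> defect K l"
    unfolding defect_def using zero_le_power2[of "hs F X"] zero_le_power2[of "hs F Y"] by linarith+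
  show "0 \<le> defect K l" using d(1) zero_le_power2[of "hs F X"] by linarith
  have "hs F X \<le> sqrt (defect K l)" "hs F Y \<le> sqrt (defect K l)" using d by (auto intro: real_le_rsqrt)
  moreover have "hs F (\<lambda>y z. Amp G l y z - Psi K l y z) \<le> hs F X + hs F Y"
  proof -
    have "(\<lambda>y z. Amp G l y z - Psi K l y z) = (\<lambda>y z. X y z + Y y z)"
      by (auto simp: X_def Y_def Psi_def fun_eq_iff Amp_split[of l _ _ K] distrib_left)
    then show ?thesis using hs_triangle[OF finFG(1) kX kY] by simp
  qed
  ultimately show "hs F (\<lambda>y z. Amp G l y z - Psi K l y z) \<le> 2 * sqrt (defect K l)" by linarith
  have "(hs F (Psi K l))\<^sup>2 \<le> (hs F (Amp G l))\<^sup>2"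
    unfolding hs_Psi using a b zero_le_power2[of "hs F X"] zero_le_power2[of "hs F Y"] by linarith
  then show "hs F (Psi K l) \<le> hs F (Amp G l)" by (rule power2_le_imp_le) simp
qed

text \<open>
  A row of the product is obtained from a row of \<open>\<Phi>\<close> by alternating multiplications and
  convolutions: multiply by the truncated \<open>f\<close>, convolve with the Dirichlet kernel, multiply by
  the truncated \<open>g\<close>, convolve again. The convolutions contribute \<open>(2 pi)\<^sup>2\<close> and \<open>g\<close>
  contributes \<open>K\<close>. So does \<open>f\<close>, a factor \<open>\<surd>K\<close> at each end, where the norms of \<open>L\<^sup>2(f(x) dx)\<close>
  and of \<open>L\<^sup>2(dx)\<close> are compared.
\<close>

theorem hs_kmult_Psi:
  assumes Phi: "kernel \<Phi>" and K: "0 \<le> K"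
  shows "hs F (kmult F \<Phi> (Psi K l)) \<le> (2 * pi)\<^sup>2 * K\<^sup>2 * hs F \<Phi>"
proof (rule hs_kmult_row_bound[OF finFG(1) Phi kernel_Psi])
  note [measurable] = symbols_measurable
  show "0 \<le> (2 * pi)\<^sup>2 * K\<^sup>2" by simp
  fix y
  interpret F: sigma_finite_measure F by (rule fin_borelD(3)[OF finFG(1)])
  let ?E = "{x. f x \<le> K}"
  let ?tg = "trunc K g"
  note TG = bounded_densityD[OF trunc_bounded_density[OF g K]]
  note [measurable] = level_sets(1) TG(4)
  note [measurable (raw)] = kernel_measurable[OF Phi] kernel_measurable[OF kernel_Psi]
  have sP: "sq_int F (\<Phi> y)" by (intro bdd_sq_int fin_borelD[OF finFG(1)] kernel_bdd[OF Phi]) measurable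
  obtain B where B: "B \<ge> 0" "\<And>w. norm (\<Phi> y w) \<le> B" by (rule bddE[OF kernel_bdd[OF Phi, of "\<lambda>_. y" "\<lambda>w. w"]]) (rule that)
  obtain DC where DC: "DC \<ge> 0" "\<And>x. norm (Dirichlet l x) \<le> DC" by (rule bddE[OF Dirichlet_bdd[of l "\<lambda>x. x"]]) (rule that)
  define q where "q w = (f w * indicator ?E w) *\<^sub>R \<Phi> y w" for w
  have [measurable]: "q \<in> borel_measurable borel" unfolding q_def by measurable
  have q: "integrable lborel q"
  proof (rule Bochner_Integration.integrable_bound[of _ "\<lambda>w. B * f w"])
    show "integrable lborel (\<lambda>w. B * f w)" using f by simp
    show "AE w in lborel. norm (q w) \<le> norm (B * f w)"
      using B f(2) by (intro AE_I2) (auto simp: q_def indicator_def mult.commute[of B] intro!: mult_left_mono)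
  qed measurable
  define \<xi> where "\<xi> = Lop l q"
  have \<xi>b: "norm (\<xi> x) \<le> DC * (\<integral>w. norm (q w) \<partial>lborel)" for x
  proof -
    have "norm (\<xi> x) \<le> (\<integral>w. norm (q w * Dirichlet l (x - w)) \<partial>lborel)"
      unfolding \<xi>_def Lop_def by (rule integral_norm_bound)
    also have "\<dots> \<le> (\<integral>w. DC * norm (q w) \<partial>lborel)"
      using q DC by (intro integral_mono') (auto simp: norm_mult mult.commute[of DC] intro!: mult_left_mono)
    finally show ?thesis by simp
  qed
  have [measurable]: "\<xi> \<in> borel_measurable borel" unfolding \<xi>_def Lop_def[abs_def] by measurable
  define \<eta> where "\<eta> x = ?tg x *\<^sub>R \<xi> x" for x
  have \<eta>: "integrable lborel \<eta>"
  proof (rule Bochner_Integration.integrable_bound[of _ "\<lambda>x. ?tg x * (DC * (\<integral>w. norm (q w) \<partial>lborel))"])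
    show "AE x in lborel. norm (\<eta> x) \<le> norm (?tg x * (DC * (\<integral>w. norm (q w) \<partial>lborel)))"
      using \<xi>b TG(2) DC by (intro AE_I2) (auto simp: \<eta>_def abs_mult intro!: mult_left_mono)
  qed (use TG in \<open>auto simp: \<eta>_def[abs_def]\<close>)
  have [measurable]: "\<eta> \<in> borel_measurable borel" unfolding \<eta>_def by measurable
  have row: "kmult F \<Phi> (Psi K l) y z = indicator ?E z * Lop l \<eta> z" for z
  proof -
    have A: "Amp (dens ?tg) l w z = (\<integral>x. ?tg x *\<^sub>R (Dirichlet l (x - w) * Dirichlet l (z - x)) \<partial>lborel)" for w
    proof -
      have "cnj (Dirichlet l (x - z)) = Dirichlet l (z - x)" for x unfolding Dirichlet_def cnj_ftm by simp
      then show ?thesis unfolding Amp_spectral[OF finFG(4)] using TG(2) by (subst integral_dens) auto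
    qed
    have "kmult F \<Phi> (Psi K l) y z = (\<integral>w. f w *\<^sub>R (\<Phi> y w * Psi K l w z) \<partial>lborel)"
      unfolding kmult_def using f(2) by (subst integral_dens) auto
    also have "\<dots> = (\<integral>w. indicator ?E z * (q w * Amp (dens ?tg) l w z) \<partial>lborel)"
      by (intro Bochner_Integration.integral_cong) (auto simp: q_def Psi_def indicator_def)
    also have "\<dots> = indicator ?E z * (\<integral>w. q w * Amp (dens ?tg) l w z \<partial>lborel)" by simp
    also have "(\<integral>w. q w * Amp (dens ?tg) l w z \<partial>lborel) = (\<integral>w. \<integral>x. q w * (?tg x *\<^sub>R (Dirichlet l (x - w) * Dirichlet l (z - x))) \<partial>lborel \<partial>lborel)"
      by (simp add: A flip: integral_mult_right_zero)
    also have "\<dots> = (\<integral>x. \<integral>w. q w * (?tg x *\<^sub>R (Dirichlet l (x - w) * Dirichlet l (z - x))) \<partial>lborel \<partial>lborel)"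
    proof (rule Fubini_swap_dominated[where p = "\<lambda>w. norm (q w)" and q = "\<lambda>x. ?tg x * (DC * DC)"])
      fix w x
      have 1: "norm (Dirichlet l (x - w)) * norm (Dirichlet l (z - x)) \<le> DC * DC" using DC by (intro mult_mono) auto
      have "norm (q w * (?tg x *\<^sub>R (Dirichlet l (x - w) * Dirichlet l (z - x))))
          = norm (q w) * (?tg x * (norm (Dirichlet l (x - w)) * norm (Dirichlet l (z - x))))"
        using TG(2)[of x] by (simp add: norm_mult)
      also have "\<dots> \<le> norm (q w) * (?tg x * (DC * DC))" by (intro mult_left_mono 1 TG(2) norm_ge_zero)
      finally show "norm (q w * (?tg x *\<^sub>R (Dirichlet l (x - w) * Dirichlet l (z - x)))) \<le> norm (q w) * (?tg x * (DC * DC))" .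
    qed (use q TG in \<open>auto simp: lborel.sigma_finite_measure_axioms\<close>)
    also have "\<dots> = (\<integral>x. (?tg x *\<^sub>R \<xi> x) * Dirichlet l (z - x) \<partial>lborel)"
    proof (intro Bochner_Integration.integral_cong refl)
      fix x
      have "(\<integral>w. q w * (?tg x *\<^sub>R (Dirichlet l (x - w) * Dirichlet l (z - x))) \<partial>lborel)
        = (\<integral>w. (q w * Dirichlet l (x - w)) * (?tg x *\<^sub>R Dirichlet l (z - x)) \<partial>lborel)"
        by (intro Bochner_Integration.integral_cong) (auto simp: mult_ac)
      also have "\<dots> = \<xi> x * (?tg x *\<^sub>R Dirichlet l (z - x))"
        unfolding \<xi>_def Lop_def by (rule integral_mult_left_zero)
      finally show "(\<integral>w. q w * (?tg x *\<^sub>R (Dirichlet l (x - w) * Dirichlet l (z - x))) \<partial>lborel) = (?tg x *\<^sub>R \<xi> x) * Dirichlet l (z - x)"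
        by simp
    qed
    finally show ?thesis by (simp add: Lop_def \<eta>_def)
  qed
  let ?n = "\<lambda>h. \<integral>\<^sup>+x. ennreal ((norm (h x :: complex))\<^sup>2) \<partial>lborel"
  have [measurable]: "Lop l \<eta> \<in> borel_measurable borel" unfolding Lop_def[abs_def] by measurable
  have "(\<integral>\<^sup>+z. ennreal ((norm (kmult F \<Phi> (Psi K l) y z))\<^sup>2) \<partial>F) = (\<integral>\<^sup>+z. ennreal (f z) * ennreal ((norm (indicator ?E z * Lop l \<eta> z))\<^sup>2) \<partial>lborel)"
    unfolding row by (rule nn_integral_dens) measurable
  also have "\<dots> \<le> (\<integral>\<^sup>+z. ennreal K * ennreal ((norm (Lop l \<eta> z))\<^sup>2) \<partial>lborel)"
    by (intro nn_integral_mono) (auto simp: indicator_def intro!: mult_right_mono ennreal_leI)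
  also have "\<dots> = ennreal K * ?n (Lop l \<eta>)" by (rule nn_integral_cmult) measurable
  also have "\<dots> \<le> ennreal K * (ennreal ((2 * pi)\<^sup>2) * ?n \<eta>)"
    by (intro mult_left_mono Lop_bound \<eta>) simp
  also have "?n \<eta> \<le> (\<integral>\<^sup>+x. ennreal (K\<^sup>2) * ennreal ((norm (\<xi> x))\<^sup>2) \<partial>lborel)"
    using TG(2,3) by (intro nn_integral_mono)
      (auto simp: \<eta>_def power_mult_distrib simp flip: ennreal_mult intro!: ennreal_leI mult_right_mono power_mono)
  also have "\<dots> = ennreal (K\<^sup>2) * ?n \<xi>" by (rule nn_integral_cmult) measurable
  also have "\<dots> \<le> ennreal (K\<^sup>2) * (ennreal ((2 * pi)\<^sup>2) * ?n q)"
    unfolding \<xi>_def by (intro mult_left_mono Lop_bound q) simp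
  also have "?n q \<le> (\<integral>\<^sup>+w. ennreal K * (ennreal (f w) * ennreal ((norm (\<Phi> y w))\<^sup>2)) \<partial>lborel)"
  proof (intro nn_integral_mono)
    fix w
    have "(norm (q w))\<^sup>2 \<le> K * (f w * (norm (\<Phi> y w))\<^sup>2)"
      using f(2)[of w] K by (auto simp: q_def indicator_def power_mult_distrib power2_eq_square[of "f w"] mult.assoc intro!: mult_right_mono)
    then show "ennreal ((norm (q w))\<^sup>2) \<le> ennreal K * (ennreal (f w) * ennreal ((norm (\<Phi> y w))\<^sup>2))"
      using f(2)[of w] K by (simp flip: ennreal_mult)
  qed
  also have "\<dots> = ennreal K * (\<integral>\<^sup>+w. ennreal (f w) * ennreal ((norm (\<Phi> y w))\<^sup>2) \<partial>lborel)" by (rule nn_integral_cmult) measurable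
  also have "(\<integral>\<^sup>+w. ennreal (f w) * ennreal ((norm (\<Phi> y w))\<^sup>2) \<partial>lborel) = (\<integral>\<^sup>+w. ennreal ((norm (\<Phi> y w))\<^sup>2) \<partial>F)"
    by (rule nn_integral_dens[symmetric]) measurable
  also have "\<dots> = ennreal ((sqn F (\<Phi> y))\<^sup>2)" by (rule sq_int_nn[OF sP])
  also have "ennreal K * (ennreal ((2 * pi)\<^sup>2) * (ennreal (K\<^sup>2) * (ennreal ((2 * pi)\<^sup>2) * (ennreal K * ennreal ((sqn F (\<Phi> y))\<^sup>2)))))
      = ennreal (((2 * pi)\<^sup>2 * K\<^sup>2 * sqn F (\<Phi> y))\<^sup>2)"
  proof -
    have "((2 * pi)\<^sup>2 * K\<^sup>2 * sqn F (\<Phi> y))\<^sup>2 = K * ((2 * pi)\<^sup>2 * (K\<^sup>2 * ((2 * pi)\<^sup>2 * (K * (sqn F (\<Phi> y))\<^sup>2))))"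
      by (simp add: power2_eq_square mult_ac)
    then show ?thesis using K by (simp only: ennreal_mult zero_le_power2 mult_nonneg_nonneg)
  qed
  finally have le: "(\<integral>\<^sup>+z. ennreal ((norm (kmult F \<Phi> (Psi K l) y z))\<^sup>2) \<partial>F) \<le> ennreal (((2 * pi)\<^sup>2 * K\<^sup>2 * sqn F (\<Phi> y))\<^sup>2)"
    by (auto simp: mult_left_mono)
  note [measurable (raw)] = kernel_measurable[OF kernel_kmult[OF finFG(1) Phi kernel_Psi]]
  have "sqn F (kmult F \<Phi> (Psi K l) y) \<le> (2 * pi)\<^sup>2 * K\<^sup>2 * sqn F (\<Phi> y)"
    by (rule sq_intI_nn(2)[OF _ le]) auto
  then have "(sqn F (kmult F \<Phi> (Psi K l) y))\<^sup>2 \<le> ((2 * pi)\<^sup>2 * K\<^sup>2 * sqn F (\<Phi> y))\<^sup>2" by (rule power_mono) simp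
  then show "(\<integral>z. (norm (kmult F \<Phi> (Psi K l) y z))\<^sup>2 \<partial>F) \<le> ((2 * pi)\<^sup>2 * K\<^sup>2)\<^sup>2 * (\<integral>w. (norm (\<Phi> y w))\<^sup>2 \<partial>F)"
    unfolding power_mult_distrib[of "(2 * pi)\<^sup>2 * K\<^sup>2"] sqn_square .
qed

end

section \<open>Trace asymptotics for general symbols\<close>

text \<open>
  The index \<open>n\<close> is a level of approximation: for fixed \<open>n\<close> the error has a limit in \<open>T\<close>, and
  this limit is small for large \<open>n\<close>.
\<close>

lemma tendsto_by_approximation:
  fixes h :: "real \<Rightarrow> 'b::real_normed_vector" and E :: "nat \<Rightarrow> real \<Rightarrow> real"
  assumes "\<And>n. \<forall>\<^sub>F T in at_top. norm (h T - x) \<le> E n T"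
    and E: "\<And>n. (E n \<longlongrightarrow> e n) at_top" and e: "e \<longlonglongrightarrow> 0"
  shows "(h \<longlongrightarrow> x) at_top"
proof (rule tendstoI)
  fix r :: real assume r: "0 < r"
  obtain n where n: "e n < r"
    using order_tendstoD(2)[OF e r] by (auto simp: eventually_sequentially)
  show "\<forall>\<^sub>F T in at_top. dist (h T) x < r"
    using assms(1)[of n] order_tendstoD(2)[OF E n] by eventually_elim (simp add: dist_norm)
qed

text \<open>
  The operator of a weighted sum of normalised functionals at the times \<open>t\<close>.
\<close>

definition Phi :: "(real \<Rightarrow> real) \<Rightarrow> ('k::finite \<Rightarrow> real) \<Rightarrow> ('k \<Rightarrow> real) \<Rightarrow> real \<Rightarrow> real \<Rightarrow> real \<Rightarrow> complex" where
  "Phi g c t T y z = (\<Sum>k\<in>UNIV. complex_of_real (c k / sqrt T) * Amp (dens g) (T * t k) y z)"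

context
  fixes f g :: "real \<Rightarrow> real"
  assumes f: "integrable lborel f" "\<And>x. 0 \<le> f x" and g: "integrable lborel g" "\<And>x. 0 \<le> g x"
    and fg: "integrable lborel (\<lambda>x. (f x * g x)\<^sup>2)"
    and trace: "((\<lambda>T. (hs (dens f) (Amp (dens g) T))\<^sup>2 / T) \<longlongrightarrow> (2 * pi) ^ 3 * (\<integral>x. (f x * g x)\<^sup>2 \<partial>lborel)) at_top"
begin

private abbreviation "I0 \<equiv> (2 * pi) ^ 3 * (\<integral>x. (f x * g x)\<^sup>2 \<partial>lborel)"
private abbreviation "IK n \<equiv> (2 * pi) ^ 3 * (\<integral>x. (trunc (real n) f x * trunc (real n) g x)\<^sup>2 \<partial>lborel)"

lemma IK_limit: "(\<lambda>n. IK n) \<longlonglongrightarrow> I0"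
proof (intro tendsto_mult_left integral_dominated_convergence[where w = "\<lambda>x. (f x * g x)\<^sup>2"])
  note [measurable] = symbols_measurable[OF f g]
  show "AE x in lborel. (\<lambda>n. (trunc (real n) f x * trunc (real n) g x)\<^sup>2) \<longlonglongrightarrow> (f x * g x)\<^sup>2"
  proof (intro AE_I2 tendsto_eventually)
    fix x
    obtain N :: nat where "max (f x) (g x) \<le> real N" using real_arch_simple by blast
    then show "\<forall>\<^sub>F n in sequentially. (trunc (real n) f x * trunc (real n) g x)\<^sup>2 = (f x * g x)\<^sup>2"
      by (intro eventually_sequentiallyI[of N]) (auto simp: trunc_def indicator_def)
  qed
  have [measurable]: "trunc K f \<in> borel_measurable borel" "trunc K g \<in> borel_measurable borel" for K
    unfolding trunc_def[abs_def] by measurable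
  show "(\<lambda>x. (trunc (real n) f x * trunc (real n) g x)\<^sup>2) \<in> borel_measurable lborel" for n by measurable
  show "AE x in lborel. norm ((trunc (real n) f x * trunc (real n) g x)\<^sup>2) \<le> (f x * g x)\<^sup>2" for n
    by (intro AE_I2) (auto simp: trunc_def indicator_def)
qed (use fg in auto)

text \<open>
  The assumption \<open>trace\<close>, which is the one on the variance at time one, rescaled to other
  times. It provides what the truncation argument needs: that no trace escapes as the window
  grows.
\<close>

lemma hs_growth:
  assumes "0 \<le> s" shows "((\<lambda>T. (hs (dens f) (Amp (dens g) (T * s)))\<^sup>2 / T) \<longlongrightarrow> s * I0) at_top"
proof (cases "s = 0")
  case True
  have "((\<lambda>T. (hs (dens f) (Amp (dens g) 0))\<^sup>2 / T) \<longlongrightarrow> 0) at_top"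
    by (intro tendsto_divide_0[OF tendsto_const] filterlim_at_top_imp_at_infinity filterlim_ident)
  then show ?thesis using True by simp
next
  case False
  with assms have s: "s > 0" by simp
  have "filterlim (\<lambda>T. T * s) at_top at_top"
    using s by (intro filterlim_tendsto_pos_mult_at_top[OF tendsto_const _ filterlim_ident, of s, simplified mult.commute[of s]]) auto
  then have "((\<lambda>T. s * ((hs (dens f) (Amp (dens g) (T * s)))\<^sup>2 / (T * s))) \<longlongrightarrow> s * I0) at_top"
    by (intro tendsto_mult_left filterlim_compose[OF trace])
  then show ?thesis using s by simp
qed

text \<open>
  The full trace grows by assumption and the truncated one by the theorem for bounded symbols.
  The difference of the rates tends to zero with the level of truncation.
\<close>

lemma defect_growth:
  assumes "0 \<le> s" shows "((\<lambda>T. defect f g (real n) (T * s) / T) \<longlongrightarrow> s * (I0 - IK n)) at_top"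
proof -
  note b = trunc_bounded_density[OF f, of "real n", simplified] trunc_bounded_density[OF g, of "real n", simplified]
  have "((\<lambda>T. overlap (dens (trunc (real n) g)) (dens (trunc (real n) f)) (T * s) (T * s) / T)
    \<longlongrightarrow> complex_of_real ((2 * pi) ^ 3 * min s s * (\<integral>x. (trunc (real n) f x * trunc (real n) g x)\<^sup>2 \<partial>lborel))) at_top"
    by (rule Toeplitz_trace_limit[OF b assms assms])
  then have "((\<lambda>T. complex_of_real ((hs (dens (trunc (real n) f)) (Amp (dens (trunc (real n) g)) (T * s)))\<^sup>2 / T)) \<longlongrightarrow> complex_of_real (s * IK n)) at_top"
    unfolding overlap_diag[OF bounded_densityD(8)[OF b(2)] bounded_densityD(8)[OF b(1)]]
    by (simp add: mult_ac)
  then have "((\<lambda>T. (hs (dens (trunc (real n) f)) (Amp (dens (trunc (real n) g)) (T * s)))\<^sup>2 / T) \<longlongrightarrow> s * IK n) at_top"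
    by (simp only: tendsto_of_real_iff)
  with hs_growth[OF assms]
  have "((\<lambda>T. (hs (dens f) (Amp (dens g) (T * s)))\<^sup>2 / T - (hs (dens (trunc (real n) f)) (Amp (dens (trunc (real n) g)) (T * s)))\<^sup>2 / T) \<longlongrightarrow> s * I0 - s * IK n) at_top"
    by (rule tendsto_diff)
  then show ?thesis by (simp add: defect_def[OF f g] diff_divide_distrib right_diff_distrib)
qed

lemma sqrt_growth:
  assumes "0 \<le> s"
  shows "((\<lambda>T. hs (dens f) (Amp (dens g) (T * s)) / sqrt T) \<longlongrightarrow> sqrt (s * I0)) at_top"
    "((\<lambda>T. sqrt (defect f g (real n) (T * s)) / sqrt T) \<longlongrightarrow> sqrt (s * (I0 - IK n))) at_top"
proof -
  have "((\<lambda>T. sqrt ((hs (dens f) (Amp (dens g) (T * s)))\<^sup>2 / T)) \<longlongrightarrow> sqrt (s * I0)) at_top"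
    by (intro tendsto_real_sqrt hs_growth assms)
  then show "((\<lambda>T. hs (dens f) (Amp (dens g) (T * s)) / sqrt T) \<longlongrightarrow> sqrt (s * I0)) at_top"
    by (simp add: real_sqrt_divide)
  have "((\<lambda>T. sqrt (defect f g (real n) (T * s) / T)) \<longlongrightarrow> sqrt (s * (I0 - IK n))) at_top"
    by (intro tendsto_real_sqrt defect_growth assms)
  then show "((\<lambda>T. sqrt (defect f g (real n) (T * s)) / sqrt T) \<longlongrightarrow> sqrt (s * (I0 - IK n))) at_top"
    by (simp add: real_sqrt_divide)
qed

lemma gap_limit: "(\<lambda>n. sqrt (s * (I0 - IK n))) \<longlonglongrightarrow> 0"
proof -
  have "(\<lambda>n. sqrt (s * (I0 - IK n))) \<longlonglongrightarrow> sqrt (s * (I0 - I0))"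
    by (intro tendsto_real_sqrt tendsto_mult_left tendsto_diff tendsto_const IK_limit)
  then show ?thesis by simp
qed

lemma overlap_truncation:
  "norm (overlap (dens g) (dens f) l l' - overlap (dens (trunc K g)) (dens (trunc K f)) l l')
    \<le> 2 * sqrt (defect f g K l) * hs (dens f) (Amp (dens g) l') + hs (dens f) (Amp (dens g) l) * (2 * sqrt (defect f g K l'))"
proof -
  note fin = finFG[OF f g]
  let ?P = "(dens f) \<Otimes>\<^sub>M (dens f)"
  define A where "A l p = Amp (dens g) l (fst p) (snd p)" for l and p :: "real \<times> real"
  define B where "B l p = Psi f g K l (fst p) (snd p)" for l and p :: "real \<times> real"
  have A: "sq_int ?P (A l)" for l unfolding A_def[abs_def] by (intro kernel_sq_int fin kernel_Amp)
  have B: "sq_int ?P (B l)" for l unfolding B_def[abs_def] by (intro kernel_sq_int fin kernel_Psi f g)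
  have n: "sqn ?P (A l) = hs (dens f) (Amp (dens g) l)" "sqn ?P (B l) \<le> hs (dens f) (Amp (dens g) l)" for l
    using truncation_distance(3)[OF f g, of K l] by (auto simp: A_def[abs_def] B_def[abs_def] hs_def)
  have d: "sqn ?P (\<lambda>p. A l p - B l p) \<le> 2 * sqrt (defect f g K l)" for l
    using truncation_distance(2)[OF f g, of l K] by (simp add: A_def B_def hs_def)
  have "overlap (dens g) (dens f) l l' - overlap (dens (trunc K g)) (dens (trunc K f)) l l' = (\<integral>p. A l p * cnj (A l' p) - B l p * cnj (B l' p) \<partial>?P)"
    using sq_int_integrable_mult[OF A[of l] sq_int_cnj[OF A[of l']]] sq_int_integrable_mult[OF B[of l] sq_int_cnj[OF B[of l']]]
    unfolding overlap_Psi[OF f g] overlap_def[of "dens g" "dens f"] by (simp add: A_def B_def)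
  also have "\<dots> = (\<integral>p. (A l p - B l p) * cnj (A l' p) + B l p * cnj (A l' p - B l' p) \<partial>?P)"
    by (intro Bochner_Integration.integral_cong) (auto simp: algebra_simps)
  also have "\<dots> = (\<integral>p. (A l p - B l p) * cnj (A l' p) \<partial>?P) + (\<integral>p. B l p * cnj (A l' p - B l' p) \<partial>?P)"
    by (intro Bochner_Integration.integral_add sq_int_integrable_mult sq_int_diff sq_int_cnj A B)
  finally have eq: "overlap (dens g) (dens f) l l' - overlap (dens (trunc K g)) (dens (trunc K f)) l l'
    = (\<integral>p. (A l p - B l p) * cnj (A l' p) \<partial>?P) + (\<integral>p. B l p * cnj (A l' p - B l' p) \<partial>?P)" .
  show ?thesis
    unfolding eq
  proof (intro order_trans[OF norm_triangle_ineq] add_mono)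
    have "norm (\<integral>p. (A l p - B l p) * cnj (A l' p) \<partial>?P) \<le> sqn ?P (\<lambda>p. A l p - B l p) * sqn ?P (\<lambda>p. cnj (A l' p))"
      by (intro sq_int_Cauchy_Schwarz sq_int_diff sq_int_cnj A B)
    also have "\<dots> \<le> 2 * sqrt (defect f g K l) * hs (dens f) (Amp (dens g) l')"
      using d[of l] by (simp add: n mult_right_mono)
    finally show "norm (\<integral>p. (A l p - B l p) * cnj (A l' p) \<partial>?P) \<le> \<dots>" .
    have "norm (\<integral>p. B l p * cnj (A l' p - B l' p) \<partial>?P) \<le> sqn ?P (B l) * sqn ?P (\<lambda>p. cnj (A l' p - B l' p))"
      by (intro sq_int_Cauchy_Schwarz sq_int_diff sq_int_cnj A B)
    also have "\<dots> \<le> hs (dens f) (Amp (dens g) l) * (2 * sqrt (defect f g K l'))"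
      using d[of l'] n(2)[of l] unfolding sqn_cnj by (intro mult_mono) auto
    finally show "norm (\<integral>p. B l p * cnj (A l' p - B l' p) \<partial>?P) \<le> \<dots>" .
  qed
qed

text \<open>
  The limit \<open>min s t\<close> is where the covariance of Brownian motion appears.
\<close>

theorem overlap_limit:
  assumes s: "0 \<le> s" and t: "0 \<le> t"
  shows "((\<lambda>T. overlap (dens g) (dens f) (T * s) (T * t) / T) \<longlongrightarrow> complex_of_real (min s t * I0)) at_top"
proof -
  note [measurable] = symbols_measurable[OF f g]
  define N where "N v T = hs (dens f) (Amp (dens g) (T * v)) / sqrt T" for v T
  define d where "d n v T = sqrt (defect f g (real n) (T * v)) / sqrt T" for n v T
  define tK where "tK n T = overlap (dens (trunc (real n) g)) (dens (trunc (real n) f)) (T * s) (T * t) / complex_of_real T" for n T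
  let ?x = "complex_of_real (min s t * I0)"
  show ?thesis
  proof (rule tendsto_by_approximation[where
      E = "\<lambda>n T. 2 * d n s T * N t T + N s T * (2 * d n t T) + norm (tK n T - ?x)" and
      e = "\<lambda>n. 2 * sqrt (s * (I0 - IK n)) * sqrt (t * I0) + sqrt (s * I0) * (2 * sqrt (t * (I0 - IK n))) + norm (complex_of_real (min s t * IK n) - ?x)"])
    fix n
    show "\<forall>\<^sub>F T in at_top. norm (overlap (dens g) (dens f) (T * s) (T * t) / complex_of_real T - ?x) \<le> 2 * d n s T * N t T + N s T * (2 * d n t T) + norm (tK n T - ?x)"
      using eventually_gt_at_top[of 0]
    proof eventually_elim
      case (elim T)
      let ?t = "overlap (dens g) (dens f) (T * s) (T * t)" and ?k = "overlap (dens (trunc (real n) g)) (dens (trunc (real n) f)) (T * s) (T * t)"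
      have "norm (?t / complex_of_real T - ?x) \<le> norm (?t / complex_of_real T - tK n T) + norm (tK n T - ?x)"
        using norm_triangle_ineq[of "?t / complex_of_real T - tK n T" "tK n T - ?x"] by simp
      moreover have "norm (?t / complex_of_real T - tK n T) = norm (?t - ?k) / T"
        using elim by (simp add: tK_def diff_divide_distrib[symmetric] norm_divide)
      moreover have "norm (?t - ?k) / T \<le> (2 * sqrt (defect f g (real n) (T * s)) * hs (dens f) (Amp (dens g) (T * t)) + hs (dens f) (Amp (dens g) (T * s)) * (2 * sqrt (defect f g (real n) (T * t)))) / (sqrt T * sqrt T)"
        using overlap_truncation[of "T * s" "T * t" "real n"] elim by (simp add: divide_right_mono)
      moreover have "\<dots> = 2 * d n s T * N t T + N s T * (2 * d n t T)"
        by (simp add: d_def N_def add_divide_distrib)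
      ultimately show ?case by linarith
    qed
    have tK: "(tK n \<longlongrightarrow> complex_of_real (min s t * IK n)) at_top"
      using Toeplitz_trace_limit[OF trunc_bounded_density[OF f] trunc_bounded_density[OF g] s t, of "real n"]
      unfolding tK_def by (simp add: mult_ac)
    show "((\<lambda>T. 2 * d n s T * N t T + N s T * (2 * d n t T) + norm (tK n T - ?x)) \<longlongrightarrow>
      2 * sqrt (s * (I0 - IK n)) * sqrt (t * I0) + sqrt (s * I0) * (2 * sqrt (t * (I0 - IK n))) + norm (complex_of_real (min s t * IK n) - ?x)) at_top"
      unfolding d_def N_def by (intro tendsto_intros tendsto_mult tendsto_add sqrt_growth s t tK tendsto_norm tendsto_diff tendsto_const)
  next
    have "(\<lambda>n. 2 * sqrt (s * (I0 - IK n)) * sqrt (t * I0) + sqrt (s * I0) * (2 * sqrt (t * (I0 - IK n))) + norm (complex_of_real (min s t * IK n) - ?x))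
      \<longlonglongrightarrow> 2 * 0 * sqrt (t * I0) + sqrt (s * I0) * (2 * 0) + norm (?x - ?x)"
      by (intro tendsto_add tendsto_mult tendsto_const gap_limit tendsto_norm tendsto_diff tendsto_of_real IK_limit)
    then show "(\<lambda>n. 2 * sqrt (s * (I0 - IK n)) * sqrt (t * I0) + sqrt (s * I0) * (2 * sqrt (t * (I0 - IK n))) + norm (complex_of_real (min s t * IK n) - ?x)) \<longlonglongrightarrow> 0"
      by simp
  qed
qed

lemma kernel_Phi: "kernel (Phi g c t T)"
  unfolding Phi_def[abs_def] by (intro kernel_sum kernel_cmult kernel_Amp finFG[OF f g])

lemma hs_Phi_le: "hs (dens f) (Phi g c t T) \<le> (\<Sum>k\<in>UNIV. \<bar>c k\<bar> * (hs (dens f) (Amp (dens g) (T * t k)) / sqrt T))" if "T > 0"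
proof -
  have "hs (dens f) (Phi g c t T) \<le> (\<Sum>k\<in>UNIV. norm (complex_of_real (c k / sqrt T)) * hs (dens f) (Amp (dens g) (T * t k)))"
    unfolding Phi_def[abs_def] by (intro hs_sum_le finFG[OF f g] kernel_Amp) auto
  then show ?thesis using that by (simp add: norm_divide)
qed

text \<open>
  The second factor is split into its truncation and a remainder. Composition with the
  truncation is bounded uniformly in the window, and so vanishes after division by \<open>sqrt T\<close>;
  the remainder has a small Hilbert-Schmidt norm.
\<close>

theorem fourth_trace_limit:
  assumes t: "\<And>k. 0 \<le> t k"
  shows "((\<lambda>T. hs (dens f) (kmult (dens f) (Phi g c t T) (Phi g c t T))) \<longlongrightarrow> 0) at_top"
proof -
  note [measurable] = symbols_measurable[OF f g]
  note fin = finFG[OF f g]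
  define N where "N v T = hs (dens f) (Amp (dens g) (T * v)) / sqrt T" for v T
  define d where "d n v T = sqrt (defect f g (real n) (T * v)) / sqrt T" for n v T
  define Cn where "Cn n = (2 * pi)\<^sup>2 * (real n)\<^sup>2" for n :: nat
  show ?thesis
  proof (rule tendsto_by_approximation[where
      E = "\<lambda>n T. (\<Sum>k\<in>UNIV. \<bar>c k\<bar> * N (t k) T) * (\<Sum>k\<in>UNIV. \<bar>c k\<bar> * (Cn n / sqrt T + 2 * d n (t k) T))" and
      e = "\<lambda>n. (\<Sum>k\<in>UNIV. \<bar>c k\<bar> * sqrt (t k * I0)) * (\<Sum>k\<in>UNIV. \<bar>c k\<bar> * (0 + 2 * sqrt (t k * (I0 - IK n))))"])
    fix n
    show "\<forall>\<^sub>F T in at_top. norm (hs (dens f) (kmult (dens f) (Phi g c t T) (Phi g c t T)) - 0)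
       \<le> (\<Sum>k\<in>UNIV. \<bar>c k\<bar> * N (t k) T) * (\<Sum>k\<in>UNIV. \<bar>c k\<bar> * (Cn n / sqrt T + 2 * d n (t k) T))"
      using eventually_gt_at_top[of 0]
    proof eventually_elim
      case (elim T)
      let ?P = "Phi g c t T"
      note kP = kernel_Phi[of c t T]
      have one: "hs (dens f) (kmult (dens f) ?P (Amp (dens g) l)) \<le> hs (dens f) ?P * (Cn n + 2 * sqrt (defect f g (real n) l))" for l
      proof -
        note [measurable_cong] = fin_borelD(2)[OF fin(1)]
        note [measurable (raw)] = kernel_measurable[OF kP] kernel_measurable[OF kernel_Amp[OF fin(2)]] kernel_measurable[OF kernel_Psi[OF f g]]
        have kD: "kernel (\<lambda>y z. Amp (dens g) l y z - Psi f g (real n) l y z)"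
          by (intro kernel_diff kernel_Amp fin kernel_Psi f g)
        have int: "integrable (dens f) (\<lambda>w. ?P y w * K w z)" if K: "kernel K" for K y z
        proof -
          note [measurable (raw)] = kernel_measurable[OF K]
          show ?thesis by (intro bdd_integrable fin_borelD[OF fin(1)] bdd_mult kernel_bdd[OF kP] kernel_bdd[OF K]) measurable
        qed
        have "kmult (dens f) ?P (Amp (dens g) l) = (\<lambda>y z. kmult (dens f) ?P (Psi f g (real n) l) y z + kmult (dens f) ?P (\<lambda>y z. Amp (dens g) l y z - Psi f g (real n) l y z) y z)"
        proof (intro ext)
          fix y z
          show "kmult (dens f) ?P (Amp (dens g) l) y z = kmult (dens f) ?P (Psi f g (real n) l) y z + kmult (dens f) ?P (\<lambda>y z. Amp (dens g) l y z - Psi f g (real n) l y z) y z"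
            unfolding kmult_def
            using Bochner_Integration.integral_add[OF int[OF kernel_Psi[OF f g, of "real n" l], of y z] int[OF kD, of y z]]
            by (simp add: algebra_simps)
        qed
        then have "hs (dens f) (kmult (dens f) ?P (Amp (dens g) l)) \<le> hs (dens f) (kmult (dens f) ?P (Psi f g (real n) l)) + hs (dens f) (kmult (dens f) ?P (\<lambda>y z. Amp (dens g) l y z - Psi f g (real n) l y z))"
          using hs_triangle[OF fin(1) kernel_kmult[OF fin(1) kP kernel_Psi[OF f g, of "real n" l]] kernel_kmult[OF fin(1) kP kD]] by simp
        also have "hs (dens f) (kmult (dens f) ?P (Psi f g (real n) l)) \<le> Cn n * hs (dens f) ?P"
          unfolding Cn_def by (rule hs_kmult_Psi[OF f g kP]) simp
        also have "hs (dens f) (kmult (dens f) ?P (\<lambda>y z. Amp (dens g) l y z - Psi f g (real n) l y z)) \<le> hs (dens f) ?P * (2 * sqrt (defect f g (real n) l))"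
          using hs_kmult_le[OF fin(1) kP kD] mult_left_mono[OF truncation_distance(2)[OF f g, of l "real n"] hs_nonneg[of "dens f" ?P]] by linarith
        finally show ?thesis by (simp add: algebra_simps)
      qed
      have "kmult (dens f) ?P ?P = (\<lambda>y z. \<Sum>k\<in>UNIV. complex_of_real (c k / sqrt T) * kmult (dens f) ?P (Amp (dens g) (T * t k)) y z)"
      proof (intro ext)
        fix y z
        note [measurable_cong] = fin_borelD(2)[OF fin(1)]
        note [measurable (raw)] = kernel_measurable[OF kP] kernel_measurable[OF kernel_Amp[OF fin(2)]]
        have int: "integrable (dens f) (\<lambda>w. complex_of_real (c k / sqrt T) * (?P y w * Amp (dens g) (T * t k) w z))" for k
          by (intro integrable_mult_right bdd_integrable fin_borelD[OF fin(1)] bdd_mult kernel_bdd[OF kP] kernel_bdd[OF kernel_Amp[OF fin(2)]]) measurable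
        have "kmult (dens f) ?P ?P y z = (\<integral>w. (\<Sum>k\<in>UNIV. complex_of_real (c k / sqrt T) * (?P y w * Amp (dens g) (T * t k) w z)) \<partial>dens f)"
          unfolding kmult_def Phi_def[of g c t T _ z] by (simp add: sum_distrib_left mult_ac)
        also have "\<dots> = (\<Sum>k\<in>UNIV. \<integral>w. complex_of_real (c k / sqrt T) * (?P y w * Amp (dens g) (T * t k) w z) \<partial>dens f)"
          by (rule Bochner_Integration.integral_sum) (rule int)
        finally show "kmult (dens f) ?P ?P y z = (\<Sum>k\<in>UNIV. complex_of_real (c k / sqrt T) * kmult (dens f) ?P (Amp (dens g) (T * t k)) y z)"
          by (simp only: kmult_def integral_mult_right_zero)
      qed
      then have "hs (dens f) (kmult (dens f) ?P ?P) \<le> (\<Sum>k\<in>UNIV. norm (complex_of_real (c k / sqrt T)) * hs (dens f) (kmult (dens f) ?P (Amp (dens g) (T * t k))))"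
        by (simp only:) (intro hs_sum_le fin kernel_kmult kP kernel_Amp; simp)
      also have "\<dots> \<le> (\<Sum>k\<in>UNIV. (\<bar>c k\<bar> / sqrt T) * (hs (dens f) ?P * (Cn n + 2 * sqrt (defect f g (real n) (T * t k)))))"
        using elim by (intro sum_mono mult_mono one) (auto simp: norm_divide)
      also have "\<dots> = hs (dens f) ?P * (\<Sum>k\<in>UNIV. \<bar>c k\<bar> * (Cn n / sqrt T + 2 * d n (t k) T))"
        by (simp add: sum_distrib_left d_def add_divide_distrib algebra_simps)
      also have "\<dots> \<le> (\<Sum>k\<in>UNIV. \<bar>c k\<bar> * N (t k) T) * (\<Sum>k\<in>UNIV. \<bar>c k\<bar> * (Cn n / sqrt T + 2 * d n (t k) T))"
      proof (rule mult_right_mono)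
        show "hs (dens f) ?P \<le> (\<Sum>k\<in>UNIV. \<bar>c k\<bar> * N (t k) T)" unfolding N_def by (rule hs_Phi_le[OF elim])
        show "0 \<le> (\<Sum>k\<in>UNIV. \<bar>c k\<bar> * (Cn n / sqrt T + 2 * d n (t k) T))"
          using elim truncation_distance(1)[OF f g] by (intro sum_nonneg) (auto simp: Cn_def d_def)
      qed
      finally show ?case by simp
    qed
    have z: "((\<lambda>T. Cn n / sqrt T) \<longlongrightarrow> 0) at_top"
      by (intro tendsto_divide_0[OF tendsto_const] filterlim_at_top_imp_at_infinity sqrt_at_top)
    show "((\<lambda>T. (\<Sum>k\<in>UNIV. \<bar>c k\<bar> * N (t k) T) * (\<Sum>k\<in>UNIV. \<bar>c k\<bar> * (Cn n / sqrt T + 2 * d n (t k) T))) \<longlongrightarrow>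
       (\<Sum>k\<in>UNIV. \<bar>c k\<bar> * sqrt (t k * I0)) * (\<Sum>k\<in>UNIV. \<bar>c k\<bar> * (0 + 2 * sqrt (t k * (I0 - IK n))))) at_top"
      unfolding d_def N_def by (intro tendsto_mult tendsto_sum tendsto_add tendsto_const sqrt_growth t z)
  next
    have "(\<lambda>n. (\<Sum>k\<in>UNIV. \<bar>c k\<bar> * sqrt (t k * I0)) * (\<Sum>k\<in>UNIV. \<bar>c k\<bar> * (0 + 2 * sqrt (t k * (I0 - IK n)))))
      \<longlonglongrightarrow> (\<Sum>k\<in>UNIV. \<bar>c k\<bar> * sqrt (t k * I0)) * (\<Sum>k\<in>UNIV. \<bar>c k\<bar> * (0 + 2 * 0))"
      by (intro tendsto_mult tendsto_sum tendsto_add tendsto_const gap_limit)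
    then show "(\<lambda>n. (\<Sum>k\<in>UNIV. \<bar>c k\<bar> * sqrt (t k * I0)) * (\<Sum>k\<in>UNIV. \<bar>c k\<bar> * (0 + 2 * sqrt (t k * (I0 - IK n))))) \<longlonglongrightarrow> 0"
      by simp
  qed
qed

theorem second_trace_limit:
  assumes t: "\<And>k. 0 \<le> t k"
  shows "((\<lambda>T. (hs (dens f) (Phi g c t T))\<^sup>2) \<longlongrightarrow> I0 * (\<Sum>j\<in>UNIV. \<Sum>k\<in>UNIV. c j * c k * min (t j) (t k))) at_top"
proof -
  note fin = finFG[OF f g]
  let ?S = "\<Sum>j\<in>UNIV. \<Sum>k\<in>UNIV. complex_of_real (c j * c k) * complex_of_real (min (t j) (t k) * I0)"
  have "((\<lambda>T. \<Sum>j\<in>UNIV. \<Sum>k\<in>UNIV. complex_of_real (c j * c k) * (overlap (dens g) (dens f) (T * t j) (T * t k) / T)) \<longlongrightarrow> ?S) at_top"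
    by (intro tendsto_sum tendsto_mult_left overlap_limit t)
  moreover have "\<forall>\<^sub>F T in at_top. (\<Sum>j\<in>UNIV. \<Sum>k\<in>UNIV. complex_of_real (c j * c k) * (overlap (dens g) (dens f) (T * t j) (T * t k) / T)) = complex_of_real ((hs (dens f) (Phi g c t T))\<^sup>2)"
    using eventually_gt_at_top[of 0]
  proof eventually_elim
    case (elim T)
    let ?P = "(dens f) \<Otimes>\<^sub>M (dens f)"
    define A where "A k p = complex_of_real (c k / sqrt T) * Amp (dens g) (T * t k) (fst p) (snd p)" for k and p :: "real \<times> real"
    have A: "sq_int ?P (A k)" for k unfolding A_def[abs_def] by (intro sq_int_cmult kernel_sq_int fin kernel_Amp)
    have "complex_of_real ((hs (dens f) (Phi g c t T))\<^sup>2) = (\<integral>p. (\<Sum>k\<in>UNIV. A k p) * cnj (\<Sum>k\<in>UNIV. A k p) \<partial>?P)"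
      unfolding hs_def sqn_square Phi_def
      by (subst integral_complex_of_real[symmetric]) (simp only: complex_norm_square A_def)
    also have "\<dots> = (\<integral>p. (\<Sum>j\<in>UNIV. \<Sum>k\<in>UNIV. A j p * cnj (A k p)) \<partial>?P)"
      by (simp add: sum_product)
    also have "\<dots> = (\<Sum>j\<in>UNIV. \<Sum>k\<in>UNIV. \<integral>p. A j p * cnj (A k p) \<partial>?P)"
      by (subst Bochner_Integration.integral_sum | intro Bochner_Integration.integrable_sum sq_int_integrable_mult sq_int_cnj A refl sum.cong)+
    also have "\<dots> = (\<Sum>j\<in>UNIV. \<Sum>k\<in>UNIV. complex_of_real (c j * c k) * (overlap (dens g) (dens f) (T * t j) (T * t k) / T))"
    proof (intro sum.cong refl)
      fix j k
      have sT: "complex_of_real (sqrt T) * complex_of_real (sqrt T) = complex_of_real T"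
        using elim by (simp flip: of_real_mult)
      have "(\<integral>p. A j p * cnj (A k p) \<partial>?P) = (\<integral>p. complex_of_real (c j * c k) / (complex_of_real (sqrt T) * complex_of_real (sqrt T)) * (Amp (dens g) (T * t j) (fst p) (snd p) * cnj (Amp (dens g) (T * t k) (fst p) (snd p))) \<partial>?P)"
        by (intro Bochner_Integration.integral_cong) (auto simp: A_def)
      then show "(\<integral>p. A j p * cnj (A k p) \<partial>?P) = complex_of_real (c j * c k) * (overlap (dens g) (dens f) (T * t j) (T * t k) / T)"
        unfolding sT by (simp add: overlap_def)
    qed
    finally show ?case ..
  qed
  ultimately have "((\<lambda>T. complex_of_real ((hs (dens f) (Phi g c t T))\<^sup>2)) \<longlongrightarrow> ?S) at_top"
    by (rule Lim_transform_eventually)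
  also have "?S = complex_of_real (I0 * (\<Sum>j\<in>UNIV. \<Sum>k\<in>UNIV. c j * c k * min (t j) (t k)))"
    by (simp add: sum_distrib_left mult_ac)
  finally show ?thesis by (simp only: tendsto_of_real_iff)
qed

end

section \<open>Random variables with all moments\<close>

text \<open>
  Closed under products and under integration over a parameter in a finite measure space, so
  that it settles all questions of integrability in the moment computations.
\<close>

definition all_moments :: "'a measure \<Rightarrow> ('a \<Rightarrow> real) \<Rightarrow> bool" where
  "all_moments M Z \<longleftrightarrow> Z \<in> borel_measurable M \<and> (\<forall>n::nat. integrable M (\<lambda>x. \<bar>Z x\<bar> ^ n))"

lemma all_momentsD:
  assumes "all_moments M Z"
  shows "Z \<in> borel_measurable M" "integrable M (\<lambda>x. \<bar>Z x\<bar> ^ n)" "integrable M (\<lambda>x. Z x ^ n)" "integrable M Z"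
proof -
  show m[measurable]: "Z \<in> borel_measurable M" using assms by (simp add: all_moments_def)
  show i: "integrable M (\<lambda>x. \<bar>Z x\<bar> ^ n)" for n using assms by (simp add: all_moments_def)
  show "integrable M (\<lambda>x. Z x ^ n)"
    by (rule Bochner_Integration.integrable_bound[OF i[of n]]) (auto simp: power_abs)
  show "integrable M Z"
    by (rule Bochner_Integration.integrable_bound[OF i[of 1]]) auto
qed

lemma all_moments_const:
  assumes "finite_measure M" shows "all_moments M (\<lambda>x. c)"
  using assms by (simp add: all_moments_def finite_measure.integrable_const)

lemma all_moments_bdd:
  assumes M: "finite_measure M" and [measurable]: "Z \<in> borel_measurable M" and b: "bdd Z"
  shows "all_moments M Z"
proof -
  obtain C where C: "C \<ge> 0" "\<And>x. norm (Z x) \<le> C" by (rule bddE[OF b]) (rule that)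
  have "integrable M (\<lambda>x. \<bar>Z x\<bar> ^ n)" for n
    using C by (intro finite_measure.integrable_const_bound[OF M, of _ "C ^ n"]) (auto intro!: power_mono)
  then show ?thesis by (simp add: all_moments_def)
qed

lemma all_moments_mult:
  assumes Y: "all_moments M Y" and Z: "all_moments M Z"
  shows "all_moments M (\<lambda>x. Y x * Z x)"
proof -
  note [measurable] = all_momentsD(1)[OF Y] all_momentsD(1)[OF Z]
  have "integrable M (\<lambda>x. \<bar>Y x * Z x\<bar> ^ n)" for n
  proof (rule Bochner_Integration.integrable_bound)
    show "integrable M (\<lambda>x. \<bar>Y x\<bar> ^ (2 * n) + \<bar>Z x\<bar> ^ (2 * n))"
      by (intro Bochner_Integration.integrable_add all_momentsD Y Z)
    show "AE x in M. norm (\<bar>Y x * Z x\<bar> ^ n) \<le> norm (\<bar>Y x\<bar> ^ (2 * n) + \<bar>Z x\<bar> ^ (2 * n))"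
    proof (intro AE_I2)
      fix x
      have "2 * (\<bar>Y x\<bar> ^ n * \<bar>Z x\<bar> ^ n) \<le> (\<bar>Y x\<bar> ^ n)\<^sup>2 + (\<bar>Z x\<bar> ^ n)\<^sup>2"
        using sum_squares_bound[of "\<bar>Y x\<bar> ^ n" "\<bar>Z x\<bar> ^ n"] by simp
      moreover have "0 \<le> \<bar>Y x\<bar> ^ n * \<bar>Z x\<bar> ^ n" by simp
      ultimately have "\<bar>Y x\<bar> ^ n * \<bar>Z x\<bar> ^ n \<le> (\<bar>Y x\<bar> ^ n)\<^sup>2 + (\<bar>Z x\<bar> ^ n)\<^sup>2" by linarith
      then show "norm (\<bar>Y x * Z x\<bar> ^ n) \<le> norm (\<bar>Y x\<bar> ^ (2 * n) + \<bar>Z x\<bar> ^ (2 * n))"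
        by (simp add: abs_mult power_mult_distrib power_mult[symmetric] mult.commute[of n 2] power_even_abs flip: power_mult)
    qed
  qed measurable
  then show ?thesis by (simp add: all_moments_def)
qed

lemma all_moments_add:
  assumes Y: "all_moments M Y" and Z: "all_moments M Z"
  shows "all_moments M (\<lambda>x. Y x + Z x)"
proof -
  note [measurable] = all_momentsD(1)[OF Y] all_momentsD(1)[OF Z]
  have "integrable M (\<lambda>x. \<bar>Y x + Z x\<bar> ^ n)" for n
  proof (rule Bochner_Integration.integrable_bound)
    show "integrable M (\<lambda>x. 2 ^ n * (\<bar>Y x\<bar> ^ n + \<bar>Z x\<bar> ^ n))"
      by (intro integrable_mult_right Bochner_Integration.integrable_add all_momentsD Y Z)
    show "AE x in M. norm (\<bar>Y x + Z x\<bar> ^ n) \<le> norm (2 ^ n * (\<bar>Y x\<bar> ^ n + \<bar>Z x\<bar> ^ n))"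
    proof (intro AE_I2)
      fix x
      let ?m = "max \<bar>Y x\<bar> \<bar>Z x\<bar>"
      have "\<bar>Y x + Z x\<bar> ^ n \<le> (2 * ?m) ^ n" by (intro power_mono) (auto simp: max_def)
      also have "\<dots> = 2 ^ n * ?m ^ n" by (simp add: power_mult_distrib)
      also have "\<dots> \<le> 2 ^ n * (\<bar>Y x\<bar> ^ n + \<bar>Z x\<bar> ^ n)" by (intro mult_left_mono) (auto simp: max_def)
      finally show "norm (\<bar>Y x + Z x\<bar> ^ n) \<le> norm (2 ^ n * (\<bar>Y x\<bar> ^ n + \<bar>Z x\<bar> ^ n))" by simp
    qed
  qed measurable
  then show ?thesis by (simp add: all_moments_def)
qed

lemma all_moments_cmult:
  assumes "all_moments M Z" shows "all_moments M (\<lambda>x. c * Z x)"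
  using all_momentsD[OF assms] by (simp add: all_moments_def abs_mult power_mult_distrib)

lemma all_moments_diff:
  assumes "all_moments M Y" "all_moments M Z" shows "all_moments M (\<lambda>x. Y x - Z x)"
  using all_moments_add[OF assms(1) all_moments_cmult[OF assms(2), of "-1"]] by simp

lemma all_moments_sum:
  assumes "finite_measure M" "\<And>i. i \<in> I \<Longrightarrow> all_moments M (Z i)"
  shows "all_moments M (\<lambda>x. \<Sum>i\<in>I. Z i x)"
  using assms(2)
  by (induction I rule: infinite_finite_induct) (auto intro: all_moments_add all_moments_const assms(1))

lemma all_moments_prod_list:
  assumes "finite_measure M" "\<And>i. i \<in> set xs \<Longrightarrow> all_moments M (Z i)"
  shows "all_moments M (\<lambda>x. prod_list (map (\<lambda>i. Z i x) xs))"
  using assms(2)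
  by (induction xs) (auto intro: all_moments_mult all_moments_const assms(1))

text \<open>
  Exponents \<open>2\<^sup>k\<close> are reached by iterating the Cauchy-Schwarz inequality.
\<close>

lemma all_moments_dyadic:
  assumes M: "finite_measure M" and [measurable]: "Z \<in> borel_measurable M"
    and i: "\<And>k. integrable M (\<lambda>x. \<bar>Z x\<bar> ^ (2 ^ k))"
  shows "all_moments M Z"
proof -
  have "integrable M (\<lambda>x. \<bar>Z x\<bar> ^ n)" for n
  proof (rule Bochner_Integration.integrable_bound)
    show "integrable M (\<lambda>x. 1 + \<bar>Z x\<bar> ^ (2 ^ n))" using i M by (simp add: finite_measure.integrable_const)
    show "AE x in M. norm (\<bar>Z x\<bar> ^ n) \<le> norm (1 + \<bar>Z x\<bar> ^ (2 ^ n))"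
    proof (intro AE_I2)
      fix x
      have "\<bar>Z x\<bar> ^ n \<le> 1 + \<bar>Z x\<bar> ^ (2 ^ n)"
      proof (cases "\<bar>Z x\<bar> \<le> 1")
        case True
        then have "\<bar>Z x\<bar> ^ n \<le> 1" by (simp add: power_le_one)
        then show ?thesis by (simp add: add_increasing2)
      next
        case False
        then have "\<bar>Z x\<bar> ^ n \<le> \<bar>Z x\<bar> ^ (2 ^ n)" by (intro power_increasing) (auto intro: less_imp_le less_exp)
        then show ?thesis by simp
      qed
      then show "norm (\<bar>Z x\<bar> ^ n) \<le> norm (1 + \<bar>Z x\<bar> ^ (2 ^ n))" by simp
    qed
  qed measurable
  then show ?thesis by (simp add: all_moments_def)
qed

lemma all_moments_snd:
  assumes N: "finite_measure N" and M: "finite_measure M" and Z: "all_moments M Z"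
  shows "all_moments (N \<Otimes>\<^sub>M M) (\<lambda>p. Z (snd p))"
proof -
  interpret N: finite_measure N by fact
  interpret M: finite_measure M by fact
  note [measurable] = all_momentsD(1)[OF Z]
  have "integrable (N \<Otimes>\<^sub>M M) (\<lambda>p. \<bar>Z (snd p)\<bar> ^ n)" for n
    by (rule integrable_pair_dominated[where p = "\<lambda>_. 1" and q = "\<lambda>x. \<bar>Z x\<bar> ^ n"])
       (auto intro: N.sigma_finite_measure M.sigma_finite_measure all_momentsD Z)
  then show ?thesis by (simp add: all_moments_def)
qed

lemma all_moments_fst:
  assumes N: "finite_measure N" and M: "finite_measure M" and Z: "all_moments N Z"
  shows "all_moments (N \<Otimes>\<^sub>M M) (\<lambda>p. Z (fst p))"
proof -
  interpret N: finite_measure N by fact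
  interpret M: finite_measure M by fact
  note [measurable] = all_momentsD(1)[OF Z]
  have "integrable (N \<Otimes>\<^sub>M M) (\<lambda>p. \<bar>Z (fst p)\<bar> ^ n)" for n
    by (rule integrable_pair_dominated[where p = "\<lambda>x. \<bar>Z x\<bar> ^ n" and q = "\<lambda>_. 1"])
       (auto intro: N.sigma_finite_measure M.sigma_finite_measure all_momentsD Z)
  then show ?thesis by (simp add: all_moments_def)
qed

lemma nn_integral_dyadic_power:
  assumes [measurable]: "Y \<in> borel_measurable N"
  shows "(\<integral>\<^sup>+x. Y x \<partial>N) ^ (2 ^ k) \<le> (\<integral>\<^sup>+x. (Y x) ^ (2 ^ k) \<partial>N) * emeasure N (space N) ^ (2 ^ k - 1)"
proof (induction k)
  case (Suc k)
  let ?m = "emeasure N (space N)" and ?I = "\<integral>\<^sup>+x. (Y x) ^ (2 ^ k) \<partial>N"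
  have "(\<integral>\<^sup>+x. Y x \<partial>N) ^ (2 ^ Suc k) = ((\<integral>\<^sup>+x. Y x \<partial>N) ^ (2 ^ k))\<^sup>2"
    by (simp add: power_mult[symmetric] mult.commute)
  also have "\<dots> \<le> (?I * ?m ^ (2 ^ k - 1))\<^sup>2" by (intro power_mono Suc) simp
  also have "\<dots> = (\<integral>\<^sup>+x. (Y x) ^ (2 ^ k) * 1 \<partial>N)\<^sup>2 * ?m ^ (2 * (2 ^ k - 1))"
    by (simp add: power_mult_distrib power_mult[symmetric] mult.commute)
  also have "\<dots> \<le> ((\<integral>\<^sup>+x. ((Y x) ^ (2 ^ k))\<^sup>2 \<partial>N) * (\<integral>\<^sup>+x. 1\<^sup>2 \<partial>N)) * ?m ^ (2 * (2 ^ k - 1))"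
    by (intro mult_right_mono Cauchy_Schwarz_nn_integral) auto
  also have "\<dots> = (\<integral>\<^sup>+x. (Y x) ^ (2 ^ Suc k) \<partial>N) * ?m ^ (1 + 2 * (2 ^ k - 1))"
    by (simp add: power_mult[symmetric] mult_ac)
  also have "1 + 2 * (2 ^ k - 1) = 2 ^ Suc k - (1::nat)"
  proof -
    have "1 \<le> (2::nat) ^ k" by simp
    then show ?thesis unfolding power_Suc by arith
  qed
  finally show ?case .
qed simp

lemma all_moments_integral:
  assumes N: "finite_measure N" and M: "finite_measure M" and Z: "all_moments (N \<Otimes>\<^sub>M M) (\<lambda>p. Z (fst p) (snd p))"
  shows "all_moments M (\<lambda>\<omega>. \<integral>x. Z x \<omega> \<partial>N)"
proof (rule all_moments_dyadic[OF M])
  interpret N: finite_measure N by fact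
  interpret M: finite_measure M by fact
  interpret pair_sigma_finite N M ..
  note [measurable] = all_momentsD(1)[OF Z]
  have m[measurable (raw)]: "(\<lambda>y. Z (h y) (k y)) \<in> borel_measurable L"
    if "h \<in> L \<rightarrow>\<^sub>M N" "k \<in> L \<rightarrow>\<^sub>M M" for h k and L :: "'c measure"
    using measurable_compose[OF measurable_Pair[OF that] all_momentsD(1)[OF Z]] by simp
  show meas[measurable]: "(\<lambda>\<omega>. \<integral>x. Z x \<omega> \<partial>N) \<in> borel_measurable M" by measurable
  fix k :: nat
  have "(\<integral>\<^sup>+\<omega>. ennreal (\<bar>\<integral>x. Z x \<omega> \<partial>N\<bar> ^ (2 ^ k)) \<partial>M) \<le> (\<integral>\<^sup>+\<omega>. (\<integral>\<^sup>+x. ennreal (\<bar>Z x \<omega>\<bar> ^ (2 ^ k)) \<partial>N) * emeasure N (space N) ^ (2 ^ k - 1) \<partial>M)"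
  proof (intro nn_integral_mono)
    fix \<omega> assume [measurable]: "\<omega> \<in> space M"
    have "ennreal (\<bar>\<integral>x. Z x \<omega> \<partial>N\<bar> ^ (2 ^ k)) = (ennreal (norm (\<integral>x. Z x \<omega> \<partial>N))) ^ (2 ^ k)"
      by (simp add: ennreal_power)
    also have "\<dots> \<le> (\<integral>\<^sup>+x. ennreal (norm (Z x \<omega>)) \<partial>N) ^ (2 ^ k)"
      by (intro power_mono norm_integral_le_nn_integral) simp
    also have "\<dots> \<le> (\<integral>\<^sup>+x. (ennreal (norm (Z x \<omega>))) ^ (2 ^ k) \<partial>N) * emeasure N (space N) ^ (2 ^ k - 1)"
      by (rule nn_integral_dyadic_power) measurable
    finally show "ennreal (\<bar>\<integral>x. Z x \<omega> \<partial>N\<bar> ^ (2 ^ k)) \<le> (\<integral>\<^sup>+x. ennreal (\<bar>Z x \<omega>\<bar> ^ (2 ^ k)) \<partial>N) * emeasure N (space N) ^ (2 ^ k - 1)"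
      by (simp add: ennreal_power)
  qed
  also have "\<dots> = (\<integral>\<^sup>+\<omega>. \<integral>\<^sup>+x. ennreal (\<bar>Z x \<omega>\<bar> ^ (2 ^ k)) \<partial>N \<partial>M) * emeasure N (space N) ^ (2 ^ k - 1)"
    by (rule nn_integral_multc) measurable
  also have "(\<integral>\<^sup>+\<omega>. \<integral>\<^sup>+x. ennreal (\<bar>Z x \<omega>\<bar> ^ (2 ^ k)) \<partial>N \<partial>M) = (\<integral>\<^sup>+p. ennreal (\<bar>Z (fst p) (snd p)\<bar> ^ (2 ^ k)) \<partial>(N \<Otimes>\<^sub>M M))"
    by (subst nn_integral_snd[symmetric]) auto
  also have "\<dots> * emeasure N (space N) ^ (2 ^ k - 1) < \<infinity>"
  proof -
    have "integrable (N \<Otimes>\<^sub>M M) (\<lambda>p. \<bar>Z (fst p) (snd p)\<bar> ^ (2 ^ k))" by (rule all_momentsD(2)[OF Z])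
    then have "(\<integral>\<^sup>+p. ennreal (\<bar>Z (fst p) (snd p)\<bar> ^ (2 ^ k)) \<partial>(N \<Otimes>\<^sub>M M)) < \<infinity>"
      by (simp add: integrable_iff_bounded)
    then show ?thesis
      using N.finite_emeasure_space[unfolded infinity_ennreal_def, THEN top.not_eq_extremum[THEN iffD1]]
      by (simp add: infinity_ennreal_def ennreal_mult_less_top power_less_top_ennreal less_top)
  qed
  finally have fin: "(\<integral>\<^sup>+\<omega>. ennreal (\<bar>\<integral>x. Z x \<omega> \<partial>N\<bar> ^ (2 ^ k)) \<partial>M) < \<infinity>" .
  show "integrable M (\<lambda>\<omega>. \<bar>\<integral>x. Z x \<omega> \<partial>N\<bar> ^ (2 ^ k))"
    unfolding integrable_iff_bounded
  proof
    show "(\<lambda>\<omega>. \<bar>\<integral>x. Z x \<omega> \<partial>N\<bar> ^ (2 ^ k)) \<in> borel_measurable M" by measurable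
  qed (use fin in simp)
qed

lemma all_moments_Fubini:
  assumes N: "finite_measure N" and M: "finite_measure M" and H: "all_moments (N \<Otimes>\<^sub>M M) (\<lambda>p. H (fst p) (snd p))"
    and Z: "all_moments M Z"
  shows "(\<integral>\<omega>. (\<integral>x. H x \<omega> \<partial>N) * Z \<omega> \<partial>M) = (\<integral>x. (\<integral>\<omega>. H x \<omega> * Z \<omega> \<partial>M) \<partial>N)"
    "integrable N (\<lambda>x. \<integral>\<omega>. H x \<omega> * Z \<omega> \<partial>M)"
proof -
  interpret N: finite_measure N by fact
  interpret M: finite_measure M by fact
  interpret pair_sigma_finite N M ..
  have "all_moments (N \<Otimes>\<^sub>M M) (\<lambda>p. H (fst p) (snd p) * Z (snd p))"
    by (intro all_moments_mult H all_moments_snd N M Z)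
  then have i: "integrable (N \<Otimes>\<^sub>M M) (\<lambda>(x, \<omega>). H x \<omega> * Z \<omega>)"
    using all_momentsD(4) by (simp add: case_prod_unfold)
  have "(\<integral>\<omega>. (\<integral>x. H x \<omega> \<partial>N) * Z \<omega> \<partial>M) = (\<integral>\<omega>. \<integral>x. H x \<omega> * Z \<omega> \<partial>N \<partial>M)" by simp
  also have "\<dots> = (\<integral>x. \<integral>\<omega>. H x \<omega> * Z \<omega> \<partial>M \<partial>N)" using Fubini_integral[OF i] by simp
  finally show "(\<integral>\<omega>. (\<integral>x. H x \<omega> \<partial>N) * Z \<omega> \<partial>M) = (\<integral>x. (\<integral>\<omega>. H x \<omega> * Z \<omega> \<partial>M) \<partial>N)" .
  show "integrable N (\<lambda>x. \<integral>\<omega>. H x \<omega> * Z \<omega> \<partial>M)" using integrable_fst'[OF i] by simp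
qed

section \<open>Gaussian integration by parts\<close>

text \<open>
  All ways to take one entry out of a list, with the rest of the list: the summands of Wick's
  formula for the first factor of a product.
\<close>

fun picks :: "'b list \<Rightarrow> ('b \<times> 'b list) list" where
  "picks [] = []"
| "picks (x # xs) = (x, xs) # map (\<lambda>(y, ys). (y, x # ys)) (picks xs)"

lemma sum_picks_Cons:
  fixes h :: "'b \<Rightarrow> 'b list \<Rightarrow> 'c::comm_monoid_add"
  shows "(\<Sum>(y, ys)\<leftarrow>picks (x # xs). h y ys) = h x xs + (\<Sum>(y, ys)\<leftarrow>picks xs. h y (x # ys))"
  by (simp add: o_def case_prod_unfold)

lemma set_picks: "(y, ys) \<in> set (picks xs) \<Longrightarrow> y \<in> set xs \<and> set ys \<subseteq> set xs \<and> length xs = Suc (length ys)"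
  by (induction xs arbitrary: y ys) (auto split: prod.splits, blast+)

lemma iexp_second_order: "norm (cis (a + e * x) - cis a - complex_of_real e * (\<i> * complex_of_real x * cis a)) \<le> e\<^sup>2 * x\<^sup>2"
proof -
  have "cis (a + e * x) = cis a * cis (e * x)" by (simp add: cis_mult)
  then have "cis (a + e * x) - cis a - complex_of_real e * (\<i> * complex_of_real x * cis a)
      = cis a * (cis (e * x) - (1 + \<i> * complex_of_real (e * x)))" by (simp add: algebra_simps)
  also have "norm \<dots> = norm (cis (e * x) - (1 + \<i> * complex_of_real (e * x)))" by (simp add: norm_mult)
  also have "\<dots> \<le> \<bar>e * x\<bar>\<^sup>2 / 2"
    using iexp_approx1[of "e * x" 1] by (simp add: cis_conv_exp numeral_2_eq_2)
  also have "\<dots> \<le> e\<^sup>2 * x\<^sup>2" by (simp add: power_mult_distrib)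
  finally show ?thesis .
qed

text \<open>
  Gaussianity is used only through the characteristic functions of linear combinations; the
  moments are to be bounded uniformly in time, which for the processes considered here follows
  from stationarity of the variance.
\<close>

locale gaussian_field = prob_space M for M :: "'a measure" +
  fixes X :: "real \<Rightarrow> 'a \<Rightarrow> real" and R :: "real \<Rightarrow> real \<Rightarrow> real"
  assumes X_joint: "(\<lambda>p. X (fst p) (snd p)) \<in> borel_measurable (borel \<Otimes>\<^sub>M M)"
    and X_moments: "\<And>n::nat. \<exists>C. \<forall>t. integrable M (\<lambda>\<omega>. \<bar>X t \<omega>\<bar> ^ n) \<and> (\<integral>\<omega>. \<bar>X t \<omega>\<bar> ^ n \<partial>M) \<le> C"
    and R_def: "\<And>s t. R s t = (\<integral>\<omega>. X s \<omega> * X t \<omega> \<partial>M)"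
    and X_char: "\<And>J c. finite J \<Longrightarrow> (\<integral>\<omega>. cis (\<Sum>t\<in>J. c t * X t \<omega>) \<partial>M)
       = complex_of_real (exp (- (\<integral>\<omega>. (\<Sum>t\<in>J. c t * X t \<omega>)\<^sup>2 \<partial>M) / 2))"
begin

lemma finM: "finite_measure M" by unfold_locales

lemma X_measurable [measurable]: "X t \<in> borel_measurable M"
  using measurable_compose[OF measurable_Pair1' X_joint, of t] by simp

lemma X_measurable_compose [measurable (raw)]:
  assumes "h \<in> borel_measurable L" "k \<in> L \<rightarrow>\<^sub>M M" shows "(\<lambda>y. X (h y) (k y)) \<in> borel_measurable L"
  using measurable_compose[OF measurable_Pair[OF assms] X_joint] by simp

lemma am_X: "all_moments M (X t)"
  using X_moments by (auto simp: all_moments_def)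

lemma am_X_pair:
  assumes N: "finite_measure N" and [measurable]: "h \<in> borel_measurable N"
  shows "all_moments (N \<Otimes>\<^sub>M M) (\<lambda>p. X (h (fst p)) (snd p))"
proof -
  interpret N: finite_measure N by fact
  interpret pair_sigma_finite N M ..
  have "integrable (N \<Otimes>\<^sub>M M) (\<lambda>p. \<bar>X (h (fst p)) (snd p)\<bar> ^ n)" for n
  proof (rule Fubini_integrable)
    obtain C where C: "\<And>t. integrable M (\<lambda>\<omega>. \<bar>X t \<omega>\<bar> ^ n)" "\<And>t. (\<integral>\<omega>. \<bar>X t \<omega>\<bar> ^ n \<partial>M) \<le> C" using X_moments[of n] by blast
    show "integrable N (\<lambda>x. \<integral>y. norm (\<bar>X (h (fst (x, y))) (snd (x, y))\<bar> ^ n) \<partial>M)"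
      using C(2) by (intro N.integrable_const_bound[of _ C]) (auto simp: abs_of_nonneg integral_nonneg_AE)
    show "AE x in N. integrable M (\<lambda>y. \<bar>X (h (fst (x, y))) (snd (x, y))\<bar> ^ n)" using C(1) by simp
  qed measurable
  then show ?thesis by (simp add: all_moments_def)
qed

lemma R_sym: "R s t = R t s" by (simp add: R_def mult.commute)

lemma R_measurable: "(\<lambda>q. R (fst q) (snd q)) \<in> borel_measurable (borel \<Otimes>\<^sub>M borel)"
  unfolding R_def by measurable

lemma R_measurable_compose [measurable (raw)]:
  assumes "h \<in> borel_measurable L" "k \<in> borel_measurable L" shows "(\<lambda>y. R (h y) (k y)) \<in> borel_measurable L"
  using measurable_compose[OF measurable_Pair[OF assms] R_measurable] by simp

lemma R_bdd: "bdd (\<lambda>x. R (h x) (k x))"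
proof -
  obtain C where C: "\<And>t. integrable M (\<lambda>\<omega>. \<bar>X t \<omega>\<bar> ^ 2)" "\<And>t. (\<integral>\<omega>. \<bar>X t \<omega>\<bar> ^ 2 \<partial>M) \<le> C" using X_moments[of 2] by blast
  have "\<bar>R s t\<bar> \<le> C + C" for s t
  proof -
    have "\<bar>R s t\<bar> \<le> (\<integral>\<omega>. \<bar>X s \<omega> * X t \<omega>\<bar> \<partial>M)" unfolding R_def by (rule integral_abs_bound)
    also have "\<dots> \<le> (\<integral>\<omega>. \<bar>X s \<omega>\<bar> ^ 2 + \<bar>X t \<omega>\<bar> ^ 2 \<partial>M)"
    proof (rule integral_mono')
      fix \<omega>
      have "2 * (\<bar>X s \<omega>\<bar> * \<bar>X t \<omega>\<bar>) \<le> \<bar>X s \<omega>\<bar> ^ 2 + \<bar>X t \<omega>\<bar> ^ 2"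
        using sum_squares_bound[of "\<bar>X s \<omega>\<bar>" "\<bar>X t \<omega>\<bar>"] by simp
      moreover have "0 \<le> \<bar>X s \<omega>\<bar> * \<bar>X t \<omega>\<bar>" by simp
      ultimately show "\<bar>X s \<omega> * X t \<omega>\<bar> \<le> \<bar>X s \<omega>\<bar> ^ 2 + \<bar>X t \<omega>\<bar> ^ 2" unfolding abs_mult by linarith
    qed (use C in auto)
    also have "\<dots> = (\<integral>\<omega>. \<bar>X s \<omega>\<bar> ^ 2 \<partial>M) + (\<integral>\<omega>. \<bar>X t \<omega>\<bar> ^ 2 \<partial>M)" using C(1) by simp
    also have "\<dots> \<le> C + C" by (intro add_mono C)
    finally show ?thesis .
  qed
  then show ?thesis by (intro bddI[of _ "C + C"]) simp
qed

definition lin :: "('a \<Rightarrow> real) set" where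
  "lin = {L. \<exists>J c. finite J \<and> L = (\<lambda>\<omega>. \<Sum>t\<in>J. c t * X t \<omega>)}"

lemma lin_zero: "(\<lambda>\<omega>. 0) \<in> lin"
  unfolding lin_def by (auto intro!: exI[of _ "{}"])

lemma lin_add: assumes "L \<in> lin" shows "(\<lambda>\<omega>. L \<omega> + e * X v \<omega>) \<in> lin"
proof -
  obtain J c where J: "finite J" "L = (\<lambda>\<omega>. \<Sum>t\<in>J. c t * X t \<omega>)" using assms by (auto simp: lin_def)
  define c' where "c' t = (if t \<in> J then c t else 0) + (if t = v then e else 0)" for t
  have "L \<omega> + e * X v \<omega> = (\<Sum>t\<in>insert v J. c' t * X t \<omega>)" for \<omega>
  proof -
    have "(\<Sum>t\<in>insert v J. c' t * X t \<omega>) = (\<Sum>t\<in>insert v J. (if t \<in> J then c t * X t \<omega> else 0)) + (\<Sum>t\<in>insert v J. (if t = v then e * X t \<omega> else 0))"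
      unfolding c'_def sum.distrib[symmetric] by (intro sum.cong) (auto simp: algebra_simps)
    also have "(\<Sum>t\<in>insert v J. (if t = v then e * X t \<omega> else 0)) = e * X v \<omega>" using J(1) by (simp add: sum.delta)
    also have "(\<Sum>t\<in>insert v J. (if t \<in> J then c t * X t \<omega> else 0)) = (\<Sum>t\<in>J. c t * X t \<omega>)"
      using J(1) by (intro sum.mono_neutral_cong_right) auto
    finally show ?thesis by (simp add: J(2))
  qed
  then show ?thesis using J(1) unfolding lin_def by blast
qed

lemma am_lin: "L \<in> lin \<Longrightarrow> all_moments M L"
  unfolding lin_def by (auto intro!: all_moments_sum all_moments_cmult am_X finM)

lemma integrable_cis_am:
  assumes "all_moments M Z" "L \<in> borel_measurable M"
  shows "integrable M (\<lambda>\<omega>. complex_of_real (Z \<omega>) * cis (L \<omega>))"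
  using integrable_cis_mult[OF integrable_of_real[OF all_momentsD(4)[OF assms(1)]] assms(2)] by (simp add: mult.commute)

lemma char_derivative:
  assumes Z: "all_moments M Z" and L: "all_moments M L"
  shows "((\<lambda>e. \<integral>\<omega>. complex_of_real (Z \<omega>) * cis (L \<omega> + e * X v \<omega>) \<partial>M)
     has_vector_derivative \<i> * (\<integral>\<omega>. complex_of_real (Z \<omega> * X v \<omega>) * cis (L \<omega>) \<partial>M)) (at 0)"
proof -
  note [measurable] = all_momentsD(1)[OF Z] all_momentsD(1)[OF L]
  let ?I = "\<lambda>e. \<integral>\<omega>. complex_of_real (Z \<omega>) * cis (L \<omega> + e * X v \<omega>) \<partial>M"
  let ?D = "\<i> * (\<integral>\<omega>. complex_of_real (Z \<omega> * X v \<omega>) * cis (L \<omega>) \<partial>M)"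
  define B where "B = (\<integral>\<omega>. \<bar>Z \<omega>\<bar> * (X v \<omega>)\<^sup>2 \<partial>M)"
  have amZ: "all_moments M (\<lambda>\<omega>. \<bar>Z \<omega>\<bar>)" using Z by (auto simp: all_moments_def)
  have bnd: "norm (?I e - ?I 0 - e *\<^sub>R ?D) \<le> e\<^sup>2 * B" for e
  proof -
    have i1: "integrable M (\<lambda>\<omega>. complex_of_real (Z \<omega>) * cis (L \<omega> + d * X v \<omega>))" for d
      by (intro integrable_cis_am Z) measurable
    have i2: "integrable M (\<lambda>\<omega>. complex_of_real (Z \<omega> * X v \<omega>) * cis (L \<omega>))"
      by (intro integrable_cis_am all_moments_mult Z am_X) measurable
    have "?I e - ?I 0 - e *\<^sub>R ?D = (\<integral>\<omega>. complex_of_real (Z \<omega>) * cis (L \<omega> + e * X v \<omega>) - complex_of_real (Z \<omega>) * cis (L \<omega> + 0 * X v \<omega>)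
        - complex_of_real e * \<i> * (complex_of_real (Z \<omega> * X v \<omega>) * cis (L \<omega>)) \<partial>M)"
      using i1[of e] i1[of 0] i2 by (simp add: scaleR_conv_of_real mult.assoc)
    also have "\<dots> = (\<integral>\<omega>. complex_of_real (Z \<omega>) * (cis (L \<omega> + e * X v \<omega>) - cis (L \<omega>) - complex_of_real e * (\<i> * complex_of_real (X v \<omega>) * cis (L \<omega>))) \<partial>M)"
      by (intro Bochner_Integration.integral_cong) (auto simp: algebra_simps)
    finally have "norm (?I e - ?I 0 - e *\<^sub>R ?D)
        \<le> (\<integral>\<omega>. norm (complex_of_real (Z \<omega>) * (cis (L \<omega> + e * X v \<omega>) - cis (L \<omega>) - complex_of_real e * (\<i> * complex_of_real (X v \<omega>) * cis (L \<omega>)))) \<partial>M)"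
      by (simp only: integral_norm_bound)
    also have "\<dots> \<le> (\<integral>\<omega>. e\<^sup>2 * (\<bar>Z \<omega>\<bar> * (X v \<omega>)\<^sup>2) \<partial>M)"
    proof (rule integral_mono')
      show "integrable M (\<lambda>\<omega>. e\<^sup>2 * (\<bar>Z \<omega>\<bar> * (X v \<omega>)\<^sup>2))"
        unfolding power2_eq_square[of "X v _"]
        by (intro integrable_mult_right all_momentsD(4) all_moments_mult amZ am_X)
      fix \<omega>
      show "norm (complex_of_real (Z \<omega>) * (cis (L \<omega> + e * X v \<omega>) - cis (L \<omega>) - complex_of_real e * (\<i> * complex_of_real (X v \<omega>) * cis (L \<omega>)))) \<le> e\<^sup>2 * (\<bar>Z \<omega>\<bar> * (X v \<omega>)\<^sup>2)"
        using mult_left_mono[OF iexp_second_order[of "L \<omega>" e "X v \<omega>"], of "\<bar>Z \<omega>\<bar>"] by (simp add: norm_mult mult_ac)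
    qed auto
    finally show ?thesis by (simp add: B_def)
  qed
  have "((\<lambda>e. norm (?I (0 + e) - ?I 0 - e *\<^sub>R ?D) / norm e) \<longlongrightarrow> 0) (at 0)"
  proof (rule Lim_null_comparison)
    show "\<forall>\<^sub>F e in at 0. norm (norm (?I (0 + e) - ?I 0 - e *\<^sub>R ?D) / norm e) \<le> \<bar>e\<bar> * B"
    proof (intro always_eventually allI)
      fix e :: real
      have "norm (?I e - ?I 0 - e *\<^sub>R ?D) / \<bar>e\<bar> \<le> e\<^sup>2 * B / \<bar>e\<bar>" using bnd by (rule divide_right_mono) simp
      also have "\<dots> = \<bar>e\<bar> * B" by (cases "e = 0") (auto simp: power2_eq_square abs_if)
      finally show "norm (norm (?I (0 + e) - ?I 0 - e *\<^sub>R ?D) / norm e) \<le> \<bar>e\<bar> * B" by simp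
    qed
    show "((\<lambda>e. \<bar>e\<bar> * B) \<longlongrightarrow> 0) (at (0::real))"
      by (intro tendsto_mult_left_zero tendsto_rabs_zero tendsto_ident_at)
  qed
  then show ?thesis
    unfolding has_vector_derivative_def has_derivative_at by (auto simp: bounded_linear_scaleR_left)
qed

lemma char_lin:
  assumes "L \<in> lin" shows "(\<integral>\<omega>. cis (L \<omega>) \<partial>M) = complex_of_real (exp (- (\<integral>\<omega>. (L \<omega>)\<^sup>2 \<partial>M) / 2))"
  using assms X_char by (auto simp: lin_def)

text \<open>
  The derivative at zero of the characteristic function of \<open>L + e X(u)\<close>, computed in two ways.
\<close>

lemma Stein_lin:
  assumes L: "L \<in> lin"
  shows "(\<integral>\<omega>. complex_of_real (X u \<omega>) * cis (L \<omega>) \<partial>M) = \<i> * complex_of_real (\<integral>\<omega>. X u \<omega> * L \<omega> \<partial>M) * (\<integral>\<omega>. cis (L \<omega>) \<partial>M)"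
proof -
  have am1: "all_moments M (\<lambda>_. 1)" by (rule all_moments_const[OF finM])
  let ?v = "\<integral>\<omega>. (L \<omega>)\<^sup>2 \<partial>M" and ?c = "\<integral>\<omega>. X u \<omega> * L \<omega> \<partial>M" and ?w = "\<integral>\<omega>. (X u \<omega>)\<^sup>2 \<partial>M"
  have var: "(\<integral>\<omega>. (L \<omega> + e * X u \<omega>)\<^sup>2 \<partial>M) = ?v + 2 * e * ?c + e\<^sup>2 * ?w" for e
  proof -
    have "integrable M (\<lambda>\<omega>. (L \<omega>)\<^sup>2)" "integrable M (\<lambda>\<omega>. X u \<omega> * L \<omega>)" "integrable M (\<lambda>\<omega>. (X u \<omega>)\<^sup>2)"
      using all_momentsD(3)[OF am_lin[OF L], of 2] all_momentsD(3)[OF am_X, of u 2] all_momentsD(4)[OF all_moments_mult[OF am_X[of u] am_lin[OF L]]] by auto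
    moreover have "(\<integral>\<omega>. (L \<omega> + e * X u \<omega>)\<^sup>2 \<partial>M) = (\<integral>\<omega>. (L \<omega>)\<^sup>2 + (2 * e) * (X u \<omega> * L \<omega>) + e\<^sup>2 * (X u \<omega>)\<^sup>2 \<partial>M)"
      by (intro Bochner_Integration.integral_cong) (auto simp: power2_sum power_mult_distrib)
    ultimately show ?thesis by simp
  qed
  have "((\<lambda>e. \<integral>\<omega>. complex_of_real 1 * cis (L \<omega> + e * X u \<omega>) \<partial>M) has_vector_derivative \<i> * (\<integral>\<omega>. complex_of_real (1 * X u \<omega>) * cis (L \<omega>) \<partial>M)) (at 0)"
    by (rule char_derivative[OF am1 am_lin[OF L]])
  then have d1: "((\<lambda>e. complex_of_real (exp (- (?v + 2 * e * ?c + e\<^sup>2 * ?w) / 2))) has_vector_derivative \<i> * (\<integral>\<omega>. complex_of_real (X u \<omega>) * cis (L \<omega>) \<partial>M)) (at 0)"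
    by (simp add: char_lin[OF lin_add[OF L]] var)
  have "((\<lambda>e. exp (- (?v + 2 * e * ?c + e\<^sup>2 * ?w) / 2)) has_real_derivative exp (- ?v / 2) * (- ?c)) (at 0)"
    by (auto intro!: derivative_eq_intros)
  then have "((\<lambda>e. complex_of_real (exp (- (?v + 2 * e * ?c + e\<^sup>2 * ?w) / 2))) has_vector_derivative complex_of_real (exp (- ?v / 2) * (- ?c))) (at 0)"
    by (intro has_vector_derivative_of_real) (simp add: has_real_derivative_iff_has_vector_derivative)
  with d1 have "\<i> * (\<integral>\<omega>. complex_of_real (X u \<omega>) * cis (L \<omega>) \<partial>M) = complex_of_real (exp (- ?v / 2) * (- ?c))"
    by (rule vector_derivative_unique_at)
  then have "\<i> * (\<integral>\<omega>. complex_of_real (X u \<omega>) * cis (L \<omega>) \<partial>M) = \<i> * (\<i> * complex_of_real ?c * (\<integral>\<omega>. cis (L \<omega>) \<partial>M))"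
    by (simp add: char_lin[OF L] mult.commute flip: mult.assoc)
  then show ?thesis by simp
qed

definition PX :: "real list \<Rightarrow> 'a \<Rightarrow> real" where
  "PX vs \<omega> = prod_list (map (\<lambda>v. X v \<omega>) vs)"

lemma PX_Cons: "PX (v # vs) \<omega> = X v \<omega> * PX vs \<omega>" and PX_Nil: "PX [] \<omega> = 1"
  by (simp_all add: PX_def)

lemma am_PX: "all_moments M (PX vs)"
  unfolding PX_def[abs_def] by (intro all_moments_prod_list finM am_X)

lemma has_vector_derivative_sum_list:
  assumes "\<And>x. x \<in> set xs \<Longrightarrow> (h x has_vector_derivative h' x) F"
  shows "((\<lambda>e. \<Sum>x\<leftarrow>xs. h x e) has_vector_derivative (\<Sum>x\<leftarrow>xs. h' x)) F"
  using assms by (induction xs) (auto intro!: derivative_eq_intros)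

text \<open>
  Differentiation in the direction \<open>X(v)\<close> produces one more factor \<open>X(v)\<close> on both sides. To
  have a direction at hand in every step, the exponential of an arbitrary linear combination
  is carried along.
\<close>

lemma Wick_exp:
  assumes "L \<in> lin"
  shows "(\<integral>\<omega>. complex_of_real (X u \<omega> * PX vs \<omega>) * cis (L \<omega>) \<partial>M)
    = (\<Sum>(y, ys)\<leftarrow>picks vs. complex_of_real (R u y) * (\<integral>\<omega>. complex_of_real (PX ys \<omega>) * cis (L \<omega>) \<partial>M))
    + \<i> * complex_of_real (\<integral>\<omega>. X u \<omega> * L \<omega> \<partial>M) * (\<integral>\<omega>. complex_of_real (PX vs \<omega>) * cis (L \<omega>) \<partial>M)"
  using assms
proof (induction vs arbitrary: L)
  case Nil
  then show ?case using Stein_lin by (simp add: PX_Nil)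
next
  case (Cons v vs)
  let ?E = "\<lambda>Z. \<integral>\<omega>. complex_of_real (Z \<omega>) * cis (L \<omega>) \<partial>M"
  let ?Ee = "\<lambda>Z e. \<integral>\<omega>. complex_of_real (Z \<omega>) * cis (L \<omega> + e * X v \<omega>) \<partial>M"
  let ?c = "\<integral>\<omega>. X u \<omega> * L \<omega> \<partial>M"
  have amL: "all_moments M L" by (rule am_lin[OF Cons.prems])
  have der: "(?Ee Z has_vector_derivative \<i> * ?E (\<lambda>\<omega>. Z \<omega> * X v \<omega>)) (at 0)" if "all_moments M Z" for Z
    by (rule char_derivative[OF that amL])
  have "integrable M (\<lambda>\<omega>. X u \<omega> * L \<omega>)" "integrable M (\<lambda>\<omega>. X u \<omega> * X v \<omega>)"
    by (intro all_momentsD(4) all_moments_mult am_X amL)+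
  then have c: "(\<integral>\<omega>. X u \<omega> * (L \<omega> + e * X v \<omega>) \<partial>M) = ?c + e * R u v" for e
    by (simp add: R_def distrib_left mult.left_commute[of _ e])
  have IH: "?Ee (\<lambda>\<omega>. X u \<omega> * PX vs \<omega>) = (\<lambda>e. (\<Sum>q\<leftarrow>picks vs. complex_of_real (R u (fst q)) * ?Ee (PX (snd q)) e)
      + \<i> * complex_of_real (?c + e * R u v) * ?Ee (PX vs) e)"
    using Cons.IH[OF lin_add[OF Cons.prems]] by (auto simp: c case_prod_unfold)
  have "((\<lambda>e. (\<Sum>q\<leftarrow>picks vs. complex_of_real (R u (fst q)) * ?Ee (PX (snd q)) e) + \<i> * complex_of_real (?c + e * R u v) * ?Ee (PX vs) e)
    has_vector_derivative (\<Sum>q\<leftarrow>picks vs. complex_of_real (R u (fst q)) * (\<i> * ?E (\<lambda>\<omega>. PX (snd q) \<omega> * X v \<omega>)))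
      + (\<i> * complex_of_real (?c + 0 * R u v) * (\<i> * ?E (\<lambda>\<omega>. PX vs \<omega> * X v \<omega>)) + \<i> * complex_of_real (R u v) * ?Ee (PX vs) 0)) (at 0)"
  proof (intro has_vector_derivative_add has_vector_derivative_sum_list has_vector_derivative_mult_right der am_PX has_vector_derivative_mult)
    have "((\<lambda>e. ?c + e * R u v) has_real_derivative R u v) (at 0)" by (auto intro!: derivative_eq_intros)
    then show "((\<lambda>e. complex_of_real (?c + e * R u v)) has_vector_derivative complex_of_real (R u v)) (at 0)"
      by (intro has_vector_derivative_of_real) (simp add: has_real_derivative_iff_has_vector_derivative)
  qed
  moreover have "(?Ee (\<lambda>\<omega>. X u \<omega> * PX vs \<omega>) has_vector_derivative \<i> * ?E (\<lambda>\<omega>. X u \<omega> * PX vs \<omega> * X v \<omega>)) (at 0)"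
    by (intro der all_moments_mult am_X am_PX)
  ultimately have "\<i> * ?E (\<lambda>\<omega>. X u \<omega> * PX vs \<omega> * X v \<omega>) = (\<Sum>q\<leftarrow>picks vs. complex_of_real (R u (fst q)) * (\<i> * ?E (\<lambda>\<omega>. PX (snd q) \<omega> * X v \<omega>)))
      + (\<i> * complex_of_real (?c + 0 * R u v) * (\<i> * ?E (\<lambda>\<omega>. PX vs \<omega> * X v \<omega>)) + \<i> * complex_of_real (R u v) * ?Ee (PX vs) 0)"
    unfolding IH by (rule vector_derivative_unique_at[rotated])
  also have "\<dots> = \<i> * ((\<Sum>q\<leftarrow>picks vs. complex_of_real (R u (fst q)) * ?E (\<lambda>\<omega>. PX (snd q) \<omega> * X v \<omega>))
      + \<i> * complex_of_real ?c * ?E (\<lambda>\<omega>. PX vs \<omega> * X v \<omega>) + complex_of_real (R u v) * ?E (PX vs))"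
    by (simp add: sum_list_const_mult[symmetric] distrib_left mult_ac)
  finally have "?E (\<lambda>\<omega>. X u \<omega> * PX vs \<omega> * X v \<omega>) = (\<Sum>q\<leftarrow>picks vs. complex_of_real (R u (fst q)) * ?E (\<lambda>\<omega>. PX (snd q) \<omega> * X v \<omega>))
      + \<i> * complex_of_real ?c * ?E (\<lambda>\<omega>. PX vs \<omega> * X v \<omega>) + complex_of_real (R u v) * ?E (PX vs)"
    by simp
  then show ?case unfolding sum_picks_Cons by (simp add: PX_Cons case_prod_unfold mult_ac add_ac)
qed

theorem Wick:
  "(\<integral>\<omega>. X u \<omega> * PX vs \<omega> \<partial>M) = (\<Sum>(y, ys)\<leftarrow>picks vs. R u y * (\<integral>\<omega>. PX ys \<omega> \<partial>M))"
proof -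
  have r: "(\<integral>\<omega>. complex_of_real (Z \<omega>) * cis 0 \<partial>M) = complex_of_real (\<integral>\<omega>. Z \<omega> \<partial>M)" for Z by simp
  have of_sum: "complex_of_real (sum_list (map h xs)) = (\<Sum>x\<leftarrow>xs. complex_of_real (h x))" for h and xs :: "(real \<times> real list) list"
    by (induction xs) auto
  have "complex_of_real (\<integral>\<omega>. X u \<omega> * PX vs \<omega> \<partial>M) = complex_of_real (\<Sum>(y, ys)\<leftarrow>picks vs. R u y * (\<integral>\<omega>. PX ys \<omega> \<partial>M))"
    using Wick_exp[OF lin_zero, of u vs] unfolding r of_sum by (simp add: case_prod_unfold)
  then show ?thesis by (simp only: of_real_eq_iff)
qed

end

section \<open>Moments of quadratic functionals\<close>

lemma integral_sum_list:
  fixes h :: "'b \<Rightarrow> 'c \<Rightarrow> real"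
  assumes "\<And>x. x \<in> set xs \<Longrightarrow> integrable N (h x)"
  shows "integrable N (\<lambda>p. \<Sum>x\<leftarrow>xs. h x p)" "(\<integral>p. (\<Sum>x\<leftarrow>xs. h x p) \<partial>N) = (\<Sum>x\<leftarrow>xs. \<integral>p. h x p \<partial>N)"
proof -
  have "integrable N (\<lambda>p. \<Sum>x\<leftarrow>xs. h x p) \<and> (\<integral>p. (\<Sum>x\<leftarrow>xs. h x p) \<partial>N) = (\<Sum>x\<leftarrow>xs. \<integral>p. h x p \<partial>N)"
    using assms by (induction xs) auto
  then show "integrable N (\<lambda>p. \<Sum>x\<leftarrow>xs. h x p)" "(\<integral>p. (\<Sum>x\<leftarrow>xs. h x p) \<partial>N) = (\<Sum>x\<leftarrow>xs. \<integral>p. h x p \<partial>N)" by auto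
qed

lemma sum_list_fun_diff:
  fixes h k :: "'b \<Rightarrow> real"
  shows "(\<Sum>x\<leftarrow>xs. h x) - (\<Sum>x\<leftarrow>xs. k x) = (\<Sum>x\<leftarrow>xs. h x - k x)"
  by (induction xs) auto

text \<open>
  The kernels \<open>K n\<close> with \<open>n \<ge> 1\<close> are the powers of \<open>K 1\<close> with respect to composition through
  the covariance.
\<close>

locale quadratic_functionals = gaussian_field M X R for M :: "'a measure" and X R +
  fixes S :: "real measure" and K :: "nat \<Rightarrow> real \<Rightarrow> real \<Rightarrow> real"
  assumes S: "fin_borel S"
    and K_measurable: "\<And>n. (\<lambda>q. K n (fst q) (snd q)) \<in> borel_measurable (borel \<Otimes>\<^sub>M borel)"
    and K_bounded: "\<And>n. bdd (\<lambda>q. K n (fst q) (snd q))"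
    and K_sym: "\<And>n a b. K n a b = K n b a"
    and K_comp: "\<And>m n b d. 1 \<le> m \<Longrightarrow> 1 \<le> n \<Longrightarrow> K (m + n) b d = (\<integral>a. \<integral>c. K m b a * R a c * K n c d \<partial>S \<partial>S)"
begin

abbreviation SS :: "(real \<times> real) measure" where "SS \<equiv> S \<Otimes>\<^sub>M S"

lemma finS: "finite_measure S" and finSS: "finite_measure SS"
  and sets_S [measurable_cong]: "sets S = sets borel" and sigS: "sigma_finite_measure S"
  by (rule fin_borelD[OF S] finite_measure_pair_measure)+

lemma sets_SS: "sets SS = sets (borel \<Otimes>\<^sub>M borel)" by (rule sets_pair_measure_cong) (rule sets_S)+

lemma K_measurable_compose [measurable (raw)]:
  assumes "h \<in> borel_measurable L" "k \<in> borel_measurable L" shows "(\<lambda>y. K n (h y) (k y)) \<in> borel_measurable L"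
  using measurable_compose[OF measurable_Pair[OF assms] K_measurable] by simp

lemma K_bdd: "bdd (\<lambda>x. K n (h x) (k x))"
proof -
  obtain C where C: "\<And>q. norm (K n (fst q) (snd q)) \<le> C" by (rule bddE[OF K_bounded[of n]]) (rule that)
  have "norm (K n a b) \<le> C" for a b using C[of "(a, b)"] by simp
  then show ?thesis by (intro bddI[of _ C]) auto
qed

definition Q :: "nat \<Rightarrow> 'a \<Rightarrow> real" where
  "Q n \<omega> = (\<integral>p. K n (fst p) (snd p) * (X (fst p) \<omega> * X (snd p) \<omega> - R (fst p) (snd p)) \<partial>SS)"

text \<open>
  Half the derivative of the functional in the direction of \<open>X(u)\<close>: the kernel is symmetric,
  so both variables contribute equally.
\<close>

definition DQ :: "real \<Rightarrow> nat \<Rightarrow> 'a \<Rightarrow> real" where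
  "DQ u n \<omega> = (\<integral>p. R u (fst p) * K n (fst p) (snd p) * X (snd p) \<omega> \<partial>SS)"

definition PQ :: "nat list \<Rightarrow> 'a \<Rightarrow> real" where
  "PQ ns \<omega> = prod_list (map (\<lambda>n. Q n \<omega>) ns)"

text \<open>
  The trace of a power.
\<close>

definition ptr :: "nat \<Rightarrow> real" where
  "ptr n = (\<integral>p. K n (fst p) (snd p) * R (fst p) (snd p) \<partial>SS)"

lemma PQ_Cons: "PQ (n # ns) \<omega> = Q n \<omega> * PQ ns \<omega>" and PQ_Nil: "PQ [] \<omega> = 1"
  by (simp_all add: PQ_def)

lemma am_coefficient:
  assumes "h \<in> borel_measurable SS" "bdd h"
  shows "all_moments (SS \<Otimes>\<^sub>M M) (\<lambda>q. h (fst q))"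
  by (intro all_moments_fst finSS finM all_moments_bdd assms)

lemma am_Q_integrand: "all_moments (SS \<Otimes>\<^sub>M M)
    (\<lambda>q. K n (fst (fst q)) (snd (fst q)) * (X (fst (fst q)) (snd q) * X (snd (fst q)) (snd q) - R (fst (fst q)) (snd (fst q))))"
proof -
  have "all_moments (SS \<Otimes>\<^sub>M M) (\<lambda>q. K n (fst (fst q)) (snd (fst q)))"
    by (rule am_coefficient[of "\<lambda>p. K n (fst p) (snd p)"]) (measurable, rule K_bdd)
  moreover have "all_moments (SS \<Otimes>\<^sub>M M) (\<lambda>q. R (fst (fst q)) (snd (fst q)))"
    by (rule am_coefficient[of "\<lambda>p. R (fst p) (snd p)"]) (measurable, rule R_bdd)
  moreover have "all_moments (SS \<Otimes>\<^sub>M M) (\<lambda>q. X (fst (fst q)) (snd q))" "all_moments (SS \<Otimes>\<^sub>M M) (\<lambda>q. X (snd (fst q)) (snd q))"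
    by (intro am_X_pair finSS, measurable)+
  ultimately show ?thesis by (intro all_moments_mult all_moments_diff)
qed

lemma am_DQ_integrand: "all_moments (SS \<Otimes>\<^sub>M M)
    (\<lambda>q. R u (fst (fst q)) * K n (fst (fst q)) (snd (fst q)) * X (snd (fst q)) (snd q))"
proof -
  have "all_moments (SS \<Otimes>\<^sub>M M) (\<lambda>q. K n (fst (fst q)) (snd (fst q)))"
    by (rule am_coefficient[of "\<lambda>p. K n (fst p) (snd p)"]) (measurable, rule K_bdd)
  moreover have "all_moments (SS \<Otimes>\<^sub>M M) (\<lambda>q. R u (fst (fst q)))"
    by (rule am_coefficient[of "\<lambda>p. R u (fst p)"]) (measurable, rule R_bdd)
  moreover have "all_moments (SS \<Otimes>\<^sub>M M) (\<lambda>q. X (snd (fst q)) (snd q))"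
    by (intro am_X_pair finSS, measurable)+
  ultimately show ?thesis by (intro all_moments_mult)
qed

lemma am_Q: "all_moments M (Q n)"
  unfolding Q_def[abs_def]
  by (rule all_moments_integral[OF finSS finM, of "\<lambda>p \<omega>. K n (fst p) (snd p) * (X (fst p) \<omega> * X (snd p) \<omega> - R (fst p) (snd p))"])
     (rule am_Q_integrand)

lemma am_DQ: "all_moments M (DQ u n)"
  unfolding DQ_def[abs_def]
  by (rule all_moments_integral[OF finSS finM, of "\<lambda>p \<omega>. R u (fst p) * K n (fst p) (snd p) * X (snd p) \<omega>"])
     (rule am_DQ_integrand)

lemma am_PQ: "all_moments M (PQ ns)"
  unfolding PQ_def[abs_def] by (intro all_moments_prod_list finM am_Q)

lemma expectation_Q:
  assumes Z: "all_moments M Z"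
  shows "(\<integral>\<omega>. Q n \<omega> * Z \<omega> \<partial>M) = (\<integral>p. K n (fst p) (snd p) *
      ((\<integral>\<omega>. X (fst p) \<omega> * X (snd p) \<omega> * Z \<omega> \<partial>M) - R (fst p) (snd p) * (\<integral>\<omega>. Z \<omega> \<partial>M)) \<partial>SS)"
    "integrable SS (\<lambda>p. K n (fst p) (snd p) *
      ((\<integral>\<omega>. X (fst p) \<omega> * X (snd p) \<omega> * Z \<omega> \<partial>M) - R (fst p) (snd p) * (\<integral>\<omega>. Z \<omega> \<partial>M)))"
proof -
  let ?H = "\<lambda>p \<omega>. K n (fst p) (snd p) * (X (fst p) \<omega> * X (snd p) \<omega> - R (fst p) (snd p))"
  have inner: "(\<integral>\<omega>. ?H p \<omega> * Z \<omega> \<partial>M) = K n (fst p) (snd p) * ((\<integral>\<omega>. X (fst p) \<omega> * X (snd p) \<omega> * Z \<omega> \<partial>M) - R (fst p) (snd p) * (\<integral>\<omega>. Z \<omega> \<partial>M))" for p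
  proof -
    have i: "integrable M (\<lambda>\<omega>. X (fst p) \<omega> * X (snd p) \<omega> * Z \<omega>)" "integrable M Z"
      by (intro all_momentsD(4) all_moments_mult am_X Z)+
    have "(\<integral>\<omega>. ?H p \<omega> * Z \<omega> \<partial>M) = (\<integral>\<omega>. K n (fst p) (snd p) * (X (fst p) \<omega> * X (snd p) \<omega> * Z \<omega> - R (fst p) (snd p) * Z \<omega>) \<partial>M)"
      by (intro Bochner_Integration.integral_cong) (auto simp: algebra_simps)
    then show ?thesis using i by simp
  qed
  note F = all_moments_Fubini[OF finSS finM, of ?H, OF am_Q_integrand Z]
  show "(\<integral>\<omega>. Q n \<omega> * Z \<omega> \<partial>M) = (\<integral>p. K n (fst p) (snd p) *
      ((\<integral>\<omega>. X (fst p) \<omega> * X (snd p) \<omega> * Z \<omega> \<partial>M) - R (fst p) (snd p) * (\<integral>\<omega>. Z \<omega> \<partial>M)) \<partial>SS)"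
    using F(1) by (simp only: inner Q_def)
  show "integrable SS (\<lambda>p. K n (fst p) (snd p) *
      ((\<integral>\<omega>. X (fst p) \<omega> * X (snd p) \<omega> * Z \<omega> \<partial>M) - R (fst p) (snd p) * (\<integral>\<omega>. Z \<omega> \<partial>M)))"
    using F(2) by (simp only: inner)
qed

lemma expectation_DQ:
  assumes Z: "all_moments M Z"
  shows "(\<integral>\<omega>. DQ u n \<omega> * Z \<omega> \<partial>M) = (\<integral>p. R u (fst p) * K n (fst p) (snd p) * (\<integral>\<omega>. X (snd p) \<omega> * Z \<omega> \<partial>M) \<partial>SS)"
    "integrable SS (\<lambda>p. R u (fst p) * K n (fst p) (snd p) * (\<integral>\<omega>. X (snd p) \<omega> * Z \<omega> \<partial>M))"
proof -
  let ?H = "\<lambda>p \<omega>. R u (fst p) * K n (fst p) (snd p) * X (snd p) \<omega>"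
  have inner: "(\<integral>\<omega>. ?H p \<omega> * Z \<omega> \<partial>M) = R u (fst p) * K n (fst p) (snd p) * (\<integral>\<omega>. X (snd p) \<omega> * Z \<omega> \<partial>M)" for p
    by (simp add: mult.assoc)
  note F = all_moments_Fubini[OF finSS finM, of ?H, OF am_DQ_integrand Z]
  show "(\<integral>\<omega>. DQ u n \<omega> * Z \<omega> \<partial>M) = (\<integral>p. R u (fst p) * K n (fst p) (snd p) * (\<integral>\<omega>. X (snd p) \<omega> * Z \<omega> \<partial>M) \<partial>SS)"
    using F(1) by (simp only: inner DQ_def)
  show "integrable SS (\<lambda>p. R u (fst p) * K n (fst p) (snd p) * (\<integral>\<omega>. X (snd p) \<omega> * Z \<omega> \<partial>M))"
    using F(2) by (simp only: inner)
qed

lemma SS_swap: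
  fixes h :: "real \<Rightarrow> real \<Rightarrow> real"
  assumes "(\<lambda>p. h (fst p) (snd p)) \<in> borel_measurable SS"
  shows "(\<integral>p. h (snd p) (fst p) \<partial>SS) = (\<integral>p. h (fst p) (snd p) \<partial>SS)"
    "integrable SS (\<lambda>p. h (fst p) (snd p)) \<Longrightarrow> integrable SS (\<lambda>p. h (snd p) (fst p))"
proof -
  interpret S: sigma_finite_measure S by (rule sigS)
  interpret pair_sigma_finite S S ..
  show "(\<integral>p. h (snd p) (fst p) \<partial>SS) = (\<integral>p. h (fst p) (snd p) \<partial>SS)"
    using integral_product_swap[OF assms] by (simp add: case_prod_unfold)
  show "integrable SS (\<lambda>p. h (fst p) (snd p)) \<Longrightarrow> integrable SS (\<lambda>p. h (snd p) (fst p))"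
    using integrable_product_swap[of "\<lambda>p. h (fst p) (snd p)"] by (simp add: case_prod_unfold)
qed

lemma expectation_DQ_swap:
  assumes Z: "all_moments M Z"
  shows "(\<integral>\<omega>. DQ u n \<omega> * Z \<omega> \<partial>M) = (\<integral>p. K n (fst p) (snd p) * (R u (snd p) * (\<integral>\<omega>. X (fst p) \<omega> * Z \<omega> \<partial>M)) \<partial>SS)"
    "integrable SS (\<lambda>p. K n (fst p) (snd p) * (R u (snd p) * (\<integral>\<omega>. X (fst p) \<omega> * Z \<omega> \<partial>M)))"
proof -
  let ?h = "\<lambda>a b. R u a * K n a b * (\<integral>\<omega>. X b \<omega> * Z \<omega> \<partial>M)"
  have eq: "?h b a = K n a b * (R u b * (\<integral>\<omega>. X a \<omega> * Z \<omega> \<partial>M))" for a b by (simp add: K_sym[of n b a])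
  note i = expectation_DQ(2)[OF Z, where u = u and n = n]
  note sw = SS_swap[of ?h, OF borel_measurable_integrable[OF i]]
  show "(\<integral>\<omega>. DQ u n \<omega> * Z \<omega> \<partial>M) = (\<integral>p. K n (fst p) (snd p) * (R u (snd p) * (\<integral>\<omega>. X (fst p) \<omega> * Z \<omega> \<partial>M)) \<partial>SS)"
    using sw(1) expectation_DQ(1)[OF Z, where u = u and n = n] unfolding eq by simp
  show "integrable SS (\<lambda>p. K n (fst p) (snd p) * (R u (snd p) * (\<integral>\<omega>. X (fst p) \<omega> * Z \<omega> \<partial>M)))"
    using sw(2)[OF i] unfolding eq by simp
qed

text \<open>
  Induction on the number of functionals: writing one of them as an integral of \<open>X(a) X(b)\<close>
  reduces the claim to fewer functionals and two more linear factors. Pairing \<open>X(u)\<close> with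
  either of the two new factors gives a derivative, and all other pairings leave the
  functional intact.
\<close>

theorem Wick_quadratic:
  "(\<integral>\<omega>. X u \<omega> * (PX vs \<omega> * PQ ns \<omega>) \<partial>M)
    = (\<Sum>(y, ys)\<leftarrow>picks vs. R u y * (\<integral>\<omega>. PX ys \<omega> * PQ ns \<omega> \<partial>M))
    + (\<Sum>(n, ns')\<leftarrow>picks ns. 2 * (\<integral>\<omega>. DQ u n \<omega> * (PX vs \<omega> * PQ ns' \<omega>) \<partial>M))"
proof (induction ns arbitrary: vs)
  case Nil
  then show ?case using Wick by (simp add: PQ_Nil)
next
  case (Cons n ns)
  let ?V = "PX vs" and ?P = "PQ ns"
  let ?K = "\<lambda>p. K n (fst p) (snd p)"
  let ?e = "\<lambda>Z. \<integral>\<omega>. Z \<omega> \<partial>M"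
  let ?q = "\<lambda>Z p. ?K p * ((\<integral>\<omega>. X (fst p) \<omega> * X (snd p) \<omega> * Z \<omega> \<partial>M) - R (fst p) (snd p) * ?e Z)"
  define Y where "Y q = (\<lambda>\<omega>. PX (snd q) \<omega> * PQ ns \<omega>)" for q :: "real \<times> real list"
  define W where "W q = (\<lambda>\<omega>. DQ u (fst q) \<omega> * (PX vs \<omega> * PQ (snd q) \<omega>))" for q :: "nat \<times> nat list"
  have amY: "all_moments M (Y q)" for q unfolding Y_def by (intro all_moments_mult am_PX am_PQ)
  have amW: "all_moments M (W q)" for q unfolding W_def by (intro all_moments_mult am_PX am_PQ am_DQ)
  have amVP: "all_moments M (\<lambda>\<omega>. ?V \<omega> * ?P \<omega>)" by (intro all_moments_mult am_PX am_PQ)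
  have amZ: "all_moments M (\<lambda>\<omega>. X u \<omega> * (?V \<omega> * ?P \<omega>))" by (intro all_moments_mult am_X amVP)
  have IH0: "?e (\<lambda>\<omega>. X u \<omega> * (?V \<omega> * ?P \<omega>)) = (\<Sum>q\<leftarrow>picks vs. R u (fst q) * ?e (Y q)) + (\<Sum>q\<leftarrow>picks ns. 2 * ?e (W q))"
    using Cons.IH[of vs] by (simp add: case_prod_unfold Y_def W_def)
  have IH2: "(\<integral>\<omega>. X a \<omega> * X b \<omega> * (X u \<omega> * (?V \<omega> * ?P \<omega>)) \<partial>M) =
      R u a * (\<integral>\<omega>. X b \<omega> * (?V \<omega> * ?P \<omega>) \<partial>M) + R u b * (\<integral>\<omega>. X a \<omega> * (?V \<omega> * ?P \<omega>) \<partial>M)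
      + (\<Sum>q\<leftarrow>picks vs. R u (fst q) * (\<integral>\<omega>. X a \<omega> * X b \<omega> * Y q \<omega> \<partial>M)) + (\<Sum>q\<leftarrow>picks ns. 2 * (\<integral>\<omega>. X a \<omega> * X b \<omega> * W q \<omega> \<partial>M))" for a b
  proof -
    have "(\<integral>\<omega>. X a \<omega> * X b \<omega> * (X u \<omega> * (?V \<omega> * ?P \<omega>)) \<partial>M) = (\<integral>\<omega>. X u \<omega> * (PX (a # b # vs) \<omega> * ?P \<omega>) \<partial>M)"
      by (simp add: PX_Cons mult_ac)
    then show ?thesis
      unfolding Cons.IH sum_picks_Cons by (simp add: PX_Cons case_prod_unfold Y_def W_def mult_ac add_ac)
  qed
  have split: "?q (\<lambda>\<omega>. X u \<omega> * (?V \<omega> * ?P \<omega>)) p =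
      R u (fst p) * ?K p * (\<integral>\<omega>. X (snd p) \<omega> * (?V \<omega> * ?P \<omega>) \<partial>M) + ?K p * (R u (snd p) * (\<integral>\<omega>. X (fst p) \<omega> * (?V \<omega> * ?P \<omega>) \<partial>M))
      + (\<Sum>q\<leftarrow>picks vs. R u (fst q) * ?q (Y q) p) + (\<Sum>q\<leftarrow>picks ns. 2 * ?q (W q) p)" for p
  proof -
    have "(\<integral>\<omega>. X (fst p) \<omega> * X (snd p) \<omega> * (X u \<omega> * (?V \<omega> * ?P \<omega>)) \<partial>M) - R (fst p) (snd p) * ?e (\<lambda>\<omega>. X u \<omega> * (?V \<omega> * ?P \<omega>)) =
      R u (fst p) * (\<integral>\<omega>. X (snd p) \<omega> * (?V \<omega> * ?P \<omega>) \<partial>M) + R u (snd p) * (\<integral>\<omega>. X (fst p) \<omega> * (?V \<omega> * ?P \<omega>) \<partial>M)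
      + ((\<Sum>q\<leftarrow>picks vs. R u (fst q) * (\<integral>\<omega>. X (fst p) \<omega> * X (snd p) \<omega> * Y q \<omega> \<partial>M)) - (\<Sum>q\<leftarrow>picks vs. R (fst p) (snd p) * (R u (fst q) * ?e (Y q))))
      + ((\<Sum>q\<leftarrow>picks ns. 2 * (\<integral>\<omega>. X (fst p) \<omega> * X (snd p) \<omega> * W q \<omega> \<partial>M)) - (\<Sum>q\<leftarrow>picks ns. R (fst p) (snd p) * (2 * ?e (W q))))"
      unfolding IH0 IH2 sum_list_const_mult by (simp add: algebra_simps)
    then show ?thesis
      unfolding sum_list_fun_diff by (simp add: distrib_left sum_list_const_mult[symmetric] right_diff_distrib mult_ac)
  qed
  note eD = expectation_DQ[OF amVP, where u = u and n = n] expectation_DQ_swap[OF amVP, where u = u and n = n]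
  have iY: "integrable SS (\<lambda>p. R u (fst q) * ?q (Y q) p)" for q by (intro integrable_mult_right expectation_Q(2) amY)
  have iW: "integrable SS (\<lambda>p. 2 * ?q (W q) p)" for q by (intro integrable_mult_right expectation_Q(2) amW)
  note LY = integral_sum_list[of "picks vs" SS "\<lambda>q p. R u (fst q) * ?q (Y q) p", OF iY]
  note LW = integral_sum_list[of "picks ns" SS "\<lambda>q p. 2 * ?q (W q) p", OF iW]
  have "(\<integral>\<omega>. X u \<omega> * (PX vs \<omega> * PQ (n # ns) \<omega>) \<partial>M) = (\<integral>\<omega>. Q n \<omega> * (X u \<omega> * (?V \<omega> * ?P \<omega>)) \<partial>M)"
    by (simp add: PQ_Cons mult_ac)
  also have "\<dots> = (\<integral>p. ?q (\<lambda>\<omega>. X u \<omega> * (?V \<omega> * ?P \<omega>)) p \<partial>SS)" by (rule expectation_Q(1)[OF amZ])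
  also have "\<dots> = (\<integral>\<omega>. DQ u n \<omega> * (?V \<omega> * ?P \<omega>) \<partial>M) + (\<integral>\<omega>. DQ u n \<omega> * (?V \<omega> * ?P \<omega>) \<partial>M)
      + (\<Sum>q\<leftarrow>picks vs. R u (fst q) * (\<integral>p. ?q (Y q) p \<partial>SS)) + (\<Sum>q\<leftarrow>picks ns. 2 * (\<integral>p. ?q (W q) p \<partial>SS))"
    unfolding split using eD(2,4) LY LW by (simp add: eD(1)[symmetric] eD(3)[symmetric])
  also have "\<dots> = 2 * (\<integral>\<omega>. DQ u n \<omega> * (?V \<omega> * ?P \<omega>) \<partial>M)
      + (\<Sum>q\<leftarrow>picks vs. R u (fst q) * (\<integral>\<omega>. Q n \<omega> * Y q \<omega> \<partial>M)) + (\<Sum>q\<leftarrow>picks ns. 2 * (\<integral>\<omega>. Q n \<omega> * W q \<omega> \<partial>M))"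
    by (simp only: expectation_Q(1)[OF amY] expectation_Q(1)[OF amW] mult_2)
  finally show ?case
    unfolding sum_picks_Cons by (simp add: case_prod_unfold Y_def W_def PQ_Cons mult_ac add_ac)
qed

lemma pair_moment_bounded:
  assumes Z: "all_moments M Z"
  shows "bdd (\<lambda>x. \<integral>\<omega>. X (h x) \<omega> * X (k x) \<omega> * Z \<omega> \<partial>M)"
proof -
  obtain C where C: "\<And>t. integrable M (\<lambda>\<omega>. \<bar>X t \<omega>\<bar> ^ 4)" "\<And>t. (\<integral>\<omega>. \<bar>X t \<omega>\<bar> ^ 4 \<partial>M) \<le> C" using X_moments[of 4] by blast
  have iZ: "integrable M (\<lambda>\<omega>. \<bar>Z \<omega>\<bar> ^ 2)" by (rule all_momentsD(2)[OF Z])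
  have "\<bar>\<integral>\<omega>. X s \<omega> * X t \<omega> * Z \<omega> \<partial>M\<bar> \<le> C + C + (\<integral>\<omega>. \<bar>Z \<omega>\<bar> ^ 2 \<partial>M)" for s t
  proof -
    have "\<bar>\<integral>\<omega>. X s \<omega> * X t \<omega> * Z \<omega> \<partial>M\<bar> \<le> (\<integral>\<omega>. \<bar>X s \<omega> * X t \<omega> * Z \<omega>\<bar> \<partial>M)" by (rule integral_abs_bound)
    also have "\<dots> \<le> (\<integral>\<omega>. \<bar>X s \<omega>\<bar> ^ 4 + \<bar>X t \<omega>\<bar> ^ 4 + \<bar>Z \<omega>\<bar> ^ 2 \<partial>M)"
    proof (rule integral_mono')
      fix \<omega>
      have "2 * (\<bar>X s \<omega> * X t \<omega>\<bar> * \<bar>Z \<omega>\<bar>) \<le> \<bar>X s \<omega> * X t \<omega>\<bar>\<^sup>2 + \<bar>Z \<omega>\<bar>\<^sup>2"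
        using sum_squares_bound[of "\<bar>X s \<omega> * X t \<omega>\<bar>" "\<bar>Z \<omega>\<bar>"] by simp
      moreover have "2 * \<bar>X s \<omega> * X t \<omega>\<bar>\<^sup>2 \<le> \<bar>X s \<omega>\<bar> ^ 4 + \<bar>X t \<omega>\<bar> ^ 4"
        using sum_squares_bound[of "\<bar>X s \<omega>\<bar>\<^sup>2" "\<bar>X t \<omega>\<bar>\<^sup>2"] by (simp add: abs_mult power_mult_distrib power_mult[symmetric] flip: power_mult)
      moreover have "0 \<le> \<bar>X s \<omega> * X t \<omega>\<bar> * \<bar>Z \<omega>\<bar>" "0 \<le> \<bar>X s \<omega>\<bar> ^ 4" "0 \<le> \<bar>X t \<omega>\<bar> ^ 4" by auto
      ultimately show "\<bar>X s \<omega> * X t \<omega> * Z \<omega>\<bar> \<le> \<bar>X s \<omega>\<bar> ^ 4 + \<bar>X t \<omega>\<bar> ^ 4 + \<bar>Z \<omega>\<bar> ^ 2"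
        unfolding abs_mult[of "X s \<omega> * X t \<omega>"] by linarith
    qed (use C iZ in auto)
    also have "\<dots> = (\<integral>\<omega>. \<bar>X s \<omega>\<bar> ^ 4 \<partial>M) + (\<integral>\<omega>. \<bar>X t \<omega>\<bar> ^ 4 \<partial>M) + (\<integral>\<omega>. \<bar>Z \<omega>\<bar> ^ 2 \<partial>M)" using C(1) iZ by simp
    also have "\<dots> \<le> C + C + (\<integral>\<omega>. \<bar>Z \<omega>\<bar> ^ 2 \<partial>M)" by (intro add_mono C order_refl)
    finally show ?thesis .
  qed
  then show ?thesis by (intro bddI[of _ "C + C + (\<integral>\<omega>. \<bar>Z \<omega>\<bar> ^ 2 \<partial>M)"]) simp
qed

text \<open>
  Pairing a variable of a kernel with a variable of another one joins the two kernels into a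
  composition. The remaining two factors \<open>X\<close> are not centred, which accounts for the trace.
\<close>

lemma contraction:
  assumes Z: "all_moments M Z" and mn: "1 \<le> m" "1 \<le> n"
  shows "(\<integral>p. K m (fst p) (snd p) * (\<integral>\<omega>. DQ (fst p) n \<omega> * (X (snd p) \<omega> * Z \<omega>) \<partial>M) \<partial>SS)
    = (\<integral>\<omega>. Q (m + n) \<omega> * Z \<omega> \<partial>M) + ptr (m + n) * (\<integral>\<omega>. Z \<omega> \<partial>M)"
proof -
  interpret S: sigma_finite_measure S by (rule sigS)
  note [measurable] = all_momentsD(1)[OF Z]
  define e where "e d b = (\<integral>\<omega>. X d \<omega> * X b \<omega> * Z \<omega> \<partial>M)" for d b
  have e_meas: "(\<lambda>q. e (fst q) (snd q)) \<in> borel_measurable (borel \<Otimes>\<^sub>M borel)" unfolding e_def by measurable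
  have e_meas2[measurable (raw)]: "(\<lambda>y. e (h y) (k y)) \<in> borel_measurable L" if "h \<in> borel_measurable L" "k \<in> borel_measurable L" for h k and L :: "'c measure"
    using measurable_compose[OF measurable_Pair[OF that] e_meas] by simp
  have e_bdd: "bdd (\<lambda>x. e (h x) (k x))" for h k :: "'c \<Rightarrow> real" unfolding e_def by (rule pair_moment_bounded[OF Z])
  have e_bdd2: "bdd (\<lambda>x. e (h x) (k x))" for h k :: "real \<times> real \<Rightarrow> real" unfolding e_def by (rule pair_moment_bounded[OF Z])
  have e_bdd3: "bdd (\<lambda>x. e (h x) (k x))" for h k :: "(real \<times> real) \<times> real \<Rightarrow> real" unfolding e_def by (rule pair_moment_bounded[OF Z])
  have e_bdd4: "bdd (\<lambda>x. e (h x) (k x))" for h k :: "((real \<times> real) \<times> real) \<times> real \<Rightarrow> real" unfolding e_def by (rule pair_moment_bounded[OF Z])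
  note b = finS bdd_mult bdd_integral K_bdd R_bdd e_bdd2 e_bdd3 e_bdd4
  have D: "(\<integral>\<omega>. DQ a n \<omega> * (X b \<omega> * Z \<omega>) \<partial>M) = (\<integral>c. \<integral>d. R a c * K n c d * e d b \<partial>S \<partial>S)" for a b
  proof -
    have "(\<integral>\<omega>. DQ a n \<omega> * (X b \<omega> * Z \<omega>) \<partial>M) = (\<integral>p. R a (fst p) * K n (fst p) (snd p) * e (snd p) b \<partial>SS)"
      by (subst expectation_DQ(1)[OF all_moments_mult[OF am_X Z]]) (simp add: e_def mult.assoc)
    also have "\<dots> = (\<integral>c. \<integral>d. R a c * K n c d * e d b \<partial>S \<partial>S)"
      by (intro integral_pair_bdd b) measurable
    finally show ?thesis .
  qed
  have "(\<integral>p. K m (fst p) (snd p) * (\<integral>\<omega>. DQ (fst p) n \<omega> * (X (snd p) \<omega> * Z \<omega>) \<partial>M) \<partial>SS)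
      = (\<integral>a. \<integral>b. K m a b * (\<integral>c. \<integral>d. R a c * K n c d * e d b \<partial>S \<partial>S) \<partial>S \<partial>S)"
    unfolding D by (intro integral_pair_bdd b) measurable
  also have "\<dots> = (\<integral>a. \<integral>b. \<integral>c. \<integral>d. K m b a * R a c * K n c d * e d b \<partial>S \<partial>S \<partial>S \<partial>S)"
    by (simp add: mult.assoc K_sym[of m] flip: integral_mult_right_zero)
  also have "\<dots> = (\<integral>b. \<integral>a. \<integral>c. \<integral>d. K m b a * R a c * K n c d * e d b \<partial>S \<partial>S \<partial>S \<partial>S)"
    by (intro Fubini_bdd b) measurable
  also have "\<dots> = (\<integral>b. \<integral>a. \<integral>d. \<integral>c. K m b a * R a c * K n c d * e d b \<partial>S \<partial>S \<partial>S \<partial>S)"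
    by (intro Bochner_Integration.integral_cong refl Fubini_bdd b) measurable
  also have "\<dots> = (\<integral>b. \<integral>d. \<integral>a. \<integral>c. K m b a * R a c * K n c d * e d b \<partial>S \<partial>S \<partial>S \<partial>S)"
    by (intro Bochner_Integration.integral_cong refl Fubini_bdd b) measurable
  also have "\<dots> = (\<integral>b. \<integral>d. K (m + n) b d * e d b \<partial>S \<partial>S)"
    by (simp add: K_comp[OF mn])
  also have "\<dots> = (\<integral>p. K (m + n) (fst p) (snd p) * e (snd p) (fst p) \<partial>SS)"
    by (intro integral_pair_bdd[symmetric] b) measurable
  finally have eq: "(\<integral>p. K m (fst p) (snd p) * (\<integral>\<omega>. DQ (fst p) n \<omega> * (X (snd p) \<omega> * Z \<omega>) \<partial>M) \<partial>SS)
    = (\<integral>p. K (m + n) (fst p) (snd p) * e (snd p) (fst p) \<partial>SS)" .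
  have i1: "integrable SS (\<lambda>p. K (m + n) (fst p) (snd p) * e (snd p) (fst p))"
    by (intro bdd_integrable finSS b) measurable
  have i2: "integrable SS (\<lambda>p. K (m + n) (fst p) (snd p) * R (fst p) (snd p))"
    by (intro bdd_integrable finSS b) measurable
  have "(\<integral>\<omega>. Q (m + n) \<omega> * Z \<omega> \<partial>M)
    = (\<integral>p. K (m + n) (fst p) (snd p) * e (snd p) (fst p) - (K (m + n) (fst p) (snd p) * R (fst p) (snd p)) * (\<integral>\<omega>. Z \<omega> \<partial>M) \<partial>SS)"
    unfolding expectation_Q(1)[OF Z] by (intro Bochner_Integration.integral_cong) (auto simp: e_def algebra_simps)
  also have "\<dots> = (\<integral>p. K (m + n) (fst p) (snd p) * e (snd p) (fst p) \<partial>SS) - ptr (m + n) * (\<integral>\<omega>. Z \<omega> \<partial>M)"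
    using i1 i2 by (simp add: ptr_def)
  finally show ?thesis unfolding eq by simp
qed

text \<open>
  Integration by parts for one of the two factors \<open>X\<close> in the first functional; its pairing
  with the other one is cancelled by the centring.
\<close>

theorem moment_recursion:
  assumes m: "1 \<le> m" and ns: "\<forall>n\<in>set ns. 1 \<le> n"
  shows "(\<integral>\<omega>. PQ (m # ns) \<omega> \<partial>M)
    = (\<Sum>(n, ns')\<leftarrow>picks ns. 2 * ((\<integral>\<omega>. PQ ((m + n) # ns') \<omega> \<partial>M) + ptr (m + n) * (\<integral>\<omega>. PQ ns' \<omega> \<partial>M)))"
proof -
  let ?K = "\<lambda>p. K m (fst p) (snd p)"
  define W where "W q p = (\<integral>\<omega>. DQ (fst p) (fst q) \<omega> * (X (snd p) \<omega> * PQ (snd q) \<omega>) \<partial>M)" for q :: "nat \<times> nat list" and p :: "real \<times> real"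
  interpret S: sigma_finite_measure S by (rule sigS)
  have W_meas: "W q \<in> borel_measurable SS" for q
  proof -
    note [measurable] = all_momentsD(1)[OF am_PQ, of "snd q"]
    have "(\<lambda>p. DQ (fst (fst p)) (fst q) (snd p)) \<in> borel_measurable (SS \<Otimes>\<^sub>M M)"
    proof -
      interpret SS: sigma_finite_measure SS using finSS by (simp add: finite_measure_def)
      show ?thesis unfolding DQ_def by measurable
    qed
    note [measurable] = this
    show ?thesis unfolding W_def[abs_def] by measurable
  qed
  have step: "?K p * ((\<integral>\<omega>. X (fst p) \<omega> * X (snd p) \<omega> * PQ ns \<omega> \<partial>M) - R (fst p) (snd p) * (\<integral>\<omega>. PQ ns \<omega> \<partial>M)) = (\<Sum>q\<leftarrow>picks ns. 2 * (?K p * W q p))" for p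
    using Wick_quadratic[of "fst p" "[snd p]" ns]
    by (simp add: PX_Cons PX_Nil W_def case_prod_unfold mult.assoc mult.left_commute[of "K m (fst p) (snd p)"] flip: sum_list_const_mult)
  have iW: "integrable SS (\<lambda>p. 2 * (?K p * W q p))" for q
  proof -
    have bW: "bdd (W q)"
    proof -
      let ?Z = "PQ (snd q)"
      interpret S: sigma_finite_measure S by (rule sigS)
      have eq: "W q = (\<lambda>p. \<integral>c. R (fst p) (fst c) * K (fst q) (fst c) (snd c) * (\<integral>\<omega>. X (snd c) \<omega> * X (snd p) \<omega> * ?Z \<omega> \<partial>M) \<partial>SS)"
        unfolding W_def by (subst expectation_DQ(1)[OF all_moments_mult[OF am_X am_PQ]]) (simp add: mult.assoc)
      show ?thesis unfolding eq
        by (intro bdd_integral finSS bdd_mult R_bdd K_bdd pair_moment_bounded am_PQ)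
    qed
    show ?thesis
      by (intro integrable_mult_right bdd_integrable finSS bdd_mult bW K_bdd borel_measurable_times W_meas) measurable
  qed
  have "(\<integral>\<omega>. PQ (m # ns) \<omega> \<partial>M) = (\<integral>\<omega>. Q m \<omega> * PQ ns \<omega> \<partial>M)" by (simp add: PQ_Cons)
  also have "\<dots> = (\<integral>p. (\<Sum>q\<leftarrow>picks ns. 2 * (?K p * W q p)) \<partial>SS)"
    by (simp only: expectation_Q(1)[OF am_PQ] step)
  also have "\<dots> = (\<Sum>q\<leftarrow>picks ns. 2 * (\<integral>p. ?K p * W q p \<partial>SS))"
    by (subst integral_sum_list(2)[OF iW]) simp
  also have "\<dots> = (\<Sum>q\<leftarrow>picks ns. 2 * ((\<integral>\<omega>. PQ ((m + fst q) # snd q) \<omega> \<partial>M) + ptr (m + fst q) * (\<integral>\<omega>. PQ (snd q) \<omega> \<partial>M)))"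
  proof (rule arg_cong[where f = sum_list], rule map_cong[OF refl])
    fix q assume "q \<in> set (picks ns)"
    then have "1 \<le> fst q" using set_picks[of "fst q" "snd q" ns] ns by auto
    from contraction[OF am_PQ m this, of "snd q"]
    show "2 * (\<integral>p. ?K p * W q p \<partial>SS) = 2 * ((\<integral>\<omega>. PQ ((m + fst q) # snd q) \<omega> \<partial>M) + ptr (m + fst q) * (\<integral>\<omega>. PQ (snd q) \<omega> \<partial>M))"
      by (simp add: W_def PQ_Cons)
  qed
  finally show ?thesis by (simp add: case_prod_unfold)
qed

end

section \<open>Convergence of moments to Gaussian moments\<close>

text \<open>
  The moments of the centred normal law with variance \<open>V\<close>.
\<close>

fun gmom :: "real \<Rightarrow> nat \<Rightarrow> real" where
  "gmom V 0 = 1"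
| "gmom V (Suc 0) = 0"
| "gmom V (Suc (Suc n)) = real (Suc n) * V * gmom V n"

lemma set_picks_eq: "(y, ys) \<in> set (picks xs) \<Longrightarrow> set xs = insert y (set ys)"
  by (induction xs arbitrary: y ys) (auto split: prod.splits)

lemma length_picks: "length (picks xs) = length xs"
  by (induction xs) auto

lemma tendsto_sum_list:
  fixes h :: "'b \<Rightarrow> 'i \<Rightarrow> real"
  assumes "\<And>x. x \<in> set xs \<Longrightarrow> (h x \<longlongrightarrow> l x) F"
  shows "((\<lambda>i. \<Sum>x\<leftarrow>xs. h x i) \<longlongrightarrow> (\<Sum>x\<leftarrow>xs. l x)) F"
  using assms by (induction xs) (auto intro!: tendsto_add)

text \<open>
  The recursion lowers the number of functionals by one or by two, so induction on that number
  applies. In the limit only the traces \<open>p 2\<close> survive, and they arise from two functionals of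
  index one; a product with any other index tends to zero. On indices equal to one the
  recursion becomes that of the normal moments.
\<close>

theorem moments_limit:
  fixes e :: "'i \<Rightarrow> nat list \<Rightarrow> real" and p :: "'i \<Rightarrow> nat \<Rightarrow> real"
  assumes e0: "\<forall>\<^sub>F i in F. e i [] = 1"
    and rec: "\<And>m ns. 1 \<le> m \<Longrightarrow> \<forall>n\<in>set ns. 1 \<le> n \<Longrightarrow>
      \<forall>\<^sub>F i in F. e i (m # ns) = (\<Sum>(n, ns')\<leftarrow>picks ns. 2 * (e i ((m + n) # ns') + p i (m + n) * e i ns'))"
    and p2: "((\<lambda>i. p i 2) \<longlongrightarrow> V / 2) F" and p3: "\<And>n. 3 \<le> n \<Longrightarrow> ((\<lambda>i. p i n) \<longlongrightarrow> 0) F"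
    and "\<forall>n\<in>set ns. 1 \<le> n"
  shows "((\<lambda>i. e i ns) \<longlongrightarrow> (if \<forall>n\<in>set ns. n = 1 then gmom V (length ns) else 0)) F"
  using assms(5)
proof (induction ns rule: measure_induct_rule[where f = length])
  case (less ns)
  define \<gamma> where "\<gamma> ns = (if \<forall>n\<in>set ns. n = 1 then gmom V (length ns) else 0)" for ns :: "nat list"
  show ?case
  proof (cases ns)
    case Nil
    then show ?thesis using e0 by (auto intro: tendsto_eventually)
  next
    case (Cons m l)
    have m: "1 \<le> m" and l: "\<forall>n\<in>set l. 1 \<le> n" using less.prems Cons by auto
    define c where "c k = (if k = 2 then V / 2 else 0)" for k :: nat
    have c: "((\<lambda>i. p i k) \<longlongrightarrow> c k) F" if "2 \<le> k" for k
      using p2 p3[of k] that by (cases "k = 2") (auto simp: c_def)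
    have "((\<lambda>i. \<Sum>q\<leftarrow>picks l. 2 * (e i ((m + fst q) # snd q) + p i (m + fst q) * e i (snd q)))
      \<longlongrightarrow> (\<Sum>q\<leftarrow>picks l. 2 * (0 + c (m + fst q) * \<gamma> (snd q)))) F"
    proof (rule tendsto_sum_list)
      fix q assume "q \<in> set (picks l)"
      then have q: "fst q \<in> set l" "set (snd q) \<subseteq> set l" "length l = Suc (length (snd q))"
        using set_picks[of "fst q" "snd q" l] by auto
      have f1: "1 \<le> fst q" using q(1) l by auto
      have "((\<lambda>i. e i ((m + fst q) # snd q)) \<longlongrightarrow> (if \<forall>n\<in>set ((m + fst q) # snd q). n = 1 then gmom V (length ((m + fst q) # snd q)) else 0)) F"
        using q l Cons f1 by (intro less.IH) auto
      then have "((\<lambda>i. e i ((m + fst q) # snd q)) \<longlongrightarrow> 0) F" using m f1 by simp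
      moreover have "((\<lambda>i. e i (snd q)) \<longlongrightarrow> \<gamma> (snd q)) F"
        unfolding \<gamma>_def using q l Cons by (intro less.IH) auto
      ultimately show "((\<lambda>i. 2 * (e i ((m + fst q) # snd q) + p i (m + fst q) * e i (snd q))) \<longlongrightarrow> 2 * (0 + c (m + fst q) * \<gamma> (snd q))) F"
        using c[of "m + fst q"] m f1 by (intro tendsto_mult_left tendsto_add tendsto_mult) auto
    qed
    moreover have "\<forall>\<^sub>F i in F. (\<Sum>q\<leftarrow>picks l. 2 * (e i ((m + fst q) # snd q) + p i (m + fst q) * e i (snd q))) = e i (m # l)"
      using rec[OF m l] by eventually_elim (simp add: case_prod_unfold)
    ultimately have lim: "((\<lambda>i. e i (m # l)) \<longlongrightarrow> (\<Sum>q\<leftarrow>picks l. 2 * (0 + c (m + fst q) * \<gamma> (snd q)))) F"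
      by (rule Lim_transform_eventually)
    have "(\<Sum>q\<leftarrow>picks l. 2 * (0 + c (m + fst q) * \<gamma> (snd q))) = \<gamma> (m # l)"
    proof (cases "m = 1 \<and> (\<forall>n\<in>set l. n = 1)")
      case True
      have "(\<Sum>q\<leftarrow>picks l. 2 * (0 + c (m + fst q) * \<gamma> (snd q))) = (\<Sum>q\<leftarrow>picks l. V * gmom V (length l - 1))"
      proof (rule arg_cong[where f = sum_list], rule map_cong[OF refl])
        fix q assume "q \<in> set (picks l)"
        then have "fst q \<in> set l" "set (snd q) \<subseteq> set l" "length l = Suc (length (snd q))"
          using set_picks[of "fst q" "snd q" l] by auto
        note p = this
        have "fst q = 1" "length (snd q) = length l - 1" using p True by auto
        moreover have "\<forall>n\<in>set (snd q). n = 1" using p(2) True by blast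
        ultimately show "2 * (0 + c (m + fst q) * \<gamma> (snd q)) = V * gmom V (length l - 1)"
          using True by (simp add: c_def \<gamma>_def)
      qed
      also have "\<dots> = real (length l) * (V * gmom V (length l - 1))"
        by (simp add: sum_list_triv length_picks)
      also have "\<dots> = gmom V (Suc (length l))" by (cases "length l") auto
      finally show ?thesis using True by (simp add: \<gamma>_def)
    next
      case False
      have "(\<Sum>q\<leftarrow>picks l. 2 * (0 + c (m + fst q) * \<gamma> (snd q))) = (\<Sum>q\<leftarrow>picks l. 0)"
      proof (rule arg_cong[where f = sum_list], rule map_cong[OF refl])
        fix q assume "q \<in> set (picks l)"
        then have s: "set l = insert (fst q) (set (snd q))" using set_picks_eq[of "fst q" "snd q" l] by simp
        then have f1: "1 \<le> fst q" using l by auto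
        show "2 * (0 + c (m + fst q) * \<gamma> (snd q)) = 0"
          using False m f1 s by (auto simp: c_def \<gamma>_def)
      qed
      then show ?thesis using False by (auto simp: \<gamma>_def)
    qed
    with lim have "((\<lambda>i. e i (m # l)) \<longlongrightarrow> \<gamma> (m # l)) F" by (simp only:)
    then show ?thesis unfolding Cons \<gamma>_def .
  qed
qed

lemma gmom_even: "gmom V (2 * N) / fact (2 * N) = (V / 2) ^ N / fact N"
proof (induction N)
  case (Suc N)
  have f: "fact (2 * Suc N) = (real (2 * N + 2) * real (2 * N + 1)) * fact (2 * N)"
    by (simp add: field_simps)
  have "gmom V (2 * Suc N) = real (2 * N + 1) * V * gmom V (2 * N)" by simp
  then have "gmom V (2 * Suc N) / fact (2 * Suc N) = V / real (2 * N + 2) * (gmom V (2 * N) / fact (2 * N))"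
    unfolding f by (simp add: divide_simps del: of_nat_add of_nat_mult of_nat_Suc)
  also have "\<dots> = V / real (2 * N + 2) * ((V / 2) ^ N / fact N)" by (simp only: Suc)
  also have "\<dots> = (V / 2) ^ Suc N / fact (Suc N)" by (simp add: field_simps)
  finally show ?case .
qed simp

lemma gmom_odd: "gmom V (2 * N + 1) = 0"
  by (induction N) auto

text \<open>
  The even terms form the exponential series of \<open>- V / 2\<close>, the odd ones vanish.
\<close>

lemma gmom_exp_partial_sum:
  "(\<Sum>k\<le>2 * N. \<i> ^ k / fact k * complex_of_real (gmom V k)) = (\<Sum>k\<le>N. complex_of_real ((- V / 2) ^ k / fact k))"
proof (induction N)
  case (Suc N)
  have e: "\<i> ^ (2 * Suc N) = complex_of_real ((- 1) ^ Suc N)" unfolding power_mult by simp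
  have "(\<Sum>k\<le>2 * Suc N. \<i> ^ k / fact k * complex_of_real (gmom V k))
    = (\<Sum>k\<le>2 * N. \<i> ^ k / fact k * complex_of_real (gmom V k)) + \<i> ^ (2 * N + 1) / fact (2 * N + 1) * complex_of_real (gmom V (2 * N + 1))
      + \<i> ^ (2 * Suc N) / fact (2 * Suc N) * complex_of_real (gmom V (2 * Suc N))"
  proof -
    have "2 * Suc N = Suc (Suc (2 * N))" "2 * N + 1 = Suc (2 * N)" by auto
    then show ?thesis by (simp only: sum.atMost_Suc)
  qed
  also have "\<i> ^ (2 * Suc N) / fact (2 * Suc N) * complex_of_real (gmom V (2 * Suc N)) = complex_of_real ((- 1) ^ Suc N * (gmom V (2 * Suc N) / fact (2 * Suc N)))"
    unfolding e by (simp only: of_real_mult of_real_divide of_real_fact times_divide_eq_left times_divide_eq_right)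
  also have "(- 1) ^ Suc N * (gmom V (2 * Suc N) / fact (2 * Suc N)) = (- V / 2) ^ Suc N / fact (Suc N)"
  proof -
    have "- V / 2 = (- 1) * (V / 2)" by simp
    then have "(- V / 2) ^ Suc N = (- 1) ^ Suc N * (V / 2) ^ Suc N" by (simp only: power_mult_distrib)
    then show ?thesis by (simp only: gmom_even times_divide_eq_right)
  qed
  finally show ?case unfolding gmom_odd Suc by simp
qed simp

text \<open>
  The error of a Taylor polynomial of degree \<open>2 N\<close> is bounded by the moment of that order
  divided by \<open>(2 N)!\<close>; for normal moments this is \<open>(V / 2)\<^sup>N / N!\<close> up to a constant.
\<close>

theorem moments_imp_char_limit:
  assumes "prob_space M"
    and am: "\<forall>\<^sub>F T in at_top. all_moments M (Z T)"
    and lim: "\<And>n. ((\<lambda>T::real. \<integral>\<omega>. Z T \<omega> ^ n \<partial>M) \<longlongrightarrow> gmom V n) at_top"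
  shows "((\<lambda>T. \<integral>\<omega>. cis (Z T \<omega>) \<partial>M) \<longlongrightarrow> complex_of_real (exp (- V / 2))) at_top"
proof -
  interpret prob_space M by fact
  define s where "s N T = (\<Sum>k\<le>2 * N. \<i> ^ k / fact k * complex_of_real (\<integral>\<omega>. Z T \<omega> ^ k \<partial>M))" for N T
  let ?x = "complex_of_real (exp (- V / 2))"
  show ?thesis
  proof (rule tendsto_by_approximation[where
      E = "\<lambda>N T. 2 / fact (2 * N) * (\<integral>\<omega>. Z T \<omega> ^ (2 * N) \<partial>M) + norm (s N T - ?x)" and
      e = "\<lambda>N. 2 / fact (2 * N) * gmom V (2 * N) + norm ((\<Sum>k\<le>2 * N. \<i> ^ k / fact k * complex_of_real (gmom V k)) - ?x)"])
    fix N
    show "\<forall>\<^sub>F T in at_top. norm ((\<integral>\<omega>. cis (Z T \<omega>) \<partial>M) - ?x) \<le> 2 / fact (2 * N) * (\<integral>\<omega>. Z T \<omega> ^ (2 * N) \<partial>M) + norm (s N T - ?x)"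
      using am
    proof eventually_elim
      case (elim T)
      note [measurable] = all_momentsD(1)[OF elim]
      have i1: "integrable M (\<lambda>\<omega>. cis (Z T \<omega>))" by (rule integrable_const_bound[of _ 1]) auto
      have i2: "integrable M (\<lambda>\<omega>. \<i> ^ k / fact k * complex_of_real (Z T \<omega> ^ k))" for k
        by (intro integrable_mult_right integrable_of_real all_momentsD(3)[OF elim])
      have "(\<integral>\<omega>. cis (Z T \<omega>) \<partial>M) - s N T = (\<integral>\<omega>. cis (Z T \<omega>) - (\<Sum>k\<le>2 * N. \<i> ^ k / fact k * complex_of_real (Z T \<omega> ^ k)) \<partial>M)"
      proof -
        have "s N T = (\<Sum>k\<le>2 * N. \<integral>\<omega>. \<i> ^ k / fact k * complex_of_real (Z T \<omega> ^ k) \<partial>M)"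
          unfolding s_def by (simp only: integral_mult_right_zero integral_complex_of_real)
        also have "\<dots> = (\<integral>\<omega>. (\<Sum>k\<le>2 * N. \<i> ^ k / fact k * complex_of_real (Z T \<omega> ^ k)) \<partial>M)"
          by (rule Bochner_Integration.integral_sum[symmetric]) (rule i2)
        finally show ?thesis using i1 i2 by (simp only: Bochner_Integration.integral_diff Bochner_Integration.integrable_sum)
      qed
      then have "norm ((\<integral>\<omega>. cis (Z T \<omega>) \<partial>M) - s N T) \<le> (\<integral>\<omega>. norm (cis (Z T \<omega>) - (\<Sum>k\<le>2 * N. \<i> ^ k / fact k * complex_of_real (Z T \<omega> ^ k))) \<partial>M)"
        by (simp only: integral_norm_bound)
      also have "\<dots> \<le> (\<integral>\<omega>. 2 / fact (2 * N) * Z T \<omega> ^ (2 * N) \<partial>M)"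
      proof (rule integral_mono')
        show "integrable M (\<lambda>\<omega>. 2 / fact (2 * N) * Z T \<omega> ^ (2 * N))" by (intro integrable_mult_right all_momentsD(3)[OF elim])
        fix \<omega>
        have "norm (cis (Z T \<omega>) - (\<Sum>k\<le>2 * N. (\<i> * complex_of_real (Z T \<omega>)) ^ k / fact k)) \<le> 2 * \<bar>Z T \<omega>\<bar> ^ (2 * N) / fact (2 * N)"
          using iexp_approx2[of "Z T \<omega>" "2 * N"] by (simp add: cis_conv_exp)
        then show "norm (cis (Z T \<omega>) - (\<Sum>k\<le>2 * N. \<i> ^ k / fact k * complex_of_real (Z T \<omega> ^ k))) \<le> 2 / fact (2 * N) * Z T \<omega> ^ (2 * N)"
          by (simp add: power_mult_distrib power_even_abs)
      qed (simp add: power_mult)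
      finally have "norm ((\<integral>\<omega>. cis (Z T \<omega>) \<partial>M) - s N T) \<le> 2 / fact (2 * N) * (\<integral>\<omega>. Z T \<omega> ^ (2 * N) \<partial>M)" by simp
      moreover have "norm ((\<integral>\<omega>. cis (Z T \<omega>) \<partial>M) - ?x) \<le> norm ((\<integral>\<omega>. cis (Z T \<omega>) \<partial>M) - s N T) + norm (s N T - ?x)"
        using norm_triangle_ineq[of "(\<integral>\<omega>. cis (Z T \<omega>) \<partial>M) - s N T" "s N T - ?x"] by simp
      ultimately show ?case by linarith
    qed
    show "((\<lambda>T. 2 / fact (2 * N) * (\<integral>\<omega>. Z T \<omega> ^ (2 * N) \<partial>M) + norm (s N T - ?x)) \<longlongrightarrow>
      2 / fact (2 * N) * gmom V (2 * N) + norm ((\<Sum>k\<le>2 * N. \<i> ^ k / fact k * complex_of_real (gmom V k)) - ?x)) at_top"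
      unfolding s_def by (intro tendsto_add tendsto_mult_left lim tendsto_norm tendsto_diff tendsto_const tendsto_sum tendsto_of_real)
  next
    have exp_sums: "(\<lambda>k. x ^ k / fact k) sums exp x" for x :: real
      using exp_converges[of x] by (simp only: real_scaleR_def divide_inverse_commute)
    note sums = exp_sums[of "- V / 2"]
    have "(\<lambda>N. \<Sum>k\<le>N. (- V / 2) ^ k / fact k) \<longlonglongrightarrow> exp (- V / 2)"
      using sums by (simp add: sums_def_le)
    then have 1: "(\<lambda>N. \<Sum>k\<le>N. complex_of_real ((- V / 2) ^ k / fact k)) \<longlonglongrightarrow> ?x"
      unfolding of_real_sum[symmetric] by (rule tendsto_of_real)
    have "summable (\<lambda>k. (V / 2) ^ k / fact k)"
      by (rule sums_summable[OF exp_sums])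
    then have 2: "(\<lambda>N. (V / 2) ^ N / fact N) \<longlonglongrightarrow> 0" by (rule summable_LIMSEQ_zero)
    have "2 / fact (2 * N) * gmom V (2 * N) = 2 * ((V / 2) ^ N / fact N)" for N
      using gmom_even[of V N] by simp
    then have "(\<lambda>N. 2 / fact (2 * N) * gmom V (2 * N)) \<longlonglongrightarrow> 2 * 0"
      by (simp only:) (intro tendsto_mult_left 2)
    then have "(\<lambda>N. 2 / fact (2 * N) * gmom V (2 * N) + norm ((\<Sum>k\<le>2 * N. \<i> ^ k / fact k * complex_of_real (gmom V k)) - ?x)) \<longlonglongrightarrow> 2 * 0 + norm (?x - ?x)"
      unfolding gmom_exp_partial_sum by (intro tendsto_add tendsto_norm tendsto_diff 1 tendsto_const)
    then show "(\<lambda>N. 2 / fact (2 * N) * gmom V (2 * N) + norm ((\<Sum>k\<le>2 * N. \<i> ^ k / fact k * complex_of_real (gmom V k)) - ?x)) \<longlonglongrightarrow> 0"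
      by simp
  qed
qed

section \<open>Weak convergence from convergence of characteristic functions\<close>

text \<open>
  Trigonometric polynomials with real coefficients.
\<close>

inductive trig :: "(real ^ 'k::finite \<Rightarrow> real) \<Rightarrow> bool" where
  trig_cos: "trig (\<lambda>y. cos (c \<bullet> y))"
| trig_sin: "trig (\<lambda>y. sin (c \<bullet> y))"
| trig_add: "trig h \<Longrightarrow> trig h' \<Longrightarrow> trig (\<lambda>y. h y + h' y)"
| trig_scale: "trig h \<Longrightarrow> trig (\<lambda>y. a * h y)"

lemma trig_const: "trig (\<lambda>y. a)"
  using trig_scale[OF trig_cos[of 0], of a] by simp

lemma trig_cos_sin_mult:
  assumes "trig h" shows "trig (\<lambda>y. cos (c \<bullet> y) * h y) \<and> trig (\<lambda>y. sin (c \<bullet> y) * h y)"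
  using assms
proof induction
  case (trig_cos d)
  have "(\<lambda>y. cos (c \<bullet> y) * cos (d \<bullet> y)) = (\<lambda>y. 1 / 2 * cos ((c - d) \<bullet> y) + 1 / 2 * cos ((c + d) \<bullet> y))"
    "(\<lambda>y. sin (c \<bullet> y) * cos (d \<bullet> y)) = (\<lambda>y. 1 / 2 * sin ((c - d) \<bullet> y) + 1 / 2 * sin ((c + d) \<bullet> y))"
    by (auto simp: fun_eq_iff inner_diff_left inner_add_left cos_diff cos_add sin_diff sin_add field_simps)
  then show ?case by (simp only:) (intro conjI trig.intros)
next
  case (trig_sin d)
  have "(\<lambda>y. cos (c \<bullet> y) * sin (d \<bullet> y)) = (\<lambda>y. 1 / 2 * sin ((c + d) \<bullet> y) + (- 1 / 2) * sin ((c - d) \<bullet> y))"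
    "(\<lambda>y. sin (c \<bullet> y) * sin (d \<bullet> y)) = (\<lambda>y. 1 / 2 * cos ((c - d) \<bullet> y) + (- 1 / 2) * cos ((c + d) \<bullet> y))"
    by (auto simp: fun_eq_iff inner_diff_left inner_add_left cos_diff cos_add sin_diff sin_add field_simps)
  then show ?case by (simp only:) (intro conjI trig.intros)
next
  case (trig_add h h')
  then show ?case using trig.trig_add by (fastforce simp: distrib_left)
next
  case (trig_scale h a)
  have "(\<lambda>y. g y * (a * h y)) = (\<lambda>y. a * (g y * h y))" for g :: "real ^ 'a \<Rightarrow> real" by (simp add: mult.left_commute)
  then show ?case using trig_scale trig.trig_scale by metis
qed

lemma trig_mult:
  assumes "trig h" "trig h'" shows "trig (\<lambda>y. h y * h' y)"
  using assms(1)
proof induction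
  case (trig_add h1 h2)
  then show ?case using trig.trig_add[of "\<lambda>y. h1 y * h' y" "\<lambda>y. h2 y * h' y"] by (simp add: distrib_right)
next
  case (trig_scale h a)
  then show ?case using trig.trig_scale[of "\<lambda>y. h y * h' y" a] by (simp add: mult.assoc)
qed (use trig_cos_sin_mult[OF assms(2)] in auto)

lemma trig_continuous: "trig h \<Longrightarrow> continuous_on S h"
  by (induction rule: trig.induct) (auto intro!: continuous_intros)

lemma trig_bdd: "trig h \<Longrightarrow> bdd h"
proof (induction rule: trig.induct)
  case (trig_cos c) show ?case by (rule bddI[of _ 1]) simp
next
  case (trig_sin c) show ?case by (rule bddI[of _ 1]) simp
qed (auto intro: bdd_add bdd_mult bdd_const)

lemma trig_polynomial:
  assumes "real_polynomial_function p" and h: "trig h"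
  shows "trig (\<lambda>y. p (h y))"
  using assms(1)
proof induction
  case (linear f)
  then obtain c where "f = (\<lambda>x. x * c)" using real_bounded_linear by auto
  then show ?case using trig_scale[OF h, of c] by (simp add: mult.commute)
qed (auto intro: trig_const trig_add trig_mult)

text \<open>
  The Stone-Weierstrass theorem gives no control outside of the box. Composition with a
  polynomial that imitates clipping at \<open>B\<close> restores the bound everywhere and is again a
  trigonometric polynomial.
\<close>

lemma trig_approximation:
  fixes \<phi> :: "real ^ 'k::finite \<Rightarrow> real"
  assumes \<phi>: "continuous_on UNIV \<phi>" "\<And>y. \<bar>\<phi> y\<bar> \<le> B" and e: "0 < e" and \<rho>: "0 < \<rho>"
  obtains h where "trig h" "\<And>y. (\<forall>k. \<bar>y $ k\<bar> \<le> \<rho>) \<Longrightarrow> \<bar>\<phi> y - h y\<bar> \<le> e" "\<And>y. \<bar>h y\<bar> \<le> B + e"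
proof -
  let ?S = "{y :: real ^ 'k. \<forall>k. \<bar>y $ k\<bar> \<le> \<rho>}"
  have S: "?S = cbox (\<chi> k. - \<rho>) (\<chi> k. \<rho>)" by (auto simp: mem_box_cart abs_le_iff minus_le_iff)
  have B: "0 \<le> B" using order_trans[OF abs_ge_zero \<phi>(2)] .
  interpret function_ring_on "{h. trig h}" ?S
  proof
    show "compact ?S" unfolding S by (rule compact_cbox)
    show "\<And>f. f \<in> {h. trig h} \<Longrightarrow> continuous_on ?S f" by (auto intro: trig_continuous)
    show "\<And>f g. f \<in> {h. trig h} \<Longrightarrow> g \<in> {h. trig h} \<Longrightarrow> (\<lambda>x. f x + g x) \<in> {h. trig h}" by (auto intro: trig_add)
    show "\<And>f g. f \<in> {h. trig h} \<Longrightarrow> g \<in> {h. trig h} \<Longrightarrow> (\<lambda>x. f x * g x) \<in> {h. trig h}" by (auto intro: trig_mult)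
    show "\<And>c. (\<lambda>_. c) \<in> {h. trig h}" by (auto intro: trig_const)
    fix x y :: "real ^ 'k" assume xy: "x \<in> ?S" "y \<in> ?S" "x \<noteq> y"
    then obtain k where k: "x $ k \<noteq> y $ k" by (auto simp: vec_eq_iff)
    \<comment> \<open>The frequency is small enough for the sine to be injective on the box.\<close>
    define c :: "real ^ 'k" where "c = axis k (1 / \<rho>)"
    have c: "c \<bullet> z = z $ k / \<rho>" for z :: "real ^ 'k" by (simp add: c_def inner_axis')
    have r: "\<bar>z $ k / \<rho>\<bar> \<le> 1" if "z \<in> ?S" for z using that \<rho> by auto
    have "sin (c \<bullet> x) \<noteq> sin (c \<bullet> y)"
    proof
      assume "sin (c \<bullet> x) = sin (c \<bullet> y)"
      then have sn: "sin (x $ k / \<rho>) = sin (y $ k / \<rho>)" by (simp only: c)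
      have "- 1 \<le> x $ k / \<rho>" "x $ k / \<rho> \<le> 1" "- 1 \<le> y $ k / \<rho>" "y $ k / \<rho> \<le> 1"
        using r[OF xy(1)] r[OF xy(2)] by linarith+
      then have "x $ k / \<rho> = y $ k / \<rho>"
        using pi_gt3 by (intro sin_inj_pi[OF _ _ _ _ sn]) linarith+
      then show False using k \<rho> by simp
    qed
    then show "\<exists>f\<in>{h. trig h}. f x \<noteq> f y" by (auto intro!: trig_sin)
  qed
  obtain q where q: "trig q" "\<And>y. y \<in> ?S \<Longrightarrow> \<bar>\<phi> y - q y\<bar> < e / 2"
    using Stone_Weierstrass_basic[OF continuous_on_subset[OF \<phi>(1)], of "e / 2"] e by auto
  obtain C where C: "0 \<le> C" "\<And>y. norm (q y) \<le> C" by (rule bddE[OF trig_bdd[OF q(1)]]) (rule that)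
  define clip where "clip x = max (- B) (min B x)" for x
  have "continuous_on {- C..C} clip" unfolding clip_def by (intro continuous_intros)
  then obtain p where p: "real_polynomial_function p" "\<And>x. x \<in> {- C..C} \<Longrightarrow> \<bar>clip x - p x\<bar> < e / 2"
    using Stone_Weierstrass_real_polynomial_function[of "{- C..C}" clip "e / 2"] e by auto
  have qC: "q y \<in> {- C..C}" for y using C(2)[of y] by (auto simp: abs_le_iff)
  show ?thesis
  proof
    show "trig (\<lambda>y. p (q y))" by (rule trig_polynomial[OF p(1) q(1)])
    fix y :: "real ^ 'k"
    have "\<bar>clip (q y) - p (q y)\<bar> < e / 2" by (rule p(2)[OF qC])
    moreover have "\<bar>clip (q y)\<bar> \<le> B" using B by (auto simp: clip_def)
    ultimately show "\<bar>p (q y)\<bar> \<le> B + e" using e by linarith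
  next
    fix y :: "real ^ 'k" assume "\<forall>k. \<bar>y $ k\<bar> \<le> \<rho>"
    then have "\<bar>\<phi> y - q y\<bar> < e / 2" by (intro q(2)) simp
    moreover have "\<bar>\<phi> y - clip (q y)\<bar> \<le> \<bar>\<phi> y - q y\<bar>" using \<phi>(2)[of y] by (auto simp: clip_def)
    moreover have "\<bar>clip (q y) - p (q y)\<bar> < e / 2" by (rule p(2)[OF qC])
    ultimately show "\<bar>\<phi> y - p (q y)\<bar> \<le> e" by linarith
  qed
qed

lemma trig_expectation_limit:
  fixes Y :: "real \<Rightarrow> 'a \<Rightarrow> real ^ 'k::finite"
  assumes h: "trig h" and M: "prob_space M" and N: "prob_space N"
    and Y: "\<And>T. Y T \<in> borel_measurable M" and W: "W \<in> borel_measurable N"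
    and char: "\<And>c. ((\<lambda>T. \<integral>\<omega>. cis (c \<bullet> Y T \<omega>) \<partial>M) \<longlongrightarrow> (\<integral>\<omega>. cis (c \<bullet> W \<omega>) \<partial>N)) at_top"
  shows "((\<lambda>T. \<integral>\<omega>. h (Y T \<omega>) \<partial>M) \<longlongrightarrow> (\<integral>\<omega>. h (W \<omega>) \<partial>N)) at_top"
proof -
  interpret M: prob_space M by fact
  interpret N: prob_space N by fact
  note [measurable] = Y W
  have hm: "h \<in> borel_measurable borel" if "trig h" for h :: "real ^ 'k \<Rightarrow> real"
    by (intro borel_measurable_continuous_onI trig_continuous that)
  have iM: "integrable M (\<lambda>\<omega>. h (Y T \<omega>))" if th: "trig h" for h T
  proof -
    obtain C where C: "\<And>y. norm (h y) \<le> C" by (rule bddE[OF trig_bdd[OF th]]) (rule that)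
    note [measurable] = hm[OF th]
    show ?thesis using C by (intro M.integrable_const_bound[of _ C]) auto
  qed
  have iN: "integrable N (\<lambda>\<omega>. h (W \<omega>))" if th: "trig h" for h
  proof -
    obtain C where C: "\<And>y. norm (h y) \<le> C" by (rule bddE[OF trig_bdd[OF th]]) (rule that)
    note [measurable] = hm[OF th]
    show ?thesis using C by (intro N.integrable_const_bound[of _ C]) auto
  qed
  have cM: "integrable M (\<lambda>\<omega>. cis (c \<bullet> Y T \<omega>))" for c T by (rule M.integrable_const_bound[of _ 1]) auto
  have cN: "integrable N (\<lambda>\<omega>. cis (c \<bullet> W \<omega>))" for c by (rule N.integrable_const_bound[of _ 1]) auto
  show ?thesis using h
  proof induction
    case (trig_cos c)
    have "((\<lambda>T. Re (\<integral>\<omega>. cis (c \<bullet> Y T \<omega>) \<partial>M)) \<longlongrightarrow> Re (\<integral>\<omega>. cis (c \<bullet> W \<omega>) \<partial>N)) at_top"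
      by (intro tendsto_Re char)
    then show ?case using integral_Re[OF cM] integral_Re[OF cN] by simp
  next
    case (trig_sin c)
    have "((\<lambda>T. Im (\<integral>\<omega>. cis (c \<bullet> Y T \<omega>) \<partial>M)) \<longlongrightarrow> Im (\<integral>\<omega>. cis (c \<bullet> W \<omega>) \<partial>N)) at_top"
      by (intro tendsto_Im char)
    then show ?case using integral_Im[OF cM] integral_Im[OF cN] by simp
  next
    case (trig_add h h')
    then show ?case using iM iN by (simp add: tendsto_add)
  next
    case (trig_scale h a)
    then show ?case by (simp add: tendsto_mult_left)
  qed
qed

text \<open>
  The second moments give tightness: by Chebyshev's inequality the region outside of a large
  box, where the approximation by a trigonometric polynomial is only bounded, has small
  probability.
\<close>

theorem weak_convergence_from_char:
  fixes Y :: "real \<Rightarrow> 'a \<Rightarrow> real ^ 'k::finite" and \<phi> :: "real ^ 'k \<Rightarrow> real"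
  assumes M: "prob_space M" and N: "prob_space N"
    and Y: "\<And>T. Y T \<in> borel_measurable M" and W: "W \<in> borel_measurable N"
    and char: "\<And>c. ((\<lambda>T. \<integral>\<omega>. cis (c \<bullet> Y T \<omega>) \<partial>M) \<longlongrightarrow> (\<integral>\<omega>. cis (c \<bullet> W \<omega>) \<partial>N)) at_top"
    and momY: "\<forall>\<^sub>F T in at_top. \<forall>k. integrable M (\<lambda>\<omega>. (Y T \<omega> $ k)\<^sup>2) \<and> (\<integral>\<omega>. (Y T \<omega> $ k)\<^sup>2 \<partial>M) \<le> D"
    and momW: "\<And>k. integrable N (\<lambda>\<omega>. (W \<omega> $ k)\<^sup>2)" "\<And>k. (\<integral>\<omega>. (W \<omega> $ k)\<^sup>2 \<partial>N) \<le> D"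
    and \<phi>: "continuous_on UNIV \<phi>" "bounded (range \<phi>)"
  shows "((\<lambda>T. \<integral>\<omega>. \<phi> (Y T \<omega>) \<partial>M) \<longlongrightarrow> (\<integral>\<omega>. \<phi> (W \<omega>) \<partial>N)) at_top"
proof (rule tendstoI)
  fix r :: real assume r: "0 < r"
  obtain B where B: "\<And>y. \<bar>\<phi> y\<bar> \<le> B" using \<phi>(2) by (auto simp: bounded_iff)
  have B0: "0 \<le> B" using order_trans[OF abs_ge_zero B] .
  have D0: "0 \<le> D" by (rule order_trans[OF integral_nonneg_AE momW(2)]) simp
  define n where "n = real CARD('k)"
  define e where "e = min 1 (r / 8)"
  have e: "0 < e" "e \<le> 1" "e \<le> r / 8" using r by (auto simp: e_def)
  \<comment> \<open>The radius makes the contribution from outside of the box at most \<open>r / 8\<close>.\<close>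
  define \<rho> where "\<rho> = sqrt (1 + (2 * B + 1) * n * D * 8 / r)"
  have arg: "0 \<le> (2 * B + 1) * n * D * 8 / r" using B0 D0 r by (simp add: n_def)
  have \<rho>: "0 < \<rho>" "\<rho>\<^sup>2 = 1 + (2 * B + 1) * n * D * 8 / r" using arg by (auto simp: \<rho>_def)
  obtain h where h: "trig h" "\<And>y. (\<forall>k. \<bar>y $ k\<bar> \<le> \<rho>) \<Longrightarrow> \<bar>\<phi> y - h y\<bar> \<le> e" "\<And>y. \<bar>h y\<bar> \<le> B + e"
    by (rule trig_approximation[OF \<phi>(1) B e(1) \<rho>(1)]) (rule that)
  have [measurable]: "\<phi> \<in> borel_measurable borel" "h \<in> borel_measurable borel"
    by (intro borel_measurable_continuous_onI \<phi> trig_continuous h)+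
  have pt: "\<bar>\<phi> y - h y\<bar> \<le> e + (2 * B + 1) / \<rho>\<^sup>2 * (\<Sum>k\<in>UNIV. (y $ k)\<^sup>2)" for y
  proof (cases "\<forall>k. \<bar>y $ k\<bar> \<le> \<rho>")
    case True
    have "0 \<le> (2 * B + 1) / \<rho>\<^sup>2 * (\<Sum>k\<in>UNIV. (y $ k)\<^sup>2)" using B0 by (intro mult_nonneg_nonneg sum_nonneg) auto
    then show ?thesis using h(2)[OF True] by linarith
  next
    case False
    then obtain k where k: "\<rho> < \<bar>y $ k\<bar>" by (meson not_le_imp_less)
    have "\<rho>\<^sup>2 \<le> (y $ k)\<^sup>2" using k \<rho>(1) by (intro abs_le_square_iff[THEN iffD1]) simp
    also have "\<dots> \<le> (\<Sum>k\<in>UNIV. (y $ k)\<^sup>2)" by (rule member_le_sum) auto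
    finally have "(2 * B + 1) / \<rho>\<^sup>2 * \<rho>\<^sup>2 \<le> (2 * B + 1) / \<rho>\<^sup>2 * (\<Sum>k\<in>UNIV. (y $ k)\<^sup>2)"
      using B0 by (intro mult_left_mono) auto
    then have "2 * B + 1 \<le> (2 * B + 1) / \<rho>\<^sup>2 * (\<Sum>k\<in>UNIV. (y $ k)\<^sup>2)" using \<rho>(1) by simp
    then show ?thesis using B[of y] h(3)[of y] e by linarith
  qed
  have est: "\<bar>(\<integral>\<omega>. \<phi> (V \<omega>) \<partial>L) - (\<integral>\<omega>. h (V \<omega>) \<partial>L)\<bar> \<le> r / 4"
    if L: "prob_space L" and V[measurable]: "V \<in> borel_measurable L"
      and mom: "\<And>k. integrable L (\<lambda>\<omega>. (V \<omega> $ k)\<^sup>2)" "\<And>k. (\<integral>\<omega>. (V \<omega> $ k)\<^sup>2 \<partial>L) \<le> D" for L :: "'c measure" and V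
  proof -
    interpret L: prob_space L by fact
    have i: "integrable L (\<lambda>\<omega>. \<phi> (V \<omega>))" "integrable L (\<lambda>\<omega>. h (V \<omega>))"
    proof -
      show "integrable L (\<lambda>\<omega>. \<phi> (V \<omega>))" by (rule L.integrable_const_bound[of _ B]) (use B in auto)
      show "integrable L (\<lambda>\<omega>. h (V \<omega>))" by (rule L.integrable_const_bound[of _ "B + e"]) (use h(3) in auto)
    qed
    have "\<bar>(\<integral>\<omega>. \<phi> (V \<omega>) \<partial>L) - (\<integral>\<omega>. h (V \<omega>) \<partial>L)\<bar> \<le> (\<integral>\<omega>. \<bar>\<phi> (V \<omega>) - h (V \<omega>)\<bar> \<partial>L)"
      using i by (simp flip: Bochner_Integration.integral_diff)
    also have "\<dots> \<le> (\<integral>\<omega>. e + (2 * B + 1) / \<rho>\<^sup>2 * (\<Sum>k\<in>UNIV. (V \<omega> $ k)\<^sup>2) \<partial>L)"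
      using i mom pt by (intro integral_mono) auto
    also have "\<dots> = e + (2 * B + 1) / \<rho>\<^sup>2 * (\<Sum>k\<in>UNIV. (\<integral>\<omega>. (V \<omega> $ k)\<^sup>2 \<partial>L))"
      using mom by (simp add: L.prob_space)
    also have "\<dots> \<le> e + (2 * B + 1) / \<rho>\<^sup>2 * (\<Sum>k\<in>(UNIV :: 'k set). D)"
      using B0 mom by (intro add_left_mono mult_left_mono sum_mono) auto
    also have "\<dots> = e + (2 * B + 1) * n * D / \<rho>\<^sup>2" by (simp add: n_def)
    also have "\<dots> \<le> r / 8 + r / 8"
    proof (intro add_mono e(3))
      have "(2 * B + 1) * n * D = r / 8 * ((2 * B + 1) * n * D * 8 / r)" using r by simp
      also have "\<dots> \<le> r / 8 * \<rho>\<^sup>2" unfolding \<rho>(2) using r by (intro mult_left_mono) auto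
      finally show "(2 * B + 1) * n * D / \<rho>\<^sup>2 \<le> r / 8" using \<rho>(1) by (simp add: divide_le_eq)
    qed
    finally show ?thesis by simp
  qed
  have "\<forall>\<^sub>F T in at_top. dist (\<integral>\<omega>. h (Y T \<omega>) \<partial>M) (\<integral>\<omega>. h (W \<omega>) \<partial>N) < r / 4"
    using trig_expectation_limit[OF h(1) M N Y W char] r by (intro tendstoD) auto
  with momY show "\<forall>\<^sub>F T in at_top. dist (\<integral>\<omega>. \<phi> (Y T \<omega>) \<partial>M) (\<integral>\<omega>. \<phi> (W \<omega>) \<partial>N) < r"
  proof eventually_elim
    case (elim T)
    have a: "\<bar>(\<integral>\<omega>. \<phi> (Y T \<omega>) \<partial>M) - (\<integral>\<omega>. h (Y T \<omega>) \<partial>M)\<bar> \<le> r / 4"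
      using elim by (intro est M Y) auto
    have b: "\<bar>(\<integral>\<omega>. \<phi> (W \<omega>) \<partial>N) - (\<integral>\<omega>. h (W \<omega>) \<partial>N)\<bar> \<le> r / 4"
      by (intro est N W momW)
    show ?case using a b elim(2) r unfolding dist_real_def by linarith
  qed
qed

section \<open>Gaussian laws and Brownian motion\<close>

lemma integral_gaussian_law:
  fixes h :: "real \<Rightarrow> 'b::{banach, second_countable_topology}"
  assumes [measurable]: "h \<in> borel_measurable borel" and "s > 0"
  shows "(\<integral>x. h x \<partial>gaussian_law m s) = (\<integral>x. normal_density m s x *\<^sub>R h x \<partial>lborel)"
    "integrable (gaussian_law m s) h \<longleftrightarrow> integrable lborel (\<lambda>x. normal_density m s x *\<^sub>R h x)"
  using assms(2) by (auto simp: gaussian_law_def integral_density integrable_density normal_density_nonneg)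

lemma gaussian_law_degenerate: "gaussian_law m 0 = return borel m" by (simp add: gaussian_law_def)

lemma gaussian_law_moments:
  assumes "s \<ge> 0" shows "integrable (gaussian_law 0 s) (\<lambda>x. \<bar>x\<bar> ^ n)"
proof (cases "s = 0")
  case True then show ?thesis
    by (auto simp: gaussian_law_degenerate nn_integral_return intro!: integrableI_bounded)
next
  case False
  with assms have s: "s > 0" by simp
  show ?thesis using integrable_normal_moment_abs[OF s, of 0 n] by (subst integral_gaussian_law(2)) (use s in auto)
qed

lemma gaussian_law_mean:
  assumes "s \<ge> 0" shows "(\<integral>x. x \<partial>gaussian_law m s) = m"
proof (cases "s = 0")
  case True then show ?thesis by (simp add: gaussian_law_degenerate integral_return)
next
  case False
  with assms have s: "s > 0" by simp
  show ?thesis using integral_normal_moment_nz_1[OF s, of m] by (subst integral_gaussian_law(1)) (use s in auto)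
qed

lemma gaussian_law_variance:
  assumes "s \<ge> 0" shows "(\<integral>x. x\<^sup>2 \<partial>gaussian_law 0 s) = s\<^sup>2"
proof (cases "s = 0")
  case True then show ?thesis by (simp add: gaussian_law_degenerate integral_return)
next
  case False
  with assms have s: "s > 0" by simp
  have "(\<integral>x. normal_density 0 s x * x\<^sup>2 \<partial>lborel) = s\<^sup>2"
    using integral_normal_moment_even[OF s, of 0 1] s by (simp add: fact_2)
  then show ?thesis by (subst integral_gaussian_law(1)) (use s in auto)
qed

lemma gaussian_law_char:
  assumes "s \<ge> 0" shows "(\<integral>x. cis (d * x) \<partial>gaussian_law 0 s) = complex_of_real (exp (- (d\<^sup>2 * s\<^sup>2) / 2))"
proof (cases "s = 0")
  case True then show ?thesis by (simp add: gaussian_law_degenerate integral_return)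
next
  case False
  with assms have s: "s > 0" by simp
  have "(\<integral>x. cis (d * x) \<partial>gaussian_law 0 s) = (\<integral>x. normal_density 0 s x *\<^sub>R cis (d * x) \<partial>lborel)"
    by (rule integral_gaussian_law(1)) (use s in auto)
  also have "\<dots> = s *\<^sub>R (\<integral>z. normal_density 0 s (s * z) *\<^sub>R cis (d * (s * z)) \<partial>lborel)"
    using lborel_integral_real_affine[of s "\<lambda>x. normal_density 0 s x *\<^sub>R cis (d * x)" 0] s by simp
  also have "\<dots> = (\<integral>z. (s * normal_density 0 s (s * z)) *\<^sub>R cis (d * (s * z)) \<partial>lborel)"
    by (subst integral_scaleR_right[symmetric]) simp
  also have "(\<lambda>z. (s * normal_density 0 s (s * z)) *\<^sub>R cis (d * (s * z))) = (\<lambda>z. std_normal_density z *\<^sub>R cis ((d * s) * z))"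
    using s by (auto simp: normal_density_def std_normal_density_def power_mult_distrib real_sqrt_mult mult.assoc)
  also have "(\<integral>z. std_normal_density z *\<^sub>R cis ((d * s) * z) \<partial>lborel) = char std_normal_distribution (d * s)"
    unfolding char_def by (subst integral_density) (auto simp: cis_conv_exp)
  finally show ?thesis by (simp add: char_std_normal_distribution power_mult_distrib)
qed

lemma distr_gaussian:
  assumes Y: "Y \<in> borel_measurable M" and D: "distr M borel Y = gaussian_law 0 s" and s: "s \<ge> 0"
  shows "integrable M (\<lambda>\<omega>. \<bar>Y \<omega>\<bar> ^ n)" "(\<integral>\<omega>. \<bar>Y \<omega>\<bar> ^ n \<partial>M) = (\<integral>x. \<bar>x\<bar> ^ n \<partial>gaussian_law 0 s)"
    "(\<integral>\<omega>. (Y \<omega>)\<^sup>2 \<partial>M) = s\<^sup>2" "(\<integral>\<omega>. cis (d * Y \<omega>) \<partial>M) = complex_of_real (exp (- (d\<^sup>2 * s\<^sup>2) / 2))"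
proof -
  note [measurable] = Y
  show "integrable M (\<lambda>\<omega>. \<bar>Y \<omega>\<bar> ^ n)"
    using gaussian_law_moments[OF s, of n] unfolding D[symmetric] by (subst (asm) integrable_distr_eq) auto
  show "(\<integral>\<omega>. \<bar>Y \<omega>\<bar> ^ n \<partial>M) = (\<integral>x. \<bar>x\<bar> ^ n \<partial>gaussian_law 0 s)"
    unfolding D[symmetric] by (subst integral_distr) auto
  show "(\<integral>\<omega>. (Y \<omega>)\<^sup>2 \<partial>M) = s\<^sup>2"
    using gaussian_law_variance[OF s] unfolding D[symmetric] by (subst (asm) integral_distr) auto
  show "(\<integral>\<omega>. cis (d * Y \<omega>) \<partial>M) = complex_of_real (exp (- (d\<^sup>2 * s\<^sup>2) / 2))"
    using gaussian_law_char[OF s, of d] unfolding D[symmetric] by (subst (asm) integral_distr) auto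
qed

lemma Brownian_square:
  assumes B: "standard_brownian_motion_on {0..1} N B" and t: "t \<in> {0..1}"
  shows "integrable N (\<lambda>\<omega>. (B t \<omega>)\<^sup>2)" "(\<integral>\<omega>. (B t \<omega>)\<^sup>2 \<partial>N) \<le> 1"
proof -
  have [measurable]: "B v \<in> borel_measurable N" if "v \<in> {0..1}" for v
    using B that by (simp add: standard_brownian_motion_on_def)
  have [measurable]: "B 0 \<in> borel_measurable N" "B t \<in> borel_measurable N" using t by auto
  have B0: "AE \<omega> in N. B 0 \<omega> = 0" using B by (simp add: standard_brownian_motion_on_def)
  have "integrable N (\<lambda>\<omega>. (B t \<omega>)\<^sup>2) \<and> (\<integral>\<omega>. (B t \<omega>)\<^sup>2 \<partial>N) \<le> 1"
  proof (cases "t = 0")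
    case True
    have ae: "AE \<omega> in N. (B t \<omega>)\<^sup>2 = 0" using B0 True by auto
    show ?thesis using integrable_cong_AE[OF _ _ ae] integral_cong_AE[OF _ _ ae] by simp
  next
    case False
    let ?Y = "\<lambda>\<omega>. B t \<omega> - B 0 \<omega>"
    have D: "distr N borel ?Y = gaussian_law 0 (sqrt (t - 0))"
      using B t False unfolding standard_brownian_motion_on_def by auto
    have Y: "?Y \<in> borel_measurable N" by measurable
    have s: "0 \<le> sqrt (t - 0)" using t by simp
    have i: "integrable N (\<lambda>\<omega>. (?Y \<omega>)\<^sup>2)" using distr_gaussian(1)[OF Y D s, of 2] by simp
    have v: "(\<integral>\<omega>. (?Y \<omega>)\<^sup>2 \<partial>N) = t" using distr_gaussian(3)[OF Y D s] t by simp
    have ae: "AE \<omega> in N. (B t \<omega>)\<^sup>2 = (?Y \<omega>)\<^sup>2" using B0 by auto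
    show ?thesis using integrable_cong_AE[OF _ _ ae] integral_cong_AE[OF _ _ ae] i v t by simp
  qed
  then show "integrable N (\<lambda>\<omega>. (B t \<omega>)\<^sup>2)" "(\<integral>\<omega>. (B t \<omega>)\<^sup>2 \<partial>N) \<le> 1" by auto
qed

text \<open>
  A combination of values is a combination of independent increments over the sorted time
  points; a sum by parts expresses its variance by the covariances \<open>min (t j) (t k)\<close>.
\<close>

theorem Brownian_char:
  fixes t a :: "'k::finite \<Rightarrow> real"
  assumes B: "standard_brownian_motion_on {0..1} N B" and t: "\<And>k. t k \<in> {0..1}"
  shows "(\<integral>\<omega>. cis (\<Sum>k\<in>UNIV. a k * B (t k) \<omega>) \<partial>N)
    = complex_of_real (exp (- (\<Sum>j\<in>UNIV. \<Sum>k\<in>UNIV. a j * a k * min (t j) (t k)) / 2))"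
proof -
  interpret N: prob_space N using B by (simp add: standard_brownian_motion_on_def)
  have Bm: "B v \<in> borel_measurable N" if "v \<in> {0..1}" for v
    using B that by (simp add: standard_brownian_motion_on_def)
  define P where "P = insert 0 (range t)"
  have P: "finite P" "P \<subseteq> {0..1}" "0 \<in> P" "P \<noteq> {}" unfolding P_def using t by auto
  define xs where "xs = sorted_list_of_set P"
  have xs: "set xs = P" "sorted_wrt (<) xs" "xs \<noteq> []" using P by (auto simp: xs_def)
  define n where "n = length xs - 1"
  have len: "length xs = Suc n" using xs(3) by (cases xs) (auto simp: n_def)
  define \<tau> where "\<tau> i = xs ! i" for i
  have \<tau>P: "\<tau> i \<in> P" if "i \<le> n" for i using that len xs(1) nth_mem[of i xs] by (auto simp: \<tau>_def)
  have \<tau>I: "\<tau> i \<in> {0..1}" if "i \<le> n" for i using \<tau>P[OF that] P(2) by blast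
  have \<tau>less: "\<tau> i < \<tau> j" if "i < j" "j \<le> n" for i j
    using sorted_wrt_nth_less[OF xs(2), of i j] that len by (simp add: \<tau>_def)
  have \<tau>le: "\<tau> i \<le> \<tau> j" if "i \<le> j" "j \<le> n" for i j using \<tau>less[of i j] that by (cases "i = j") auto
  have \<tau>0: "\<tau> 0 = 0"
  proof -
    obtain i where i: "i \<le> n" "\<tau> i = 0" using P(3) xs(1) len by (auto simp: in_set_conv_nth \<tau>_def less_Suc_eq_le)
    have "\<tau> 0 \<le> 0" using \<tau>le[of 0 i] i by simp
    moreover have "0 \<le> \<tau> 0" using \<tau>I[of 0] by simp
    ultimately show ?thesis by simp
  qed
  have "\<exists>i\<le>n. \<tau> i = t k" for k
    using xs(1) len by (auto simp: P_def in_set_conv_nth \<tau>_def less_Suc_eq_le dest!: equalityD2 subsetD[of _ _ "t k"])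
  then obtain idx where idx: "\<And>k. idx k \<le> n" "\<And>k. \<tau> (idx k) = t k" by metis
  define \<Delta> where "\<Delta> i \<omega> = B (\<tau> (Suc i)) \<omega> - B (\<tau> i) \<omega>" for i \<omega>
  \<comment> \<open>The coefficient of the increment after \<open>\<tau> i\<close>: all later values contain it.\<close>
  define d where "d i = (\<Sum>k\<in>UNIV. if i < idx k then a k else 0)" for i
  have \<Delta>m: "\<Delta> i \<in> borel_measurable N" if "i < n" for i
    unfolding \<Delta>_def[abs_def] using that by (intro borel_measurable_diff Bm \<tau>I) auto
  have telescope: "(\<Sum>i<m. h (Suc i) - h i) = h m - h 0" for h :: "nat \<Rightarrow> real" and m
    by (rule sum_lessThan_telescope)
  have upto: "(\<Sum>i<n. if i < m then h i else 0) = (\<Sum>i<m. h i)" if "m \<le> n" for h :: "nat \<Rightarrow> real" and m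
    using that by (intro sum.mono_neutral_cong_right) auto
  have B0: "AE \<omega> in N. B 0 \<omega> = 0" using B by (simp add: standard_brownian_motion_on_def)
  have ae: "AE \<omega> in N. (\<Sum>k\<in>UNIV. a k * B (t k) \<omega>) = (\<Sum>i<n. d i * \<Delta> i \<omega>)"
    using B0
  proof eventually_elim
    case (elim \<omega>)
    have "a k * B (t k) \<omega> = (\<Sum>i<n. (if i < idx k then a k else 0) * \<Delta> i \<omega>)" for k
    proof -
      have "(\<Sum>i<n. (if i < idx k then a k else 0) * \<Delta> i \<omega>) = (\<Sum>i<n. if i < idx k then a k * \<Delta> i \<omega> else 0)"
        by (intro sum.cong) auto
      also have "\<dots> = (\<Sum>i<idx k. a k * \<Delta> i \<omega>)" by (rule upto[OF idx(1)])
      also have "\<dots> = a k * (\<Sum>i<idx k. B (\<tau> (Suc i)) \<omega> - B (\<tau> i) \<omega>)" by (simp only: sum_distrib_left \<Delta>_def)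
      also have "\<dots> = a k * B (t k) \<omega>" unfolding telescope[of "\<lambda>i. B (\<tau> i) \<omega>"] by (simp add: \<tau>0 idx elim)
      finally show ?thesis ..
    qed
    then have "(\<Sum>k\<in>UNIV. a k * B (t k) \<omega>) = (\<Sum>k\<in>UNIV. \<Sum>i<n. (if i < idx k then a k else 0) * \<Delta> i \<omega>)" by simp
    also have "\<dots> = (\<Sum>i<n. d i * \<Delta> i \<omega>)" by (subst sum.swap) (simp add: d_def sum_distrib_right)
    finally show ?case .
  qed
  have indep: "N.indep_vars (\<lambda>_. borel) (\<lambda>i \<omega>. B (\<tau> (Suc i)) \<omega> - B (\<tau> i) \<omega>) {..<n}"
  proof -
    have "(\<forall>i\<le>n. \<tau> i \<in> {0..1}) \<and> (\<forall>i<n. \<tau> i \<le> \<tau> (Suc i))" using \<tau>I \<tau>le by auto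
    then show ?thesis using B unfolding standard_brownian_motion_on_def by blast
  qed
  have indep': "N.indep_vars (\<lambda>_. borel) (\<lambda>i \<omega>. d i * \<Delta> i \<omega>) {..<n}"
    unfolding \<Delta>_def by (rule N.indep_vars_compose2[OF indep, of "\<lambda>i x. d i * x"]) auto
  have one: "char (distr N borel (\<lambda>\<omega>. d i * \<Delta> i \<omega>)) 1 = complex_of_real (exp (- ((d i)\<^sup>2 * (\<tau> (Suc i) - \<tau> i)) / 2))" if i: "i < n" for i
  proof -
    note [measurable] = \<Delta>m[OF i]
    have lt: "\<tau> i < \<tau> (Suc i)" using \<tau>less[of i "Suc i"] i by simp
    have D: "distr N borel (\<Delta> i) = gaussian_law 0 (sqrt (\<tau> (Suc i) - \<tau> i))"
      using B lt \<tau>I[of i] \<tau>I[of "Suc i"] i unfolding standard_brownian_motion_on_def \<Delta>_def[abs_def] by auto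
    have "char (distr N borel (\<lambda>\<omega>. d i * \<Delta> i \<omega>)) 1 = (\<integral>\<omega>. cis (d i * \<Delta> i \<omega>) \<partial>N)"
      unfolding char_def by (subst integral_distr) (auto simp: cis_conv_exp)
    then show ?thesis using distr_gaussian(4)[OF \<Delta>m[OF i] D, of "d i"] lt by simp
  qed
  have "(\<integral>\<omega>. cis (\<Sum>k\<in>UNIV. a k * B (t k) \<omega>) \<partial>N) = (\<integral>\<omega>. cis (\<Sum>i<n. d i * \<Delta> i \<omega>) \<partial>N)"
  proof (rule integral_cong_AE)
    show "(\<lambda>\<omega>. cis (\<Sum>k\<in>UNIV. a k * B (t k) \<omega>)) \<in> borel_measurable N"
      by (intro measurable_compose[OF _ cis_measurable] borel_measurable_sum borel_measurable_times borel_measurable_const Bm t)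
    show "(\<lambda>\<omega>. cis (\<Sum>i<n. d i * \<Delta> i \<omega>)) \<in> borel_measurable N"
      by (intro measurable_compose[OF _ cis_measurable] borel_measurable_sum borel_measurable_times borel_measurable_const \<Delta>m) simp
  qed (use ae in auto)
  also have "\<dots> = char (distr N borel (\<lambda>\<omega>. \<Sum>i<n. d i * \<Delta> i \<omega>)) 1"
  proof -
    have "(\<lambda>\<omega>. \<Sum>i<n. d i * \<Delta> i \<omega>) \<in> borel_measurable N"
      by (intro borel_measurable_sum borel_measurable_times borel_measurable_const \<Delta>m) simp
    then show ?thesis unfolding char_def by (subst integral_distr) (auto simp: cis_conv_exp)
  qed
  also have "\<dots> = (\<Prod>i<n. char (distr N borel (\<lambda>\<omega>. d i * \<Delta> i \<omega>)) 1)"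
    by (rule N.char_distr_sum[OF indep'])
  also have "\<dots> = (\<Prod>i<n. complex_of_real (exp (- ((d i)\<^sup>2 * (\<tau> (Suc i) - \<tau> i)) / 2)))"
    using one by (intro prod.cong) auto
  also have "\<dots> = complex_of_real (exp (\<Sum>i<n. - ((d i)\<^sup>2 * (\<tau> (Suc i) - \<tau> i)) / 2))"
    by (simp only: of_real_prod[symmetric] exp_sum finite_lessThan)
  also have "(\<Sum>i<n. - ((d i)\<^sup>2 * (\<tau> (Suc i) - \<tau> i)) / 2) = - (\<Sum>i<n. (d i)\<^sup>2 * (\<tau> (Suc i) - \<tau> i)) / 2"
    by (simp add: sum_negf sum_divide_distrib)
  also have "(\<Sum>i<n. (d i)\<^sup>2 * (\<tau> (Suc i) - \<tau> i)) = (\<Sum>j\<in>UNIV. \<Sum>k\<in>UNIV. a j * a k * min (t j) (t k))"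
  proof -
    have "(d i)\<^sup>2 * (\<tau> (Suc i) - \<tau> i) = (\<Sum>j\<in>UNIV. \<Sum>k\<in>UNIV. a j * a k * (if i < min (idx j) (idx k) then \<tau> (Suc i) - \<tau> i else 0))" for i
    proof -
      have "(d i)\<^sup>2 * (\<tau> (Suc i) - \<tau> i) = (\<Sum>j\<in>UNIV. \<Sum>k\<in>UNIV. ((if i < idx j then a j else 0) * (if i < idx k then a k else 0)) * (\<tau> (Suc i) - \<tau> i))"
      proof -
        have "(d i)\<^sup>2 = (\<Sum>j\<in>UNIV. \<Sum>k\<in>UNIV. (if i < idx j then a j else 0) * (if i < idx k then a k else 0))"
          by (simp only: d_def power2_eq_square sum_product)
        then show ?thesis by (simp only: sum_distrib_right)
      qed
      also have "\<dots> = (\<Sum>j\<in>UNIV. \<Sum>k\<in>UNIV. a j * a k * (if i < min (idx j) (idx k) then \<tau> (Suc i) - \<tau> i else 0))"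
        by (intro sum.cong refl) auto
      finally show ?thesis .
    qed
    then have "(\<Sum>i<n. (d i)\<^sup>2 * (\<tau> (Suc i) - \<tau> i)) = (\<Sum>i<n. \<Sum>j\<in>UNIV. \<Sum>k\<in>UNIV. a j * a k * (if i < min (idx j) (idx k) then \<tau> (Suc i) - \<tau> i else 0))"
      by simp
    also have "\<dots> = (\<Sum>j\<in>UNIV. \<Sum>i<n. \<Sum>k\<in>UNIV. a j * a k * (if i < min (idx j) (idx k) then \<tau> (Suc i) - \<tau> i else 0))"
      by (rule sum.swap)
    also have "\<dots> = (\<Sum>j\<in>UNIV. \<Sum>k\<in>UNIV. \<Sum>i<n. a j * a k * (if i < min (idx j) (idx k) then \<tau> (Suc i) - \<tau> i else 0))"
      by (intro sum.cong refl) (rule sum.swap)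
    also have "\<dots> = (\<Sum>j\<in>UNIV. \<Sum>k\<in>UNIV. a j * a k * min (t j) (t k))"
    proof (intro sum.cong refl)
      fix j k
      have "(\<Sum>i<n. a j * a k * (if i < min (idx j) (idx k) then \<tau> (Suc i) - \<tau> i else 0)) = a j * a k * (\<Sum>i<min (idx j) (idx k). \<tau> (Suc i) - \<tau> i)"
        using idx(1)[of j] by (simp only: sum_distrib_left[symmetric]) (subst upto, auto)
      also have "(\<Sum>i<min (idx j) (idx k). \<tau> (Suc i) - \<tau> i) = \<tau> (min (idx j) (idx k))" unfolding telescope by (simp add: \<tau>0)
      also have "\<tau> (min (idx j) (idx k)) = min (t j) (t k)"
        using \<tau>le[of "idx j" "idx k"] \<tau>le[of "idx k" "idx j"] idx(1)[of j] idx(1)[of k] idx(2)[of j] idx(2)[of k]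
        by (cases "idx j \<le> idx k") (auto simp: min_def)
      finally show "(\<Sum>i<n. a j * a k * (if i < min (idx j) (idx k) then \<tau> (Suc i) - \<tau> i else 0)) = a j * a k * min (t j) (t k)" .
    qed
    finally show ?thesis .
  qed
  finally show ?thesis .
qed

section \<open>Iterated kernels\<close>

text \<open>
  The real kernels of the time domain, in contrast to the complex ones of the spectral side.
\<close>

definition rkernel :: "(real \<Rightarrow> real \<Rightarrow> real) \<Rightarrow> bool" where
  "rkernel K \<longleftrightarrow> (\<lambda>q. K (fst q) (snd q)) \<in> borel_measurable (borel \<Otimes>\<^sub>M borel) \<and> bdd (\<lambda>q. K (fst q) (snd q))"

lemma rkernel_measurable:
  assumes "rkernel K" "f \<in> borel_measurable M" "g \<in> borel_measurable M"
  shows "(\<lambda>x. K (f x) (g x)) \<in> borel_measurable M"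
proof -
  have "(\<lambda>x. (\<lambda>q. K (fst q) (snd q)) (f x, g x)) \<in> borel_measurable M"
    using assms by (intro measurable_compose[OF measurable_Pair]) (auto simp: rkernel_def)
  then show ?thesis by simp
qed

lemma rkernel_bdd: "rkernel K \<Longrightarrow> bdd (\<lambda>x. K (f x) (g x))"
proof -
  assume "rkernel K"
  then obtain C where C: "\<And>q. norm (K (fst q) (snd q)) \<le> C" by (auto simp: rkernel_def bdd_def)
  have "norm (K (f x) (g x)) \<le> C" for x using C[of "(f x, g x)"] by simp
  then show ?thesis by (rule bddI)
qed

lemma rkernel_of_real: "rkernel K \<Longrightarrow> kernel (\<lambda>u v. complex_of_real (K u v))"
  unfolding rkernel_def kernel_def by (auto intro: bdd_of_real)

definition rcomp :: "real measure \<Rightarrow> (real \<Rightarrow> real \<Rightarrow> real) \<Rightarrow> (real \<Rightarrow> real \<Rightarrow> real) \<Rightarrow> (real \<Rightarrow> real \<Rightarrow> real) \<Rightarrow> real \<Rightarrow> real \<Rightarrow> real" where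
  "rcomp S R K L b d = (\<integral>a. \<integral>c. K b a * R a c * L c d \<partial>S \<partial>S)"

text \<open>
  Powers with respect to composition. A neutral element is missing, so \<open>kpow0\<close> counts from the
  first power, and \<open>kpow\<close> has the proper exponents for \<open>n \<ge> 1\<close>.
\<close>

primrec kpow0 :: "real measure \<Rightarrow> (real \<Rightarrow> real \<Rightarrow> real) \<Rightarrow> (real \<Rightarrow> real \<Rightarrow> real) \<Rightarrow> nat \<Rightarrow> real \<Rightarrow> real \<Rightarrow> real" where
  "kpow0 S R K 0 = K"
| "kpow0 S R K (Suc n) = rcomp S R K (kpow0 S R K n)"

definition kpow :: "real measure \<Rightarrow> (real \<Rightarrow> real \<Rightarrow> real) \<Rightarrow> (real \<Rightarrow> real \<Rightarrow> real) \<Rightarrow> nat \<Rightarrow> real \<Rightarrow> real \<Rightarrow> real" where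
  "kpow S R K n = kpow0 S R K (n - 1)"

definition hatr :: "real measure \<Rightarrow> (real \<Rightarrow> real \<Rightarrow> real) \<Rightarrow> real \<Rightarrow> real \<Rightarrow> complex" where
  "hatr S K = hat S S (\<lambda>u v. complex_of_real (K u v))"

definition rtr :: "real measure \<Rightarrow> (real \<Rightarrow> real \<Rightarrow> real) \<Rightarrow> (real \<Rightarrow> real \<Rightarrow> real) \<Rightarrow> real" where
  "rtr S R K = (\<integral>p. K (fst p) (snd p) * R (fst p) (snd p) \<partial>(S \<Otimes>\<^sub>M S))"

context
  fixes S :: "real measure" and R :: "real \<Rightarrow> real \<Rightarrow> real"
  assumes S: "fin_borel S" and R: "rkernel R"
begin

lemma rkernel_rcomp:
  assumes K: "rkernel K" and L: "rkernel L"
  shows "rkernel (rcomp S R K L)"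
  unfolding rkernel_def
proof
  interpret S: sigma_finite_measure S by (rule fin_borelD(3)[OF S])
  note [measurable_cong] = fin_borelD(2)[OF S]
  note [measurable (raw)] = rkernel_measurable[OF K] rkernel_measurable[OF L] rkernel_measurable[OF R]
  show "(\<lambda>q. rcomp S R K L (fst q) (snd q)) \<in> borel_measurable (borel \<Otimes>\<^sub>M borel)"
    unfolding rcomp_def by measurable
  show "bdd (\<lambda>q. rcomp S R K L (fst q) (snd q))"
    unfolding rcomp_def by (intro bdd_integral fin_borelD[OF S] bdd_mult rkernel_bdd K L R)
qed

lemma rcomp_assoc:
  assumes K: "rkernel K" and L: "rkernel L" and N: "rkernel N"
  shows "rcomp S R (rcomp S R K L) N = rcomp S R K (rcomp S R L N)"
proof (intro ext)
  fix b d
  interpret S: sigma_finite_measure S by (rule fin_borelD(3)[OF S])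
  note [measurable_cong] = fin_borelD(2)[OF S]
  note [measurable (raw)] = rkernel_measurable[OF K] rkernel_measurable[OF L] rkernel_measurable[OF R] rkernel_measurable[OF N]
  note b = bdd_integral fin_borelD[OF S] bdd_mult rkernel_bdd[OF K] rkernel_bdd[OF L] rkernel_bdd[OF R] rkernel_bdd[OF N]
  let ?h = "\<lambda>a c x y. K b x * R x y * L y a * (R a c * N c d)"
  have "rcomp S R (rcomp S R K L) N b d = (\<integral>a. \<integral>c. \<integral>x. \<integral>y. ?h a c x y \<partial>S \<partial>S \<partial>S \<partial>S)"
    by (simp add: rcomp_def mult.assoc flip: integral_mult_left_zero)
  also have "\<dots> = (\<integral>a. \<integral>x. \<integral>c. \<integral>y. ?h a c x y \<partial>S \<partial>S \<partial>S \<partial>S)"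
    by (intro Bochner_Integration.integral_cong refl Fubini_bdd b) measurable
  also have "\<dots> = (\<integral>a. \<integral>x. \<integral>y. \<integral>c. ?h a c x y \<partial>S \<partial>S \<partial>S \<partial>S)"
    by (intro Bochner_Integration.integral_cong refl Fubini_bdd b) measurable
  also have "\<dots> = (\<integral>x. \<integral>a. \<integral>y. \<integral>c. ?h a c x y \<partial>S \<partial>S \<partial>S \<partial>S)"
    by (intro Fubini_bdd b) measurable
  also have "\<dots> = (\<integral>x. \<integral>y. \<integral>a. \<integral>c. ?h a c x y \<partial>S \<partial>S \<partial>S \<partial>S)"
    by (intro Bochner_Integration.integral_cong refl Fubini_bdd b) measurable
  also have "\<dots> = rcomp S R K (rcomp S R L N) b d"
    by (simp add: rcomp_def mult.assoc flip: integral_mult_right_zero)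
  finally show "rcomp S R (rcomp S R K L) N b d = rcomp S R K (rcomp S R L N) b d" .
qed

lemma rcomp_transpose:
  assumes K: "rkernel K" and L: "rkernel L" and Rs: "\<And>s t. R s t = R t s"
  shows "rcomp S R K L b d = rcomp S R (\<lambda>u v. L v u) (\<lambda>u v. K v u) d b"
proof -
  interpret S: sigma_finite_measure S by (rule fin_borelD(3)[OF S])
  note [measurable_cong] = fin_borelD(2)[OF S]
  note [measurable (raw)] = rkernel_measurable[OF K] rkernel_measurable[OF L] rkernel_measurable[OF R]
  have "rcomp S R K L b d = (\<integral>c. \<integral>a. K b a * R a c * L c d \<partial>S \<partial>S)"
    unfolding rcomp_def by (intro Fubini_bdd bdd_mult fin_borelD[OF S] rkernel_bdd K L R) measurable
  also have "\<dots> = rcomp S R (\<lambda>u v. L v u) (\<lambda>u v. K v u) d b"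
    unfolding rcomp_def by (intro Bochner_Integration.integral_cong refl) (simp add: Rs[of _ "_"] mult_ac)
  finally show ?thesis .
qed

lemma rkernel_kpow: "rkernel K \<Longrightarrow> rkernel (kpow S R K n)"
proof -
  assume K: "rkernel K"
  have "rkernel (kpow0 S R K m)" for m by (induction m) (auto intro: rkernel_rcomp K)
  then show ?thesis by (simp add: kpow_def)
qed

lemma kpow0_add:
  assumes K: "rkernel K" shows "kpow0 S R K (Suc (m + n)) = rcomp S R (kpow0 S R K m) (kpow0 S R K n)"
proof (induction m)
  case (Suc m)
  have k: "rkernel (kpow0 S R K j)" for j by (induction j) (auto intro: rkernel_rcomp K)
  have "kpow0 S R K (Suc (Suc m + n)) = rcomp S R K (kpow0 S R K (Suc (m + n)))" by simp
  also have "\<dots> = rcomp S R K (rcomp S R (kpow0 S R K m) (kpow0 S R K n))" by (simp only: Suc)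
  also have "\<dots> = rcomp S R (kpow0 S R K (Suc m)) (kpow0 S R K n)" by (simp add: rcomp_assoc[OF K k k])
  finally show ?case .
qed simp

lemma kpow_add:
  assumes K: "rkernel K" and mn: "1 \<le> m" "1 \<le> n"
  shows "kpow S R K (m + n) = rcomp S R (kpow S R K m) (kpow S R K n)"
proof -
  have "m + n - 1 = Suc ((m - 1) + (n - 1))" using mn by simp
  then show ?thesis unfolding kpow_def by (simp only: kpow0_add[OF K])
qed

lemma kpow_sym:
  assumes K: "rkernel K" and Ks: "\<And>u v. K u v = K v u" and Rs: "\<And>s t. R s t = R t s"
  shows "kpow S R K n u v = kpow S R K n v u"
proof -
  have k: "rkernel (kpow0 S R K j)" for j by (induction j) (auto intro: rkernel_rcomp K)
  have "kpow0 S R K m u v = kpow0 S R K m v u" for m u v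
  proof (induction m arbitrary: u v)
    case (Suc m)
    have "(\<lambda>u v. kpow0 S R K m v u) = kpow0 S R K m" "(\<lambda>u v. K v u) = K" using Suc Ks by (auto simp: fun_eq_iff)
    then have "kpow0 S R K (Suc m) u v = rcomp S R (kpow0 S R K m) (kpow0 S R K 0) v u"
      using rcomp_transpose[OF K k[of m] Rs, of u v] by simp
    also have "\<dots> = kpow0 S R K (Suc m) v u" using kpow0_add[OF K, of m 0] by simp
    finally show ?case .
  qed (simp, rule Ks)
  then show ?thesis by (simp add: kpow_def)
qed

context
  fixes F :: "real measure"
  assumes F: "fin_borel F" and spec: "\<And>s t. complex_of_real (R s t) = ftm F (s - t)"
    and Rs: "\<And>s t. R s t = R t s"
begin

lemma kernel_hatr: "rkernel K \<Longrightarrow> kernel (hatr S K)"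
  unfolding hatr_def by (intro kernel_hat S rkernel_of_real)

lemma hatr_rcomp:
  assumes K: "rkernel K" and L: "rkernel L"
  shows "hatr S (rcomp S R K L) = kmult F (hatr S K) (hatr S L)"
proof (intro ext)
  fix y z
  have "(\<lambda>u v. complex_of_real (rcomp S R K L u v)) = kcomp S S (ftm F) (\<lambda>u v. complex_of_real (K u v)) (\<lambda>u v. complex_of_real (L u v))"
    by (intro ext) (simp add: rcomp_def kcomp_def flip: spec integral_complex_of_real)
  then show "hatr S (rcomp S R K L) y z = kmult F (hatr S K) (hatr S L) y z"
    unfolding hatr_def kmult_def using hat_kcomp[OF S S S S F rkernel_of_real[OF K] rkernel_of_real[OF L], of y z] by simp
qed

lemma cnj_hatr:
  assumes K: "rkernel K" and Ks: "\<And>u v. K u v = K v u"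
  shows "cnj (hatr S K y w) = hatr S K w y"
proof -
  interpret S: sigma_finite_measure S by (rule fin_borelD(3)[OF S])
  note [measurable_cong] = fin_borelD(2)[OF S]
  note [measurable (raw)] = rkernel_measurable[OF K]
  have "cnj (hatr S K y w) = (\<integral>u. \<integral>v. cis (- (w * v)) * complex_of_real (K v u) * cis (y * u) \<partial>S \<partial>S)"
    unfolding hatr_def hat_def Bochner_Integration.integral_cnj[symmetric]
    by (simp add: cis_cnj Ks[of _ "_"] mult_ac)
  also have "\<dots> = (\<integral>v. \<integral>u. cis (- (w * v)) * complex_of_real (K v u) * cis (y * u) \<partial>S \<partial>S)"
    by (intro Fubini_bdd bdd_mult bdd_cis bdd_of_real fin_borelD[OF S] rkernel_bdd K) measurable
  finally show ?thesis by (simp add: hatr_def hat_def)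
qed

lemma rtr_rcomp:
  assumes K: "rkernel K" and L: "rkernel L" and Ls: "\<And>u v. L u v = L v u"
  shows "complex_of_real (rtr S R (rcomp S R K L)) = (\<integral>p. hatr S K (fst p) (snd p) * cnj (hatr S L (fst p) (snd p)) \<partial>(F \<Otimes>\<^sub>M F))"
proof -
  interpret S: sigma_finite_measure S by (rule fin_borelD(3)[OF S])
  interpret F: sigma_finite_measure F by (rule fin_borelD(3)[OF F])
  note [measurable_cong] = fin_borelD(2)[OF S] fin_borelD(2)[OF F]
  note KL = rkernel_rcomp[OF K L]
  note [measurable (raw)] = rkernel_measurable[OF KL] rkernel_measurable[OF R] kernel_measurable[OF kernel_hatr[OF K]] kernel_measurable[OF kernel_hatr[OF L]]
  have "rtr S R (rcomp S R K L) = (\<integral>u. \<integral>v. rcomp S R K L u v * R u v \<partial>S \<partial>S)"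
    unfolding rtr_def by (intro integral_pair_bdd bdd_mult fin_borelD[OF S] rkernel_bdd KL R) measurable
  then have "complex_of_real (rtr S R (rcomp S R K L)) = (\<integral>u. \<integral>v. complex_of_real (rcomp S R K L u v) * ftm F (v - u) \<partial>S \<partial>S)"
    by (simp add: Rs[of _ "_"] flip: spec integral_complex_of_real)
  also have "\<dots> = (\<integral>y. hatr S (rcomp S R K L) y y \<partial>F)"
    unfolding hatr_def by (rule trace_hat[OF S S F rkernel_of_real[OF KL], symmetric])
  also have "\<dots> = (\<integral>y. \<integral>w. hatr S K y w * cnj (hatr S L y w) \<partial>F \<partial>F)"
    by (simp add: hatr_rcomp[OF K L] kmult_def cnj_hatr[OF L Ls])
  also have "\<dots> = (\<integral>p. hatr S K (fst p) (snd p) * cnj (hatr S L (fst p) (snd p)) \<partial>(F \<Otimes>\<^sub>M F))"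
    by (intro integral_pair_bdd[symmetric] fin_borelD[OF F] bdd_mult bdd_cnj kernel_bdd kernel_hatr K L) measurable
  finally show ?thesis .
qed

text \<open>
  On the spectral side powers of kernels are powers of one Hermitian operator \<open>H\<close>. The trace
  of \<open>H\<^sup>2\<close> is the square of its Hilbert-Schmidt norm, and the trace of \<open>H\<^sup>n\<close> is the inner
  product of \<open>H\<^sup>2\<close> and \<open>H\<^sup>n\<^sup>-\<^sup>2\<close>.
\<close>

theorem rtr_bounds:
  assumes K: "rkernel K" and Ks: "\<And>u v. K u v = K v u"
  shows "rtr S R (kpow S R K 2) = (hs F (hatr S K))\<^sup>2"
    "3 \<le> n \<Longrightarrow> \<bar>rtr S R (kpow S R K n)\<bar> \<le> hs F (kmult F (hatr S K) (hatr S K)) * hs F (hatr S K) ^ (n - 2)"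
proof -
  note k = rkernel_kpow[OF K] and ks = kpow_sym[OF K Ks Rs]
  have k1: "kpow S R K 1 = K" by (simp add: kpow_def)
  have k2: "kpow S R K 2 = rcomp S R K K" using kpow_add[OF K, of 1 1] unfolding k1 by (simp only: one_add_one order_refl)
  have "complex_of_real (rtr S R (kpow S R K 2)) = complex_of_real ((hs F (hatr S K))\<^sup>2)"
    unfolding k2 rtr_rcomp[OF K K Ks] hs_def sqn_square
    by (subst integral_complex_of_real[symmetric]) (simp only: complex_norm_square)
  then show "rtr S R (kpow S R K 2) = (hs F (hatr S K))\<^sup>2" by (simp only: of_real_eq_iff)
  have pow: "hs F (hatr S (kpow S R K (Suc m))) \<le> hs F (hatr S K) ^ Suc m" for m
  proof (induction m)
    case 0 then show ?case using k1 by simp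
  next
    case (Suc m)
    have "kpow S R K (Suc (Suc m)) = rcomp S R K (kpow S R K (Suc m))" using kpow_add[OF K, of 1 "Suc m", unfolded k1] by simp
    then have "hs F (hatr S (kpow S R K (Suc (Suc m)))) \<le> hs F (hatr S K) * hs F (hatr S (kpow S R K (Suc m)))"
      using hs_kmult_le[OF F kernel_hatr[OF K] kernel_hatr[OF k]] by (simp add: hatr_rcomp[OF K k])
    also have "\<dots> \<le> hs F (hatr S K) * hs F (hatr S K) ^ Suc m" by (intro mult_left_mono Suc) simp
    finally show ?case by simp
  qed
  assume n: "3 \<le> n"
  have "kpow S R K n = rcomp S R (kpow S R K 2) (kpow S R K (n - 2))"
  proof -
    have "kpow S R K (2 + (n - 2)) = rcomp S R (kpow S R K 2) (kpow S R K (n - 2))" by (rule kpow_add[OF K]) (use n in auto)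
    moreover have "2 + (n - 2) = n" using n by simp
    ultimately show ?thesis by (simp only:)
  qed
  then have "\<bar>rtr S R (kpow S R K n)\<bar> = norm (\<integral>p. hatr S (kpow S R K 2) (fst p) (snd p) * cnj (hatr S (kpow S R K (n - 2)) (fst p) (snd p)) \<partial>(F \<Otimes>\<^sub>M F))"
    by (simp only: rtr_rcomp[OF k k ks, symmetric] norm_of_real)
  also have "\<dots> \<le> hs F (hatr S (kpow S R K 2)) * sqn (F \<Otimes>\<^sub>M F) (\<lambda>p. cnj (hatr S (kpow S R K (n - 2)) (fst p) (snd p)))"
    unfolding hs_def by (intro sq_int_Cauchy_Schwarz sq_int_cnj kernel_sq_int F kernel_hatr k)
  also have "\<dots> = hs F (kmult F (hatr S K) (hatr S K)) * hs F (hatr S (kpow S R K (n - 2)))"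
    unfolding sqn_cnj k2 hatr_rcomp[OF K K] hs_def ..
  also have "\<dots> \<le> hs F (kmult F (hatr S K) (hatr S K)) * hs F (hatr S K) ^ (n - 2)"
    using pow[of "n - 3"] n by (intro mult_left_mono) (auto simp: Suc_diff_Suc numeral_3_eq_3 numeral_2_eq_2)
  finally show "\<bar>rtr S R (kpow S R K n)\<bar> \<le> hs F (kmult F (hatr S K) (hatr S K)) * hs F (hatr S K) ^ (n - 2)" .
qed

end

end

section \<open>Toeplitz functionals of a Gaussian process\<close>

text \<open>
  All functionals are written over the window at time one, those at earlier times with a
  cut-off.
\<close>

lemma integral_window_sub:
  fixes h :: "real \<Rightarrow> 'b::{banach, second_countable_topology}"
  assumes [measurable]: "h \<in> borel_measurable borel" and "l \<le> T"
  shows "(\<integral>u. indicator {0..l} u *\<^sub>R h u \<partial>window T) = (\<integral>u. h u \<partial>window l)"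
proof -
  have "(\<integral>u. indicator {0..l} u *\<^sub>R h u \<partial>window T) = (\<integral>u. indicator {0..T} u *\<^sub>R (indicator {0..l} u *\<^sub>R h u) \<partial>lborel)"
    by (rule integral_window) measurable
  also have "\<dots> = (\<integral>u. indicator {0..l} u *\<^sub>R h u \<partial>lborel)"
    using assms(2) by (intro Bochner_Integration.integral_cong) (auto simp: indicator_def)
  also have "\<dots> = (\<integral>u. h u \<partial>window l)" by (rule integral_window[symmetric]) measurable
  finally show ?thesis .
qed

locale toeplitz_functionals = gaussian_field M X R for M :: "'a measure" and X R +
  fixes f g :: "real \<Rightarrow> real"
  assumes f: "integrable lborel f" "\<And>x. 0 \<le> f x" and g: "integrable lborel g" "\<And>x. 0 \<le> g x"
    and g_even: "\<And>x. g (- x) = g x"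
    and spec: "\<And>s t. complex_of_real (R s t) = ftm (dens f) (s - t)"
begin

abbreviation "F \<equiv> dens f"
abbreviation "G \<equiv> dens g"

lemma finF: "fin_borel F" and finG: "fin_borel G" by (rule finFG[OF f g])+

text \<open>
  The transform of an even function is real.
\<close>

definition gh :: "real \<Rightarrow> real" where "gh x = Re (fourier_hat g x)"

lemma of_real_gh: "complex_of_real (gh x) = ftm G x"
proof -
  have [measurable]: "g \<in> borel_measurable borel" using g by auto
  have eq: "ftm G x = ft (\<lambda>x. complex_of_real (g x)) x" by (rule ftm_dens) (use g in auto)
  have "cnj (ftm G x) = ftm G x"
    unfolding eq cnj_ft using ft_reflect[of "\<lambda>x. complex_of_real (g x)" x] by (simp add: g_even)
  then show ?thesis unfolding gh_def fourier_hat_eq_ft eq by (simp add: complex_eq_iff)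
qed

lemma gh_measurable [measurable]: "gh \<in> borel_measurable borel"
proof -
  have "gh = (\<lambda>x. Re (ftm G x))" by (simp flip: of_real_gh)
  then show ?thesis using ftm_measurable[OF finG] by simp
qed

lemma gh_bdd: "bdd (\<lambda>x. gh (h x))"
  using ftm_bdd[OF finG, of h] by (simp add: bdd_def flip: of_real_gh)

lemma gh_even: "gh (- x) = gh x"
proof -
  have "complex_of_real (gh (- x)) = cnj (complex_of_real (gh x))" unfolding of_real_gh cnj_ftm ..
  then show ?thesis by simp
qed

definition k1 :: "real \<Rightarrow> real \<Rightarrow> real \<Rightarrow> real \<Rightarrow> real" where
  "k1 s T u v = indicator {0..T * s} u * (indicator {0..T * s} v * gh (u - v)) / sqrt T"

lemma k1_sym: "k1 s T u v = k1 s T v u"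
  using gh_even[of "u - v"] by (simp add: k1_def)

lemma rkernel_k1: "rkernel (k1 s T)"
  unfolding rkernel_def k1_def divide_inverse
  by (intro conjI bdd_mult bdd_indicator gh_bdd bdd_const) measurable

definition K1 :: "('k::finite \<Rightarrow> real) \<Rightarrow> ('k \<Rightarrow> real) \<Rightarrow> real \<Rightarrow> real \<Rightarrow> real \<Rightarrow> real" where
  "K1 c t T u v = (\<Sum>k\<in>UNIV. c k * k1 (t k) T u v)"

lemma K1_sym: "K1 c t T u v = K1 c t T v u"
  unfolding K1_def using k1_sym by (intro sum.cong refl) simp

lemma rkernel_K1: "rkernel (K1 c t T)"
proof -
  have 1: "(\<lambda>q. k1 s T (fst q) (snd q)) \<in> borel_measurable (borel \<Otimes>\<^sub>M borel)" "bdd (\<lambda>q. k1 s T (fst q) (snd q))" for s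
    using rkernel_k1 by (auto simp: rkernel_def)
  show ?thesis unfolding rkernel_def K1_def
    by (intro conjI bdd_sum bdd_mult bdd_const 1 borel_measurable_sum borel_measurable_times borel_measurable_const)
qed

lemma rkernel_R: "rkernel R"
  unfolding rkernel_def using R_measurable R_bdd by auto

lemma hatr_k1:
  assumes T: "0 < T" and s: "s \<le> 1"
  shows "hatr (window T) (k1 s T) y z = complex_of_real (1 / sqrt T) * Amp G (T * s) y z"
proof -
  have l: "T * s \<le> T" using T s by simp
  let ?l = "T * s"
  note [measurable (raw)] = kernel_measurable[OF kernel_Toep[OF finG]]
  interpret S: sigma_finite_measure "window ?l" by simp
  have "hatr (window T) (k1 s T) y z
     = (\<integral>u. \<integral>v. complex_of_real (1 / sqrt T) * (indicator {0..?l} u *\<^sub>R (indicator {0..?l} v *\<^sub>R (cis (- (y * u)) * Toep G u v * cis (z * v)))) \<partial>window T \<partial>window T)"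
    unfolding hatr_def hat_def
    by (intro Bochner_Integration.integral_cong refl) (auto simp: k1_def Toep_def scaleR_conv_of_real indicator_def simp flip: of_real_gh)
  also have "\<dots> = complex_of_real (1 / sqrt T) * (\<integral>u. indicator {0..?l} u *\<^sub>R (\<integral>v. indicator {0..?l} v *\<^sub>R (cis (- (y * u)) * Toep G u v * cis (z * v)) \<partial>window T) \<partial>window T)"
    by (simp only: integral_mult_right_zero integral_scaleR_right)
  also have "(\<lambda>u. \<integral>v. indicator {0..?l} v *\<^sub>R (cis (- (y * u)) * Toep G u v * cis (z * v)) \<partial>window T) = (\<lambda>u. \<integral>v. cis (- (y * u)) * Toep G u v * cis (z * v) \<partial>window ?l)"
    by (intro ext integral_window_sub l) measurable
  also have "(\<integral>u. indicator {0..?l} u *\<^sub>R (\<integral>v. cis (- (y * u)) * Toep G u v * cis (z * v) \<partial>window ?l) \<partial>window T) = (\<integral>u. \<integral>v. cis (- (y * u)) * Toep G u v * cis (z * v) \<partial>window ?l \<partial>window ?l)"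
    by (intro integral_window_sub l) measurable
  finally show ?thesis by (simp add: Amp_def hat_def)
qed

lemma hatr_K1:
  assumes T: "0 < T" and t: "\<And>k. t k \<le> 1"
  shows "hatr (window T) (K1 c t T) = Phi g c t T"
proof (intro ext)
  fix y z
  note [measurable (raw)] = rkernel_measurable[OF rkernel_k1]
  interpret S: sigma_finite_measure "window T" by simp
  note b = bdd_integral finite_window bdd_mult bdd_cis bdd_const bdd_of_real rkernel_bdd[OF rkernel_k1]
  let ?h = "\<lambda>k u v. complex_of_real (c k) * (cis (- (y * u)) * complex_of_real (k1 (t k) T u v) * cis (z * v))"
  have i1: "integrable (window T) (\<lambda>v. ?h k u v)" for k u
    by (intro bdd_integrable b) measurable
  have i2: "integrable (window T) (\<lambda>u. \<integral>v. ?h k u v \<partial>window T)" for k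
    by (intro bdd_integrable b) measurable
  have "hatr (window T) (K1 c t T) y z = (\<integral>u. \<integral>v. (\<Sum>k\<in>UNIV. ?h k u v) \<partial>window T \<partial>window T)"
    unfolding hatr_def hat_def
    by (intro Bochner_Integration.integral_cong refl) (simp add: K1_def sum_distrib_left sum_distrib_right mult_ac)
  also have "\<dots> = (\<integral>u. (\<Sum>k\<in>UNIV. \<integral>v. ?h k u v \<partial>window T) \<partial>window T)"
    by (intro Bochner_Integration.integral_cong refl Bochner_Integration.integral_sum i1)
  also have "\<dots> = (\<Sum>k\<in>UNIV. \<integral>u. \<integral>v. ?h k u v \<partial>window T \<partial>window T)"
    by (rule Bochner_Integration.integral_sum) (rule i2)
  also have "\<dots> = (\<Sum>k\<in>UNIV. complex_of_real (c k) * hatr (window T) (k1 (t k) T) y z)"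
    by (simp only: integral_mult_right_zero hatr_def hat_def)
  also have "\<dots> = Phi g c t T y z"
    unfolding Phi_def using hatr_k1[OF T t] by (intro sum.cong refl) simp
  finally show "hatr (window T) (K1 c t T) y z = Phi g c t T y z" .
qed

lemma quadratic: "quadratic_functionals M X R (window T) (kpow (window T) R (K1 c t T))"
proof unfold_locales
  show "fin_borel (window T)" by simp
  have k: "rkernel (kpow (window T) R (K1 c t T) n)" for n
    by (rule rkernel_kpow[OF fin_borel_window rkernel_R rkernel_K1])
  show "(\<lambda>q. kpow (window T) R (K1 c t T) n (fst q) (snd q)) \<in> borel_measurable (borel \<Otimes>\<^sub>M borel)"
    "bdd (\<lambda>q. kpow (window T) R (K1 c t T) n (fst q) (snd q))" for n
    using k[of n] by (auto simp: rkernel_def)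
  show "kpow (window T) R (K1 c t T) n a b = kpow (window T) R (K1 c t T) n b a" for n a b
    by (rule kpow_sym[OF fin_borel_window rkernel_R rkernel_K1 K1_sym R_sym])
  show "kpow (window T) R (K1 c t T) (m + n) b d = (\<integral>a. \<integral>e. kpow (window T) R (K1 c t T) m b a * R a e * kpow (window T) R (K1 c t T) n e d \<partial>window T \<partial>window T)"
    if "1 \<le> m" "1 \<le> n" for m n b d
    using kpow_add[OF fin_borel_window[of T] rkernel_R rkernel_K1[of c t T] that] by (simp add: rcomp_def)
qed

text \<open>
  The weighted sum of the functionals, as one quadratic functional; \<open>W_eq_Q_tilde\<close> makes the
  connection.
\<close>

definition W :: "('k::finite \<Rightarrow> real) \<Rightarrow> ('k \<Rightarrow> real) \<Rightarrow> real \<Rightarrow> 'a \<Rightarrow> real" where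
  "W c t T \<omega> = (\<integral>p. K1 c t T (fst p) (snd p) * (X (fst p) \<omega> * X (snd p) \<omega> - R (fst p) (snd p)) \<partial>(window T \<Otimes>\<^sub>M window T))"

lemma am_W: "all_moments M (W c t T)"
proof -
  interpret q: quadratic_functionals M X R "window T" "kpow (window T) R (K1 c t T)" by (rule quadratic)
  have "W c t T = q.Q 1" by (simp add: fun_eq_iff W_def q.Q_def kpow_def)
  then show ?thesis using q.am_Q by simp
qed

lemma trace_facts:
  assumes T: "0 < T" and t: "\<And>k. t k \<le> 1"
  shows "rtr (window T) R (kpow (window T) R (K1 c t T) 2) = (hs F (Phi g c t T))\<^sup>2"
    "3 \<le> n \<Longrightarrow> \<bar>rtr (window T) R (kpow (window T) R (K1 c t T) n)\<bar> \<le> hs F (kmult F (Phi g c t T) (Phi g c t T)) * hs F (Phi g c t T) ^ (n - 2)"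
  using rtr_bounds(2)[OF fin_borel_window[of T] rkernel_R finF spec R_sym rkernel_K1[of c t T] K1_sym, of n]
    rtr_bounds(1)[OF fin_borel_window[of T] rkernel_R finF spec R_sym rkernel_K1[of c t T] K1_sym]
  unfolding hatr_K1[OF T t] by auto

text \<open>
  The case of two functionals of index one in the recursion.
\<close>

lemma W_second_moment:
  assumes T: "0 < T" and t: "\<And>k. t k \<le> 1"
  shows "(\<integral>\<omega>. (W c t T \<omega>)\<^sup>2 \<partial>M) = 2 * (hs F (Phi g c t T))\<^sup>2"
proof -
  interpret q: quadratic_functionals M X R "window T" "kpow (window T) R (K1 c t T)" by (rule quadratic)
  have W: "W c t T = q.Q 1" by (simp add: fun_eq_iff W_def q.Q_def kpow_def)
  have tr: "q.ptr 2 = (hs F (Phi g c t T))\<^sup>2"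
    using trace_facts(1)[OF T t, of c] by (simp add: q.ptr_def rtr_def)
  have PQ0: "q.PQ [] = (\<lambda>_. 1)" by (simp add: fun_eq_iff q.PQ_Nil)
  have "(\<integral>\<omega>. q.PQ [2] \<omega> \<partial>M) = 0" using q.moment_recursion[of 2 "[]"] by simp
  then have "(\<integral>\<omega>. q.PQ [1, 1] \<omega> \<partial>M) = 2 * q.ptr 2"
    using q.moment_recursion[of 1 "[1]"] by (simp add: PQ0 prob_space numeral_2_eq_2)
  then show ?thesis unfolding W tr by (simp add: q.PQ_Cons q.PQ_Nil power2_eq_square)
qed

text \<open>
  The conclusion of the moment method, with \<open>V\<close> the variance of the weighted sum of the values
  of the limit process.
\<close>

theorem W_char_limit:
  fixes c t :: "'k::finite \<Rightarrow> real"
  assumes fg: "integrable lborel (\<lambda>x. (f x * g x)\<^sup>2)"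
    and trace: "((\<lambda>T. (hs F (Amp G T))\<^sup>2 / T) \<longlongrightarrow> (2 * pi) ^ 3 * (\<integral>x. (f x * g x)\<^sup>2 \<partial>lborel)) at_top"
    and t: "\<And>k. t k \<in> {0..1}"
  defines "V \<equiv> 2 * ((2 * pi) ^ 3 * (\<integral>x. (f x * g x)\<^sup>2 \<partial>lborel) * (\<Sum>j\<in>UNIV. \<Sum>k\<in>UNIV. c j * c k * min (t j) (t k)))"
  shows "((\<lambda>T. \<integral>\<omega>. cis (W c t T \<omega>) \<partial>M) \<longlongrightarrow> complex_of_real (exp (- V / 2))) at_top"
proof (rule moments_imp_char_limit)
  show "prob_space M" by unfold_locales
  show "\<forall>\<^sub>F T in at_top. all_moments M (W c t T)" by (simp add: am_W)
  have t0: "0 \<le> t k" "t k \<le> 1" for k using t[of k] by auto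
  let ?Phi = "Phi g c t"
  define KK where "KK T = kpow (window T) R (K1 c t T)" for T
  define q where "q T n \<omega> = (\<integral>p. KK T n (fst p) (snd p) * (X (fst p) \<omega> * X (snd p) \<omega> - R (fst p) (snd p)) \<partial>(window T \<Otimes>\<^sub>M window T))" for T n \<omega>
  define e where "e T ns = (\<integral>\<omega>. prod_list (map (\<lambda>n. q T n \<omega>) ns) \<partial>M)" for T ns
  define p where "p T n = (\<integral>p. KK T n (fst p) (snd p) * R (fst p) (snd p) \<partial>(window T \<Otimes>\<^sub>M window T))" for T n
  have pr: "p T n = rtr (window T) R (kpow (window T) R (K1 c t T) n)" for T n
    by (simp add: p_def KK_def rtr_def)
  have hs2: "((\<lambda>T. (hs F (?Phi T))\<^sup>2) \<longlongrightarrow> V / 2) at_top"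
    using second_trace_limit[OF f g fg trace, of t c, OF t0(1)] by (simp add: V_def mult.assoc)
  have hs1: "((\<lambda>T. hs F (?Phi T)) \<longlongrightarrow> sqrt (V / 2)) at_top"
    using tendsto_real_sqrt[OF hs2] by simp
  have p2: "((\<lambda>T. p T 2) \<longlongrightarrow> V / 2) at_top"
  proof (rule Lim_transform_eventually[OF hs2])
    show "\<forall>\<^sub>F T in at_top. (hs F (?Phi T))\<^sup>2 = p T 2"
      using eventually_gt_at_top[of 0] by eventually_elim (simp add: pr trace_facts(1) t0)
  qed
  have p3: "((\<lambda>T. p T n) \<longlongrightarrow> 0) at_top" if n: "3 \<le> n" for n
  proof (rule Lim_null_comparison)
    show "\<forall>\<^sub>F T in at_top. norm (p T n) \<le> hs F (kmult F (?Phi T) (?Phi T)) * hs F (?Phi T) ^ (n - 2)"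
      using eventually_gt_at_top[of 0] by eventually_elim (simp add: pr trace_facts(2) t0 n)
    have "((\<lambda>T. hs F (kmult F (?Phi T) (?Phi T)) * hs F (?Phi T) ^ (n - 2)) \<longlongrightarrow> 0 * sqrt (V / 2) ^ (n - 2)) at_top"
      by (intro tendsto_mult tendsto_power hs1 fourth_trace_limit[OF f g fg trace, of t c, OF t0(1)])
    then show "((\<lambda>T. hs F (kmult F (?Phi T) (?Phi T)) * hs F (?Phi T) ^ (n - 2)) \<longlongrightarrow> 0) at_top" by simp
  qed
  have rec: "e T (m # ns) = (\<Sum>(n, ns')\<leftarrow>picks ns. 2 * (e T ((m + n) # ns') + p T (m + n) * e T ns'))"
    if "1 \<le> m" "\<forall>n\<in>set ns. 1 \<le> n" for m ns T
  proof -
    interpret q: quadratic_functionals M X R "window T" "KK T" unfolding KK_def by (rule quadratic)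
    have "q.Q = q T" by (simp add: fun_eq_iff q.Q_def q_def)
    then have "e T ns = (\<integral>\<omega>. q.PQ ns \<omega> \<partial>M)" for ns by (simp add: e_def q.PQ_def)
    moreover have "p T n = q.ptr n" for n by (simp add: p_def q.ptr_def)
    ultimately show ?thesis using q.moment_recursion[OF that] by simp
  qed
  fix n
  have "((\<lambda>T. e T (replicate n 1)) \<longlongrightarrow> (if \<forall>n\<in>set (replicate n (1::nat)). n = 1 then gmom V (length (replicate n (1::nat))) else 0)) at_top"
  proof (rule moments_limit[where p = p])
    show "\<forall>\<^sub>F T in at_top. e T [] = 1" by (simp add: e_def prob_space)
    show "\<forall>\<^sub>F T in at_top. e T (m # ns) = (\<Sum>(n, ns')\<leftarrow>picks ns. 2 * (e T ((m + n) # ns') + p T (m + n) * e T ns'))"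
      if "1 \<le> m" "\<forall>n\<in>set ns. 1 \<le> n" for m ns
      by (intro always_eventually allI rec that)
    show "((\<lambda>T. p T 2) \<longlongrightarrow> V / 2) at_top" by (rule p2)
    show "((\<lambda>T. p T n) \<longlongrightarrow> 0) at_top" if "3 \<le> n" for n by (rule p3[OF that])
  qed auto
  moreover have "e T (replicate n 1) = (\<integral>\<omega>. W c t T \<omega> ^ n \<partial>M)" for T
    by (simp add: e_def q_def W_def KK_def kpow_def map_replicate_const prod_list_replicate)
  ultimately show "((\<lambda>T. \<integral>\<omega>. W c t T \<omega> ^ n \<partial>M) \<longlongrightarrow> gmom V n) at_top" by simp
qed

text \<open>
  The functionals are defined by iterated integrals along paths. For almost all paths these
  are integrals over the square, where the combinatorics of kernels takes place.
\<close>

lemma path_integrable: "AE \<omega> in M. integrable (window T) (\<lambda>u. X u \<omega>)"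
proof -
  interpret S: sigma_finite_measure "window T" by simp
  interpret pair_sigma_finite "window T" M ..
  have "all_moments (window T \<Otimes>\<^sub>M M) (\<lambda>p. X (fst p) (snd p))" by (rule am_X_pair) auto
  from all_momentsD(4)[OF this] show ?thesis
    using AE_integrable_snd[of "\<lambda>u \<omega>. X u \<omega>"] by (simp add: case_prod_unfold)
qed

lemma path_pair_integrable:
  assumes \<omega>: "\<omega> \<in> space M" "integrable (window T) (\<lambda>u. X u \<omega>)" and K: "rkernel K"
  shows "integrable (window T \<Otimes>\<^sub>M window T) (\<lambda>p. K (fst p) (snd p) * (X (fst p) \<omega> * X (snd p) \<omega>))"
proof -
  note [measurable] = \<omega>(1)
  note [measurable (raw)] = rkernel_measurable[OF K]
  obtain C where C: "C \<ge> 0" "\<And>q. norm (K (fst q) (snd q)) \<le> C" by (rule bddE[OF rkernel_bdd[OF K]]) (rule that)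
  show ?thesis
  proof (rule integrable_pair_dominated[where p = "\<lambda>u. C * \<bar>X u \<omega>\<bar>" and q = "\<lambda>v. \<bar>X v \<omega>\<bar>"])
    fix u v
    show "norm (K (fst (u, v)) (snd (u, v)) * (X (fst (u, v)) \<omega> * X (snd (u, v)) \<omega>)) \<le> C * \<bar>X u \<omega>\<bar> * \<bar>X v \<omega>\<bar>"
      using C(2)[of "(u, v)"] by (simp add: abs_mult mult.assoc mult_right_mono)
  qed (use \<omega>(2) in auto)
qed

lemma kernel_R_integrable:
  assumes K: "rkernel K"
  shows "integrable (window T \<Otimes>\<^sub>M window T) (\<lambda>p. K (fst p) (snd p) * R (fst p) (snd p))"
proof -
  note [measurable (raw)] = rkernel_measurable[OF K]
  show ?thesis by (intro bdd_integrable finite_measure_pair_measure finite_window bdd_mult rkernel_bdd K rkernel_R) measurable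
qed

lemma Q_func_measurable: "Q_func g X T s \<in> borel_measurable M"
proof -
  have "Q_func g X T s = (\<lambda>\<omega>. \<integral>v. indicator {0..T * s} v *\<^sub>R (\<integral>u. indicator {0..T * s} u *\<^sub>R (gh (u - v) * X u \<omega> * X v \<omega>) \<partial>lborel) \<partial>lborel)"
    by (intro ext) (simp only: Q_func_def set_lebesgue_integral_def gh_def)
  then show ?thesis by simp
qed

lemma Q_func_eq:
  assumes T: "0 < T" and s: "s \<le> 1" and \<omega>: "\<omega> \<in> space M" "integrable (window T) (\<lambda>u. X u \<omega>)"
  shows "Q_func g X T s \<omega> = sqrt T * (\<integral>p. k1 s T (fst p) (snd p) * (X (fst p) \<omega> * X (snd p) \<omega>) \<partial>(window T \<Otimes>\<^sub>M window T))"
proof -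
  have l: "T * s \<le> T" using T s by simp
  let ?l = "T * s"
  note [measurable] = \<omega>(1)
  interpret S: sigma_finite_measure "window T" by simp
  interpret Sl: sigma_finite_measure "window ?l" by simp
  interpret pair_sigma_finite "window T" "window T" ..
  have "Q_func g X T s \<omega> = (\<integral>v. \<integral>u. gh (u - v) * X u \<omega> * X v \<omega> \<partial>window ?l \<partial>window ?l)"
    unfolding Q_func_def set_lebesgue_integral_def gh_def[symmetric]
    by (subst integral_window, measurable, subst integral_window, measurable)
  also have "\<dots> = (\<integral>v. indicator {0..?l} v *\<^sub>R (\<integral>u. gh (u - v) * X u \<omega> * X v \<omega> \<partial>window ?l) \<partial>window T)"
    by (rule integral_window_sub[OF _ l, symmetric]) measurable
  also have "(\<lambda>v. \<integral>u. gh (u - v) * X u \<omega> * X v \<omega> \<partial>window ?l) = (\<lambda>v. \<integral>u. indicator {0..?l} u *\<^sub>R (gh (u - v) * X u \<omega> * X v \<omega>) \<partial>window T)"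
    by (intro ext integral_window_sub[OF _ l, symmetric]) measurable
  also have "(\<integral>v. indicator {0..?l} v *\<^sub>R (\<integral>u. indicator {0..?l} u *\<^sub>R (gh (u - v) * X u \<omega> * X v \<omega>) \<partial>window T) \<partial>window T)
      = (\<integral>v. \<integral>u. sqrt T * (k1 s T v u * (X v \<omega> * X u \<omega>)) \<partial>window T \<partial>window T)"
  proof -
    have "indicator {0..?l} v *\<^sub>R (indicator {0..?l} u *\<^sub>R (gh (u - v) * X u \<omega> * X v \<omega>)) = sqrt T * (k1 s T v u * (X v \<omega> * X u \<omega>))" for u v
      using T gh_even[of "u - v"] by (simp add: k1_def)
    then show ?thesis by (simp only: integral_scaleR_right[symmetric])
  qed
  also have "\<dots> = sqrt T * (\<integral>v. \<integral>u. k1 s T v u * (X v \<omega> * X u \<omega>) \<partial>window T \<partial>window T)"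
    by (simp only: integral_mult_right_zero)
  also have "(\<integral>v. \<integral>u. k1 s T v u * (X v \<omega> * X u \<omega>) \<partial>window T \<partial>window T) = (\<integral>p. k1 s T (fst p) (snd p) * (X (fst p) \<omega> * X (snd p) \<omega>) \<partial>(window T \<Otimes>\<^sub>M window T))"
    using integral_fst'[OF path_pair_integrable[OF \<omega> rkernel_k1]] by simp
  finally show ?thesis .
qed

lemma Q_func_mean:
  assumes T: "0 < T" and s: "s \<le> 1"
  shows "(\<integral>\<omega>. Q_func g X T s \<omega> \<partial>M) = sqrt T * (\<integral>p. k1 s T (fst p) (snd p) * R (fst p) (snd p) \<partial>(window T \<Otimes>\<^sub>M window T))"
proof -
  let ?SS = "window T \<Otimes>\<^sub>M window T"
  let ?H = "\<lambda>p \<omega>. k1 s T (fst p) (snd p) * (X (fst p) \<omega> * X (snd p) \<omega>)"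
  note [measurable (raw)] = rkernel_measurable[OF rkernel_k1]
  have fin: "finite_measure ?SS" by (rule finite_measure_pair_measure) auto
  have am: "all_moments (?SS \<Otimes>\<^sub>M M) (\<lambda>q. ?H (fst q) (snd q))"
  proof (intro all_moments_mult)
    show "all_moments (?SS \<Otimes>\<^sub>M M) (\<lambda>q. k1 s T (fst (fst q)) (snd (fst q)))"
      by (intro all_moments_fst[of ?SS M "\<lambda>p. k1 s T (fst p) (snd p)"] fin finM all_moments_bdd rkernel_bdd rkernel_k1) measurable
    show "all_moments (?SS \<Otimes>\<^sub>M M) (\<lambda>q. X (fst (fst q)) (snd q))" "all_moments (?SS \<Otimes>\<^sub>M M) (\<lambda>q. X (snd (fst q)) (snd q))"
      by (intro am_X_pair fin, measurable)+
  qed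
  note [measurable] = all_momentsD(1)[OF all_moments_integral[OF fin finM am]] Q_func_measurable
  have "(\<integral>\<omega>. Q_func g X T s \<omega> \<partial>M) = (\<integral>\<omega>. sqrt T * (\<integral>p. ?H p \<omega> \<partial>?SS) \<partial>M)"
  proof (rule integral_cong_AE)
    show "AE \<omega> in M. Q_func g X T s \<omega> = sqrt T * (\<integral>p. ?H p \<omega> \<partial>?SS)"
      using path_integrable[of T] AE_space by eventually_elim (rule Q_func_eq[OF T s])
  qed measurable
  also have "\<dots> = sqrt T * (\<integral>\<omega>. (\<integral>p. ?H p \<omega> \<partial>?SS) * 1 \<partial>M)" by simp
  also have "(\<integral>\<omega>. (\<integral>p. ?H p \<omega> \<partial>?SS) * 1 \<partial>M) = (\<integral>p. (\<integral>\<omega>. ?H p \<omega> * 1 \<partial>M) \<partial>?SS)"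
    by (rule all_moments_Fubini(1)[OF fin finM am all_moments_const[OF finM]])
  also have "\<dots> = (\<integral>p. k1 s T (fst p) (snd p) * R (fst p) (snd p) \<partial>?SS)" by (simp add: R_def)
  finally show ?thesis .
qed

lemma W_eq_Q_tilde:
  assumes T: "0 < T" and t: "\<And>k. t k \<le> 1"
  shows "AE \<omega> in M. W c t T \<omega> = (\<Sum>k\<in>UNIV. c k * Q_tilde M g X T (t k) \<omega>)"
  using path_integrable[of T] AE_space
proof eventually_elim
  case (elim \<omega>)
  let ?SS = "window T \<Otimes>\<^sub>M window T"
  let ?x = "\<lambda>p. X (fst p) \<omega> * X (snd p) \<omega>" and ?r = "\<lambda>p. R (fst p) (snd p)"
  have i: "integrable ?SS (\<lambda>p. k1 s T (fst p) (snd p) * ?x p)" "integrable ?SS (\<lambda>p. k1 s T (fst p) (snd p) * ?r p)" for s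
    using path_pair_integrable[OF elim(2,1) rkernel_k1] kernel_R_integrable[OF rkernel_k1] by auto
  have tilde: "Q_tilde M g X T (t k) \<omega> = (\<integral>p. k1 (t k) T (fst p) (snd p) * ?x p \<partial>?SS) - (\<integral>p. k1 (t k) T (fst p) (snd p) * ?r p \<partial>?SS)" for k
  proof -
    have "T powr (- 1 / 2) * sqrt T = 1" using T by (simp add: powr_minus powr_half_sqrt)
    then show ?thesis
      unfolding Q_tilde_def Q_func_eq[OF T t elim(2,1)] Q_func_mean[OF T t]
      by (simp add: right_diff_distrib[symmetric] mult.assoc[symmetric])
  qed
  have "W c t T \<omega> = (\<integral>p. (\<Sum>k\<in>UNIV. c k * (k1 (t k) T (fst p) (snd p) * ?x p - k1 (t k) T (fst p) (snd p) * ?r p)) \<partial>?SS)"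
    unfolding W_def K1_def
    by (intro Bochner_Integration.integral_cong refl) (simp add: sum_distrib_right right_diff_distrib sum_subtractf mult.assoc)
  also have "\<dots> = (\<Sum>k\<in>UNIV. \<integral>p. c k * (k1 (t k) T (fst p) (snd p) * ?x p - k1 (t k) T (fst p) (snd p) * ?r p) \<partial>?SS)"
    by (intro Bochner_Integration.integral_sum integrable_mult_right Bochner_Integration.integrable_diff i)
  also have "\<dots> = (\<Sum>k\<in>UNIV. c k * Q_tilde M g X T (t k) \<omega>)"
    using i by (simp add: tilde)
  finally show ?case .
qed

lemma Q_tilde_measurable: "Q_tilde M g X T s \<in> borel_measurable M"
  using Q_func_measurable unfolding Q_tilde_def[abs_def] by measurable

lemma Q_tilde_second_moment:
  assumes T: "0 < T" and s: "s \<le> 1"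
  shows "integrable M (\<lambda>\<omega>. (Q_tilde M g X T s \<omega>)\<^sup>2)"
    "(\<integral>\<omega>. (Q_tilde M g X T s \<omega>)\<^sup>2 \<partial>M) = 2 * ((hs F (Amp G (T * s)))\<^sup>2 / T)"
proof -
  note [measurable] = Q_tilde_measurable all_momentsD(1)[OF am_W]
  let ?W = "W (\<lambda>_::unit. 1) (\<lambda>_. s) T"
  have "AE \<omega> in M. ?W \<omega> = Q_tilde M g X T s \<omega>"
    using W_eq_Q_tilde[OF T, of "\<lambda>_::unit. s" "\<lambda>_. 1"] s by (simp add: UNIV_unit)
  then have ae: "AE \<omega> in M. (Q_tilde M g X T s \<omega>)\<^sup>2 = (?W \<omega>)\<^sup>2" by eventually_elim simp
  have iW: "integrable M (\<lambda>\<omega>. (?W \<omega>)\<^sup>2)" by (rule all_momentsD(3)[OF am_W])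
  show "integrable M (\<lambda>\<omega>. (Q_tilde M g X T s \<omega>)\<^sup>2)"
    using integrable_cong_AE[OF _ _ ae] iW by simp
  have "(\<integral>\<omega>. (Q_tilde M g X T s \<omega>)\<^sup>2 \<partial>M) = (\<integral>\<omega>. (?W \<omega>)\<^sup>2 \<partial>M)"
    by (rule integral_cong_AE[OF _ _ ae]) measurable
  also have "\<dots> = 2 * (hs F (Phi g (\<lambda>_::unit. 1) (\<lambda>_. s) T))\<^sup>2" by (rule W_second_moment[OF T s])
  also have "Phi g (\<lambda>_::unit. 1) (\<lambda>_. s) T = (\<lambda>y z. complex_of_real (1 / sqrt T) * Amp G (T * s) y z)"
    by (simp add: Phi_def UNIV_unit fun_eq_iff)
  also have "hs F \<dots> = hs F (Amp G (T * s)) / sqrt T"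
    unfolding hs_def sqn_cmult using T by (simp add: norm_divide)
  also have "\<dots>\<^sup>2 = (hs F (Amp G (T * s)))\<^sup>2 / T" using T by (simp add: power_divide)
  finally show "(\<integral>\<omega>. (Q_tilde M g X T s \<omega>)\<^sup>2 \<partial>M) = 2 * ((hs F (Amp G (T * s)))\<^sup>2 / T)" .
qed

end

text \<open>
  Centring fixes the means of the normal laws of linear combinations. The spectral density
  makes the covariance a function of the time difference, so all \<open>X(t)\<close> have the same law and
  the same moments.
\<close>

lemma gaussian_field_from_spectral_density:
  fixes f :: "real \<Rightarrow> real"
  assumes M: "prob_space M" and gauss: "gaussian_process M X" and cent: "centered_process M X"
    and meas: "measurable_process M X" and sd: "has_spectral_density M X f"
  shows "gaussian_field M X (\<lambda>s t. \<integral>\<omega>. X s \<omega> * X t \<omega> \<partial>M)"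
    "complex_of_real (\<integral>\<omega>. X s \<omega> * X t \<omega> \<partial>M) = ftm (dens f) (s - t)"
proof -
  interpret prob_space M by fact
  have Xm[measurable]: "X t \<in> borel_measurable M" for t using gauss by (simp add: gaussian_process_def)
  have Xi: "integrable M (X t)" "(\<integral>\<omega>. X t \<omega> \<partial>M) = 0" for t using cent by (auto simp: centered_process_def)
  have f: "integrable lborel f" "\<And>x. 0 \<le> f x"
    and cov: "complex_of_real (\<integral>\<omega>. X (s + t) \<omega> * X s \<omega> \<partial>M) = fourier_hat f t" for s t
    using sd by (auto simp: has_spectral_density_def)
  have fm[measurable]: "f \<in> borel_measurable borel" using f by auto
  have ftm: "ftm (dens f) u = fourier_hat f u" for u
    unfolding fourier_hat_eq_ft using f by (intro ftm_dens) auto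
  show spec: "complex_of_real (\<integral>\<omega>. X s \<omega> * X t \<omega> \<partial>M) = ftm (dens f) (s - t)" for s t
    using cov[of t "s - t"] by (simp add: ftm)
  have law: "\<exists>s\<ge>0. distr M borel (\<lambda>\<omega>. \<Sum>t\<in>J. c t * X t \<omega>) = gaussian_law 0 s" if J: "finite J" for J c
  proof -
    obtain m s where ms: "s \<ge> 0" "distr M borel (\<lambda>\<omega>. \<Sum>t\<in>J. c t * X t \<omega>) = gaussian_law m s"
      using gauss J unfolding gaussian_process_def by meson
    have "m = (\<integral>x. x \<partial>distr M borel (\<lambda>\<omega>. \<Sum>t\<in>J. c t * X t \<omega>))" unfolding ms(2) by (simp add: gaussian_law_mean ms(1))
    also have "\<dots> = (\<integral>\<omega>. (\<Sum>t\<in>J. c t * X t \<omega>) \<partial>M)" by (subst integral_distr) auto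
    also have "\<dots> = 0" using Xi by simp
    finally show ?thesis using ms by auto
  qed
  have single: "distr M borel (X t) = gaussian_law 0 (sqrt (\<integral>\<omega>. (X 0 \<omega>)\<^sup>2 \<partial>M))" for t
  proof -
    obtain s where s: "s \<ge> 0" "distr M borel (X t) = gaussian_law 0 s" using law[of "{t}" "\<lambda>_. 1"] by auto
    have "s\<^sup>2 = (\<integral>\<omega>. (X t \<omega>)\<^sup>2 \<partial>M)" using distr_gaussian(3)[OF Xm s(2,1)] by simp
    also have "complex_of_real \<dots> = complex_of_real (\<integral>\<omega>. (X 0 \<omega>)\<^sup>2 \<partial>M)"
      using spec[of t t] spec[of 0 0] by (simp add: power2_eq_square)
    finally have "s\<^sup>2 = (\<integral>\<omega>. (X 0 \<omega>)\<^sup>2 \<partial>M)" by (simp only: of_real_eq_iff)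
    then have "s = sqrt (\<integral>\<omega>. (X 0 \<omega>)\<^sup>2 \<partial>M)" using s(1) by (simp add: real_sqrt_unique)
    then show ?thesis using s(2) by simp
  qed
  show "gaussian_field M X (\<lambda>s t. \<integral>\<omega>. X s \<omega> * X t \<omega> \<partial>M)"
  proof
    show "(\<lambda>p. X (fst p) (snd p)) \<in> borel_measurable (borel \<Otimes>\<^sub>M M)"
      using meas by (simp add: measurable_process_def case_prod_unfold)
    show "\<exists>C. \<forall>t. integrable M (\<lambda>\<omega>. \<bar>X t \<omega>\<bar> ^ n) \<and> (\<integral>\<omega>. \<bar>X t \<omega>\<bar> ^ n \<partial>M) \<le> C" for n
      using distr_gaussian(1,2)[OF Xm single] by (intro exI[of _ "\<integral>x. \<bar>x\<bar> ^ n \<partial>gaussian_law 0 (sqrt (\<integral>\<omega>. (X 0 \<omega>)\<^sup>2 \<partial>M))"]) auto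
    show "(\<integral>\<omega>. cis (\<Sum>t\<in>J. c t * X t \<omega>) \<partial>M) = complex_of_real (exp (- (\<integral>\<omega>. (\<Sum>t\<in>J. c t * X t \<omega>)\<^sup>2 \<partial>M) / 2))"
      if J: "finite J" for J c
    proof -
      obtain s where s: "s \<ge> 0" "distr M borel (\<lambda>\<omega>. \<Sum>t\<in>J. c t * X t \<omega>) = gaussian_law 0 s" using law[OF J] by blast
      have m: "(\<lambda>\<omega>. \<Sum>t\<in>J. c t * X t \<omega>) \<in> borel_measurable M" by measurable
      show ?thesis using distr_gaussian(4)[OF m s(2,1), of 1] distr_gaussian(3)[OF m s(2,1)] by simp
    qed
  qed simp
qed

lemma measurable_vec_lambda:
  fixes Y :: "'k::finite \<Rightarrow> 'a \<Rightarrow> real"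
  assumes "\<And>k. Y k \<in> borel_measurable M"
  shows "(\<lambda>\<omega>. \<chi> k. Y k \<omega>) \<in> borel_measurable M"
proof (subst borel_measurable_euclidean_space, intro ballI)
  fix b :: "real ^ 'k" assume "b \<in> Basis"
  then obtain k where "b = axis k 1" by (auto simp: Basis_vec_def)
  then show "(\<lambda>\<omega>. (\<chi> k. Y k \<omega>) \<bullet> b) \<in> borel_measurable M" using assms[of k] by (simp add: inner_axis)
qed

theorem theorem2p1:
  fixes M :: "'a measure" and X :: "real \<Rightarrow> 'a \<Rightarrow> real"
    and N :: "'b measure" and B :: "real \<Rightarrow> 'b \<Rightarrow> real"
    and f g :: "real \<Rightarrow> real" and \<sigma> :: real
    and t :: "'k::finite \<Rightarrow> real"
  assumes "prob_space M"
    and "gaussian_process M X"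
    and "centered_process M X"
    and "stationary_process M X"
    and "measurable_process M X"
    and "has_spectral_density M X f"
    and "integrable lborel g"
    and "\<And>x. g (- x) = g x"
    and "\<And>x. g x \<ge> 0"
    and "integrable lborel (\<lambda>x. f x * g x)"
    and "integrable lborel (\<lambda>x. (f x * g x)\<^sup>2)"
    and "((\<lambda>T. \<integral>\<omega>. (Q_tilde M g X T 1 \<omega>)\<^sup>2 \<partial>M) \<longlongrightarrow>
           16 * pi ^ 3 * (LBINT x. (f x)\<^sup>2 * (g x)\<^sup>2)) at_top"
    and "\<sigma>\<^sup>2 = 16 * pi ^ 3 * (LBINT x. (f x)\<^sup>2 * (g x)\<^sup>2)"
    and "standard_brownian_motion_on {0..1} N B"
    and "\<And>k. t k \<in> {0..1}"
  shows "weakly_tendsto (\<lambda>T. fin_dim_law M (Q_tilde M g X T) t)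
           (fin_dim_law N (\<lambda>s \<omega>. \<sigma> * B s \<omega>) t) at_top"
proof -
  let ?R = "\<lambda>s t. \<integral>\<omega>. X s \<omega> * X t \<omega> \<partial>M"
  note field = gaussian_field_from_spectral_density[OF assms(1,2,3,5,6)]
  interpret gaussian_field M X ?R by (rule field(1))
  have f: "integrable lborel f" "\<And>x. 0 \<le> f x" using assms(6) by (auto simp: has_spectral_density_def)
  interpret toeplitz_functionals M X ?R f g
    by unfold_locales (use f assms(7,8,9) field(2) in auto)
  note t = assms(15) note BM = assms(14)
  interpret N: prob_space N using BM by (simp add: standard_brownian_motion_on_def)
  have t1: "0 \<le> t k" "t k \<le> 1" for k using t[of k] by auto
  define I0 where "I0 = (2 * pi) ^ 3 * (\<integral>x. (f x * g x)\<^sup>2 \<partial>lborel)"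
  have \<sigma>: "\<sigma>\<^sup>2 = 2 * I0" using assms(13) by (simp add: I0_def power_mult_distrib)
  have trace: "((\<lambda>T. (hs F (Amp G T))\<^sup>2 / T) \<longlongrightarrow> I0) at_top"
  proof -
    have "((\<lambda>T. (\<integral>\<omega>. (Q_tilde M g X T 1 \<omega>)\<^sup>2 \<partial>M) / 2) \<longlongrightarrow> \<sigma>\<^sup>2 / 2) at_top"
      unfolding assms(13) by (intro tendsto_divide assms(12) tendsto_const) simp
    moreover have "\<forall>\<^sub>F T in at_top. (\<integral>\<omega>. (Q_tilde M g X T 1 \<omega>)\<^sup>2 \<partial>M) / 2 = (hs F (Amp G T))\<^sup>2 / T"
      using eventually_gt_at_top[of 0] by eventually_elim (simp add: Q_tilde_second_moment)
    ultimately have "((\<lambda>T. (hs F (Amp G T))\<^sup>2 / T) \<longlongrightarrow> \<sigma>\<^sup>2 / 2) at_top" by (rule Lim_transform_eventually)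
    then show ?thesis by (simp add: \<sigma>)
  qed
  define Y where "Y T \<omega> = (\<chi> k. Q_tilde M g X T (t k) \<omega>)" for T \<omega>
  define Z where "Z \<omega> = (\<chi> k. \<sigma> * B (t k) \<omega>)" for \<omega>
  have Bm: "B (t k) \<in> borel_measurable N" for k using BM t by (simp add: standard_brownian_motion_on_def)
  have Y: "Y T \<in> borel_measurable M" for T
    unfolding Y_def[abs_def] by (intro measurable_vec_lambda Q_tilde_measurable)
  have Z: "Z \<in> borel_measurable N"
    unfolding Z_def[abs_def] by (intro measurable_vec_lambda borel_measurable_times borel_measurable_const Bm)
  have char: "((\<lambda>T. \<integral>\<omega>. cis (c \<bullet> Y T \<omega>) \<partial>M) \<longlongrightarrow> (\<integral>\<omega>. cis (c \<bullet> Z \<omega>) \<partial>N)) at_top" for c :: "real ^ 'k"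
  proof -
    let ?s = "\<Sum>j\<in>UNIV. \<Sum>k\<in>UNIV. c $ j * c $ k * min (t j) (t k)"
    have "((\<lambda>T. \<integral>\<omega>. cis (W (($) c) t T \<omega>) \<partial>M) \<longlongrightarrow> complex_of_real (exp (- (2 * (I0 * ?s)) / 2))) at_top"
      unfolding I0_def by (rule W_char_limit[OF assms(11) trace[unfolded I0_def] t])
    moreover have "\<forall>\<^sub>F T in at_top. (\<integral>\<omega>. cis (W (($) c) t T \<omega>) \<partial>M) = (\<integral>\<omega>. cis (c \<bullet> Y T \<omega>) \<partial>M)"
      using eventually_gt_at_top[of 0]
    proof eventually_elim
      case (elim T)
      note [measurable] = all_momentsD(1)[OF am_W] Y
      show ?case
      proof (rule integral_cong_AE)
        show "AE \<omega> in M. cis (W (($) c) t T \<omega>) = cis (c \<bullet> Y T \<omega>)"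
          using W_eq_Q_tilde[of T t "($) c", OF elim t1(2)] by eventually_elim (simp add: inner_vec_def Y_def)
      qed measurable
    qed
    ultimately have "((\<lambda>T. \<integral>\<omega>. cis (c \<bullet> Y T \<omega>) \<partial>M) \<longlongrightarrow> complex_of_real (exp (- (2 * (I0 * ?s)) / 2))) at_top"
      by (rule Lim_transform_eventually)
    moreover have "(\<integral>\<omega>. cis (c \<bullet> Z \<omega>) \<partial>N) = complex_of_real (exp (- (2 * (I0 * ?s)) / 2))"
    proof -
      have "(\<integral>\<omega>. cis (c \<bullet> Z \<omega>) \<partial>N) = (\<integral>\<omega>. cis (\<Sum>k\<in>UNIV. (c $ k * \<sigma>) * B (t k) \<omega>) \<partial>N)"
        by (simp add: inner_vec_def Z_def mult.assoc)
      also have "\<dots> = complex_of_real (exp (- (\<Sum>j\<in>UNIV. \<Sum>k\<in>UNIV. (c $ j * \<sigma>) * (c $ k * \<sigma>) * min (t j) (t k)) / 2))"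
        by (rule Brownian_char[OF BM t])
      also have "(\<Sum>j\<in>UNIV. \<Sum>k\<in>UNIV. (c $ j * \<sigma>) * (c $ k * \<sigma>) * min (t j) (t k)) = \<sigma>\<^sup>2 * ?s"
        by (simp add: sum_distrib_left power2_eq_square mult_ac)
      finally show ?thesis by (simp add: \<sigma> mult.assoc)
    qed
    ultimately show ?thesis by simp
  qed
  \<comment> \<open>The summand 1 leaves room for an inequality that holds only eventually.\<close>
  have momY: "\<forall>\<^sub>F T in at_top. \<forall>k. integrable M (\<lambda>\<omega>. (Y T \<omega> $ k)\<^sup>2) \<and> (\<integral>\<omega>. (Y T \<omega> $ k)\<^sup>2 \<partial>M) \<le> 2 * I0 + 1"
  proof (rule eventually_all_finite)
    fix k
    have "((\<lambda>T. (hs F (Amp G (T * t k)))\<^sup>2 / T) \<longlongrightarrow> t k * I0) at_top"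
      using hs_growth[OF f assms(7,9) assms(11) trace[unfolded I0_def] t1(1), of k] by (simp add: I0_def)
    then have "((\<lambda>T. 2 * ((hs F (Amp G (T * t k)))\<^sup>2 / T)) \<longlongrightarrow> 2 * (t k * I0)) at_top" by (rule tendsto_mult_left)
    moreover have "2 * (t k * I0) < 2 * I0 + 1"
    proof -
      have "0 \<le> I0" using \<sigma> zero_le_power2[of \<sigma>] by linarith
      then have "t k * I0 \<le> 1 * I0" using t1[of k] by (intro mult_right_mono) auto
      then show ?thesis by simp
    qed
    ultimately have "\<forall>\<^sub>F T in at_top. 2 * ((hs F (Amp G (T * t k)))\<^sup>2 / T) < 2 * I0 + 1" by (rule order_tendstoD(2))
    then show "\<forall>\<^sub>F T in at_top. integrable M (\<lambda>\<omega>. (Y T \<omega> $ k)\<^sup>2) \<and> (\<integral>\<omega>. (Y T \<omega> $ k)\<^sup>2 \<partial>M) \<le> 2 * I0 + 1"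
      using eventually_gt_at_top[of 0]
    proof eventually_elim
      case (elim T)
      show ?case using Q_tilde_second_moment[OF elim(2) t1(2)[of k]] elim(1) by (simp add: Y_def)
    qed
  qed
  have momZ: "integrable N (\<lambda>\<omega>. (Z \<omega> $ k)\<^sup>2)" "(\<integral>\<omega>. (Z \<omega> $ k)\<^sup>2 \<partial>N) \<le> 2 * I0 + 1" for k
  proof -
    note b = Brownian_square[OF BM t[of k]]
    show "integrable N (\<lambda>\<omega>. (Z \<omega> $ k)\<^sup>2)" using b(1) by (simp add: Z_def power_mult_distrib)
    have "(\<integral>\<omega>. (Z \<omega> $ k)\<^sup>2 \<partial>N) = \<sigma>\<^sup>2 * (\<integral>\<omega>. (B (t k) \<omega>)\<^sup>2 \<partial>N)" by (simp add: Z_def power_mult_distrib)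
    also have "\<dots> \<le> \<sigma>\<^sup>2 * 1" by (intro mult_left_mono b(2)) simp
    finally show "(\<integral>\<omega>. (Z \<omega> $ k)\<^sup>2 \<partial>N) \<le> 2 * I0 + 1" by (simp add: \<sigma>)
  qed
  show ?thesis
    unfolding weakly_tendsto_def
  proof (intro allI impI)
    fix \<phi> :: "real ^ 'k \<Rightarrow> real" assume \<phi>: "continuous_on UNIV \<phi> \<and> bounded (range \<phi>)"
    then have m: "\<phi> \<in> borel_measurable borel" by (intro borel_measurable_continuous_onI) auto
    have "((\<lambda>T. \<integral>\<omega>. \<phi> (Y T \<omega>) \<partial>M) \<longlongrightarrow> (\<integral>\<omega>. \<phi> (Z \<omega>) \<partial>N)) at_top"
      using \<phi> by (intro weak_convergence_from_char[OF assms(1) N.prob_space_axioms Y Z char momY momZ]) auto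
    moreover have "(\<integral>x. \<phi> x \<partial>fin_dim_law M (Q_tilde M g X T) t) = (\<integral>\<omega>. \<phi> (Y T \<omega>) \<partial>M)" for T
      using integral_distr[OF Y[of T] m] by (simp add: fin_dim_law_def Y_def[abs_def])
    moreover have "(\<integral>x. \<phi> x \<partial>fin_dim_law N (\<lambda>s \<omega>. \<sigma> * B s \<omega>) t) = (\<integral>\<omega>. \<phi> (Z \<omega>) \<partial>N)"
      using integral_distr[OF Z m] by (simp add: fin_dim_law_def Z_def[abs_def])
    ultimately show "((\<lambda>T. \<integral>x. \<phi> x \<partial>fin_dim_law M (Q_tilde M g X T) t) \<longlongrightarrow> (\<integral>x. \<phi> x \<partial>fin_dim_law N (\<lambda>s \<omega>. \<sigma> * B s \<omega>) t)) at_top"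
      by simp
  qed
qed

end
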